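(* Let $\mathcal M=B(L_2(0,\infty))$ with the standard trace. There is an absolute constant $c>0$ such that for every $x\in\Lambda_{\log}(\mathbb Z_+)$ there exist, for each $t>0$, a filtration $\mathcal F_t=(\mathcal M_k^t)_{k\ge0}$ of von Neumann subalgebras $\mathcal M_k^t\subset\mathcal M$ and a sequence $(a_k^t)_{k\ge0}$ in $\mathcal M$, and there exist elements $z_1\in\Lambda_{\log}(\mathcal M)$ and $z_2\in L_\infty(\mathcal M)$ such that (i) $\mu(z_1)=\mu(x)$ and $$\Big(\sum_{k\ge0}a_k^t(a_k^t)^*\Big)^{\frac12}=z_1,\qquad t>0;$$ (ii) $\mu(z_2)\ge c\,S_d\mu(x)$ and $$\lim_{t\to0}\Big(\sum_{k\ge0}\mathcal E_{\mathcal M_k^t}(a_k^t)\,\mathcal E_{\mathcal M_k^t}(a_k^t)^*\Big)^{\frac12}=z_2,$$ the limit being taken in the operator (uniform) norm.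
   Context: For $z\in B(L_2(0,\infty))$, $\mu(z)=(\mu(n,z))_{n\ge0}$ with $\mu(n,z)=\inf\{s>0:\mathrm{Tr}(\chi_{(s,\infty)}(|z|))\le n\}$ (the singular value sequence); for a sequence $x\in c_0(\mathbb Z_+)$, $\mu(x)=(\mu(n,x))_{n\ge0}$ is the decreasing rearrangement of $|x|$. Inequalities between sequences are pointwise. $\Lambda_{\log}(\mathbb Z_+)=\{a\in c_0(\mathbb Z_+):\sum_{n\ge0}\mu(n,a)(\log(n+2)-\log(n+1))<\infty\}$, and $\Lambda_{\log}(\mathcal M)$ consists of the operators $z$ with $\mu(z)\in\Lambda_{\log}(\mathbb Z_+)$. The discrete Calderón operator is $(S_dy)(n)=\frac1{n+1}\sum_{k=0}^ny(k)+\sum_{k=n}^\infty\frac{y(k)}{k+1}$, $n\ge0$. A filtration is an increasing sequence of von Neumann subalgebras of $\mathcal M$ with weak$^*$-dense union such that the restriction of the trace to each of them is semifinite; $\mathcal E_{\mathcal M_k^t}$ is the trace-preserving conditional expectation onto $\mathcal M_k^t$. A series of positive operators denotes the supremum (equivalently strong limit) of its partial sums. *)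

theory Defs
  imports "HOL-Analysis.Analysis" "HOL-Library.Nonpos_Ints"
begin

section \<open>The complex Hilbert space of square-integrable functions on the half-line\<close>

abbreviation half_line :: "real measure"
  where "half_line \<equiv> lebesgue_on {0<..}"

definition square_integrable :: "(real \<Rightarrow> complex) \<Rightarrow> bool"
  where "square_integrable f \<longleftrightarrow>
    f \<in> borel_measurable half_line \<and> integrable half_line (\<lambda>x. (norm (f x))\<^sup>2)"

definition L2_eq :: "(real \<Rightarrow> complex) \<Rightarrow> (real \<Rightarrow> complex) \<Rightarrow> bool"
  where "L2_eq f g \<longleftrightarrow>
    square_integrable f \<and> square_integrable g \<and> (AE x in half_line. f x = g x)"

lemma square_integrable_zero: "square_integrable (\<lambda>x. 0)"
  by (simp add: square_integrable_def)

lemma square_integrable_scale: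
  assumes "square_integrable f"
  shows "square_integrable (\<lambda>x. c * f x)"
  using assms by (auto simp: square_integrable_def norm_mult power_mult_distrib)

lemma square_integrable_add:
  assumes f: "square_integrable f" and g: "square_integrable g"
  shows "square_integrable (\<lambda>x. f x + g x)"
proof -
  have [measurable]: "f \<in> borel_measurable half_line" "g \<in> borel_measurable half_line"
    using f g by (auto simp: square_integrable_def)
  have i: "integrable half_line (\<lambda>x. 2 * (norm (f x))\<^sup>2 + 2 * (norm (g x))\<^sup>2)"
    using f g by (auto simp: square_integrable_def)
  have b: "(norm (a + b))\<^sup>2 \<le> 2 * (norm a)\<^sup>2 + 2 * (norm b)\<^sup>2" for a b :: complex
  proof -
    have "(norm (a + b))\<^sup>2 \<le> (norm a + norm b)\<^sup>2"
      by (intro power_mono norm_triangle_ineq norm_ge_zero)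
    also have "\<dots> \<le> 2 * (norm a)\<^sup>2 + 2 * (norm b)\<^sup>2"
      using sum_squares_ge_zero[of "norm a - norm b" 0]
      by (simp add: power2_eq_square algebra_simps)
    finally show ?thesis .
  qed
  have "integrable half_line (\<lambda>x. (norm (f x + g x))\<^sup>2)"
    by (rule Bochner_Integration.integrable_bound[OF i]) (auto intro!: AE_I2 b)
  then show ?thesis by (simp add: square_integrable_def)
qed

lemma square_integrable_diff:
  assumes "square_integrable f" "square_integrable g"
  shows "square_integrable (\<lambda>x. f x - g x)"
  using square_integrable_add[OF assms(1) square_integrable_scale[OF assms(2), of "-1"]] by simp

lemma integrable_mult_cnj:
  assumes f: "square_integrable f" and g: "square_integrable g"
  shows "integrable half_line (\<lambda>x. f x * cnj (g x))"
proof -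
  have [measurable]: "f \<in> borel_measurable half_line" "g \<in> borel_measurable half_line"
    using f g by (auto simp: square_integrable_def)
  have i: "integrable half_line (\<lambda>x. (norm (f x))\<^sup>2 + (norm (g x))\<^sup>2)"
    using f g by (auto simp: square_integrable_def)
  have b: "norm (a * cnj b) \<le> (norm a)\<^sup>2 + (norm b)\<^sup>2" for a b :: complex
  proof -
    have "2 * (norm a * norm b) \<le> (norm a)\<^sup>2 + (norm b)\<^sup>2"
      using sum_squares_bound[of "norm a" "norm b"] by simp
    moreover have "0 \<le> norm a * norm b" by simp
    ultimately show ?thesis unfolding norm_mult complex_mod_cnj by linarith
  qed
  have m: "(\<lambda>x. f x * cnj (g x)) \<in> borel_measurable half_line"
    by (intro borel_measurable_times borel_measurable_continuous_on[of cnj] continuous_intros) simp_all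
  show ?thesis
    by (rule Bochner_Integration.integrable_bound[OF i m])
       (use b in \<open>auto intro!: AE_I2\<close>)
qed

quotient_type L2 = "real \<Rightarrow> complex" / partial: L2_eq
proof (rule part_equivpI)
  show "\<exists>f. L2_eq f f"
    using square_integrable_zero by (auto simp: L2_eq_def)
  show "symp L2_eq" by (auto simp: symp_def L2_eq_def elim: AE_mp)
  show "transp L2_eq" by (auto simp: transp_def L2_eq_def elim: AE_mp)
qed

instantiation L2 :: ab_group_add
begin

lift_definition zero_L2 :: L2 is "\<lambda>x. 0"
  by (simp add: L2_eq_def square_integrable_zero)

lift_definition plus_L2 :: "L2 \<Rightarrow> L2 \<Rightarrow> L2" is "\<lambda>f g x. f x + g x"
  by (auto simp: L2_eq_def intro: square_integrable_add elim: AE_mp)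

lift_definition minus_L2 :: "L2 \<Rightarrow> L2 \<Rightarrow> L2" is "\<lambda>f g x. f x - g x"
  by (auto simp: L2_eq_def intro: square_integrable_diff elim: AE_mp)

lift_definition uminus_L2 :: "L2 \<Rightarrow> L2" is "\<lambda>f x. - f x"
  using square_integrable_scale[of _ "-1"] by (auto simp: L2_eq_def elim: AE_mp)

instance
proof
  fix a b c :: L2
  show "a + b + c = a + (b + c)"
    by transfer (auto simp: L2_eq_def add.assoc intro!: square_integrable_add)
  show "a + b = b + a"
    by transfer (auto simp: L2_eq_def add.commute intro!: square_integrable_add)
  show "0 + a = a" by transfer (auto simp: L2_eq_def)
  show "- a + a = 0" by transfer (auto simp: L2_eq_def square_integrable_zero)
  show "a - b = a + - b"
    by transfer (auto simp: L2_eq_def intro!: square_integrable_diff)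
qed

end

lift_definition scaleC :: "complex \<Rightarrow> L2 \<Rightarrow> L2" (infixr \<open>*\<^sub>C\<close> 75) is "\<lambda>c f x. c * f x"
  by (auto simp: L2_eq_def intro: square_integrable_scale elim: AE_mp)

text \<open>The inner product is linear in the first argument.\<close>

lift_definition cinner :: "L2 \<Rightarrow> L2 \<Rightarrow> complex"
  is "\<lambda>f g. integral\<^sup>L half_line (\<lambda>x. f x * cnj (g x))"
proof -
  fix f f' g g' assume 1: "L2_eq f f'" and 2: "L2_eq g g'"
  have "integrable half_line (\<lambda>x. f x * cnj (g x))" "integrable half_line (\<lambda>x. f' x * cnj (g' x))"
    using 1 2 integrable_mult_cnj by (auto simp: L2_eq_def)
  moreover have "AE x in half_line. f x * cnj (g x) = f' x * cnj (g' x)"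
    using 1 2 by (auto simp: L2_eq_def elim: AE_mp)
  ultimately show "integral\<^sup>L half_line (\<lambda>x. f x * cnj (g x)) = integral\<^sup>L half_line (\<lambda>x. f' x * cnj (g' x))"
    by (intro integral_cong_AE) (auto dest: borel_measurable_integrable)
qed

lemma cinner_commute: "cinner f g = cnj (cinner g f)"
proof transfer
  fix f g
  have "integral\<^sup>L half_line (\<lambda>x. f x * cnj (g x)) = integral\<^sup>L half_line (\<lambda>x. cnj (g x * cnj (f x)))"
    by (simp add: mult.commute)
  then show "integral\<^sup>L half_line (\<lambda>x. f x * cnj (g x)) = cnj (integral\<^sup>L half_line (\<lambda>x. g x * cnj (f x)))"
    by (subst Bochner_Integration.integral_cnj[symmetric])
qed

lemma cinner_add_left: "cinner (f + g) h = cinner f h + cinner g h"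
  by transfer (simp add: L2_eq_def distrib_right integrable_mult_cnj)

lemma cinner_scaleC_left: "cinner (c *\<^sub>C f) g = c * cinner f g"
  by transfer (simp add: mult.assoc)

lemma cinner_self_real: "cinner f f = complex_of_real (Re (cinner f f))"
  using cinner_commute[of f f] by (simp add: complex_eq_iff)

lemma Re_cinner_self_nonneg: "0 \<le> Re (cinner f f)"
proof transfer
  fix f :: "real \<Rightarrow> complex"
  have "integral\<^sup>L half_line (\<lambda>x. f x * cnj (f x)) = complex_of_real (integral\<^sup>L half_line (\<lambda>x. (norm (f x))\<^sup>2))"
    by (subst integral_complex_of_real[symmetric]) (simp only: complex_norm_square)
  then show "0 \<le> Re (integral\<^sup>L half_line (\<lambda>x. f x * cnj (f x)))" by simp
qed

lemma Re_cinner_self_eq_0: "Re (cinner f f) = 0 \<longleftrightarrow> f = 0"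
proof transfer
  fix f :: "real \<Rightarrow> complex" assume f: "L2_eq f f"
  have e: "integral\<^sup>L half_line (\<lambda>x. f x * cnj (f x)) = complex_of_real (integral\<^sup>L half_line (\<lambda>x. (norm (f x))\<^sup>2))"
    by (subst integral_complex_of_real[symmetric]) (simp only: complex_norm_square)
  have "integral\<^sup>L half_line (\<lambda>x. (norm (f x))\<^sup>2) = 0 \<longleftrightarrow> (AE x in half_line. (norm (f x))\<^sup>2 = 0)"
    using f by (intro integral_nonneg_eq_0_iff_AE) (auto simp: L2_eq_def square_integrable_def)
  then show "Re (integral\<^sup>L half_line (\<lambda>x. f x * cnj (f x))) = 0 \<longleftrightarrow> L2_eq f (\<lambda>x. 0)"
    using f e by (simp add: L2_eq_def square_integrable_zero)
qed

instantiation L2 :: real_inner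
begin

definition scaleR_L2 :: "real \<Rightarrow> L2 \<Rightarrow> L2" where "scaleR_L2 r f = complex_of_real r *\<^sub>C f"
definition inner_L2 :: "L2 \<Rightarrow> L2 \<Rightarrow> real" where "inner_L2 f g = Re (cinner f g)"
definition norm_L2 :: "L2 \<Rightarrow> real" where "norm_L2 f = sqrt (inner f f)"
definition sgn_L2 :: "L2 \<Rightarrow> L2" where "sgn_L2 f = inverse (norm f) *\<^sub>R f"
definition dist_L2 :: "L2 \<Rightarrow> L2 \<Rightarrow> real" where "dist_L2 f g = norm (f - g)"
definition uniformity_L2 :: "(L2 \<times> L2) filter"
  where "uniformity_L2 = (INF e\<in>{0 <..}. principal {(x, y). dist x y < e})"
definition open_L2 :: "L2 set \<Rightarrow> bool"
  where "open_L2 U \<longleftrightarrow> (\<forall>x\<in>U. eventually (\<lambda>(x', y). x' = x \<longrightarrow> y \<in> U) uniformity)"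

instance
proof
  fix a b :: real and f g h :: L2 and U :: "L2 set"
  show "a *\<^sub>R (f + g) = a *\<^sub>R f + a *\<^sub>R g"
    unfolding scaleR_L2_def
    by transfer (auto simp: L2_eq_def distrib_left intro!: square_integrable_add square_integrable_scale)
  show "(a + b) *\<^sub>R f = a *\<^sub>R f + b *\<^sub>R f"
    unfolding scaleR_L2_def
    by transfer (auto simp: L2_eq_def distrib_right intro!: square_integrable_add square_integrable_scale)
  show "a *\<^sub>R b *\<^sub>R f = (a * b) *\<^sub>R f"
    unfolding scaleR_L2_def
    by transfer (auto simp: L2_eq_def mult.assoc intro!: square_integrable_scale)
  show "1 *\<^sub>R f = f" unfolding scaleR_L2_def by transfer (auto simp: L2_eq_def)
  show "inner f g = inner g f"
    unfolding inner_L2_def by (subst cinner_commute) simp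
  show "inner (f + g) h = inner f h + inner g h"
    by (simp add: inner_L2_def cinner_add_left)
  show "inner (a *\<^sub>R f) g = a * inner f g"
    by (simp add: inner_L2_def scaleR_L2_def cinner_scaleC_left)
  show "0 \<le> inner f f" by (simp add: inner_L2_def Re_cinner_self_nonneg)
  show "inner f f = 0 \<longleftrightarrow> f = 0" by (simp add: inner_L2_def Re_cinner_self_eq_0)
qed (simp_all add: norm_L2_def sgn_L2_def dist_L2_def uniformity_L2_def open_L2_def)

end

lemma scaleC_add_right: "c *\<^sub>C (f + g) = c *\<^sub>C f + c *\<^sub>C g"
  by transfer (auto simp: L2_eq_def distrib_left intro!: square_integrable_add square_integrable_scale)

lemma scaleC_scaleC: "c *\<^sub>C d *\<^sub>C f = (c * d) *\<^sub>C f"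
  by transfer (auto simp: L2_eq_def mult.assoc intro!: square_integrable_scale)

lemma norm_scaleC: "norm (c *\<^sub>C f) = norm c * norm f"
proof -
  have "cinner (c *\<^sub>C f) (c *\<^sub>C f) = (c * cnj c) * cinner f f"
    by (metis cinner_commute cinner_scaleC_left complex_cnj_mult mult.assoc mult.commute)
  also have "\<dots> = complex_of_real ((norm c)\<^sup>2 * Re (cinner f f))"
    by (subst cinner_self_real) (simp only: complex_norm_square of_real_mult)
  finally show ?thesis
    by (simp add: norm_L2_def inner_L2_def real_sqrt_mult)
qed

lemma bounded_linear_scaleC: "bounded_linear (\<lambda>f. c *\<^sub>C f)"
proof
  show "c *\<^sub>C r *\<^sub>R f = r *\<^sub>R c *\<^sub>C f" for r f
    by (simp add: scaleR_L2_def scaleC_scaleC mult.commute)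
  show "\<exists>K. \<forall>f. norm (c *\<^sub>C f) \<le> norm f * K"
    by (rule exI[of _ "norm c"]) (simp add: norm_scaleC)
qed (simp add: scaleC_add_right)


section \<open>Bounded operators\<close>

text \<open>
  Elements of \<^typ>\<open>L2 \<Rightarrow>\<^sub>L L2\<close> are bounded real-linear maps; the algebra \<open>B(L\<^sub>2(0,\<infinity>))\<close> is the
  set \<open>BL2\<close> of the complex-linear ones. The norm of \<^typ>\<open>L2 \<Rightarrow>\<^sub>L L2\<close> is the operator norm.
\<close>

type_synonym op = "L2 \<Rightarrow>\<^sub>L L2"

definition BL2 :: "op set"
  where "BL2 = {T. \<forall>c f. blinfun_apply T (c *\<^sub>C f) = c *\<^sub>C blinfun_apply T f}"

definition scale_op :: "complex \<Rightarrow> op \<Rightarrow> op"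
  where "scale_op c T = Blinfun (\<lambda>f. c *\<^sub>C blinfun_apply T f)"

lemma blinfun_apply_scale_op: "blinfun_apply (scale_op c T) f = c *\<^sub>C blinfun_apply T f"
  unfolding scale_op_def
  by (subst bounded_linear_Blinfun_apply)
     (rule bounded_linear_compose[OF bounded_linear_scaleC blinfun.bounded_linear_right], rule refl)

definition adj :: "op \<Rightarrow> op"
  where "adj T = (THE S. S \<in> BL2 \<and> (\<forall>f g. cinner (T f) g = cinner f (S g)))"

definition positive_op :: "op \<Rightarrow> bool"
  where "positive_op T \<longleftrightarrow> T \<in> BL2 \<and> (\<forall>f. cinner (T f) f \<in> \<real>\<^sub>\<ge>\<^sub>0)"

definition projection_op :: "op \<Rightarrow> bool"
  where "projection_op P \<longleftrightarrow> P \<in> BL2 \<and> P o\<^sub>L P = P \<and> adj P = P"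

definition sqrt_op :: "op \<Rightarrow> op"
  where "sqrt_op T = (THE S. positive_op S \<and> S o\<^sub>L S = T)"

definition abs_op :: "op \<Rightarrow> op"
  where "abs_op T = sqrt_op (adj T o\<^sub>L T)"

text \<open>Series in the strong operator topology.\<close>

definition strong_sums :: "(nat \<Rightarrow> op) \<Rightarrow> op \<Rightarrow> bool"
  where "strong_sums A S \<longleftrightarrow> (\<forall>f. (\<lambda>k. blinfun_apply (A k) f) sums blinfun_apply S f)"

definition strong_summable :: "(nat \<Rightarrow> op) \<Rightarrow> bool"
  where "strong_summable A \<longleftrightarrow> (\<exists>S. strong_sums A S)"

definition strong_suminf :: "(nat \<Rightarrow> op) \<Rightarrow> op"
  where "strong_suminf A = (THE S. strong_sums A S)"


section \<open>Trace, spectral projections and singular values\<close>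

definition orthonormal_basis :: "L2 set \<Rightarrow> bool"
  where "orthonormal_basis B \<longleftrightarrow>
    (\<forall>e\<in>B. norm e = 1) \<and> (\<forall>e\<in>B. \<forall>e'\<in>B. e \<noteq> e' \<longrightarrow> cinner e e' = 0) \<and>
    (\<forall>f. (\<forall>e\<in>B. cinner f e = 0) \<longrightarrow> f = 0)"

text \<open>
  The standard trace, meant for positive operators only; its value does not depend on the
  chosen orthonormal basis.
\<close>

definition Tr :: "op \<Rightarrow> ennreal"
  where "Tr T = (\<Sum>\<^sub>\<infinity>e\<in>(SOME B. orthonormal_basis B). ennreal (Re (cinner (T e) e)))"

definition spectral_distribution :: "(real set \<Rightarrow> op) \<Rightarrow> L2 \<Rightarrow> real measure"
  where "spectral_distribution E f =
    measure_of UNIV (sets borel) (\<lambda>X. ennreal (Re (cinner (E X f) f)))"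

text \<open>\<open>E\<close> is a projection-valued Borel measure with \<open>T = \<integral>s dE(s)\<close>.\<close>

definition spectral_resolution :: "op \<Rightarrow> (real set \<Rightarrow> op) \<Rightarrow> bool"
  where "spectral_resolution T E \<longleftrightarrow>
    (\<forall>X\<in>sets borel. projection_op (E X)) \<and>
    E UNIV = id_blinfun \<and>
    (\<forall>X. range X \<subseteq> sets borel \<longrightarrow> disjoint_family X \<longrightarrow>
       strong_sums (\<lambda>n. E (X n)) (E (\<Union>n. X n))) \<and>
    (\<forall>f. integrable (spectral_distribution E f) (\<lambda>s. s) \<and>
       cinner (T f) f = complex_of_real (integral\<^sup>L (spectral_distribution E f) (\<lambda>s. s)))"

text \<open>
  \<open>spectral_projection T X\<close> is \<open>\<chi>\<^sub>X(T)\<close> for self-adjoint \<open>T\<close> and Borel \<open>X\<close>; the resolution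
  chosen here is unique on Borel sets by the spectral theorem.
\<close>

definition spectral_projection :: "op \<Rightarrow> real set \<Rightarrow> op"
  where "spectral_projection T X = (SOME E. spectral_resolution T E) X"

definition singular_value :: "op \<Rightarrow> nat \<Rightarrow> real"
  where "singular_value z n =
    Inf {s. s > 0 \<and> Tr (spectral_projection (abs_op z) {s<..}) \<le> of_nat n}"


section \<open>Sequences\<close>

definition rearrangement :: "(nat \<Rightarrow> 'a::real_normed_vector) \<Rightarrow> nat \<Rightarrow> real"
  where "rearrangement x n =
    Inf {s. s > 0 \<and> finite {k. norm (x k) > s} \<and> card {k. norm (x k) > s} \<le> n}"

definition Lambda_log :: "(nat \<Rightarrow> 'a::real_normed_vector) set"
  where "Lambda_log = {x. x \<longlonglongrightarrow> 0 \<and>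
    summable (\<lambda>n. rearrangement x n * (ln (real n + 2) - ln (real n + 1)))}"

definition Lambda_log_op :: "op set"
  where "Lambda_log_op = {z \<in> BL2. singular_value z \<in> Lambda_log}"

definition Calderon :: "(nat \<Rightarrow> real) \<Rightarrow> nat \<Rightarrow> real"
  where "Calderon y n =
    (\<Sum>k=0..n. y k) / (real n + 1) + (\<Sum>\<^sub>\<infinity>k\<in>{n..}. y k / (real k + 1))"


section \<open>Von Neumann subalgebras, conditional expectations and filtrations\<close>

text \<open>The normal functionals, i.e. those given by trace class operators.\<close>

definition normal_functionals :: "(op \<Rightarrow> complex) set"
  where "normal_functionals =
    {\<lambda>T. \<Sum>n. cinner (blinfun_apply T (f n)) (g n) | f g :: nat \<Rightarrow> L2.
       summable (\<lambda>n. (norm (f n))\<^sup>2) \<and> summable (\<lambda>n. (norm (g n))\<^sup>2)}"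

definition weak_star :: "op topology"
  where "weak_star = topology_generated_by
    {{T \<in> BL2. \<phi> T \<in> U} | \<phi> U. \<phi> \<in> normal_functionals \<and> open U}"

text \<open>Subalgebras are understood to contain the unit of the ambient algebra.\<close>

definition vN_subalgebra :: "op set \<Rightarrow> bool"
  where "vN_subalgebra N \<longleftrightarrow>
    N \<subseteq> BL2 \<and> id_blinfun \<in> N \<and>
    (\<forall>a\<in>N. \<forall>b\<in>N. a + b \<in> N \<and> a o\<^sub>L b \<in> N) \<and>
    (\<forall>c. \<forall>a\<in>N. scale_op c a \<in> N) \<and> (\<forall>a\<in>N. adj a \<in> N) \<and>
    closedin weak_star N"

definition trace_semifinite_on :: "op set \<Rightarrow> bool"
  where "trace_semifinite_on N \<longleftrightarrow>
    (\<forall>a\<in>N. positive_op a \<and> a \<noteq> 0 \<longrightarrow>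
      (\<exists>b\<in>N. positive_op b \<and> b \<noteq> 0 \<and> positive_op (a - b) \<and> Tr b < \<infinity>))"

definition trace_preserving_expectation :: "op set \<Rightarrow> (op \<Rightarrow> op) \<Rightarrow> bool"
  where "trace_preserving_expectation N E \<longleftrightarrow>
    (\<forall>x\<in>BL2. E x \<in> N) \<and> (\<forall>b\<in>N. E b = b) \<and>
    (\<forall>x\<in>BL2. \<forall>y\<in>BL2. E (x + y) = E x + E y) \<and>
    (\<forall>c. \<forall>x\<in>BL2. E (scale_op c x) = scale_op c (E x)) \<and>
    (\<forall>x\<in>BL2. \<forall>a\<in>N. \<forall>b\<in>N. E (a o\<^sub>L x o\<^sub>L b) = a o\<^sub>L E x o\<^sub>L b) \<and>
    (\<forall>x. positive_op x \<longrightarrow> positive_op (E x) \<and> Tr (E x) = Tr x)"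

text \<open>
  When the trace is semifinite on the von Neumann subalgebra \<open>N\<close>, a trace-preserving conditional
  expectation exists and is unique on \<open>BL2\<close> (normality is automatic).
\<close>

definition cond_expectation :: "op set \<Rightarrow> op \<Rightarrow> op"
  where "cond_expectation N = (SOME E. trace_preserving_expectation N E)"

definition filtration :: "(nat \<Rightarrow> op set) \<Rightarrow> bool"
  where "filtration N \<longleftrightarrow>
    (\<forall>k. vN_subalgebra (N k) \<and> trace_semifinite_on (N k) \<and> N k \<subseteq> N (Suc k)) \<and>
    weak_star closure_of (\<Union>k. N k) = BL2"

end

theory Submission
  imports Defs
begin

text \<open>
  Put \<open>\<mu> = \<mu>(x)\<close>, \<open>e\<^sub>m(s) = exp(2\<pi>ims)\<close> and \<open>f\<^sub>j(s) = exp(2\<pi>i(j+1/2)s)\<close> on \<open>[0,1]\<close>. The operator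
  \<open>X = \<Sum>\<^sub>m \<mu>(m) e\<^sub>m \<otimes> e\<^sub>m\<close> has kernel \<open>g(s-u)\<close> with \<open>g\<close> periodic. Multiplying the kernel by \<open>sgn(u-s)\<close> makes it
  antiperiodic, so it gives an operator \<open>H\<close> that is diagonal with respect to the \<open>f\<^sub>j\<close>, with eigenvalues
  \<open>(i/\<pi>) \<Sum>\<^sub>m \<mu>(m)/(j-m+1/2)\<close>; for \<open>j = -n-1\<close> their modulus dominates a multiple of \<open>(S\<^sub>d\<mu>)(n)\<close>. The operators
  \<open>V = (X+H)/2\<close> and \<open>W = V\<^sup>* = (X-H)/2\<close> are the upper and lower triangular parts of \<open>X\<close> with respect to the
  projections \<open>\<chi>\<^sub>(\<^sub>0\<^sub>,\<^sub>s\<^sub>)\<close>.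

  Cut the half-line into cells with projections \<open>p\<^sub>0, \<dots>, p\<^sub>K\<close>, where \<open>K \<approx> 1/t\<close>, put \<open>P\<^sub>k = p\<^sub>0 + \<dots> + p\<^sub>k\<close> and
  \<open>a\<^sub>k = X p\<^sub>k\<close>, and let the \<open>k\<close>-th algebra be the commutant of \<open>P\<^sub>k, p\<^sub>k\<^sub>+\<^sub>1, \<dots>, p\<^sub>K\<close>. Then
  \<open>\<Sum>\<^sub>k a\<^sub>k a\<^sub>k\<^sup>* = X\<^sup>2\<close>, the conditional expectations are \<open>P\<^sub>k X p\<^sub>k\<close>, and \<open>\<Sum>\<^sub>k P\<^sub>k X p\<^sub>k = V + \<Sum>\<^sub>k p\<^sub>k W p\<^sub>k\<close> tends to \<open>V\<close> in norm.
  Hence \<open>z\<^sub>1 = X\<close> and \<open>z\<^sub>2 = |V\<^sup>*|\<close>. As \<open>H = V - V\<^sup>*\<close>, one has \<open>|\<langle>Hf,f\<rangle>| \<le> 2 \<parallel>z\<^sub>2 f\<parallel> \<parallel>f\<parallel>\<close>, and testing this on the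
  span of \<open>f\<^sub>-\<^sub>1, \<dots>, f\<^sub>-\<^sub>n\<^sub>-\<^sub>1\<close> bounds the \<open>n\<close>-th singular value of \<open>z\<^sub>2\<close> from below.
\<close>

section \<open>The Hilbert space\<close>

text \<open>Adjoint, square root, trace, spectral projection and conditional expectation are all
  given by \<open>THE\<close> or \<open>SOME\<close>. Hence each value that occurs must be shown to
  exist and to be forced: square roots by an explicit iteration, spectral projections by evaluating
  an arbitrary resolution on eigenvectors, expectations by the bimodule property.

  The analytic obstacle is that \<open>mu\<close> need not be summable; only mu(m)/(m+1) is. The
  series of modulated Volterra operators for V and W can therefore not be summed by adding norms.
  Their sum and their difference can be controlled: the terms of X are multiples of mutually
  orthogonal rank one projections, and the terms of H are diagonal in one common family, so that the
  norm of a tail is a supremum over j of sums of mu(m)/|j-m+1/2|. Such sums are bounded uniformly in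
  j because \<open>mu\<close> decreases.

  Triangular truncation is not bounded in the operator norm, so the convergence of the block
  truncations to V is not automatic either. It is checked on finite sums of Volterra operators,
  whose diagonal blocks are explicitly small, and carried to the limit because a pinching is a
  contraction.\<close>

lemma cinner_add_right: "cinner h (f + g) = cinner h f + cinner h g"
  by (subst (1 2 3) cinner_commute) (simp add: cinner_add_left)

lemma cinner_scaleC_right: "cinner f (c *\<^sub>C g) = cnj c * cinner f g"
  by (subst (1 2) cinner_commute) (simp add: cinner_scaleC_left)

lemma scaleR_scaleC: "r *\<^sub>R f = complex_of_real r *\<^sub>C (f::L2)"
  by (simp add: scaleR_L2_def)

lemma scaleC_one [simp]: "1 *\<^sub>C f = f"
  using scaleR_scaleC[of 1 f] by simp

lemma scaleC_zero_left [simp]: "0 *\<^sub>C f = 0"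
  using scaleR_scaleC[of 0 f] by simp

lemma scaleC_zero_right [simp]: "c *\<^sub>C 0 = 0"
  by (rule linear_simps(3)[OF bounded_linear_scaleC])

lemma scaleC_uminus_one: "(-1) *\<^sub>C f = - f"
  using scaleR_scaleC[of "-1" f] by simp

lemma scaleC_add_left: "(a + b) *\<^sub>C f = a *\<^sub>C f + b *\<^sub>C f"
  by transfer (auto simp: L2_eq_def distrib_right intro!: square_integrable_add square_integrable_scale)

lemma scaleC_minus_right [simp]: "c *\<^sub>C (- f) = - (c *\<^sub>C f)"
  using bounded_linear_scaleC[of c] by (rule linear_simps(4))

lemma scaleC_minus_left [simp]: "(- c) *\<^sub>C f = - (c *\<^sub>C f)"
  by (metis mult_minus1 scaleC_scaleC scaleC_uminus_one)

lemma scaleC_diff_right: "c *\<^sub>C (f - g) = c *\<^sub>C f - c *\<^sub>C g"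
  by (metis diff_conv_add_uminus scaleC_add_right scaleC_minus_right)

lemma scaleC_sum_right: "c *\<^sub>C (\<Sum>i\<in>F. g i) = (\<Sum>i\<in>F. c *\<^sub>C g i)"
  by (rule linear_sum[OF bounded_linear.linear[OF bounded_linear_scaleC]])

lemma cinner_zero_left [simp]: "cinner 0 f = 0"
  using cinner_add_left[of 0 0 f] by simp

lemma cinner_zero_right [simp]: "cinner f 0 = 0"
  using cinner_add_right[of f 0 0] by simp

lemma cinner_minus_left [simp]: "cinner (- f) g = - cinner f g"
  using cinner_add_left[of f "- f" g] by (simp add: eq_neg_iff_add_eq_0 add.commute)

lemma cinner_minus_right [simp]: "cinner f (- g) = - cinner f g"
  using cinner_add_right[of f g "- g"] by (simp add: eq_neg_iff_add_eq_0 add.commute)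

lemma cinner_diff_left: "cinner (f - g) h = cinner f h - cinner g h"
  using cinner_add_left[of f "- g" h] by simp

lemma cinner_diff_right: "cinner h (f - g) = cinner h f - cinner h g"
  using cinner_add_right[of h f "- g"] by simp

lemma cinner_sum_left: "cinner (\<Sum>i\<in>F. g i) h = (\<Sum>i\<in>F. cinner (g i) h)"
  by (induction F rule: infinite_finite_induct) (auto simp: cinner_add_left)

lemma cinner_sum_right: "cinner h (\<Sum>i\<in>F. g i) = (\<Sum>i\<in>F. cinner h (g i))"
  by (induction F rule: infinite_finite_induct) (auto simp: cinner_add_right)

lemma cinner_self: "cinner f f = complex_of_real ((norm f)\<^sup>2)"
  by (subst cinner_self_real) (simp add: norm_L2_def inner_L2_def Re_cinner_self_nonneg)

lemma norm_sq_cinner: "(norm f)\<^sup>2 = Re (cinner f f)"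
  by (simp add: cinner_self)

lemma cinner_swap_zero: "cinner f g = 0 \<longleftrightarrow> cinner g f = 0"
  by (metis cinner_commute complex_cnj_zero_iff)

lemma norm_cinner_commute: "norm (cinner f g) = norm (cinner g f)"
  by (metis cinner_commute complex_mod_cnj)

lemma norm_sq_add: "(norm (f + g :: L2))\<^sup>2 = (norm f)\<^sup>2 + (norm g)\<^sup>2 + 2 * Re (cinner f g)"
  using cinner_commute[of f g]
  by (simp add: norm_sq_cinner cinner_add_left cinner_add_right complex_eq_iff)

lemma norm_sq_diff: "(norm (f - g :: L2))\<^sup>2 = (norm f)\<^sup>2 + (norm g)\<^sup>2 - 2 * Re (cinner f g)"
  using norm_sq_add[of f "- g"] by simp

text \<open>A unimodular factor rotates the complex inner product onto the nonnegative reals; there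
  it is the real inner product, and the real Cauchy-Schwarz inequality applies.\<close>

lemma norm_cinner_le: "norm (cinner f g) \<le> norm f * norm g"
proof -
  obtain u where u: "norm u = 1" "u * cinner f g = norm (cinner f g)"
  proof (cases "cinner f g = 0")
    case False
    show ?thesis
    proof (rule that[of "cnj (cinner f g) / norm (cinner f g)"])
      show "norm (cnj (cinner f g) / norm (cinner f g)) = 1" using False by (simp add: norm_divide)
      show "cnj (cinner f g) / norm (cinner f g) * cinner f g = norm (cinner f g)"
        using False by (simp add: complex_norm_square[symmetric] power2_eq_square mult.commute field_simps)
    qed
  qed (use that[of 1] in simp)
  have "norm (cinner f g) = inner (u *\<^sub>C f) g"
    using u by (simp add: inner_L2_def cinner_scaleC_left)
  also have "\<dots> \<le> norm (u *\<^sub>C f) * norm g" by (rule norm_cauchy_schwarz)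
  finally show ?thesis using u by (simp add: norm_scaleC)
qed

lemma bounded_linear_cinner_left: "bounded_linear (\<lambda>f. cinner f g)"
  by (rule bounded_linear_intro[of _ "norm g"])
     (auto simp: cinner_add_left scaleR_scaleC cinner_scaleC_left scaleR_conv_of_real norm_cinner_le)

lemma bounded_linear_cinner_right: "bounded_linear (\<lambda>g. cinner f g)"
  by (rule bounded_linear_intro[of _ "norm f"])
     (auto simp: cinner_add_right scaleR_scaleC cinner_scaleC_right scaleR_conv_of_real mult.commute
        intro: order.trans[OF norm_cinner_le])

lemmas tendsto_cinner_left = bounded_linear.tendsto[OF bounded_linear_cinner_left]
lemmas tendsto_cinner_right = bounded_linear.tendsto[OF bounded_linear_cinner_right]

lemma cinner_eqI: "(\<And>g. cinner f g = cinner f' g) \<Longrightarrow> f = f'"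
  using Re_cinner_self_eq_0[of "f - f'"] cinner_diff_left[of f f' "f - f'"] by simp

lemma cinner_eqI_right: "(\<And>g. cinner g f = cinner g f') \<Longrightarrow> f = f'"
  using Re_cinner_self_eq_0[of "f - f'"] cinner_diff_right[of "f - f'" f f'] by simp

subsection \<open>Representatives and completeness\<close>

text \<open>The value 0 outside the square-integrable functions makes the map total, so that it can
  be lifted. By \<open>L2_cases\<close> every vector has a square-integrable representative.\<close>

lift_definition L2_of :: "(real \<Rightarrow> complex) \<Rightarrow> L2"
  is "\<lambda>f. if square_integrable f then f else (\<lambda>x. 0)"
  by (auto simp: L2_eq_def square_integrable_zero)

lemma L2_cases: obtains f where "square_integrable f" "F = L2_of f"
proof -
  have "\<exists>f. square_integrable f \<and> F = L2_of f"
    by transfer (auto simp: L2_eq_def)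
  then show ?thesis using that by blast
qed

lemma L2_of_add: "square_integrable f \<Longrightarrow> square_integrable g \<Longrightarrow> L2_of f + L2_of g = L2_of (\<lambda>x. f x + g x)"
  by transfer (auto simp: L2_eq_def square_integrable_add)

lemma L2_of_diff: "square_integrable f \<Longrightarrow> square_integrable g \<Longrightarrow> L2_of f - L2_of g = L2_of (\<lambda>x. f x - g x)"
  by transfer (auto simp: L2_eq_def square_integrable_diff)

lemma L2_of_scaleC: "square_integrable f \<Longrightarrow> c *\<^sub>C L2_of f = L2_of (\<lambda>x. c * f x)"
  by transfer (auto simp: L2_eq_def square_integrable_scale)

lemma cinner_L2_of: "square_integrable f \<Longrightarrow> square_integrable g \<Longrightarrow>
    cinner (L2_of f) (L2_of g) = integral\<^sup>L half_line (\<lambda>x. f x * cnj (g x))"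
  by transfer (auto simp: L2_eq_def)

lemma norm_L2_of: 
  assumes "square_integrable f"
  shows "(norm (L2_of f))\<^sup>2 = integral\<^sup>L half_line (\<lambda>x. (norm (f x))\<^sup>2)"
proof -
  have "cinner (L2_of f) (L2_of f) = complex_of_real (integral\<^sup>L half_line (\<lambda>x. (norm (f x))\<^sup>2))"
    using assms by (simp add: cinner_L2_of) (simp only: complex_norm_square[symmetric] integral_complex_of_real)
  then show ?thesis by (simp add: norm_sq_cinner)
qed

lemma nn_integral_L2_of: 
  assumes "square_integrable f"
  shows "(\<integral>\<^sup>+x. ennreal ((norm (f x))\<^sup>2) \<partial>half_line) = ennreal ((norm (L2_of f))\<^sup>2)"
  unfolding norm_L2_of[OF assms]
  by (rule nn_integral_eq_integral) (use assms in \<open>auto simp: square_integrable_def\<close>)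

lemma square_integrable_measurable: "square_integrable f \<Longrightarrow> f \<in> borel_measurable half_line"
  by (simp add: square_integrable_def)

lemma square_integrableI_nn:
  assumes "f \<in> borel_measurable half_line" "(\<integral>\<^sup>+x. ennreal ((norm (f x))\<^sup>2) \<partial>half_line) < \<infinity>"
  shows "square_integrable f"
  unfolding square_integrable_def using assms
  by (auto intro!: integrableI_nonneg)

lemma summable_norm_diff_imp_convergent:
  fixes g :: "nat \<Rightarrow> 'a::banach"
  assumes "summable (\<lambda>k. norm (g (Suc k) - g k))"
  shows "convergent g"
proof -
  have "summable (\<lambda>k. g (Suc k) - g k)" using assms by (rule summable_norm_cancel)
  then have "convergent (\<lambda>n. \<Sum>k<n. g (Suc k) - g k)" by (simp add: summable_iff_convergent)
  then have "convergent (\<lambda>n. (\<Sum>k<n. g (Suc k) - g k) + g 0)" by (intro convergent_add convergent_const)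
  then show ?thesis by (simp add: sum_lessThan_telescope)
qed

text \<open>The squared increments have integrals at most 4^(-k). Even after multiplication by 2^k
  they have a finite sum of integrals, hence a finite pointwise sum almost everywhere, and the
  increments then decay geometrically with ratio sqrt(1/2).\<close>

lemma L2_Cauchy_AE_convergent:
  assumes g: "\<And>k. square_integrable (g k)"
    and d: "\<And>k. norm (L2_of (g (Suc k)) - L2_of (g k)) \<le> (1/2)^k"
  shows "AE x in half_line. convergent (\<lambda>k. g k x)"
proof -
  have [measurable]: "\<And>k. g k \<in> borel_measurable half_line"
    using g by (simp add: square_integrable_measurable)
  define D where "D k x = ennreal (2^k) * ennreal ((norm (g (Suc k) x - g k x))\<^sup>2)" for k x
  have [measurable]: "D k \<in> borel_measurable half_line" for k unfolding D_def by measurable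
  have "(\<integral>\<^sup>+x. D k x \<partial>half_line) \<le> ennreal ((1/2)^k)" for k
  proof -
    have "(\<integral>\<^sup>+x. D k x \<partial>half_line) = ennreal (2^k) * (\<integral>\<^sup>+x. ennreal ((norm (g (Suc k) x - g k x))\<^sup>2) \<partial>half_line)"
      unfolding D_def by (rule nn_integral_cmult) measurable
    also have "\<dots> = ennreal (2^k) * ennreal ((norm (L2_of (g (Suc k)) - L2_of (g k)))\<^sup>2)"
      using g by (simp add: L2_of_diff nn_integral_L2_of square_integrable_diff)
    also have "\<dots> \<le> ennreal (2^k) * ennreal (((1/2)^k)\<^sup>2)"
      by (intro mult_left_mono ennreal_leI power_mono d) auto
    also have "\<dots> = ennreal ((1/2)^k)"
      by (simp add: ennreal_mult[symmetric] power2_eq_square power_mult_distrib[symmetric])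
    finally show ?thesis .
  qed
  then have "(\<Sum>k. \<integral>\<^sup>+x. D k x \<partial>half_line) \<le> (\<Sum>k. ennreal ((1/2)^k))"
    by (intro suminf_le) auto
  also have "\<dots> = ennreal (\<Sum>k. (1/2)^k)" by (rule suminf_ennreal2) (auto simp: summable_geometric)
  finally have "(\<integral>\<^sup>+x. (\<Sum>k. D k x) \<partial>half_line) < \<infinity>"
    by (subst nn_integral_suminf) (auto simp: le_less_trans)
  then have "AE x in half_line. (\<Sum>k. D k x) \<noteq> \<infinity>"
    by (intro nn_integral_PInf_AE) auto
  then show ?thesis
  proof (rule AE_mp, intro AE_I2 impI)
    fix x assume fin: "(\<Sum>k. D k x) \<noteq> \<infinity>"
    define C where "C = enn2real (\<Sum>k. D k x)"
    have "D k x \<le> ennreal C" for k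
      unfolding C_def using fin sum_le_suminf[of "\<lambda>k. D k x" "{k}"] by (simp add: less_top)
    then have 1: "2^k * (norm (g (Suc k) x - g k x))\<^sup>2 \<le> C" for k
      unfolding D_def by (simp add: ennreal_mult[symmetric] C_def)
    have 2: "norm (g (Suc k) x - g k x) \<le> sqrt C * (sqrt (1/2))^k" for k
    proof -
      have "(norm (g (Suc k) x - g k x))\<^sup>2 \<le> C * (1/2)^k"
        using 1[of k] by (simp add: field_simps)
      then have "norm (g (Suc k) x - g k x) \<le> sqrt (C * (1/2)^k)" by (rule real_le_rsqrt)
      then show ?thesis by (simp add: real_sqrt_mult real_sqrt_power)
    qed
    have "summable (\<lambda>k. norm (g (Suc k) x - g k x))"
      by (rule summable_comparison_test'[of "\<lambda>k. sqrt C * (sqrt (1/2))^k"])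
         (use 2 in \<open>auto intro!: summable_mult summable_geometric simp: real_sqrt_divide\<close>)
    then show "convergent (\<lambda>k. g k x)" by (rule summable_norm_diff_imp_convergent)
  qed
qed

text \<open>Riesz-Fischer: a fast subsequence converges almost everywhere, and Fatou's lemma turns
  the pointwise limit into a norm limit of the whole sequence.\<close>

instance L2 :: complete_space
proof
  fix X :: "nat \<Rightarrow> L2" assume "Cauchy X"
  then have "\<forall>k. \<exists>N. \<forall>m\<ge>N. \<forall>n\<ge>N. norm (X m - X n) < (1/2)^k"
    by (auto simp: Cauchy_def dist_norm)
  then obtain N where N: "\<And>k m n. m \<ge> N k \<Longrightarrow> n \<ge> N k \<Longrightarrow> norm (X m - X n) < (1/2)^k"
    by metis
  \<comment> \<open>The maximum over all earlier thresholds makes \<open>r j\<close> admissible for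
    every k <= j at once, as required both for consecutive differences and for the lower limit in
    Fatou's lemma.\<close>
  define r where "r k = Max (N ` {..k})" for k
  have r: "r j \<ge> N k" if "k \<le> j" for j k using that by (auto simp: r_def)
  have "\<forall>k. \<exists>g. square_integrable g \<and> X k = L2_of g" by (metis L2_cases)
  then obtain h where h: "\<And>k. square_integrable (h k)" and X: "\<And>k. X k = L2_of (h k)" by metis
  define g where "g k = h (r k)" for k
  have [measurable]: "\<And>k. h k \<in> borel_measurable half_line" "\<And>k. g k \<in> borel_measurable half_line"
    using h by (auto simp: square_integrable_measurable g_def)
  have conv: "AE x in half_line. convergent (\<lambda>k. g k x)"
  proof (rule L2_Cauchy_AE_convergent)
    show "norm (L2_of (g (Suc k)) - L2_of (g k)) \<le> (1/2)^k" for k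
      unfolding g_def X[symmetric] by (rule less_imp_le, rule N) (auto intro: r)
  qed (simp add: g_def h)
  define f where "f x = lim (\<lambda>k. g k x)" for x
  have [measurable]: "f \<in> borel_measurable half_line"
    unfolding f_def by measurable
  have lim: "AE x in half_line. (\<lambda>k. g k x) \<longlonglongrightarrow> f x"
    using conv by (rule AE_mp) (auto simp: f_def convergent_LIMSEQ_iff)
  have fatou: "(\<integral>\<^sup>+x. ennreal ((norm (h n x - f x))\<^sup>2) \<partial>half_line) \<le> ennreal (((1/2)^k)\<^sup>2)"
    if n: "n \<ge> N k" for n k
  proof -
    have "(\<integral>\<^sup>+x. ennreal ((norm (h n x - f x))\<^sup>2) \<partial>half_line)
        = (\<integral>\<^sup>+x. liminf (\<lambda>j. ennreal ((norm (h n x - g j x))\<^sup>2)) \<partial>half_line)"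
    proof (rule nn_integral_cong_AE, rule AE_mp[OF lim], intro AE_I2 impI)
      fix x assume "(\<lambda>k. g k x) \<longlonglongrightarrow> f x"
      then have "(\<lambda>j. ennreal ((norm (h n x - g j x))\<^sup>2)) \<longlonglongrightarrow> ennreal ((norm (h n x - f x))\<^sup>2)"
        by (intro tendsto_ennrealI tendsto_intros)
      then show "ennreal ((norm (h n x - f x))\<^sup>2) = liminf (\<lambda>j. ennreal ((norm (h n x - g j x))\<^sup>2))"
        using lim_imp_Liminf[OF trivial_limit_sequentially] by fastforce
    qed
    also have "\<dots> \<le> liminf (\<lambda>j. \<integral>\<^sup>+x. ennreal ((norm (h n x - g j x))\<^sup>2) \<partial>half_line)"
      by (rule nn_integral_liminf) measurable
    also have "\<dots> = liminf (\<lambda>j. ennreal ((norm (X n - X (r j)))\<^sup>2))"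
      unfolding X by (simp add: g_def h L2_of_diff nn_integral_L2_of square_integrable_diff)
    also have "\<dots> \<le> liminf (\<lambda>j. ennreal (((1/2)^k)\<^sup>2))"
    proof (rule Liminf_mono)
      show "\<forall>\<^sub>F j in sequentially. ennreal ((norm (X n - X (r j)))\<^sup>2) \<le> ennreal (((1/2)^k)\<^sup>2)"
        using eventually_ge_at_top[of k]
      proof eventually_elim
        case (elim j)
        then show ?case by (intro ennreal_leI power_mono less_imp_le[OF N[OF n r]]) auto
      qed
    qed
    finally show ?thesis by (simp add: Liminf_const)
  qed
  have hf: "square_integrable (\<lambda>x. h n x - f x)" if "n \<ge> N k" for n k
    by (rule square_integrableI_nn) (use fatou[OF that] in \<open>auto intro: le_less_trans\<close>)
  have f: "square_integrable f"
    using square_integrable_diff[OF h[of "N 0"] hf[of 0 "N 0"]] by simp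
  have "norm (X n - L2_of f) \<le> (1/2)^k" if "n \<ge> N k" for n k
  proof -
    have "ennreal ((norm (X n - L2_of f))\<^sup>2) \<le> ennreal (((1/2)^k)\<^sup>2)"
      using fatou[OF that] unfolding X by (simp add: h f L2_of_diff nn_integral_L2_of square_integrable_diff)
    then show ?thesis by (simp add: power2_le_iff_abs_le)
  qed
  moreover have "\<exists>k. (1/2::real)^k < e" if "e > 0" for e :: real
    using that by (intro real_arch_pow_inv) auto
  ultimately have "X \<longlonglongrightarrow> L2_of f"
    unfolding LIMSEQ_def dist_norm by (meson le_less_trans)
  then show "convergent X" by (auto simp: convergent_def)
qed

instance L2 :: banach ..

section \<open>Operators and orthonormal families\<close>

lemma BL2_scaleC: "T \<in> BL2 \<Longrightarrow> blinfun_apply T (c *\<^sub>C f) = c *\<^sub>C blinfun_apply T f"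
  by (simp add: BL2_def)

lemma BL2_I: "(\<And>c f. blinfun_apply T (c *\<^sub>C f) = c *\<^sub>C blinfun_apply T f) \<Longrightarrow> T \<in> BL2"
  by (simp add: BL2_def)

lemma scaleC_scaleR: "c *\<^sub>C r *\<^sub>R f = r *\<^sub>R c *\<^sub>C (f::L2)"
  by (simp add: scaleR_scaleC scaleC_scaleC mult.commute)

lemma BL2_zero [simp]: "0 \<in> BL2" by (rule BL2_I) simp
lemma BL2_id [simp]: "id_blinfun \<in> BL2" by (rule BL2_I) simp
lemma BL2_add [intro]: "T \<in> BL2 \<Longrightarrow> S \<in> BL2 \<Longrightarrow> T + S \<in> BL2"
  by (rule BL2_I) (simp add: BL2_scaleC blinfun.add_left scaleC_add_right)
lemma BL2_diff [intro]: "T \<in> BL2 \<Longrightarrow> S \<in> BL2 \<Longrightarrow> T - S \<in> BL2"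
  by (rule BL2_I) (simp add: BL2_scaleC blinfun.diff_left scaleC_diff_right)
lemma BL2_comp [intro]: "T \<in> BL2 \<Longrightarrow> S \<in> BL2 \<Longrightarrow> T o\<^sub>L S \<in> BL2"
  by (rule BL2_I) (simp add: BL2_scaleC)
lemma BL2_scaleR [intro]: "T \<in> BL2 \<Longrightarrow> r *\<^sub>R T \<in> BL2"
  by (rule BL2_I) (simp add: BL2_scaleC blinfun.scaleR_left scaleC_scaleR)
lemma BL2_sum [intro]: "(\<And>i. i \<in> F \<Longrightarrow> T i \<in> BL2) \<Longrightarrow> (\<Sum>i\<in>F. T i) \<in> BL2"
  by (induction F rule: infinite_finite_induct) auto
lemma BL2_scale_op [intro]: "T \<in> BL2 \<Longrightarrow> scale_op c T \<in> BL2"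
  by (rule BL2_I) (simp add: BL2_scaleC blinfun_apply_scale_op scaleC_scaleC mult.commute)

lemma op_eqI: "(\<And>f. blinfun_apply T f = blinfun_apply S f) \<Longrightarrow> T = S"
  by (rule blinfun_eqI)

lemma comp_assoc: "(A o\<^sub>L B) o\<^sub>L C = A o\<^sub>L (B o\<^sub>L C)"
  by (rule op_eqI) simp

lemmas comp_simps = blinfun_apply_blinfun_compose blinfun.add_left blinfun.diff_left blinfun.add_right
  blinfun.diff_right blinfun.scaleR_left blinfun.scaleR_right blinfun.sum_left blinfun.sum_right
  blinfun.minus_left blinfun.minus_right

lemma comp_sum_left: "(\<Sum>i\<in>F. A i) o\<^sub>L B = (\<Sum>i\<in>F. A i o\<^sub>L B)"
  by (rule op_eqI) (simp add: comp_simps)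
lemma comp_sum_right: "B o\<^sub>L (\<Sum>i\<in>F. A i) = (\<Sum>i\<in>F. B o\<^sub>L A i)"
  by (rule op_eqI) (simp add: comp_simps)
lemma comp_add_left: "(A + A') o\<^sub>L B = (A o\<^sub>L B) + (A' o\<^sub>L B)"
  by (rule op_eqI) (simp add: comp_simps)
lemma comp_add_right: "B o\<^sub>L (A + A') = (B o\<^sub>L A) + (B o\<^sub>L A')"
  by (rule op_eqI) (simp add: comp_simps)
lemma comp_diff_left: "(A - A') o\<^sub>L B = (A o\<^sub>L B) - (A' o\<^sub>L B)"
  by (rule op_eqI) (simp add: comp_simps)
lemma comp_diff_right: "B o\<^sub>L (A - A') = (B o\<^sub>L A) - (B o\<^sub>L A')"
  by (rule op_eqI) (simp add: comp_simps)
lemma comp_scaleR_left: "(r *\<^sub>R A) o\<^sub>L B = r *\<^sub>R (A o\<^sub>L B)"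
  by (rule op_eqI) (simp add: comp_simps)
lemma comp_scaleR_right: "A o\<^sub>L (r *\<^sub>R B) = r *\<^sub>R (A o\<^sub>L B)"
  by (rule op_eqI) (simp add: comp_simps)
lemma comp_id_left [simp]: "id_blinfun o\<^sub>L B = B" by (rule op_eqI) simp
lemma comp_id_right [simp]: "B o\<^sub>L id_blinfun = B" by (rule op_eqI) simp
lemma comp_zero_left [simp]: "0 o\<^sub>L B = (0 :: 'a::real_normed_vector \<Rightarrow>\<^sub>L 'c::real_normed_vector)" by (rule op_eqI) simp
lemma comp_zero_right [simp]: "B o\<^sub>L 0 = (0 :: 'a::real_normed_vector \<Rightarrow>\<^sub>L 'c::real_normed_vector)" by (rule op_eqI) simp

text \<open>A relation in place of the description \<open>adj\<close>: algebra with adjoints becomes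
  possible before existence is known, and \<open>adj_eqI\<close> evaluates \<open>adj\<close> from
  any exhibited pair.\<close>

definition adjoint_pair :: "op \<Rightarrow> op \<Rightarrow> bool"
  where "adjoint_pair T S \<longleftrightarrow> (\<forall>f g. cinner (T f) g = cinner f (S g))"

lemma adjoint_pairD: "adjoint_pair T S \<Longrightarrow> cinner (blinfun_apply T f) g = cinner f (blinfun_apply S g)"
  by (simp add: adjoint_pair_def)

lemma adjoint_pair_sym: "adjoint_pair T S \<Longrightarrow> adjoint_pair S T"
  unfolding adjoint_pair_def by (metis cinner_commute)

text \<open>The inner product is conjugate linear in its second argument, and this alone forces
  complex linearity of the partner. By symmetry of the relation both members of a pair lie in
  \<open>BL2\<close>.\<close>

lemma adjoint_pair_BL2: assumes "adjoint_pair T S" shows "S \<in> BL2"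
proof (rule BL2_I)
  fix c f
  show "S (c *\<^sub>C f) = c *\<^sub>C S f"
    by (rule cinner_eqI_right) (simp add: adjoint_pairD[OF assms, symmetric] cinner_scaleC_right)
qed

lemma adjoint_pair_unique: "adjoint_pair T S \<Longrightarrow> adjoint_pair T S' \<Longrightarrow> S = S'"
  by (intro op_eqI cinner_eqI_right) (metis adjoint_pairD)

lemma adj_eqI: assumes "adjoint_pair T S" shows "adj T = S"
  unfolding adj_def
proof (rule the_equality)
  show "S \<in> BL2 \<and> (\<forall>f g. cinner (T f) g = cinner f (S g))"
    using assms adjoint_pair_BL2 by (auto simp: adjoint_pair_def)
  show "S' = S" if "S' \<in> BL2 \<and> (\<forall>f g. cinner (T f) g = cinner f (S' g))" for S'
    using that assms adjoint_pair_unique by (auto simp: adjoint_pair_def)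
qed

lemma adjoint_pair_comp: "adjoint_pair T S \<Longrightarrow> adjoint_pair T' S' \<Longrightarrow> adjoint_pair (T o\<^sub>L T') (S' o\<^sub>L S)"
  by (auto simp: adjoint_pair_def)
lemma adjoint_pair_add: "adjoint_pair T S \<Longrightarrow> adjoint_pair T' S' \<Longrightarrow> adjoint_pair (T + T') (S + S')"
  by (auto simp: adjoint_pair_def blinfun.add_left cinner_add_left cinner_add_right)
lemma adjoint_pair_diff: "adjoint_pair T S \<Longrightarrow> adjoint_pair T' S' \<Longrightarrow> adjoint_pair (T - T') (S - S')"
  by (auto simp: adjoint_pair_def blinfun.diff_left cinner_diff_left cinner_diff_right)
lemma adjoint_pair_scaleR: "adjoint_pair T S \<Longrightarrow> adjoint_pair (r *\<^sub>R T) (r *\<^sub>R S)"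
  by (auto simp: adjoint_pair_def blinfun.scaleR_left scaleR_scaleC cinner_scaleC_left cinner_scaleC_right)
lemma adjoint_pair_zero: "adjoint_pair 0 0" by (auto simp: adjoint_pair_def)
lemma adjoint_pair_id: "adjoint_pair id_blinfun id_blinfun" by (auto simp: adjoint_pair_def)
lemma adjoint_pair_sum: "(\<And>i. i \<in> F \<Longrightarrow> adjoint_pair (T i) (S i)) \<Longrightarrow> adjoint_pair (\<Sum>i\<in>F. T i) (\<Sum>i\<in>F. S i)"
  by (induction F rule: infinite_finite_induct) (auto simp: adjoint_pair_zero adjoint_pair_add)
lemma adjoint_pair_lim: 
  assumes "\<And>n. adjoint_pair (T n) (S n)" "T \<longlonglongrightarrow> T'" "S \<longlonglongrightarrow> S'"
  shows "adjoint_pair T' S'"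
  unfolding adjoint_pair_def
proof (intro allI)
  fix f g
  have "(\<lambda>n. blinfun_apply (T n) f) \<longlonglongrightarrow> T' f" "(\<lambda>n. blinfun_apply (S n) g) \<longlonglongrightarrow> S' g"
    using assms by (intro tendsto_intros; simp)+
  then have "(\<lambda>n. cinner (T n f) g) \<longlonglongrightarrow> cinner (T' f) g" "(\<lambda>n. cinner f (S n g)) \<longlonglongrightarrow> cinner f (S' g)"
    by (intro tendsto_cinner_left tendsto_cinner_right; simp)+
  then show "cinner (T' f) g = cinner f (S' g)"
    using LIMSEQ_unique unfolding adjoint_pairD[OF assms(1)] by blast
qed

subsection \<open>Orthonormal families and diagonal operators\<close>

definition orthonormal :: "('i \<Rightarrow> L2) \<Rightarrow> 'i set \<Rightarrow> bool"
  where "orthonormal f I \<longleftrightarrow> (\<forall>i\<in>I. \<forall>j\<in>I. cinner (f i) (f j) = (if i = j then 1 else 0))"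

lemma orthonormalD: "orthonormal f I \<Longrightarrow> i \<in> I \<Longrightarrow> j \<in> I \<Longrightarrow> cinner (f i) (f j) = (if i = j then 1 else 0)"
  by (simp add: orthonormal_def)

lemma orthonormal_norm: "orthonormal f I \<Longrightarrow> i \<in> I \<Longrightarrow> norm (f i) = 1"
  using orthonormalD[of f I i i] norm_sq_cinner[of "f i"] by (simp add: power2_eq_1_iff)
     (smt (verit) norm_ge_zero)

lemma orthonormal_subset: "orthonormal f I \<Longrightarrow> J \<subseteq> I \<Longrightarrow> orthonormal f J"
  unfolding orthonormal_def by blast

lemma orthonormal_cinner_sum:
  assumes "orthonormal f I" "finite F" "F \<subseteq> I" "i \<in> I"
  shows "cinner (\<Sum>j\<in>F. c j *\<^sub>C f j) (f i) = (if i \<in> F then c i else 0)"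
proof -
  have "cinner (\<Sum>j\<in>F. c j *\<^sub>C f j) (f i) = (\<Sum>j\<in>F. if i = j then c j else 0)"
    unfolding cinner_sum_left using assms by (intro sum.cong refl) (auto simp: cinner_scaleC_left orthonormalD)
  then show ?thesis using assms by simp
qed

lemma norm_sq_orthonormal_sum:
  assumes "orthonormal f I" "finite F" "F \<subseteq> I"
  shows "(norm (\<Sum>i\<in>F. c i *\<^sub>C f i))\<^sup>2 = (\<Sum>i\<in>F. (norm (c i))\<^sup>2)"
proof -
  have "cinner (\<Sum>i\<in>F. c i *\<^sub>C f i) (\<Sum>i\<in>F. c i *\<^sub>C f i) = (\<Sum>i\<in>F. cnj (c i) * c i)"
    unfolding cinner_sum_right using assms
    by (intro sum.cong refl) (simp add: cinner_scaleC_right orthonormal_cinner_sum[OF assms] subsetD)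
  also have "\<dots> = complex_of_real (\<Sum>i\<in>F. (norm (c i))\<^sup>2)"
    by (simp add: complex_norm_square mult.commute del: of_real_power)
  finally show ?thesis by (simp add: norm_sq_cinner)
qed

lemma Bessel:
  assumes "orthonormal f I" "finite F" "F \<subseteq> I"
  shows "(\<Sum>i\<in>F. (norm (cinner g (f i)))\<^sup>2) \<le> (norm g)\<^sup>2"
proof -
  define h where "h = (\<Sum>i\<in>F. cinner g (f i) *\<^sub>C f i)"
  have "cinner g h = (\<Sum>i\<in>F. cnj (cinner g (f i)) * cinner g (f i))"
    by (simp add: h_def cinner_sum_right cinner_scaleC_right)
  also have "\<dots> = complex_of_real (\<Sum>i\<in>F. (norm (cinner g (f i)))\<^sup>2)"
    by (simp add: complex_norm_square mult.commute del: of_real_power)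
  finally have "Re (cinner g h) = (\<Sum>i\<in>F. (norm (cinner g (f i)))\<^sup>2)" by simp
  moreover have "(norm h)\<^sup>2 = (\<Sum>i\<in>F. (norm (cinner g (f i)))\<^sup>2)"
    unfolding h_def by (rule norm_sq_orthonormal_sum[OF assms])
  moreover have "0 \<le> (norm (g - h))\<^sup>2" by simp
  ultimately show ?thesis unfolding norm_sq_diff by linarith
qed

text \<open>A finite set that nearly attains the supremum of the coefficient sums leaves little norm
  to any larger one, by Pythagoras. So the net of partial sums is Cauchy, and completeness gives the
  limit.\<close>

lemma orthonormal_summable:
  assumes f: "orthonormal f I" and C: "\<And>F. finite F \<Longrightarrow> F \<subseteq> I \<Longrightarrow> (\<Sum>i\<in>F. (norm (c i))\<^sup>2) \<le> C"
  shows "(\<lambda>i. c i *\<^sub>C f i) summable_on I"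
proof -
  define S where "S F = (\<Sum>i\<in>F. c i *\<^sub>C f i)" for F
  define a where "a F = (\<Sum>i\<in>F. (norm (c i))\<^sup>2)" for F
  define U where "U = (SUP F\<in>{F. finite F \<and> F \<subseteq> I}. a F)"
  have bdd: "bdd_above (a ` {F. finite F \<and> F \<subseteq> I})"
    using C by (auto simp: a_def intro!: bdd_aboveI)
  have ne: "{F. finite F \<and> F \<subseteq> I} \<noteq> {}" by auto
  have "\<exists>P. eventually P (finite_subsets_at_top I) \<and> (\<forall>F F'. P F \<and> P F' \<longrightarrow> dist (S F) (S F') < e)"
    if e: "e > 0" for e
  proof -
    have "U - (e/2)\<^sup>2 < U" using e by simp
    then obtain F0 where F0: "finite F0" "F0 \<subseteq> I" and 1: "U - (e/2)\<^sup>2 < a F0"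
      unfolding U_def using less_cSUP_iff[OF ne bdd] by auto
    have 2: "dist (S F) (S F0) < e/2" if F: "finite F" "F0 \<subseteq> F" "F \<subseteq> I" for F
    proof -
      have "a F \<le> U" unfolding U_def using F bdd by (intro cSUP_upper) auto
      moreover have "(norm (S F - S F0))\<^sup>2 = a F - a F0"
      proof -
        have "S F - S F0 = S (F - F0)" using F by (simp add: S_def sum_diff)
        moreover have "a F - a F0 = a (F - F0)" using F by (simp add: a_def sum_diff)
        ultimately show ?thesis using norm_sq_orthonormal_sum[OF f, of "F - F0" c] F
          by (auto simp: S_def a_def)
      qed
      ultimately have "(norm (S F - S F0))\<^sup>2 < (e/2)\<^sup>2" using 1 by linarith
      then show ?thesis unfolding dist_norm by (rule power_less_imp_less_base) (use e in simp)
    qed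
    show ?thesis
    proof (intro exI conjI allI impI)
      show "\<forall>\<^sub>F F in finite_subsets_at_top I. finite F \<and> F0 \<subseteq> F \<and> F \<subseteq> I"
        unfolding eventually_finite_subsets_at_top using F0 by auto
      show "dist (S F) (S F') < e" if "(finite F \<and> F0 \<subseteq> F \<and> F \<subseteq> I) \<and> (finite F' \<and> F0 \<subseteq> F' \<and> F' \<subseteq> I)" for F F'
        using that dist_triangle2[of "S F" "S F'" "S F0"] 2[of F] 2[of F'] by auto
    qed
  qed
  then have "cauchy_filter (filtermap S (finite_subsets_at_top I))"
    by (simp add: cauchy_filter_metric_filtermap)
  moreover have "complete (UNIV::L2 set)"
    by (meson Cauchy_convergent UNIV_I complete_def convergent_def)
  ultimately obtain L' where "(S \<longlongrightarrow> L') (finite_subsets_at_top I)"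
    using complete_uniform[where S="UNIV::L2 set"] by (force simp add: filterlim_def)
  then show ?thesis
    unfolding summable_on_def has_sum_def S_def by blast
qed

text \<open>The family need not be complete; on its orthogonal complement the operator is 0. The
  same notion thus covers the orthogonal projection onto the closed span (constant symbol 1), the
  operators X and H, and the spectral projections of a diagonal operator.\<close>

definition diag_fun :: "('i \<Rightarrow> L2) \<Rightarrow> 'i set \<Rightarrow> ('i \<Rightarrow> complex) \<Rightarrow> L2 \<Rightarrow> L2"
  where "diag_fun f I m g = (\<Sum>\<^sub>\<infinity>i\<in>I. (m i * cinner g (f i)) *\<^sub>C f i)"

definition diag :: "('i \<Rightarrow> L2) \<Rightarrow> 'i set \<Rightarrow> ('i \<Rightarrow> complex) \<Rightarrow> op"
  where "diag f I m = Blinfun (diag_fun f I m)"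

definition bounded_on :: "'i set \<Rightarrow> ('i \<Rightarrow> complex) \<Rightarrow> bool"
  where "bounded_on I m \<longleftrightarrow> (\<exists>C. \<forall>i\<in>I. norm (m i) \<le> C)"

lemma bounded_onI: "(\<And>i. i \<in> I \<Longrightarrow> norm (m i) \<le> C) \<Longrightarrow> bounded_on I m"
  by (auto simp: bounded_on_def)

lemma bounded_onE: assumes "bounded_on I m" obtains C where "C \<ge> 0" "\<And>i. i \<in> I \<Longrightarrow> norm (m i) \<le> C"
proof -
  obtain C where "\<forall>i\<in>I. norm (m i) \<le> C" using assms by (auto simp: bounded_on_def)
  then show ?thesis using that[of "max C 0"] by (auto simp: le_max_iff_disj)
qed

lemma bounded_on_mult:
  assumes "bounded_on I m" "bounded_on I m'"
  shows "bounded_on I (\<lambda>i. m i * m' i)"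
proof -
  obtain C C' where "\<forall>i\<in>I. norm (m i) \<le> C" "\<forall>i\<in>I. norm (m' i) \<le> C'"
    using assms unfolding bounded_on_def by blast
  then have "norm (m i * m' i) \<le> C * C'" if "i \<in> I" for i
    using that order_trans[OF norm_ge_zero] unfolding norm_mult by (intro mult_mono) auto
  then show ?thesis by (rule bounded_onI)
qed

lemma bounded_on_add:
  assumes "bounded_on I m" "bounded_on I m'"
  shows "bounded_on I (\<lambda>i. m i + m' i)"
proof -
  obtain C C' where "\<forall>i\<in>I. norm (m i) \<le> C" "\<forall>i\<in>I. norm (m' i) \<le> C'"
    using assms unfolding bounded_on_def by blast
  then have "norm (m i + m' i) \<le> C + C'" if "i \<in> I" for i
    using that by (intro norm_triangle_mono) auto
  then show ?thesis by (rule bounded_onI)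
qed

context
  fixes f :: "'i \<Rightarrow> L2" and I
  assumes f: "orthonormal f I"
begin

lemma diag_finite_bound:
  assumes C: "\<And>i. i \<in> I \<Longrightarrow> norm (m i) \<le> C" "C \<ge> 0" and F: "finite F" "F \<subseteq> I"
  shows "(\<Sum>i\<in>F. (norm (m i * cinner g (f i)))\<^sup>2) \<le> (C * norm g)\<^sup>2"
proof -
  have "(\<Sum>i\<in>F. (norm (m i * cinner g (f i)))\<^sup>2) \<le> (\<Sum>i\<in>F. C\<^sup>2 * (norm (cinner g (f i)))\<^sup>2)"
    unfolding norm_mult power_mult_distrib using F C
    by (intro sum_mono mult_right_mono power_mono) auto
  also have "\<dots> \<le> C\<^sup>2 * (norm g)\<^sup>2"
    unfolding sum_distrib_left[symmetric] by (intro mult_left_mono Bessel[OF f F]) auto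
  finally show ?thesis by (simp add: power_mult_distrib)
qed

lemma diag_fun_has_sum:
  assumes "bounded_on I m"
  shows "((\<lambda>i. (m i * cinner g (f i)) *\<^sub>C f i) has_sum diag_fun f I m g) I"
proof -
  obtain C where "C \<ge> 0" "\<And>i. i \<in> I \<Longrightarrow> norm (m i) \<le> C" using bounded_onE[OF assms] by blast
  then show ?thesis unfolding diag_fun_def
    by (intro has_sum_infsum orthonormal_summable[OF f, of _ "(C * norm g)\<^sup>2"] diag_finite_bound) auto
qed

lemma norm_diag_fun_le:
  assumes C: "\<And>i. i \<in> I \<Longrightarrow> norm (m i) \<le> C" "C \<ge> 0"
  shows "norm (diag_fun f I m g) \<le> C * norm g"
proof (rule tendsto_upperbound)
  have "bounded_on I m" using C(1) by (rule bounded_onI)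
  then show "((\<lambda>F. norm (\<Sum>i\<in>F. (m i * cinner g (f i)) *\<^sub>C f i)) \<longlongrightarrow> norm (diag_fun f I m g)) (finite_subsets_at_top I)"
    using diag_fun_has_sum[of m g] unfolding has_sum_def by (intro tendsto_norm) auto
  have "norm (\<Sum>i\<in>F. (m i * cinner g (f i)) *\<^sub>C f i) \<le> C * norm g" if "finite F" "F \<subseteq> I" for F
  proof (rule power2_le_imp_le)
    show "(norm (\<Sum>i\<in>F. (m i * cinner g (f i)) *\<^sub>C f i))\<^sup>2 \<le> (C * norm g)\<^sup>2"
      unfolding norm_sq_orthonormal_sum[OF f that] by (rule diag_finite_bound[OF C that])
  qed (use C in auto)
  then show "\<forall>\<^sub>F F in finite_subsets_at_top I. norm (\<Sum>i\<in>F. (m i * cinner g (f i)) *\<^sub>C f i) \<le> C * norm g"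
    by (intro eventually_finite_subsets_at_top_weakI) auto
qed simp

lemma bounded_linear_diag_fun: 
  assumes "bounded_on I m"
  shows "bounded_linear (diag_fun f I m)"
proof -
  obtain C where C: "C \<ge> 0" "\<And>i. i \<in> I \<Longrightarrow> norm (m i) \<le> C" using bounded_onE[OF assms] by blast
  show ?thesis
  proof (rule bounded_linear_intro[of _ C])
    fix g h r
    have "((\<lambda>i. (m i * cinner g (f i)) *\<^sub>C f i + (m i * cinner h (f i)) *\<^sub>C f i) has_sum
      diag_fun f I m g + diag_fun f I m h) I"
      by (intro has_sum_add diag_fun_has_sum assms)
    then show "diag_fun f I m (g + h) = diag_fun f I m g + diag_fun f I m h"
      unfolding diag_fun_def[of _ _ _ "g + h"]
      by (intro infsumI) (simp add: cinner_add_left distrib_left scaleC_add_left)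
    have "((\<lambda>i. r *\<^sub>R ((m i * cinner g (f i)) *\<^sub>C f i)) has_sum r *\<^sub>R diag_fun f I m g) I"
      by (rule has_sum_bounded_linear[OF bounded_linear_scaleR_right diag_fun_has_sum[OF assms], unfolded o_def])
    then show "diag_fun f I m (r *\<^sub>R g) = r *\<^sub>R diag_fun f I m g"
      unfolding diag_fun_def[of _ _ _ "r *\<^sub>R g"]
      by (intro infsumI) (simp add: scaleR_scaleC cinner_scaleC_left scaleC_scaleC mult_ac)
    show "norm (diag_fun f I m g) \<le> norm g * C" using norm_diag_fun_le[OF C(2) C(1)] by (simp add: mult.commute)
  qed
qed

lemma diag_apply: "bounded_on I m \<Longrightarrow> blinfun_apply (diag f I m) g = diag_fun f I m g"
  unfolding diag_def by (simp add: bounded_linear_diag_fun bounded_linear_Blinfun_apply)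

lemma diag_has_sum:
  assumes "bounded_on I m"
  shows "((\<lambda>i. (m i * cinner g (f i)) *\<^sub>C f i) has_sum blinfun_apply (diag f I m) g) I"
  using diag_fun_has_sum[OF assms] by (simp add: diag_apply assms)

lemma norm_diag_le:
  assumes "\<And>i. i \<in> I \<Longrightarrow> norm (m i) \<le> C" "C \<ge> 0"
  shows "norm (diag f I m) \<le> C"
proof (rule norm_blinfun_bound)
  have "bounded_on I m" using assms(1) by (rule bounded_onI)
  then show "norm (diag f I m g) \<le> C * norm g" for g
    by (simp add: diag_apply norm_diag_fun_le assms)
qed fact

lemma diag_cinner_has_sum:
  assumes "bounded_on I m"
  shows "((\<lambda>i. m i * cinner g (f i) * cinner (f i) h) has_sum cinner (diag f I m g) h) I"
  using has_sum_bounded_linear[OF bounded_linear_cinner_left diag_has_sum[OF assms, of g], of h]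
  by (simp add: o_def cinner_scaleC_left)

lemma diag_BL2: 
  assumes "bounded_on I m"
  shows "diag f I m \<in> BL2"
proof (rule BL2_I)
  fix c g
  have "((\<lambda>i. c *\<^sub>C ((m i * cinner g (f i)) *\<^sub>C f i)) has_sum c *\<^sub>C diag f I m g) I"
    by (rule has_sum_bounded_linear[OF bounded_linear_scaleC diag_has_sum[OF assms], unfolded o_def])
  then have "((\<lambda>i. ((m i * cinner (c *\<^sub>C g) (f i)) *\<^sub>C f i)) has_sum c *\<^sub>C diag f I m g) I"
    by (simp add: cinner_scaleC_left scaleC_scaleC mult_ac)
  then show "diag f I m (c *\<^sub>C g) = c *\<^sub>C diag f I m g"
    by (rule has_sum_unique[OF diag_has_sum[OF assms]])
qed

lemma diag_coeff: 
  assumes "bounded_on I m" "i \<in> I"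
  shows "cinner (diag f I m g) (f i) = m i * cinner g (f i)"
proof -
  have "((\<lambda>j. m j * cinner g (f j) * cinner (f j) (f i)) has_sum m i * cinner g (f i)) I"
    by (rule has_sum_cong_neutral[THEN iffD1, OF _ _ _ has_sum_finiteI[of "{i}" "m i * cinner g (f i)"
          "\<lambda>j. m j * cinner g (f j) * cinner (f j) (f i)"]])
       (use assms in \<open>auto simp: orthonormalD[OF f]\<close>)
  then show ?thesis by (rule has_sum_unique[OF diag_cinner_has_sum[OF assms(1)]])
qed

lemma diag_zero:
  assumes "bounded_on I m" "\<And>i. i \<in> I \<Longrightarrow> m i * cinner g (f i) = 0"
  shows "diag f I m g = 0"
proof -
  have "((\<lambda>i. (m i * cinner g (f i)) *\<^sub>C f i) has_sum 0) I"
    by (rule has_sum_0) (use assms(2) in \<open>metis scaleC_zero_left\<close>)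
  then show ?thesis by (rule has_sum_unique[OF diag_has_sum[OF assms(1)]])
qed

lemma diag_eigen:
  assumes "bounded_on I m" "i \<in> I"
  shows "diag f I m (f i) = m i *\<^sub>C f i"
proof -
  have "((\<lambda>j. (m j * cinner (f i) (f j)) *\<^sub>C f j) has_sum m i *\<^sub>C f i) I"
    by (rule has_sum_cong_neutral[THEN iffD1, OF _ _ _ has_sum_finiteI[of "{i}" "m i *\<^sub>C f i"
          "\<lambda>j. (m j * cinner (f i) (f j)) *\<^sub>C f j"]])
       (use assms in \<open>auto simp: orthonormalD[OF f]\<close>)
  then show ?thesis by (rule has_sum_unique[OF diag_has_sum[OF assms(1)]])
qed

text \<open>Subtracting from g its projection h onto the closed span leaves a vector that T
  annihilates, while T h is determined by the eigenvalue equations and continuity. This is the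
  standard way below to recognise an operator as diagonal.\<close>

lemma diag_unique:
  assumes m: "bounded_on I m" and T: "T \<in> BL2" "\<And>i. i \<in> I \<Longrightarrow> blinfun_apply T (f i) = m i *\<^sub>C f i"
    and 0: "\<And>g. (\<And>i. i \<in> I \<Longrightarrow> cinner g (f i) = 0) \<Longrightarrow> blinfun_apply T g = 0"
  shows "T = diag f I m"
proof (rule op_eqI)
  fix g
  have one: "bounded_on I (\<lambda>i. 1)" by (rule bounded_onI[of _ _ 1]) auto
  define h where "h = diag f I (\<lambda>i. 1) g"
  have "T (g - h) = 0" by (rule 0) (simp add: h_def cinner_diff_left diag_coeff one)
  moreover have "((\<lambda>i. T ((1 * cinner g (f i)) *\<^sub>C f i)) has_sum T h) I"
    unfolding h_def
    by (rule has_sum_bounded_linear[OF blinfun.bounded_linear_right diag_has_sum[OF one], unfolded o_def])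
  then have "((\<lambda>i. (m i * cinner g (f i)) *\<^sub>C f i) has_sum T h) I"
    by (rule has_sum_cong[THEN iffD1, rotated]) (simp add: BL2_scaleC T scaleC_scaleC mult_ac)
  then have "T h = diag f I m g" using has_sum_unique[OF diag_has_sum[OF m]] by simp
  ultimately show "T g = diag f I m g" by (simp add: blinfun.diff_right)
qed

lemma diag_adjoint: 
  assumes "bounded_on I m"
  shows "adjoint_pair (diag f I m) (diag f I (\<lambda>i. cnj (m i)))"
  unfolding adjoint_pair_def
proof (intro allI)
  fix g h
  have m': "bounded_on I (\<lambda>i. cnj (m i))" using assms by (auto simp: bounded_on_def)
  have "((\<lambda>i. cnj (cnj (m i) * cinner h (f i) * cinner (f i) g)) has_sum cnj (cinner (diag f I (\<lambda>i. cnj (m i)) h) g)) I"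
    by (rule has_sum_bounded_linear[OF bounded_linear_cnj diag_cinner_has_sum[OF m'], unfolded o_def])
  moreover have "cnj (cnj (m i) * cinner h (f i) * cinner (f i) g) = m i * cinner g (f i) * cinner (f i) h" for i
    by (simp add: cinner_commute[symmetric] mult_ac)
  ultimately have "((\<lambda>i. m i * cinner g (f i) * cinner (f i) h) has_sum cinner g (diag f I (\<lambda>i. cnj (m i)) h)) I"
    by (simp only: cinner_commute[of g "blinfun_apply _ _"])
  then show "cinner (diag f I m g) h = cinner g (diag f I (\<lambda>i. cnj (m i)) h)"
    by (rule has_sum_unique[OF diag_cinner_has_sum[OF assms]])
qed

lemma diag_comp:
  assumes "bounded_on I m" "bounded_on I m'"
  shows "diag f I m o\<^sub>L diag f I m' = diag f I (\<lambda>i. m i * m' i)"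
proof (rule diag_unique)
  show "bounded_on I (\<lambda>i. m i * m' i)" by (rule bounded_on_mult[OF assms])
  show "diag f I m o\<^sub>L diag f I m' \<in> BL2" using assms by (intro BL2_comp diag_BL2)
next
  fix i assume "i \<in> I"
  then show "(diag f I m o\<^sub>L diag f I m') (f i) = (m i * m' i) *\<^sub>C f i"
    by (simp add: assms diag_eigen BL2_scaleC[OF diag_BL2] scaleC_scaleC mult.commute)
next
  fix g assume g: "\<And>i. i \<in> I \<Longrightarrow> cinner g (f i) = 0"
  have "diag f I m' g = 0" by (rule diag_zero[OF assms(2)]) (simp add: g)
  then show "(diag f I m o\<^sub>L diag f I m') g = 0" by simp
qed

lemma diag_add:
  assumes "bounded_on I m" "bounded_on I m'"
  shows "diag f I m + diag f I m' = diag f I (\<lambda>i. m i + m' i)"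
proof (rule diag_unique)
  show "bounded_on I (\<lambda>i. m i + m' i)" by (rule bounded_on_add[OF assms])
  show "diag f I m + diag f I m' \<in> BL2" using assms by (intro BL2_add diag_BL2)
next
  fix i assume "i \<in> I"
  then show "(diag f I m + diag f I m') (f i) = (m i + m' i) *\<^sub>C f i"
    by (simp add: assms diag_eigen blinfun.add_left scaleC_add_left)
next
  fix g assume g: "\<And>i. i \<in> I \<Longrightarrow> cinner g (f i) = 0"
  have "diag f I m g = 0" by (rule diag_zero[OF assms(1)]) (simp add: g)
  moreover have "diag f I m' g = 0" by (rule diag_zero[OF assms(2)]) (simp add: g)
  ultimately show "(diag f I m + diag f I m') g = 0" by (simp add: blinfun.add_left)
qed

end

subsection \<open>Orthonormal bases\<close>

text \<open>Zorn's lemma inside an arbitrary set S. It is used with all vectors, to get orthonormal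
  bases, and with the set of eigenvectors of an operator, to diagonalise it.\<close>

lemma orthonormal_extend:
  assumes "orthonormal (\<lambda>x. x) B0" "B0 \<subseteq> S"
  shows "\<exists>B. B0 \<subseteq> B \<and> B \<subseteq> S \<and> orthonormal (\<lambda>x. x) B \<and>
    (\<forall>v\<in>S. norm v = 1 \<longrightarrow> (\<exists>e\<in>B. cinner v e \<noteq> 0))"
proof -
  define A where "A = {B. B0 \<subseteq> B \<and> B \<subseteq> S \<and> orthonormal (\<lambda>x. x) B}"
  have "\<exists>M\<in>A. \<forall>X\<in>A. M \<subseteq> X \<longrightarrow> X = M"
  proof (rule subset_Zorn_nonempty)
    show "A \<noteq> {}" using assms by (auto simp: A_def)
    show "\<Union>C \<in> A" if C: "C \<noteq> {}" "subset.chain A C" for C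
    proof -
      have CA: "C \<subseteq> A" using C(2) by (simp add: subset.chain_def)
      have "orthonormal (\<lambda>x. x) (\<Union>C)"
        unfolding orthonormal_def
      proof (intro ballI)
        fix i j assume "i \<in> \<Union>C" "j \<in> \<Union>C"
        then obtain X Y where XY: "i \<in> X" "X \<in> C" "j \<in> Y" "Y \<in> C" by auto
        then have "X \<subseteq> Y \<or> Y \<subseteq> X" using C(2) by (auto simp: subset.chain_def)
        then obtain Z where "Z \<in> C" "i \<in> Z" "j \<in> Z" using XY by blast
        then show "cinner i j = (if i = j then 1 else 0)"
          using CA by (auto simp: A_def orthonormal_def)
      qed
      then show ?thesis using C CA by (auto simp: A_def)
    qed
  qed
  then obtain B where B: "B \<in> A" and max: "\<And>X. X \<in> A \<Longrightarrow> B \<subseteq> X \<Longrightarrow> X = B" by blast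
  have "\<exists>e\<in>B. cinner v e \<noteq> 0" if v: "v \<in> S" "norm v = 1" for v
  proof (rule ccontr)
    assume n: "\<not> (\<exists>e\<in>B. cinner v e \<noteq> 0)"
    have vv: "cinner v v = 1" using v by (simp add: cinner_self)
    have n': "cinner v e = 0" "cinner e v = 0" if "e \<in> B" for e
      using n that cinner_swap_zero by blast+
    have "insert v B \<in> A"
      using B v vv n' unfolding A_def orthonormal_def by auto
    then have "v \<in> B" using max by blast
    then show False using n vv by auto
  qed
  then show ?thesis using B by (auto simp: A_def)
qed

lemma orthonormal_basis_iff:
  "orthonormal_basis B \<longleftrightarrow> orthonormal (\<lambda>x. x) B \<and> (\<forall>f. (\<forall>e\<in>B. cinner f e = 0) \<longrightarrow> f = 0)"
proof -
  have "norm e = 1 \<longleftrightarrow> cinner e e = 1" for e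
    unfolding cinner_self of_real_eq_1_iff power2_eq_1_iff using norm_ge_zero[of e] by linarith
  then show ?thesis unfolding orthonormal_basis_def orthonormal_def by auto
qed

lemma orthonormal_basis_orthonormal: "orthonormal_basis B \<Longrightarrow> orthonormal (\<lambda>x. x) B"
  by (simp add: orthonormal_basis_iff)

lemma orthonormal_basis_complete: "orthonormal_basis B \<Longrightarrow> (\<And>e. e \<in> B \<Longrightarrow> cinner f e = 0) \<Longrightarrow> f = 0"
  by (auto simp: orthonormal_basis_iff)

lemma orthonormal_basis_if_maximal:
  assumes "orthonormal (\<lambda>x. x) B" "\<And>v. norm v = 1 \<Longrightarrow> \<exists>e\<in>B. cinner v e \<noteq> 0"
  shows "orthonormal_basis B"
  unfolding orthonormal_basis_iff
proof (intro conjI allI impI)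
  fix f assume f: "\<forall>e\<in>B. cinner f e = 0"
  show "f = 0"
  proof (rule ccontr)
    assume "f \<noteq> 0"
    then have "norm ((1 / norm f) *\<^sub>R f) = 1" by simp
    from assms(2)[OF this] show False
      using f by (auto simp: scaleR_scaleC cinner_scaleC_left)
  qed
qed fact

lemma orthonormal_extend_basis:
  assumes "orthonormal (\<lambda>x. x) B0"
  obtains B where "B0 \<subseteq> B" "orthonormal_basis B"
proof -
  obtain B where "B0 \<subseteq> B" "orthonormal (\<lambda>x. x) B" "\<forall>v\<in>UNIV. norm v = 1 \<longrightarrow> (\<exists>e\<in>B. cinner v e \<noteq> 0)"
    using orthonormal_extend[OF assms subset_UNIV] by blast
  then show ?thesis using orthonormal_basis_if_maximal that by blast
qed

lemma ex_orthonormal_basis: "\<exists>B. orthonormal_basis B"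
  using orthonormal_extend_basis[of "{}"] by (auto simp: orthonormal_def)

lemma has_sum_ennreal:
  assumes "(f has_sum s) I" "\<And>i. 0 \<le> f i"
  shows "((\<lambda>i. ennreal (f i)) has_sum ennreal s) I"
proof -
  have "((\<lambda>F. ennreal (sum f F)) \<longlongrightarrow> ennreal s) (finite_subsets_at_top I)"
    using assms(1) unfolding has_sum_def by (rule tendsto_ennrealI)
  moreover have "sum (\<lambda>i. ennreal (f i)) = (\<lambda>F. ennreal (sum f F))" by (rule ext) (simp add: assms(2))
  ultimately show ?thesis unfolding has_sum_def by simp
qed

lemma bounded_on_one: "bounded_on I (\<lambda>i. 1)" by (rule bounded_onI[of _ _ 1]) auto

context
  fixes B assumes B: "orthonormal_basis B"
begin

lemmas onbD = orthonormal_basis_orthonormal[OF B]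

lemma diag_basis_unique:
  assumes "bounded_on B m" "T \<in> BL2" "\<And>e. e \<in> B \<Longrightarrow> blinfun_apply T e = m e *\<^sub>C e"
  shows "T = diag (\<lambda>x. x) B m"
proof (rule diag_unique[OF onbD assms(1,2)])
  fix g assume "\<And>i. i \<in> B \<Longrightarrow> cinner g i = 0"
  then have "g = 0" by (rule orthonormal_basis_complete[OF B])
  then show "T g = 0" by (simp add: blinfun.zero_right)
qed (fact assms(3))

lemma diag_one: "diag (\<lambda>x. x) B (\<lambda>x. 1) = id_blinfun"
  by (rule diag_basis_unique[symmetric]) (auto simp: bounded_on_one)

lemma basis_has_sum: "((\<lambda>e. cinner g e *\<^sub>C e) has_sum g) B"
  using diag_has_sum[OF onbD bounded_on_one, of g] by (simp add: diag_one)

lemma basis_cinner_has_sum: "((\<lambda>e. cinner g e * cinner e h) has_sum cinner g h) B"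
  using diag_cinner_has_sum[OF onbD bounded_on_one, of g h] by (simp add: diag_one)

lemma Parseval_has_sum: "((\<lambda>e. (norm (cinner g e))\<^sup>2) has_sum (norm g)\<^sup>2) B"
proof -
  have "((\<lambda>e. Re (cinner g e * cinner e g)) has_sum Re (cinner g g)) B"
    by (rule has_sum_bounded_linear[OF bounded_linear_Re basis_cinner_has_sum, unfolded o_def])
  moreover have "Re (cinner g e * cinner e g) = (norm (cinner g e))\<^sup>2" for e
    by (metis Re_complex_of_real cinner_commute complex_norm_square)
  ultimately show ?thesis by (simp add: norm_sq_cinner)
qed

lemma Parseval_ennreal: "(\<Sum>\<^sub>\<infinity>e\<in>B. ennreal ((norm (cinner g e))\<^sup>2)) = ennreal ((norm g)\<^sup>2)"
  by (rule infsumI, rule has_sum_ennreal[OF Parseval_has_sum]) simp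

lemma op_eq_basisI:
  assumes "T \<in> BL2" "S \<in> BL2" "\<And>e. e \<in> B \<Longrightarrow> blinfun_apply T e = blinfun_apply S e"
  shows "T = S"
proof -
  have "bounded_on B (\<lambda>e. 0)" by (rule bounded_onI[of _ _ 0]) auto
  then have "T - S = diag (\<lambda>x. x) B (\<lambda>e. 0)" "0 = diag (\<lambda>x. x) B (\<lambda>e. 0)"
    using assms by (intro diag_basis_unique; force simp: blinfun.diff_left)+
  then show ?thesis by (metis eq_iff_diff_eq_0)
qed

end

text \<open>The representing vector is written down in a basis, with coefficients <g, T e>. For a
  finite partial sum h of it, the squared norm of h equals <T h, g>, which bounds the norm of h by
  |T| |g|, so the coefficients are square-summable.\<close>

lemma Riesz:
  assumes T: "T \<in> BL2"
  shows "\<exists>h. \<forall>f. cinner (blinfun_apply T f) g = cinner f h"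
proof -
  obtain B where B: "orthonormal_basis B" using ex_orthonormal_basis by blast
  note on = orthonormal_basis_orthonormal[OF B]
  define c where "c e = cinner g (T e)" for e
  have "(\<Sum>e\<in>F. (norm (c e))\<^sup>2) \<le> (norm T * norm g)\<^sup>2" if F: "finite F" "F \<subseteq> B" for F
  proof -
    define h where "h = (\<Sum>e\<in>F. c e *\<^sub>C e)"
    have nh: "(norm h)\<^sup>2 = (\<Sum>e\<in>F. (norm (c e))\<^sup>2)"
      unfolding h_def by (rule norm_sq_orthonormal_sum[OF on F])
    have "cinner (T h) g = (\<Sum>e\<in>F. c e * cnj (c e))"
      by (simp add: h_def blinfun.sum_right BL2_scaleC[OF T] cinner_sum_left cinner_scaleC_left c_def cinner_commute[symmetric])
    also have "\<dots> = complex_of_real ((norm h)\<^sup>2)" unfolding nh by (simp add: complex_norm_square del: of_real_power)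
    finally have "(norm h)\<^sup>2 = norm (cinner (T h) g)" by (simp only: norm_of_real) simp
    also have "\<dots> \<le> (norm T * norm h) * norm g"
      by (rule order_trans[OF norm_cinner_le]) (intro mult_right_mono norm_blinfun, simp)
    finally have "norm h * norm h \<le> (norm T * norm g) * norm h" by (simp add: power2_eq_square mult_ac)
    then have "norm h \<le> norm T * norm g"
      by (cases "norm h = 0") (auto simp: mult_le_cancel_right)
    then show ?thesis unfolding nh[symmetric] by (intro power_mono) auto
  qed
  then have "(\<lambda>e. c e *\<^sub>C e) summable_on B" by (rule orthonormal_summable[OF on])
  then obtain h where h: "((\<lambda>e. c e *\<^sub>C e) has_sum h) B" by (auto simp: summable_on_def)
  have "cinner (T f) g = cinner f h" for f
  proof (rule has_sum_unique)
    have "((\<lambda>e. T (cinner f e *\<^sub>C e)) has_sum T f) B"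
      by (rule has_sum_bounded_linear[OF blinfun.bounded_linear_right basis_has_sum[OF B], unfolded o_def])
    then have "((\<lambda>e. cinner (T (cinner f e *\<^sub>C e)) g) has_sum cinner (T f) g) B"
      by (rule has_sum_bounded_linear[OF bounded_linear_cinner_left, unfolded o_def])
    then show "((\<lambda>e. cinner f e * cinner (T e) g) has_sum cinner (T f) g) B"
      by (simp add: BL2_scaleC[OF T] cinner_scaleC_left)
    have "((\<lambda>e. cinner f (c e *\<^sub>C e)) has_sum cinner f h) B"
      by (rule has_sum_bounded_linear[OF bounded_linear_cinner_right h, unfolded o_def])
    then show "((\<lambda>e. cinner f e * cinner (T e) g) has_sum cinner f h) B"
      by (simp add: cinner_scaleC_right c_def cinner_commute[symmetric] mult.commute)
  qed
  then show ?thesis by blast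
qed

lemma ex_adjoint:
  assumes T: "T \<in> BL2"
  shows "\<exists>S. adjoint_pair T S"
proof -
  obtain h where h: "\<And>g f. cinner (T f) g = cinner f (h g)" using Riesz[OF T] by metis
  have "bounded_linear h"
  proof (rule bounded_linear_intro[of _ "norm T"])
    show "h (x + y) = h x + h y" for x y
      by (rule cinner_eqI_right) (simp add: h[symmetric] cinner_add_right)
    show "h (r *\<^sub>R x) = r *\<^sub>R h x" for r x
      by (rule cinner_eqI_right) (simp add: scaleR_scaleC h[symmetric] cinner_scaleC_right)
    show "norm (h x) \<le> norm x * norm T" for x
    proof (cases "h x = 0")
      case False
      have "(norm (h x))\<^sup>2 = norm (cinner (T (h x)) x)"
        unfolding h cinner_self by (simp only: norm_of_real) simp
      also have "\<dots> \<le> (norm T * norm (h x)) * norm x"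
        by (rule order_trans[OF norm_cinner_le]) (intro mult_right_mono norm_blinfun, simp)
      finally show ?thesis using False by (simp add: power2_eq_square mult_ac)
    qed simp
  qed
  then have "adjoint_pair T (Blinfun h)"
    by (simp add: adjoint_pair_def bounded_linear_Blinfun_apply h)
  then show ?thesis by blast
qed

lemma adjoint_pair_adj: "T \<in> BL2 \<Longrightarrow> adjoint_pair T (adj T)"
  using ex_adjoint adj_eqI by blast

section \<open>Positive operators\<close>

text \<open>Self-adjointness follows by polarisation from the reality of the quadratic form: f + g
  gives the imaginary parts, and replacing g by i g gives the real parts.\<close>

lemma positive_opD: 
  assumes "positive_op T"
  shows "T \<in> BL2" "adjoint_pair T T" "0 \<le> Re (cinner (blinfun_apply T f) f)" "Im (cinner (blinfun_apply T f) f) = 0"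
proof -
  show T: "T \<in> BL2" using assms by (simp add: positive_op_def)
  have q: "cinner (T f) f \<in> \<real>\<^sub>\<ge>\<^sub>0" for f using assms by (simp add: positive_op_def)
  then show "0 \<le> Re (cinner (T f) f)" "Im (cinner (T f) f) = 0" by (auto simp: complex_nonneg_Reals_iff)
  have i: "Im (cinner (T f) f) = 0" for f using q by (auto simp: complex_nonneg_Reals_iff)
  show "adjoint_pair T T" unfolding adjoint_pair_def
  proof (intro allI)
    fix f g
    have 1: "Im (cinner (T f) g + cinner (T g) f) = 0" for f g
      using i[of "f + g"] i[of f] i[of g] by (simp add: blinfun.add_right cinner_add_left cinner_add_right)
    have "Re (cinner (T f) g) = Re (cinner (T g) f)"
      using 1[of f "\<i> *\<^sub>C g"] by (simp add: BL2_scaleC[OF T] cinner_scaleC_left cinner_scaleC_right)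
    moreover have "Im (cinner (T f) g) = - Im (cinner (T g) f)" using 1[of f g] by simp
    ultimately show "cinner (T f) g = cinner f (T g)"
      by (subst (2) cinner_commute) (simp add: complex_eq_iff)
  qed
qed

lemma positive_opI:
  assumes "adjoint_pair T T" "\<And>f. 0 \<le> Re (cinner (blinfun_apply T f) f)"
  shows "positive_op T"
  unfolding positive_op_def
proof (intro conjI allI)
  show "T \<in> BL2" using assms(1) by (rule adjoint_pair_BL2)
  fix f
  have "cinner (T f) f = cnj (cinner (T f) f)"
    using adjoint_pairD[OF assms(1), of f f] cinner_commute[of f "T f"] by simp
  then show "cinner (T f) f \<in> \<real>\<^sub>\<ge>\<^sub>0" using assms(2) by (simp add: complex_nonneg_Reals_iff complex_eq_iff)
qed

lemma positive_op_adj: "positive_op T \<Longrightarrow> adj T = T"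
  by (rule adj_eqI) (rule positive_opD(2))

lemma positive_op_cinner: "positive_op T \<Longrightarrow> cinner (blinfun_apply T f) f = complex_of_real (Re (cinner (blinfun_apply T f) f))"
  by (simp add: complex_eq_iff positive_opD)

lemma positive_op_scaleR: "positive_op S \<Longrightarrow> 0 \<le> r \<Longrightarrow> positive_op (r *\<^sub>R S)"
  by (rule positive_opI) (auto intro!: adjoint_pair_scaleR simp: positive_opD scaleR_scaleC blinfun.scaleR_left cinner_scaleC_left)

lemma positive_op_conj: "positive_op T \<Longrightarrow> adjoint_pair S S' \<Longrightarrow> positive_op (S o\<^sub>L T o\<^sub>L S')"
proof (rule positive_opI)
  assume T: "positive_op T" and S: "adjoint_pair S S'"
  have "adjoint_pair (S o\<^sub>L T o\<^sub>L S') (S o\<^sub>L (T o\<^sub>L S'))"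
    by (intro adjoint_pair_comp adjoint_pair_sym[OF S] S positive_opD[OF T])
  then show "adjoint_pair (S o\<^sub>L T o\<^sub>L S') (S o\<^sub>L T o\<^sub>L S')" by (simp add: comp_assoc)
  show "0 \<le> Re (cinner ((S o\<^sub>L T o\<^sub>L S') f) f)" for f
    using positive_opD(3)[OF T] by (simp add: adjoint_pairD[OF S])
qed

lemma positive_op_id: "positive_op id_blinfun"
  by (rule positive_opI) (auto simp: adjoint_pair_id cinner_self)

lemma positive_op_square: "adjoint_pair S S' \<Longrightarrow> positive_op (S o\<^sub>L S')"
  using positive_op_conj[OF positive_op_id, of S S'] by simp

text \<open>Nonnegativity of the form at f - t c g, with c = <T f, g> and t real, gives a polynomial
  in t. Its value at t = 1/b is the claim; if b = 0 it is affine in t and a large t would make it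
  negative unless c = 0.\<close>

lemma positive_op_CS:
  assumes T: "positive_op T"
  shows "(norm (cinner (blinfun_apply T f) g))\<^sup>2 \<le> Re (cinner (T f) f) * Re (cinner (T g) g)"
proof -
  define a b c where "a = Re (cinner (T f) f)" and "b = Re (cinner (T g) g)" and "c = cinner (T f) g"
  have ab: "a \<ge> 0" "b \<ge> 0" using T by (auto simp: a_def b_def positive_opD)
  have gf: "cinner (T g) f = cnj c"
    using adjoint_pairD[OF positive_opD(2)[OF T], of g f] cinner_commute[of g "T f"] by (simp add: c_def)
  have q: "0 \<le> a - 2 * t * (norm c)\<^sup>2 + t\<^sup>2 * (norm c)\<^sup>2 * b" for t :: real
  proof -
    define s where "s = complex_of_real t * c"
    have cc: "c * cnj c = complex_of_real ((norm c)\<^sup>2)" by (rule complex_norm_square[symmetric])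
    have ta: "cinner (T f) f = complex_of_real a" and tb: "cinner (T g) g = complex_of_real b"
      using positive_op_cinner[OF T] by (simp_all only: a_def b_def)
    have "T (f - s *\<^sub>C g) = T f - s *\<^sub>C T g"
      by (simp add: blinfun.diff_right BL2_scaleC[OF positive_opD(1)[OF T]])
    then have "cinner (T (f - s *\<^sub>C g)) (f - s *\<^sub>C g)
      = cinner (T f) (f - s *\<^sub>C g) - s * cinner (T g) (f - s *\<^sub>C g)"
      by (simp only: cinner_diff_left cinner_scaleC_left)
    also have "\<dots> = (cinner (T f) f - cnj s * cinner (T f) g) - s * (cinner (T g) f - cnj s * cinner (T g) g)"
      by (simp only: cinner_diff_right cinner_scaleC_right)
    also have "\<dots> = complex_of_real a - complex_of_real (2 * t) * (c * cnj c) + complex_of_real (t\<^sup>2 * b) * (c * cnj c)"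
      unfolding ta tb c_def[symmetric] gf s_def complex_cnj_mult complex_cnj_complex_of_real of_real_mult of_real_power of_real_numeral
      by algebra
    also have "\<dots> = complex_of_real (a - 2 * t * (norm c)\<^sup>2 + t\<^sup>2 * (norm c)\<^sup>2 * b)"
      unfolding cc of_real_mult[symmetric] of_real_add[symmetric] of_real_diff[symmetric]
      by (rule arg_cong[of _ _ complex_of_real]) (simp add: mult_ac)
    finally show ?thesis using positive_opD(3)[OF T, of "f - s *\<^sub>C g"] by simp
  qed
  show ?thesis
  proof (cases "b = 0")
    case True
    have "norm c = 0"
    proof (rule ccontr)
      assume "norm c \<noteq> 0"
      then have "2 * ((a + 1) / (norm c)\<^sup>2) * (norm c)\<^sup>2 = 2 * (a + 1)" by simp
      with q[of "(a + 1) / (norm c)\<^sup>2"] True have "0 \<le> a - 2 * (a + 1)" by (simp only: mult_zero_right add_0_right)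
      then show False using ab by simp
    qed
    then show ?thesis using ab by (simp add: c_def[symmetric] a_def[symmetric] b_def[symmetric])
  next
    case False
    then have "0 \<le> a - (norm c)\<^sup>2 / b" using q[of "1/b"] by (simp add: field_simps power2_eq_square)
    then have "(norm c)\<^sup>2 \<le> a * b" using False ab by (simp add: field_simps)
    then show ?thesis by (simp add: a_def b_def c_def)
  qed
qed

text \<open>The form inequality T^2 <= |T| T, obtained from \<open>positive_op_CS\<close> with g = T
  f. It drives both the square root iteration and the existence of eigenvectors.\<close>

lemma positive_op_norm_sq_le:
  assumes T: "positive_op T"
  shows "(norm (blinfun_apply T f))\<^sup>2 \<le> norm T * Re (cinner (T f) f)"
proof (cases "T f = 0")
  case True then show ?thesis by simp
next
  case False
  have "((norm (T f))\<^sup>2)\<^sup>2 = (norm (cinner (T f) (T f)))\<^sup>2" unfolding cinner_self norm_of_real by simp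
  also have "\<dots> \<le> Re (cinner (T f) f) * Re (cinner (T (T f)) (T f))" by (rule positive_op_CS[OF T])
  also have "\<dots> \<le> Re (cinner (T f) f) * (norm T * norm (T f) * norm (T f))"
  proof (rule mult_left_mono)
    have "Re (cinner (T (T f)) (T f)) \<le> norm (T (T f)) * norm (T f)"
      using complex_Re_le_cmod norm_cinner_le order_trans by blast
    also have "\<dots> \<le> norm T * norm (T f) * norm (T f)" by (intro mult_right_mono norm_blinfun) simp
    finally show "Re (cinner (T (T f)) (T f)) \<le> norm T * norm (T f) * norm (T f)" .
  qed (simp add: positive_opD[OF T])
  finally have "(norm (T f))\<^sup>2 * (norm (T f))\<^sup>2 \<le> (norm T * Re (cinner (T f) f)) * (norm (T f))\<^sup>2"
    by (simp add: power2_eq_square mult_ac)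
  then show ?thesis by (rule mult_right_le_imp_le) (use False in simp)
qed

lemma positive_op_cinner_0:
  assumes "positive_op T" "Re (cinner (blinfun_apply T f) f) = 0" shows "T f = 0"
  using positive_op_norm_sq_le[OF assms(1), of f] assms(2) by simp

subsection \<open>Square roots\<close>

text \<open>
  If \<open>Y = (B + Y\<^sup>2) / 2\<close> then \<open>(1 - Y)\<^sup>2 = 1 - B\<close>. The fixed-point iteration for \<open>Y\<close> is majorised
  by the same iteration for the number \<open>1\<close>, so it converges uniformly on the unit ball.
\<close>

primrec rootstep :: "op \<Rightarrow> nat \<Rightarrow> op" where
  "rootstep B 0 = 0"
| "rootstep B (Suc n) = (1/2) *\<^sub>R (B + (rootstep B n o\<^sub>L rootstep B n))"

primrec rootstep_real :: "nat \<Rightarrow> real" where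
  "rootstep_real 0 = 0"
| "rootstep_real (Suc n) = (1/2) * (1 + rootstep_real n * rootstep_real n)"

lemma rootstep_real_bounds: "0 \<le> rootstep_real n" "rootstep_real n \<le> 1"
proof -
  have "0 \<le> rootstep_real n \<and> rootstep_real n \<le> 1"
  proof (induction n)
    case (Suc n)
    then have "rootstep_real n * rootstep_real n \<le> 1 * 1" by (intro mult_mono) auto
    then show ?case using Suc by simp
  qed simp
  then show "0 \<le> rootstep_real n" "rootstep_real n \<le> 1" by auto
qed

lemma norm_half_scaleR: "norm ((1/2) *\<^sub>R (x::op)) = (1/2) * norm x" by simp

lemma norm_rootstep:
  assumes "norm B \<le> 1"
  shows "norm (rootstep B n) \<le> rootstep_real n"
proof (induction n)
  case (Suc n)
  have "norm (B + (rootstep B n o\<^sub>L rootstep B n)) \<le> 1 + rootstep_real n * rootstep_real n"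
    by (intro norm_triangle_mono assms order_trans[OF norm_blinfun_compose] mult_mono Suc) (auto simp: rootstep_real_bounds)
  then show ?case unfolding rootstep.simps rootstep_real.simps norm_half_scaleR by simp
qed simp

lemma norm_rootstep_Suc_diff:
  assumes "norm B \<le> 1"
  shows "norm (rootstep B (Suc n) - rootstep B n) \<le> rootstep_real (Suc n) - rootstep_real n"
proof (induction n)
  case 0 then show ?case using assms by simp
next
  case (Suc n)
  define a b where "a = rootstep B (Suc n)" and "b = rootstep B n"
  define u v where "u = rootstep_real (Suc n)" and "v = rootstep_real n"
  have ab: "norm a \<le> u" "norm b \<le> v" "norm (a - b) \<le> u - v"
    using Suc norm_rootstep[OF assms] by (auto simp: a_def b_def u_def v_def simp del: rootstep.simps rootstep_real.simps)
  have uv: "u \<ge> 0" "v \<ge> 0" by (auto simp: u_def v_def rootstep_real_bounds simp del: rootstep_real.simps)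
  \<comment> \<open>Noncommutative form of a difference of squares: a^2 - b^2 = a(a-b) +
    (a-b)b.\<close>
  have "rootstep B (Suc (Suc n)) - rootstep B (Suc n) = (1/2) *\<^sub>R ((a o\<^sub>L (a - b)) + ((a - b) o\<^sub>L b))"
    unfolding rootstep.simps(2)[of B "Suc n"] a_def[symmetric]
    by (subst a_def, subst rootstep.simps(2), subst b_def[symmetric])
       (rule op_eqI, simp add: comp_simps scaleR_add_right scaleR_diff_right flip: b_def)
  then have "norm (rootstep B (Suc (Suc n)) - rootstep B (Suc n)) = (1/2) * norm ((a o\<^sub>L (a - b)) + ((a - b) o\<^sub>L b))"
    by (simp only: norm_half_scaleR)
  also have "\<dots> \<le> (1/2) * (u * (u - v) + (u - v) * v)"
    by (intro mult_left_mono norm_triangle_mono order_trans[OF norm_blinfun_compose] mult_mono ab)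
       (use uv order_trans[OF norm_ge_zero ab(3)] in auto)
  also have "\<dots> = rootstep_real (Suc (Suc n)) - rootstep_real (Suc n)"
    unfolding rootstep_real.simps(2)[of "Suc n"] u_def[symmetric]
    by (subst (4) u_def, subst rootstep_real.simps(2), subst v_def[symmetric]) (simp add: algebra_simps flip: v_def)
  finally show ?case .
qed

lemma norm_rootstep_diff:
  assumes "norm B \<le> 1" "n \<le> m"
  shows "norm (rootstep B m - rootstep B n) \<le> rootstep_real m - rootstep_real n"
  using assms(2)
proof (induction m rule: dec_induct)
  case (step m)
  have "norm (rootstep B (Suc m) - rootstep B n) \<le> norm (rootstep B (Suc m) - rootstep B m) + norm (rootstep B m - rootstep B n)"
    using norm_triangle_ineq[of "rootstep B (Suc m) - rootstep B m" "rootstep B m - rootstep B n"] by simp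
  then show ?case using norm_rootstep_Suc_diff[OF assms(1), of m] step.IH by simp
qed simp

lemma rootstep_real_mono: "n \<le> m \<Longrightarrow> rootstep_real n \<le> rootstep_real m"
proof -
  assume "n \<le> m"
  then have "norm (rootstep 0 m - rootstep 0 n) \<le> rootstep_real m - rootstep_real n"
    by (intro norm_rootstep_diff) auto
  then show ?thesis using norm_ge_zero[of "rootstep 0 m - rootstep 0 n"] by linarith
qed

definition rootlim_real :: real where "rootlim_real = lim rootstep_real"

lemma rootstep_real_tendsto: "rootstep_real \<longlonglongrightarrow> rootlim_real"
proof -
  have "convergent rootstep_real"
    by (rule Bseq_mono_convergent) (auto simp: rootstep_real_bounds intro!: BseqI'[of _ 1] rootstep_real_mono)
  then show ?thesis by (simp add: rootlim_real_def convergent_LIMSEQ_iff)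
qed

definition rootlim :: "op \<Rightarrow> op" where "rootlim B = lim (rootstep B)"

lemma rootstep_tendsto:
  assumes B: "norm B \<le> 1"
  shows "rootstep B \<longlonglongrightarrow> rootlim B"
proof -
  have "Cauchy (rootstep B)"
  proof (rule metric_CauchyI)
    fix e :: real assume "e > 0"
    then obtain N where N: "\<And>m n. m \<ge> N \<Longrightarrow> n \<ge> N \<Longrightarrow> dist (rootstep_real m) (rootstep_real n) < e"
      using LIMSEQ_imp_Cauchy[OF rootstep_real_tendsto] unfolding Cauchy_def by blast
    have "dist (rootstep B m) (rootstep B n) < e" if "n \<le> m" "n \<ge> N" for m n
      using norm_rootstep_diff[OF B that(1)] N[of m n] that by (auto simp: dist_norm)
    then show "\<exists>M. \<forall>m\<ge>M. \<forall>n\<ge>M. dist (rootstep B m) (rootstep B n) < e"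
      by (metis dist_commute nle_le)
  qed
  then have "convergent (rootstep B)" by (simp add: Cauchy_convergent_iff)
  then show ?thesis by (simp add: rootlim_def convergent_LIMSEQ_iff)
qed

lemma norm_rootlim_diff:
  assumes B: "norm B \<le> 1"
  shows "norm (rootlim B - rootstep B n) \<le> rootlim_real - rootstep_real n"
proof (rule LIMSEQ_le)
  show "(\<lambda>m. norm (rootstep B m - rootstep B n)) \<longlonglongrightarrow> norm (rootlim B - rootstep B n)"
    by (intro tendsto_intros rootstep_tendsto B)
  show "(\<lambda>m. rootstep_real m - rootstep_real n) \<longlonglongrightarrow> rootlim_real - rootstep_real n"
    by (intro tendsto_intros rootstep_real_tendsto)
  show "\<exists>N. \<forall>m\<ge>N. norm (rootstep B m - rootstep B n) \<le> rootstep_real m - rootstep_real n"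
    using norm_rootstep_diff[OF B] by blast
qed

lemma norm_rootlim: assumes "norm B \<le> 1" shows "norm (rootlim B) \<le> 1"
proof (rule LIMSEQ_le_const2)
  show "(\<lambda>n. norm (rootstep B n)) \<longlonglongrightarrow> norm (rootlim B)" by (intro tendsto_intros rootstep_tendsto assms)
  show "\<exists>N. \<forall>n\<ge>N. norm (rootstep B n) \<le> 1"
    using order_trans[OF norm_rootstep[OF assms] rootstep_real_bounds(2)] by blast
qed

lemmas tendsto_comp = bounded_bilinear.tendsto[OF bounded_bilinear_blinfun_compose]

lemma rootlim_fixpoint:
  assumes B: "norm B \<le> 1"
  shows "rootlim B = (1/2) *\<^sub>R (B + (rootlim B o\<^sub>L rootlim B))"
proof (rule LIMSEQ_unique)
  show "(\<lambda>n. rootstep B (Suc n)) \<longlonglongrightarrow> rootlim B"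
    using rootstep_tendsto[OF B] by (rule LIMSEQ_Suc)
  show "(\<lambda>n. rootstep B (Suc n)) \<longlonglongrightarrow> (1/2) *\<^sub>R (B + (rootlim B o\<^sub>L rootlim B))"
    unfolding rootstep.simps by (intro tendsto_intros tendsto_comp rootstep_tendsto B)
qed

lemma rootlim_square:
  assumes B: "norm B \<le> 1"
  shows "(id_blinfun - rootlim B) o\<^sub>L (id_blinfun - rootlim B) = id_blinfun - B"
proof -
  define Y where "Y = rootlim B"
  have "2 *\<^sub>R Y = B + (Y o\<^sub>L Y)" using rootlim_fixpoint[OF B] unfolding Y_def[symmetric]
    by (metis (no_types, lifting) divide_self_if mult.commute scaleR_one scaleR_scaleR times_divide_eq_right zero_neq_numeral)
  then have "Y o\<^sub>L Y = Y + Y - B" by (simp add: scaleR_2)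
  then show ?thesis unfolding Y_def[symmetric] by (simp add: comp_diff_left comp_diff_right)
qed

lemma rootlim_adjoint:
  assumes B: "norm B \<le> 1" "adjoint_pair B B"
  shows "adjoint_pair (rootlim B) (rootlim B)"
proof (rule adjoint_pair_lim)
  show "adjoint_pair (rootstep B n) (rootstep B n)" for n
    by (induction n) (auto intro!: adjoint_pair_zero adjoint_pair_scaleR adjoint_pair_add adjoint_pair_comp B)
qed (rule rootstep_tendsto B)+

lemma rootlim_commute:
  assumes B: "norm B \<le> 1" "C o\<^sub>L B = B o\<^sub>L C"
  shows "C o\<^sub>L rootlim B = rootlim B o\<^sub>L C"
proof (rule LIMSEQ_unique)
  have "C o\<^sub>L rootstep B n = rootstep B n o\<^sub>L C" for n
  proof (induction n)
    case (Suc n)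
    have "C o\<^sub>L (rootstep B n o\<^sub>L rootstep B n) = (rootstep B n o\<^sub>L rootstep B n) o\<^sub>L C"
      by (metis Suc comp_assoc)
    then show ?case by (simp add: comp_scaleR_left comp_scaleR_right comp_add_left comp_add_right B)
  qed simp
  moreover show "(\<lambda>n. C o\<^sub>L rootstep B n) \<longlonglongrightarrow> (C o\<^sub>L rootlim B)"
    by (intro tendsto_comp tendsto_const rootstep_tendsto B)
  ultimately show "(\<lambda>n. C o\<^sub>L rootstep B n) \<longlonglongrightarrow> (rootlim B o\<^sub>L C)"
    by (simp, intro tendsto_comp tendsto_const rootstep_tendsto B)
qed

text \<open>Each \<open>rootstep\<close> is a polynomial in its argument, hence norm continuous, and
  \<open>norm_rootlim_diff\<close> bounds the error by a number that does not depend on the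
  argument. A uniform limit of continuous maps is continuous.\<close>

lemma tendsto_rootlim:
  assumes B: "norm B \<le> 1" "\<forall>\<^sub>F t in F. norm (A t) \<le> 1" and lim: "(A \<longlongrightarrow> B) F"
  shows "((\<lambda>t. rootlim (A t)) \<longlongrightarrow> rootlim B) F"
proof (rule tendstoI)
  fix e :: real assume e: "e > 0"
  obtain n where n: "rootlim_real - rootstep_real n < e / 3"
    using rootstep_real_tendsto e unfolding LIMSEQ_def dist_norm
    by (metis abs_minus_commute abs_le_D1 divide_pos_pos dual_order.refl le_less_trans real_norm_def zero_less_numeral)
  have "((\<lambda>t. rootstep (A t) n) \<longlongrightarrow> rootstep B n) F"
    by (induction n) (auto intro!: tendsto_intros tendsto_comp lim)
  then have "\<forall>\<^sub>F t in F. dist (rootstep (A t) n) (rootstep B n) < e/3" using e by (intro tendstoD) auto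
  with B(2) show "\<forall>\<^sub>F t in F. dist (rootlim (A t)) (rootlim B) < e"
  proof eventually_elim
    case (elim t)
    have "rootlim (A t) - rootlim B = (rootlim (A t) - rootstep (A t) n) + (rootstep (A t) n - rootstep B n) - (rootlim B - rootstep B n)"
      by simp
    also have "norm \<dots> \<le> norm (rootlim (A t) - rootstep (A t) n) + norm (rootstep (A t) n - rootstep B n) + norm (rootlim B - rootstep B n)"
      using norm_triangle_ineq4 norm_triangle_ineq by (smt (verit))
    finally show ?case
      using norm_rootlim_diff[OF elim(1), of n] norm_rootlim_diff[OF B(1), of n] n elim(2)
      by (simp add: dist_norm)
  qed
qed

lemma norm_id_minus_positive:
  assumes A: "positive_op A" "norm A \<le> 1"
  shows "norm (id_blinfun - A) \<le> 1"
proof (rule norm_blinfun_bound)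
  fix f
  have "(norm (A f))\<^sup>2 \<le> 1 * Re (cinner (A f) f)"
    by (rule order_trans[OF positive_op_norm_sq_le[OF A(1)]]) (intro mult_right_mono A positive_opD)
  moreover have "Re (cinner f (A f)) = Re (cinner (A f) f)" by (subst cinner_commute) simp
  ultimately have "(norm (f - A f))\<^sup>2 \<le> (norm f)\<^sup>2"
    using positive_opD(3)[OF A(1), of f] by (simp add: norm_sq_diff)
  then show "norm ((id_blinfun - A) f) \<le> 1 * norm f"
    by (simp add: blinfun.diff_left power2_le_iff_abs_le)
qed simp

text \<open>Division by r brings A into the unit ball, where 1 - A/r has norm at most 1 as well. The
  parameter is kept free so that a single r serves all members of a convergent family.\<close>

definition sqrt_cand :: "real \<Rightarrow> op \<Rightarrow> op"
  where "sqrt_cand r A = sqrt r *\<^sub>R (id_blinfun - rootlim (id_blinfun - (1/r) *\<^sub>R A))"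

lemma
  assumes A: "positive_op A" and r: "r > 0" "norm A \<le> r"
  shows sqrt_cand_positive: "positive_op (sqrt_cand r A)"
    and sqrt_cand_square: "sqrt_cand r A o\<^sub>L sqrt_cand r A = A"
    and sqrt_cand_commute: "C o\<^sub>L A = A o\<^sub>L C \<Longrightarrow> C o\<^sub>L sqrt_cand r A = sqrt_cand r A o\<^sub>L C"
proof -
  define B where "B = id_blinfun - (1/r) *\<^sub>R A"
  have pA: "positive_op ((1/r) *\<^sub>R A)" using A r by (intro positive_op_scaleR) auto
  have B: "norm B \<le> 1" unfolding B_def using r by (intro norm_id_minus_positive pA) auto
  have Bs: "adjoint_pair B B" unfolding B_def by (intro adjoint_pair_diff adjoint_pair_id positive_opD pA)
  have c: "sqrt_cand r A = sqrt r *\<^sub>R (id_blinfun - rootlim B)" by (simp add: sqrt_cand_def B_def)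
  have "positive_op (id_blinfun - rootlim B)"
  proof (rule positive_opI)
    show "adjoint_pair (id_blinfun - rootlim B) (id_blinfun - rootlim B)"
      by (intro adjoint_pair_diff adjoint_pair_id rootlim_adjoint B Bs)
    fix f
    have "Re (cinner (rootlim B f) f) \<le> norm (rootlim B f) * norm f"
      using complex_Re_le_cmod norm_cinner_le order_trans by blast
    also have "\<dots> \<le> (1 * norm f) * norm f"
      by (intro mult_right_mono order_trans[OF norm_blinfun] norm_rootlim B) auto
    finally show "0 \<le> Re (cinner ((id_blinfun - rootlim B) f) f)"
      by (simp add: blinfun.diff_left cinner_diff_left cinner_self power2_eq_square)
  qed
  then show "positive_op (sqrt_cand r A)" unfolding c using r by (intro positive_op_scaleR) auto
  show "sqrt_cand r A o\<^sub>L sqrt_cand r A = A"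
    unfolding c comp_scaleR_left comp_scaleR_right rootlim_square[OF B] using r by (simp add: B_def)
  assume "C o\<^sub>L A = A o\<^sub>L C"
  then have "C o\<^sub>L B = B o\<^sub>L C" by (simp add: B_def comp_diff_left comp_diff_right comp_scaleR_left comp_scaleR_right)
  from rootlim_commute[OF B this] show "C o\<^sub>L sqrt_cand r A = sqrt_cand r A o\<^sub>L C"
    by (simp add: c comp_diff_left comp_diff_right comp_scaleR_left comp_scaleR_right)
qed

text \<open>With commuting roots, (S + T)(S - T) = 0. For g = (S - T) f the two nonnegative numbers
  <S g, g> and <T g, g> add up to 0, so S g = T g = 0, and then <g, g> = <f, (S - T) g> = 0.\<close>

lemma positive_sqrt_unique:
  assumes S: "positive_op S" and T: "positive_op T" and ST: "S o\<^sub>L S = T o\<^sub>L T" and c: "S o\<^sub>L T = T o\<^sub>L S"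
  shows "S = T"
proof (rule op_eqI)
  fix f
  define g where "g = (S - T) f"
  have "S (S f) = T (T f)" "S (T f) = T (S f)"
    using ST c by (metis blinfun_apply_blinfun_compose)+
  then have "S g + T g = 0" by (simp add: g_def blinfun.diff_left blinfun.diff_right)
  then have "Re (cinner (S g) g) + Re (cinner (T g) g) = 0"
    by (metis cinner_add_left cinner_zero_left plus_complex.sel(1) zero_complex.sel(1))
  then have "Re (cinner (S g) g) = 0" "Re (cinner (T g) g) = 0"
    using positive_opD(3)[OF S, of g] positive_opD(3)[OF T, of g] by linarith+
  then have "S g = 0" "T g = 0" using positive_op_cinner_0 S T by blast+
  moreover have "cinner g g = cinner f ((S - T) g)"
    using adjoint_pairD[OF adjoint_pair_diff[OF positive_opD(2)[OF S] positive_opD(2)[OF T]], of f g] by (simp add: g_def)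
  ultimately have "cinner g g = 0" by (simp add: blinfun.diff_left)
  then have "g = 0" by (simp add: cinner_self)
  then show "S f = T f" by (simp add: g_def blinfun.diff_left)
qed

text \<open>Any positive root T of A commutes with A = T^2, hence with \<open>sqrt_cand\<close>, the
  limit of polynomials in A. So every root is in the commuting situation of
  \<open>positive_sqrt_unique\<close> and equals the candidate.\<close>

lemma sqrt_op_eqI:
  assumes "positive_op S" "S o\<^sub>L S = A"
  shows "sqrt_op A = S"
proof -
  have A: "positive_op A" using positive_op_square[OF positive_opD(2)[OF assms(1)]] assms(2) by simp
  have r: "norm A + 1 > 0" "norm A \<le> norm A + 1" by (auto intro: add_nonneg_pos)
  have *: "T = sqrt_cand (norm A + 1) A" if T: "positive_op T" "T o\<^sub>L T = A" for T
  proof (rule positive_sqrt_unique)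
    have "T o\<^sub>L A = A o\<^sub>L T" using T(2) by (metis comp_assoc)
    then show "T o\<^sub>L sqrt_cand (norm A + 1) A = sqrt_cand (norm A + 1) A o\<^sub>L T"
      by (rule sqrt_cand_commute[OF A r])
  qed (simp_all add: T sqrt_cand_positive[OF A r] sqrt_cand_square[OF A r])
  show ?thesis unfolding sqrt_op_def by (rule the_equality) (use assms * in blast)+
qed

lemma sqrt_op_eq_cand: "positive_op A \<Longrightarrow> r > 0 \<Longrightarrow> norm A \<le> r \<Longrightarrow> sqrt_op A = sqrt_cand r A"
  by (rule sqrt_op_eqI) (auto intro: sqrt_cand_positive sqrt_cand_square)

lemma sqrt_op_positive:
  assumes "positive_op A"
  shows "positive_op (sqrt_op A)" "sqrt_op A o\<^sub>L sqrt_op A = A"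
proof -
  have r: "norm A + 1 > 0" "norm A \<le> norm A + 1" by (auto intro: add_nonneg_pos)
  show "positive_op (sqrt_op A)" "sqrt_op A o\<^sub>L sqrt_op A = A"
    unfolding sqrt_op_eq_cand[OF assms r] by (rule sqrt_cand_positive[OF assms r] sqrt_cand_square[OF assms r])+
qed

text \<open>Norm continuity of the square root, which transfers the convergence of the truncations
  to the square functions. Near B the radius |B| + 1 bounds all operators involved.\<close>

lemma tendsto_sqrt_op:
  assumes lim: "(A \<longlongrightarrow> B) F" and B: "positive_op B" and A: "\<forall>\<^sub>F t in F. positive_op (A t)"
  shows "((\<lambda>t. sqrt_op (A t)) \<longlongrightarrow> sqrt_op B) F"
proof -
  define r where "r = norm B + 1"
  have r: "r > 0" "norm B \<le> r" by (auto simp: r_def intro: add_nonneg_pos)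
  have "\<forall>\<^sub>F t in F. norm (A t) < r"
    by (rule order_tendstoD(2)[OF tendsto_norm[OF lim]]) (simp add: r_def)
  then have ev: "\<forall>\<^sub>F t in F. positive_op (A t) \<and> norm (A t) \<le> r"
    using A by eventually_elim simp
  have n1: "norm (id_blinfun - (1/r) *\<^sub>R A) \<le> 1" if "positive_op A" "norm A \<le> r" for A
    using that r by (intro norm_id_minus_positive positive_op_scaleR) auto
  have "((\<lambda>t. sqrt_cand r (A t)) \<longlongrightarrow> sqrt_cand r B) F"
    unfolding sqrt_cand_def
    by (intro tendsto_intros tendsto_rootlim n1 B r lim eventually_mono[OF ev]) (auto intro: n1)
  moreover have "\<forall>\<^sub>F t in F. sqrt_cand r (A t) = sqrt_op (A t)"
    using ev by eventually_elim (metis sqrt_op_eq_cand r(1))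
  ultimately show ?thesis
    unfolding sqrt_op_eq_cand[OF B r] by (rule Lim_transform_eventually)
qed

subsection \<open>The trace\<close>

lemma ennreal_summable_on [simp]: "(f :: 'a \<Rightarrow> ennreal) summable_on S"
  by (rule nonneg_summable_on_complete) simp

lemma sum_le_infsum_ennreal:
  fixes f :: "'a \<Rightarrow> ennreal"
  assumes "finite F" "F \<subseteq> A"
  shows "sum f F \<le> infsum f A"
  unfolding nonneg_infsum_complete[of A f, OF zero_le] using assms by (intro SUP_upper) auto

lemma infsum_sum_ennreal:
  fixes f :: "'a \<Rightarrow> 'b \<Rightarrow> ennreal"
  shows "(\<Sum>a\<in>F. \<Sum>\<^sub>\<infinity>b\<in>B. f a b) = (\<Sum>\<^sub>\<infinity>b\<in>B. \<Sum>a\<in>F. f a b)"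
  by (induction F rule: infinite_finite_induct) (auto simp: infsum_add)

lemma infsum_swap_ennreal:
  fixes f :: "'a \<Rightarrow> 'b \<Rightarrow> ennreal"
  shows "(\<Sum>\<^sub>\<infinity>a\<in>A. \<Sum>\<^sub>\<infinity>b\<in>B. f a b) = (\<Sum>\<^sub>\<infinity>b\<in>B. \<Sum>\<^sub>\<infinity>a\<in>A. f a b)"
proof -
  have le: "(\<Sum>\<^sub>\<infinity>a\<in>A. \<Sum>\<^sub>\<infinity>b\<in>B. f a b) \<le> (\<Sum>\<^sub>\<infinity>b\<in>B. \<Sum>\<^sub>\<infinity>a\<in>A. f a b)"
    for A :: "'c set" and B :: "'d set" and f :: "'c \<Rightarrow> 'd \<Rightarrow> ennreal"
  proof (rule infsum_le_finite_sums)
    fix F assume F: "finite F" "F \<subseteq> A"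
    show "(\<Sum>a\<in>F. \<Sum>\<^sub>\<infinity>b\<in>B. f a b) \<le> (\<Sum>\<^sub>\<infinity>b\<in>B. \<Sum>\<^sub>\<infinity>a\<in>A. f a b)"
      unfolding infsum_sum_ennreal using F by (intro infsum_mono sum_le_infsum_ennreal) auto
  qed simp
  show ?thesis by (intro antisym le)
qed

text \<open>Both sides are the double sum of |<T e, e'>|^2 over the two bases. A self-adjoint T
  gives independence of the trace from the basis; T = S q gives its cyclicity.\<close>

lemma trace_swap:
  assumes B: "orthonormal_basis B" and B': "orthonormal_basis B'" and T: "adjoint_pair T S"
  shows "(\<Sum>\<^sub>\<infinity>e\<in>B. ennreal ((norm (T e))\<^sup>2)) = (\<Sum>\<^sub>\<infinity>e\<in>B'. ennreal ((norm (S e))\<^sup>2))"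
proof -
  have "(\<Sum>\<^sub>\<infinity>e\<in>B. ennreal ((norm (T e))\<^sup>2)) = (\<Sum>\<^sub>\<infinity>e\<in>B. \<Sum>\<^sub>\<infinity>e'\<in>B'. ennreal ((norm (cinner (T e) e'))\<^sup>2))"
    by (simp add: Parseval_ennreal[OF B'])
  also have "\<dots> = (\<Sum>\<^sub>\<infinity>e'\<in>B'. \<Sum>\<^sub>\<infinity>e\<in>B. ennreal ((norm (cinner (S e') e))\<^sup>2))"
    by (subst infsum_swap_ennreal) (simp add: adjoint_pairD[OF T] norm_cinner_commute[of _ "blinfun_apply S _"])
  finally show ?thesis by (simp add: Parseval_ennreal[OF B])
qed

lemma Tr_positive:
  assumes T: "positive_op T" and B: "orthonormal_basis B"
  shows "Tr T = (\<Sum>\<^sub>\<infinity>e\<in>B. ennreal (Re (cinner (T e) e)))"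
proof -
  define S where "S = sqrt_op T"
  have S: "adjoint_pair S S" "S o\<^sub>L S = T" using sqrt_op_positive[OF T] positive_opD(2) by (auto simp: S_def)
  have q: "Re (cinner (T e) e) = (norm (S e))\<^sup>2" for e
    unfolding S(2)[symmetric] by (simp add: norm_sq_cinner adjoint_pairD[OF S(1)])
  have "orthonormal_basis (SOME B. orthonormal_basis B)" using ex_orthonormal_basis by (rule someI_ex)
  from trace_swap[OF this B S(1)] show ?thesis unfolding Tr_def q .
qed

definition rank_one :: "L2 \<Rightarrow> L2 \<Rightarrow> op"
  where "rank_one u w = Blinfun (\<lambda>v. cinner v w *\<^sub>C u)"

lemma rank_one_apply: "blinfun_apply (rank_one u w) v = cinner v w *\<^sub>C u"
  unfolding rank_one_def
proof (subst bounded_linear_Blinfun_apply)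
  show "bounded_linear (\<lambda>v. cinner v w *\<^sub>C u)"
  proof (rule bounded_linear_intro[of _ "norm w * norm u"])
    show "norm (cinner v w *\<^sub>C u) \<le> norm v * (norm w * norm u)" for v
      using mult_right_mono[OF norm_cinner_le[of v w] norm_ge_zero[of u]] by (simp add: norm_scaleC mult_ac)
  qed (simp_all add: cinner_add_left scaleC_add_left scaleR_scaleC cinner_scaleC_left scaleC_scaleC)
qed simp

lemma rank_one_BL2: "rank_one u w \<in> BL2"
  by (rule BL2_I) (simp add: rank_one_apply cinner_scaleC_left scaleC_scaleC)

lemma rank_one_adjoint: "adjoint_pair (rank_one u w) (rank_one w u)"
  unfolding adjoint_pair_def
  by (simp add: rank_one_apply cinner_scaleC_left cinner_scaleC_right cinner_commute[symmetric] mult.commute)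

lemma cinner_mult_cnj: "cinner v h * cinner h v = complex_of_real ((norm (cinner v h))\<^sup>2)"
  unfolding complex_norm_square by (subst (2) cinner_commute) simp

lemma rank_one_positive: "positive_op (rank_one h h)"
  by (rule positive_opI) (simp_all add: rank_one_adjoint rank_one_apply cinner_scaleC_left cinner_mult_cnj del: of_real_power)

lemma Tr_rank_one: "Tr (r *\<^sub>R rank_one h h) = ennreal (r * (norm h)\<^sup>2)" if "r \<ge> 0"
proof -
  obtain B where B: "orthonormal_basis B" using ex_orthonormal_basis by blast
  have 1: "Re (cinner ((r *\<^sub>R rank_one h h) e) e) = r * (norm (cinner h e))\<^sup>2" for e
    by (simp add: blinfun.scaleR_left rank_one_apply scaleR_scaleC cinner_scaleC_left cinner_mult_cnj
        norm_cinner_commute del: of_real_power)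
  have "((\<lambda>e. r * (norm (cinner h e))\<^sup>2) has_sum r * (norm h)\<^sup>2) B"
    by (rule has_sum_cmult_right[OF Parseval_has_sum[OF B]])
  then show ?thesis
    unfolding Tr_positive[OF positive_op_scaleR[OF rank_one_positive that] B] 1
    by (intro infsumI has_sum_ennreal) (use that in auto)
qed

section \<open>Block algebras and their conditional expectations\<close>

lemma comp_scale_op_right: "A \<in> BL2 \<Longrightarrow> A o\<^sub>L scale_op c B = scale_op c (A o\<^sub>L B)"
  by (rule op_eqI) (simp add: blinfun_apply_scale_op BL2_scaleC)

lemma comp_scale_op_left: "scale_op c B o\<^sub>L A = scale_op c (B o\<^sub>L A)"
  by (rule op_eqI) (simp add: blinfun_apply_scale_op)

lemma scale_op_sum: "scale_op c (\<Sum>i\<in>F. A i) = (\<Sum>i\<in>F. scale_op c (A i))"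
  by (rule op_eqI) (simp add: blinfun_apply_scale_op blinfun.sum_left scaleC_sum_right)

definition block_system :: "'j set \<Rightarrow> ('j \<Rightarrow> op) \<Rightarrow> bool"
  where "block_system J q \<longleftrightarrow> finite J \<and> (\<forall>j\<in>J. adjoint_pair (q j) (q j)) \<and>
    (\<forall>i\<in>J. \<forall>j\<in>J. q i o\<^sub>L q j = (if i = j then q i else 0)) \<and> (\<Sum>j\<in>J. q j) = id_blinfun"

definition block_algebra :: "'j set \<Rightarrow> ('j \<Rightarrow> op) \<Rightarrow> op set"
  where "block_algebra J q = {x \<in> BL2. \<forall>j\<in>J. q j o\<^sub>L x = x o\<^sub>L q j}"

definition pinching :: "'j set \<Rightarrow> ('j \<Rightarrow> op) \<Rightarrow> op \<Rightarrow> op"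
  where "pinching J q x = (\<Sum>j\<in>J. q j o\<^sub>L x o\<^sub>L q j)"

lemma pinching_add: "pinching J q (x + y) = pinching J q x + pinching J q y"
  by (simp add: pinching_def comp_add_left comp_add_right sum.distrib)

lemma pinching_scaleR: "pinching J q (r *\<^sub>R x) = r *\<^sub>R pinching J q x"
  by (simp add: pinching_def comp_scaleR_left comp_scaleR_right scaleR_sum_right)

lemma pinching_sum: "pinching J q (\<Sum>i\<in>F. x i) = (\<Sum>i\<in>F. pinching J q (x i))"
  by (induction F rule: infinite_finite_induct) (simp_all add: pinching_add, simp_all add: pinching_def)

text \<open>Commutation of T with a self-adjoint q says that <T q u, w> - <T u, q w> vanishes for
  all u and w. Each of these conditions is a functional with two summands, which is what the
  closedness of a commutant requires.\<close>

lemma normal_functional_two: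
  "(\<lambda>T. cinner (blinfun_apply T u) w + cinner (blinfun_apply T u') w') \<in> normal_functionals"
proof -
  define f g where "f = (\<lambda>n::nat. if n = 0 then u else if n = 1 then u' else 0)"
    and "g = (\<lambda>n::nat. if n = 0 then w else if n = 1 then w' else 0)"
  have "summable (\<lambda>n. (norm (f n))\<^sup>2)" "summable (\<lambda>n. (norm (g n))\<^sup>2)"
    by (rule summable_finite[of "{0,1}"]; simp add: f_def g_def)+
  moreover have "(\<Sum>n. cinner (blinfun_apply T (f n)) (g n)) = cinner (T u) w + cinner (T u') w'" for T :: op
    by (subst suminf_finite[of "{0,1}"]) (auto simp: f_def g_def)
  ultimately show ?thesis unfolding normal_functionals_def by (intro CollectI exI[of _ f] exI[of _ g]) auto
qed

lemma topspace_weak_star: "topspace weak_star = BL2"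
proof -
  have "(\<lambda>T. cinner (blinfun_apply T 0) 0 + cinner (blinfun_apply T 0) 0) \<in> normal_functionals"
    by (rule normal_functional_two)
  then show ?thesis
    unfolding weak_star_def topology_generated_by_topspace by (blast intro: open_UNIV)
qed

lemma openin_weak_star: "\<phi> \<in> normal_functionals \<Longrightarrow> open U \<Longrightarrow> openin weak_star {T \<in> BL2. \<phi> T \<in> U}"
  unfolding weak_star_def by (rule topology_generated_by_Basis) blast

context
  fixes J :: "'j set" and q :: "'j \<Rightarrow> op"
  assumes bs: "block_system J q"
begin

lemma
  shows block_fin: "finite J" and block_adj: "\<And>j. j \<in> J \<Longrightarrow> adjoint_pair (q j) (q j)"
    and block_comp: "\<And>i j. i \<in> J \<Longrightarrow> j \<in> J \<Longrightarrow> q i o\<^sub>L q j = (if i = j then q i else 0)"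
    and block_sum: "(\<Sum>j\<in>J. q j) = id_blinfun"
  using bs by (auto simp: block_system_def)

lemma block_BL2: "j \<in> J \<Longrightarrow> q j \<in> BL2"
  using block_adj adjoint_pair_BL2 by blast

lemma block_apply: "i \<in> J \<Longrightarrow> j \<in> J \<Longrightarrow> q i (q j f) = (if i = j then q i f else 0)"
  using block_comp[of i j] by (metis blinfun_apply_blinfun_compose zero_blinfun.rep_eq)

lemma block_sum_apply: "(\<Sum>j\<in>J. q j f) = f"
  using arg_cong[OF block_sum, of "\<lambda>T. blinfun_apply T f"] by (simp add: blinfun.sum_left)

lemma block_sum_norm: "(\<Sum>j\<in>J. (norm (q j f))\<^sup>2) = (norm f)\<^sup>2"
proof -
  have "cinner f f = (\<Sum>j\<in>J. cinner (q j f) f)"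
    by (simp add: cinner_sum_left[symmetric] block_sum_apply)
  also have "\<dots> = (\<Sum>j\<in>J. cinner (q j f) (q j f))"
    by (rule sum.cong) (simp_all add: block_apply adjoint_pairD[OF block_adj])
  finally show ?thesis by (simp add: norm_sq_cinner)
qed

lemma pinching_BL2: "x \<in> BL2 \<Longrightarrow> pinching J q x \<in> BL2"
  unfolding pinching_def by (intro BL2_sum BL2_comp block_BL2)

lemma pinching_mem: assumes "x \<in> BL2" shows "pinching J q x \<in> block_algebra J q"
  unfolding block_algebra_def
proof (intro CollectI conjI ballI pinching_BL2 assms)
  fix i assume i: "i \<in> J"
  have "q i o\<^sub>L pinching J q x = (\<Sum>j\<in>J. if i = j then q i o\<^sub>L x o\<^sub>L q i else 0)"
    unfolding pinching_def comp_sum_right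
    by (rule sum.cong) (auto simp: comp_assoc[symmetric] block_comp i)
  moreover have "pinching J q x o\<^sub>L q i = (\<Sum>j\<in>J. if i = j then q i o\<^sub>L x o\<^sub>L q i else 0)"
    unfolding pinching_def comp_sum_left
    by (rule sum.cong) (auto simp: comp_assoc block_comp i)
  ultimately show "q i o\<^sub>L pinching J q x = pinching J q x o\<^sub>L q i" by simp
qed

lemma pinching_fix: assumes "x \<in> block_algebra J q" shows "pinching J q x = x"
proof -
  have "pinching J q x = (\<Sum>j\<in>J. x o\<^sub>L q j)"
    unfolding pinching_def using assms
    by (intro sum.cong refl) (auto simp: block_algebra_def comp_assoc block_comp)
  then show ?thesis by (simp add: comp_sum_right[symmetric] block_sum)
qed

lemma block_mem: "j \<in> J \<Longrightarrow> q j \<in> block_algebra J q"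
  by (auto simp: block_algebra_def block_BL2 block_comp)

lemma block_conj_mem: "j \<in> J \<Longrightarrow> x \<in> BL2 \<Longrightarrow> q j o\<^sub>L x o\<^sub>L q j \<in> block_algebra J q"
  unfolding block_algebra_def
  by (auto intro!: BL2_comp block_BL2 simp: comp_assoc block_comp comp_assoc[symmetric, of "q _" "q _"])

lemma positive_pinching: "positive_op x \<Longrightarrow> positive_op (pinching J q x)"
proof (rule positive_opI)
  assume x: "positive_op x"
  have p: "positive_op (q j o\<^sub>L x o\<^sub>L q j)" if "j \<in> J" for j
    using that by (intro positive_op_conj x block_adj)
  then show "adjoint_pair (pinching J q x) (pinching J q x)"
    unfolding pinching_def by (intro adjoint_pair_sum positive_opD(2))
  show "0 \<le> Re (cinner (pinching J q x f) f)" for f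
    unfolding pinching_def blinfun.sum_left cinner_sum_left Re_sum by (intro sum_nonneg positive_opD(3) p)
qed

text \<open>With S the square root of x, the block terms are |S q_j e|^2; \<open>trace_swap\<close>
  turns their sum over a basis into that of |q_j S e|^2, and summing over j restores |S e|^2 by
  Pythagoras.\<close>

lemma Tr_pinching:
  assumes x: "positive_op x"
  shows "Tr (pinching J q x) = Tr x"
proof -
  obtain B where B: "orthonormal_basis B" using ex_orthonormal_basis by blast
  define S where "S = sqrt_op x"
  have S: "adjoint_pair S S" "S o\<^sub>L S = x" using sqrt_op_positive[OF x] positive_opD(2) by (auto simp: S_def)
  have xS: "x f = S (S f)" for f using S(2) by (metis blinfun_apply_blinfun_compose)
  have p: "positive_op (pinching J q x)" by (rule positive_pinching[OF x])
  have "Re (cinner (pinching J q x e) e) = (\<Sum>j\<in>J. (norm (S (q j e)))\<^sup>2)" for e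
    unfolding pinching_def blinfun.sum_left cinner_sum_left Re_sum
    by (rule sum.cong) (simp_all add: xS adjoint_pairD[OF block_adj] adjoint_pairD[OF S(1)] norm_sq_cinner)
  then have "Tr (pinching J q x) = (\<Sum>\<^sub>\<infinity>e\<in>B. \<Sum>j\<in>J. ennreal ((norm ((S o\<^sub>L q j) e))\<^sup>2))"
    unfolding Tr_positive[OF p B] by (simp add: sum_ennreal)
  also have "\<dots> = (\<Sum>j\<in>J. \<Sum>\<^sub>\<infinity>e\<in>B. ennreal ((norm ((S o\<^sub>L q j) e))\<^sup>2))"
    by (rule infsum_sum_ennreal[symmetric])
  also have "\<dots> = (\<Sum>j\<in>J. \<Sum>\<^sub>\<infinity>e\<in>B. ennreal ((norm ((q j o\<^sub>L S) e))\<^sup>2))"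
    by (intro sum.cong refl trace_swap B adjoint_pair_comp S block_adj)
  also have "\<dots> = (\<Sum>\<^sub>\<infinity>e\<in>B. \<Sum>j\<in>J. ennreal ((norm ((q j o\<^sub>L S) e))\<^sup>2))"
    by (rule infsum_sum_ennreal)
  also have "\<dots> = (\<Sum>\<^sub>\<infinity>e\<in>B. ennreal ((norm (S e))\<^sup>2))"
    by (simp add: sum_ennreal block_sum_norm)
  also have "\<dots> = Tr x"
    unfolding Tr_positive[OF x B] xS by (simp add: norm_sq_cinner adjoint_pairD[OF S(1)])
  finally show ?thesis .
qed

lemma pinching_expectation: "trace_preserving_expectation (block_algebra J q) (pinching J q)"
  unfolding trace_preserving_expectation_def
proof (intro conjI ballI allI impI)
  show "pinching J q (x + y) = pinching J q x + pinching J q y" for x y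
    by (rule pinching_add)
  show "pinching J q (scale_op c x) = scale_op c (pinching J q x)" for c x
    unfolding pinching_def scale_op_sum
    by (rule sum.cong) (simp_all add: comp_scale_op_right comp_scale_op_left block_BL2)
  show "pinching J q (a o\<^sub>L x o\<^sub>L b) = a o\<^sub>L pinching J q x o\<^sub>L b"
    if "a \<in> block_algebra J q" "b \<in> block_algebra J q" for a b x
    unfolding pinching_def comp_sum_left comp_sum_right
  proof (rule sum.cong)
    fix j assume "j \<in> J"
    then have "q j o\<^sub>L a = a o\<^sub>L q j" "b o\<^sub>L q j = q j o\<^sub>L b" using that by (auto simp: block_algebra_def)
    then show "q j o\<^sub>L (a o\<^sub>L x o\<^sub>L b) o\<^sub>L q j = a o\<^sub>L (q j o\<^sub>L x o\<^sub>L q j) o\<^sub>L b"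
      by (metis comp_assoc)
  qed simp
qed (simp_all add: pinching_mem pinching_fix Tr_pinching positive_pinching)

text \<open>The bimodule property gives q_j E(x) q_j = E(q_j x q_j), and q_j x q_j already belongs
  to the algebra, so it is fixed by E. Hence the choice made in \<open>cond_expectation\<close> is
  forced.\<close>

lemma expectation_unique:
  assumes E: "trace_preserving_expectation (block_algebra J q) E" and x: "x \<in> BL2"
  shows "E x = pinching J q x"
proof -
  have add: "E (a + b) = E a + E b" if "a \<in> BL2" "b \<in> BL2" for a b
    using E that by (auto simp: trace_preserving_expectation_def)
  have efix: "E b = b" if "b \<in> block_algebra J q" for b
    using E that by (auto simp: trace_preserving_expectation_def)
  have "0 \<in> block_algebra J q" by (simp add: block_algebra_def)
  then have sum: "E (\<Sum>j\<in>F. a j) = (\<Sum>j\<in>F. E (a j))" if "\<And>j. j \<in> F \<Longrightarrow> a j \<in> BL2" for F :: "'j set" and a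
    using that by (induction F rule: infinite_finite_induct) (auto simp: efix add BL2_sum)
  have Ex: "E x \<in> block_algebra J q" using E x by (auto simp: trace_preserving_expectation_def)
  then have "E x = pinching J q (E x)" by (simp add: pinching_fix)
  also have "\<dots> = (\<Sum>j\<in>J. E (q j o\<^sub>L x o\<^sub>L q j))"
    unfolding pinching_def
    by (rule sum.cong) (use E x block_mem in \<open>auto simp: trace_preserving_expectation_def\<close>)
  also have "\<dots> = pinching J q x"
    unfolding pinching_def by (rule sum.cong) (simp_all add: efix block_conj_mem x)
  finally show ?thesis .
qed

lemma cond_expectation_block: "x \<in> BL2 \<Longrightarrow> cond_expectation (block_algebra J q) x = pinching J q x"
  unfolding cond_expectation_def
  by (rule expectation_unique[OF someI[of "trace_preserving_expectation (block_algebra J q)", OF pinching_expectation]])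

lemma block_algebra_vN: "vN_subalgebra (block_algebra J q)"
  unfolding vN_subalgebra_def
proof (intro conjI ballI allI)
  show "block_algebra J q \<subseteq> BL2" "id_blinfun \<in> block_algebra J q"
    by (auto simp: block_algebra_def)
  fix a assume a: "a \<in> block_algebra J q"
  show "scale_op c a \<in> block_algebra J q" for c
    using a by (auto simp: block_algebra_def comp_scale_op_right comp_scale_op_left block_BL2)
  have aa: "adjoint_pair a (adj a)" using a by (intro adjoint_pair_adj) (simp add: block_algebra_def)
  show "adj a \<in> block_algebra J q"
    unfolding block_algebra_def
  proof (intro CollectI conjI ballI adjoint_pair_BL2[OF aa])
    fix j assume j: "j \<in> J"
    have "adjoint_pair (a o\<^sub>L q j) (q j o\<^sub>L adj a)" "adjoint_pair (q j o\<^sub>L a) (adj a o\<^sub>L q j)"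
      by (intro adjoint_pair_comp aa block_adj j)+
    then show "q j o\<^sub>L adj a = adj a o\<^sub>L q j"
      using a j adjoint_pair_unique by (auto simp: block_algebra_def)
  qed
  fix b assume b: "b \<in> block_algebra J q"
  show "a + b \<in> block_algebra J q" "a o\<^sub>L b \<in> block_algebra J q"
    using a b unfolding block_algebra_def by (auto simp: comp_add_left comp_add_right) (metis comp_assoc)
next
  \<comment> \<open>A failure of commutation is witnessed by one normal functional with nonzero
    value, so the complement of the algebra is a union of basic open sets.\<close>
  define W where "W j u w = {T \<in> BL2. (cinner (blinfun_apply T (q j u)) w + cinner (blinfun_apply T u) (- q j w)) \<in> - {0}}" for j u w
  have W: "openin weak_star (W j u w)" for j u w
    unfolding W_def by (rule openin_weak_star[OF normal_functional_two]) auto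
  have "BL2 - block_algebra J q = (\<Union>j\<in>J. \<Union>u. \<Union>w. W j u w)"
  proof -
    have 1: "q j o\<^sub>L T = T o\<^sub>L q j \<longleftrightarrow> (\<forall>u w. cinner (T (q j u)) w + cinner (T u) (- q j w) = 0)" if "j \<in> J" for j T
    proof -
      have "cinner (T (q j u)) w + cinner (T u) (- q j w) = cinner ((T o\<^sub>L q j) u) w - cinner ((q j o\<^sub>L T) u) w" for u w
        by (simp add: adjoint_pairD[OF block_adj[OF that]])
      then have "(\<forall>u w. cinner (T (q j u)) w + cinner (T u) (- q j w) = 0) \<longleftrightarrow>
        (\<forall>u w. cinner ((T o\<^sub>L q j) u) w = cinner ((q j o\<^sub>L T) u) w)" by simp
      also have "\<dots> \<longleftrightarrow> (T o\<^sub>L q j = q j o\<^sub>L T)" using cinner_eqI op_eqI by metis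
      finally show ?thesis by auto
    qed
    show ?thesis unfolding block_algebra_def W_def using 1 by auto
  qed
  then have "openin weak_star (BL2 - block_algebra J q)" using W by (auto intro!: openin_Union)
  then show "closedin weak_star (block_algebra J q)"
    by (auto simp: closedin_def topspace_weak_star block_algebra_def)
qed

text \<open>Some vector g in the range of a single block has r = <a g, g> > 0. With h = a g, the
  operator (1/r) <., h> h is dominated by a through \<open>positive_op_CS\<close>, has finite trace,
  and commutes with all blocks because h stays in the same block.\<close>

lemma block_algebra_semifinite: "trace_semifinite_on (block_algebra J q)"
  unfolding trace_semifinite_on_def
proof (intro ballI impI, elim conjE)
  fix a assume a: "a \<in> block_algebra J q" "positive_op a" "a \<noteq> 0"
  have "\<exists>f. Re (cinner (a f) f) \<noteq> 0"
    using positive_op_cinner_0[OF a(2)] a(3) op_eqI[of a 0] by fastforce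
  then obtain f where f: "Re (cinner (a f) f) \<noteq> 0" by blast
  have "cinner (a f) f = (\<Sum>j\<in>J. cinner (a (q j f)) (q j f))"
    by (subst pinching_fix[OF a(1), symmetric], unfold pinching_def blinfun.sum_left cinner_sum_left)
       (rule sum.cong, simp_all add: adjoint_pairD[OF block_adj])
  then obtain j where j: "j \<in> J" "Re (cinner (a (q j f)) (q j f)) \<noteq> 0"
    using f by (auto simp: Re_sum dest: sum.not_neutral_contains_not_neutral)
  define g h r where "g = q j f" and "h = a g" and "r = Re (cinner h g)"
  have r: "r > 0" using j positive_opD(3)[OF a(2), of g] by (simp add: r_def h_def g_def)
  have h: "h \<noteq> 0"
  proof
    assume "h = 0"
    then have "cinner h g = 0" by (simp only: cinner_zero_left)
    then show False using r unfolding r_def by simp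
  qed
  have qa: "q i (a v) = a (q i v)" if "i \<in> J" for i v
  proof -
    have "q i o\<^sub>L a = a o\<^sub>L q i" using a(1) that by (simp add: block_algebra_def)
    from arg_cong[OF this, of "\<lambda>T. blinfun_apply T v"] show ?thesis by simp
  qed
  have qh: "q i h = (if i = j then h else 0)" if "i \<in> J" for i
    using that j by (simp add: h_def g_def qa block_apply blinfun.zero_right)
  define b where "b = (1/r) *\<^sub>R rank_one h h"
  have b: "positive_op b" unfolding b_def using r by (intro positive_op_scaleR rank_one_positive) auto
  show "\<exists>b\<in>block_algebra J q. positive_op b \<and> b \<noteq> 0 \<and> positive_op (a - b) \<and> Tr b < \<infinity>"
  proof (intro bexI[of _ b] conjI b)
    have bh: "b h = (1/r) *\<^sub>R (complex_of_real ((norm h)\<^sup>2) *\<^sub>C h)"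
      by (simp only: b_def blinfun.scaleR_left rank_one_apply cinner_self)
    have "norm (b h) = (1/r) * ((norm h)\<^sup>2 * norm h)"
      unfolding bh norm_scaleR norm_scaleC norm_of_real using r by simp
    moreover have "(1/r) * ((norm h)\<^sup>2 * norm h) \<noteq> 0" using h r by simp
    ultimately show "b \<noteq> 0" by (metis blinfun.zero_left norm_zero)
    show "Tr b < \<infinity>" unfolding b_def using r by (simp add: Tr_rank_one)
    show "b \<in> block_algebra J q"
      unfolding block_algebra_def
    proof (intro CollectI conjI ballI positive_opD(1) b op_eqI)
      fix i v assume i: "i \<in> J"
      have "cinner (q i v) h = cinner v (q i h)" by (rule adjoint_pairD[OF block_adj[OF i]])
      then show "(q i o\<^sub>L b) v = (b o\<^sub>L q i) v"
        using i by (simp add: b_def blinfun.scaleR_left blinfun.scaleR_right rank_one_apply BL2_scaleC[OF block_BL2] qh)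
    qed
    show "positive_op (a - b)"
    proof (rule positive_opI)
      show "adjoint_pair (a - b) (a - b)" using a(2) b by (intro adjoint_pair_diff positive_opD)
      fix v
      have "(norm (cinner v h))\<^sup>2 \<le> Re (cinner (a v) v) * r"
        using positive_op_CS[OF a(2), of v g] adjoint_pairD[OF positive_opD(2)[OF a(2)], of v g]
        by (simp add: h_def r_def)
      then have "(1/r) * (norm (cinner v h))\<^sup>2 \<le> Re (cinner (a v) v)" using r by (simp add: field_simps)
      moreover have "Re (cinner (b v) v) = (1/r) * (norm (cinner v h))\<^sup>2"
        by (simp add: b_def blinfun.scaleR_left rank_one_apply scaleR_scaleC cinner_scaleC_left cinner_mult_cnj del: of_real_power)
      ultimately show "0 \<le> Re (cinner ((a - b) v) v)" by (simp add: blinfun.diff_left cinner_diff_left)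
    qed
  qed
qed

end

text \<open>
  The filtration attached to a finite decomposition \<open>p 0, \<dots>, p K\<close> of the identity: the first \<open>k + 1\<close>
  blocks are merged in step \<open>k\<close>, so that from step \<open>K\<close> on the algebra is all of \<open>BL2\<close>.
\<close>

definition merged :: "(nat \<Rightarrow> op) \<Rightarrow> nat \<Rightarrow> nat \<Rightarrow> op"
  where "merged p k j = (if j = k then \<Sum>i\<le>k. p i else p j)"

definition merged_algebra :: "nat \<Rightarrow> (nat \<Rightarrow> op) \<Rightarrow> nat \<Rightarrow> op set"
  where "merged_algebra K p k = block_algebra {k..max k K} (merged p k)"

context
  fixes K :: nat and p :: "nat \<Rightarrow> op"
  assumes p: "block_system {..K} p" and p0: "\<And>j. j > K \<Longrightarrow> p j = 0"
begin

lemma decomp_adj: "adjoint_pair (p j) (p j)"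
  using block_adj[OF p, of j] p0[of j] by (cases "j \<le> K") (auto simp: adjoint_pair_zero)

lemma decomp_comp: "p i o\<^sub>L p j = (if i = j then p i else 0)"
  using block_comp[OF p, of i j] p0[of i] p0[of j] by (cases "i \<le> K"; cases "j \<le> K") auto

lemma decomp_BL2: "p j \<in> BL2" using decomp_adj adjoint_pair_BL2 by blast

lemma partial_comp: "(\<Sum>i\<le>k. p i) o\<^sub>L p j = (if j \<le> k then p j else 0)"
  by (simp add: comp_sum_left decomp_comp)

lemma partial_comp': "p j o\<^sub>L (\<Sum>i\<le>k. p i) = (if j \<le> k then p j else 0)"
  by (simp add: comp_sum_right decomp_comp)

lemma partial_sum_ge: "k \<ge> K \<Longrightarrow> (\<Sum>i\<le>k. p i) = id_blinfun"
  using sum.mono_neutral_left[of "{..k}" "{..K}" p] p0 block_sum[OF p] by force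

lemma merged_system: "block_system {k..max k K} (merged p k)"
  unfolding block_system_def
proof (intro conjI ballI)
  show "adjoint_pair (merged p k j) (merged p k j)" for j
    by (simp add: merged_def decomp_adj adjoint_pair_sum)
  have pp: "(\<Sum>i\<le>k. p i) o\<^sub>L (\<Sum>i\<le>k. p i) = (\<Sum>i\<le>k. p i)"
    unfolding comp_sum_right by (simp add: partial_comp)
  show "merged p k i o\<^sub>L merged p k j = (if i = j then merged p k i else 0)"
    if "i \<in> {k..max k K}" "j \<in> {k..max k K}" for i j
    using that by (auto simp: merged_def partial_comp partial_comp' decomp_comp pp)
  have "(\<Sum>j\<in>{k..max k K}. merged p k j) = merged p k k + (\<Sum>j\<in>{Suc k..max k K}. merged p k j)"
    by (rule sum.atLeast_Suc_atMost) simp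
  also have "(\<Sum>j\<in>{Suc k..max k K}. merged p k j) = (\<Sum>j\<in>{Suc k..max k K}. p j)"
    by (rule sum.cong) (auto simp: merged_def)
  also have "merged p k k + (\<Sum>j\<in>{Suc k..max k K}. p j) = (\<Sum>j\<le>max k K. p j)"
  proof -
    have "{..max k K} = {..k} \<union> {Suc k..max k K}" by auto
    then show ?thesis by (subst \<open>{..max k K} = _\<close>, subst sum.union_disjoint) (auto simp: merged_def)
  qed
  finally show "(\<Sum>j\<in>{k..max k K}. merged p k j) = id_blinfun" by (simp add: partial_sum_ge)
qed simp

lemma merged_algebra_mono: "merged_algebra K p k \<subseteq> merged_algebra K p (Suc k)"
proof
  fix x assume x: "x \<in> merged_algebra K p k"
  have xB: "x \<in> BL2" using x by (simp add: merged_algebra_def block_algebra_def)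
  have P: "(\<Sum>i\<le>k. p i) o\<^sub>L x = x o\<^sub>L (\<Sum>i\<le>k. p i)"
    using x unfolding merged_algebra_def block_algebra_def merged_def by (auto dest!: bspec[of _ _ k])
  have pj: "p j o\<^sub>L x = x o\<^sub>L p j" if "j > k" for j
  proof (cases "j \<le> K")
    case True
    then have "j \<in> {k..max k K}" using that by simp
    then have "merged p k j o\<^sub>L x = x o\<^sub>L merged p k j"
      using x unfolding merged_algebra_def block_algebra_def by blast
    then show ?thesis using that by (simp add: merged_def)
  qed (simp add: p0)
  show "x \<in> merged_algebra K p (Suc k)"
    using xB P pj unfolding merged_algebra_def block_algebra_def merged_def
    by (auto simp: comp_add_left comp_add_right)
qed

lemma merged_algebra_top: "k \<ge> K \<Longrightarrow> merged_algebra K p k = BL2"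
  by (auto simp: merged_algebra_def block_algebra_def merged_def partial_sum_ge max_def)

lemma merged_filtration: "filtration (merged_algebra K p)"
proof -
  have "weak_star closure_of (\<Union>k. merged_algebra K p k) = BL2"
  proof -
    have "(\<Union>k. merged_algebra K p k) = BL2"
    proof
      show "(\<Union>k. merged_algebra K p k) \<subseteq> BL2" by (auto simp: merged_algebra_def block_algebra_def)
      show "BL2 \<subseteq> (\<Union>k. merged_algebra K p k)" using merged_algebra_top[of K] by blast
    qed
    then show ?thesis using closure_of_topspace[of weak_star] by (simp add: topspace_weak_star)
  qed
  then show ?thesis
    unfolding filtration_def using block_algebra_vN[OF merged_system] block_algebra_semifinite[OF merged_system]
      merged_algebra_mono by (auto simp: merged_algebra_def)
qed

text \<open>The factor \<open>p k\<close> on the right is orthogonal to every block beyond k and is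
  absorbed by the merged block, so one term of the pinching survives.\<close>

lemma cond_expectation_merged:
  assumes X: "X \<in> BL2"
  shows "cond_expectation (merged_algebra K p k) (X o\<^sub>L p k) = (\<Sum>i\<le>k. p i) o\<^sub>L X o\<^sub>L p k"
proof -
  have "cond_expectation (merged_algebra K p k) (X o\<^sub>L p k)
      = (\<Sum>j\<in>{k..max k K}. merged p k j o\<^sub>L (X o\<^sub>L p k) o\<^sub>L merged p k j)"
    unfolding merged_algebra_def
    by (subst cond_expectation_block[OF merged_system]) (auto intro: X decomp_BL2 simp: pinching_def)
  also have "\<dots> = (\<Sum>j\<in>{k..max k K}. if j = k then (\<Sum>i\<le>k. p i) o\<^sub>L X o\<^sub>L p k else 0)"
    by (rule sum.cong) (auto simp: merged_def comp_assoc partial_comp' decomp_comp)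
  also have "\<dots> = (\<Sum>i\<le>k. p i) o\<^sub>L X o\<^sub>L p k" by simp
  finally show ?thesis .
qed

end

section \<open>Compact operators\<close>

definition compact_op :: "op \<Rightarrow> bool"
  where "compact_op T \<longleftrightarrow> (\<exists>K. compact K \<and> blinfun_apply T ` cball 0 1 \<subseteq> K)"

lemma compact_op_add:
  assumes "compact_op S" "compact_op T" shows "compact_op (S + T)"
proof -
  obtain K L where "compact K" "S ` cball 0 1 \<subseteq> K" "compact L" "T ` cball 0 1 \<subseteq> L"
    using assms by (auto simp: compact_op_def)
  then show ?thesis unfolding compact_op_def
    by (intro exI[of _ "{x + y | x y. x \<in> K \<and> y \<in> L}"])
       (auto simp: compact_sums blinfun.add_left image_subset_iff)
qed

lemma compact_op_comp_left:
  assumes "compact_op T" shows "compact_op (A o\<^sub>L T)"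
proof -
  obtain K where "compact K" "T ` cball 0 1 \<subseteq> K" using assms by (auto simp: compact_op_def)
  then show ?thesis unfolding compact_op_def
    by (intro exI[of _ "blinfun_apply A ` K"])
       (auto simp: image_subset_iff intro!: compact_continuous_image blinfun.continuous_on continuous_on_id continuous_on_const)
qed

lemma compact_op_comp_right:
  assumes "compact_op T" shows "compact_op (T o\<^sub>L A)"
proof -
  obtain K where K: "compact K" "T ` cball 0 1 \<subseteq> K" using assms by (auto simp: compact_op_def)
  define s where "s = norm A + 1"
  have s: "s > 0" by (simp add: s_def add_nonneg_pos)
  have "(T o\<^sub>L A) f \<in> (\<lambda>x. s *\<^sub>R x) ` K" if "norm f \<le> 1" for f
  proof
    have "norm (A f) \<le> norm A * norm f" by (rule norm_blinfun)
    also have "\<dots> \<le> norm A * 1" using that by (intro mult_left_mono) auto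
    finally have "norm ((1/s) *\<^sub>R A f) \<le> 1" using s by (simp add: s_def field_simps)
    then show "T ((1/s) *\<^sub>R A f) \<in> K" using K(2) by (simp add: image_subset_iff)
    show "(T o\<^sub>L A) f = s *\<^sub>R T ((1/s) *\<^sub>R A f)" using s by (simp add: blinfun.scaleR_right)
  qed
  then show ?thesis unfolding compact_op_def
    by (intro exI[of _ "(\<lambda>x. s *\<^sub>R x) ` K"]) (auto intro: compact_scaling K(1))
qed

lemma compact_op_scaleR: "compact_op T \<Longrightarrow> compact_op (r *\<^sub>R T)"
  using compact_op_comp_left[of T "r *\<^sub>R id_blinfun"] by (simp add: comp_scaleR_left)

lemma compact_op_zero: "compact_op 0"
  unfolding compact_op_def by (intro exI[of _ "{0}"]) auto

lemma compact_op_sum: "(\<And>i. i \<in> F \<Longrightarrow> compact_op (T i)) \<Longrightarrow> compact_op (\<Sum>i\<in>F. T i)"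
  by (induction F rule: infinite_finite_induct) (auto simp: compact_op_zero compact_op_add)

lemma compact_op_rank_one: "compact_op (rank_one u w)"
  unfolding compact_op_def
proof (intro exI conjI)
  show "compact ((\<lambda>c. c *\<^sub>C u) ` cball 0 (norm w))"
  proof (rule compact_continuous_image)
    have "bounded_linear (\<lambda>c. c *\<^sub>C u)"
      by (rule bounded_linear_intro[of _ "norm u"])
         (auto simp: scaleC_add_left scaleR_scaleC scaleC_scaleC norm_scaleC scaleR_conv_of_real)
    then show "continuous_on (cball 0 (norm w)) (\<lambda>c. c *\<^sub>C u)"
      by (rule bounded_linear.continuous_on) (rule continuous_on_id)
  qed simp
  show "rank_one u w ` cball 0 1 \<subseteq> (\<lambda>c. c *\<^sub>C u) ` cball 0 (norm w)"
  proof (clarsimp simp: rank_one_apply)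
    fix v :: L2 assume "norm v \<le> 1"
    then have "norm (cinner v w) \<le> 1 * norm w"
      by (intro order_trans[OF norm_cinner_le] mult_right_mono) auto
    then show "cinner v w *\<^sub>C u \<in> (\<lambda>c. c *\<^sub>C u) ` cball 0 (norm w)" by auto
  qed
qed

lemma compact_op_lim:
  assumes lim: "T \<longlonglongrightarrow> S" and T: "\<And>n. compact_op (T n)"
  shows "compact_op S"
  unfolding compact_op_def
proof (intro exI conjI)
  show "S ` cball 0 1 \<subseteq> closure (S ` cball 0 1)" by (rule closure_subset)
  show "compact (closure (S ` cball 0 1))"
    unfolding compact_eq_totally_bounded
  proof (intro conjI allI impI)
    show "complete (closure (S ` cball 0 1))"
      by (rule complete_closed_subset[OF closed_closure subset_UNIV complete_UNIV])
    fix e :: real assume e: "e > 0"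
    then obtain n where n: "norm (T n - S) < e/3"
      using lim unfolding LIMSEQ_def dist_norm by (meson divide_pos_pos order_refl zero_less_numeral)
    obtain K where K: "compact K" "T n ` cball 0 1 \<subseteq> K" using T by (auto simp: compact_op_def)
    then obtain k where k: "finite k" "K \<subseteq> (\<Union>x\<in>k. ball x (e/3))"
      using e unfolding compact_eq_totally_bounded by (meson divide_pos_pos zero_less_numeral)
    have "S ` cball 0 1 \<subseteq> (\<Union>x\<in>k. cball x (2*e/3))"
    proof clarify
      fix f :: L2 assume f: "f \<in> cball 0 1"
      then obtain x where x: "x \<in> k" "dist x (T n f) < e/3" using K k by force
      have "norm ((T n - S) f) \<le> norm (T n - S) * norm f" by (rule norm_blinfun)
      also have "\<dots> \<le> norm (T n - S) * 1" using f by (intro mult_left_mono) auto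
      finally have "dist (T n f) (S f) \<le> e/3" using n by (simp add: dist_norm blinfun.diff_left)
      then have "dist x (S f) \<le> 2*e/3" using x(2) dist_triangle[of x "S f" "T n f"] by simp
      then show "S f \<in> (\<Union>x\<in>k. cball x (2*e/3))" using x(1) by auto
    qed
    moreover have "closed (\<Union>x\<in>k. cball x (2*e/3))" using k by (intro closed_UN) auto
    ultimately have "closure (S ` cball 0 1) \<subseteq> (\<Union>x\<in>k. cball x (2*e/3))" by (rule closure_minimal)
    also have "\<dots> \<subseteq> (\<Union>x\<in>k. ball x e)" using e by auto
    finally show "\<exists>k. finite k \<and> closure (S ` cball 0 1) \<subseteq> (\<Union>x\<in>k. ball x e)" using k(1) by blast
  qed
qed

text \<open>For unit vectors f with |T f| close to l = |T|, the inequality T^2 <= l T gives |T f - l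
  f|^2 <= l^2 - |T f|^2. Compactness makes a subsequence of T f converge, and then f itself
  converges, to an eigenvector.\<close>

lemma compact_op_eigenvector:
  assumes T: "positive_op T" and c: "compact_op T" and "T \<noteq> 0"
  shows "\<exists>v. norm v = 1 \<and> blinfun_apply T v = norm T *\<^sub>R v"
proof -
  define l where "l = norm T"
  have l: "l > 0" using assms by (simp add: l_def)
  have "\<exists>f. norm f = 1 \<and> norm (T f) > l - e" if e: "e > 0" for e
  proof (rule ccontr)
    assume n: "\<not> (\<exists>f. norm f = 1 \<and> norm (T f) > l - e)"
    define m where "m = max 0 (l - e)"
    have "norm T \<le> m"
    proof (rule norm_blinfun_bound)
      fix f show "norm (T f) \<le> m * norm f"
      proof (cases "f = 0")
        case False
        then have "norm ((1 / norm f) *\<^sub>R f) = 1" by simp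
        then have "norm (T ((1 / norm f) *\<^sub>R f)) \<le> l - e" using n not_le by blast
        then have "norm (T f) / norm f \<le> m" by (simp add: blinfun.scaleR_right m_def)
        then show ?thesis using False by (simp add: field_simps)
      qed (simp add: blinfun.zero_right)
    qed (simp add: m_def)
    then show False using e l by (simp add: l_def m_def max_def split: if_splits)
  qed
  then have "\<forall>n. \<exists>f. norm f = 1 \<and> norm (T f) > l - 1 / real (Suc n)"
    by (metis of_nat_0_less_iff zero_less_Suc zero_less_divide_1_iff)
  then obtain f where f: "\<And>n. norm (f n) = 1" and Tf: "\<And>n. norm (T (f n)) > l - 1 / real (Suc n)" by metis
  have Tle: "norm (T (f n)) \<le> l" for n using norm_blinfun[of T "f n"] by (simp add: f l_def)
  have nT: "(\<lambda>n. norm (T (f n))) \<longlonglongrightarrow> l"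
  proof (rule tendsto_sandwich)
    show "(\<lambda>n. l - 1 / real (Suc n)) \<longlonglongrightarrow> l"
      using tendsto_diff[OF tendsto_const[of l] LIMSEQ_inverse_real_of_nat] by (simp add: inverse_eq_divide)
  qed (auto intro!: always_eventually Tle less_imp_le[OF Tf] simp del: of_nat_Suc)
  have diff: "(norm (T (f n) - l *\<^sub>R f n))\<^sup>2 \<le> l\<^sup>2 - (norm (T (f n)))\<^sup>2" for n
  proof -
    have "(norm (T (f n)))\<^sup>2 \<le> l * Re (cinner (T (f n)) (f n))"
      using positive_op_norm_sq_le[OF T, of "f n"] by (simp add: l_def)
    then show ?thesis
      by (simp add: norm_sq_diff power_mult_distrib f scaleR_scaleC cinner_scaleC_right norm_scaleC)
  qed
  have "(\<lambda>n. (norm (T (f n) - l *\<^sub>R f n))\<^sup>2) \<longlonglongrightarrow> 0"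
  proof (rule tendsto_sandwich[of "\<lambda>_. 0"])
    show "(\<lambda>n. l\<^sup>2 - (norm (T (f n)))\<^sup>2) \<longlonglongrightarrow> 0"
      using tendsto_diff[OF tendsto_const tendsto_power[OF nT], of "l\<^sup>2" 2] by simp
  qed (auto intro!: always_eventually diff)
  then have "(\<lambda>n. norm (T (f n) - l *\<^sub>R f n)) \<longlonglongrightarrow> 0"
    using tendsto_real_sqrt by fastforce
  then have d0: "(\<lambda>n. T (f n) - l *\<^sub>R f n) \<longlonglongrightarrow> 0" by (rule tendsto_norm_zero_cancel)
  obtain K where K: "compact K" "T ` cball 0 1 \<subseteq> K" using c by (auto simp: compact_op_def)
  have "\<forall>n. T (f n) \<in> K" using K f by (auto simp: image_subset_iff)
  then obtain y r where r: "strict_mono r" "((\<lambda>n. T (f n)) \<circ> r) \<longlonglongrightarrow> y"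
    using K(1) unfolding compact_def by meson
  define v where "v = (1/l) *\<^sub>R y"
  have fr: "(\<lambda>n. f (r n)) \<longlonglongrightarrow> v"
  proof -
    have "(\<lambda>n. (1/l) *\<^sub>R (T (f (r n)) - (T (f (r n)) - l *\<^sub>R f (r n)))) \<longlonglongrightarrow> (1/l) *\<^sub>R (y - 0)"
      using r LIMSEQ_subseq_LIMSEQ[OF d0 r(1)] by (intro tendsto_intros) (auto simp: o_def)
    then show ?thesis using l by (simp add: v_def)
  qed
  have "(\<lambda>n. norm (f (r n))) \<longlonglongrightarrow> norm v" by (intro tendsto_intros fr)
  then have "norm v = 1" using LIMSEQ_unique[OF _ tendsto_const] by (simp add: f) blast
  moreover have "(\<lambda>n. T (f (r n))) \<longlonglongrightarrow> T v" by (intro tendsto_intros fr)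
  then have "T v = y" using r(2) LIMSEQ_unique by (auto simp: o_def)
  then have "T v = l *\<^sub>R v" using l by (simp add: v_def)
  ultimately show ?thesis by (auto simp: l_def)
qed

lemma diag_positive:
  assumes f: "orthonormal f I" and m: "bounded_on I (\<lambda>i. complex_of_real (m i))" "\<And>i. i \<in> I \<Longrightarrow> 0 \<le> m i"
  shows "positive_op (diag f I (\<lambda>i. complex_of_real (m i)))"
proof (rule positive_opI)
  show "adjoint_pair (diag f I (\<lambda>i. complex_of_real (m i))) (diag f I (\<lambda>i. complex_of_real (m i)))"
    using diag_adjoint[OF f m(1)] by simp
  fix g
  have "((\<lambda>i. Re (complex_of_real (m i) * cinner g (f i) * cinner (f i) g)) has_sum
      Re (cinner (diag f I (\<lambda>i. complex_of_real (m i)) g) g)) I"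
    by (rule has_sum_bounded_linear[OF bounded_linear_Re diag_cinner_has_sum[OF f m(1)], unfolded o_def])
  then show "0 \<le> Re (cinner (diag f I (\<lambda>i. complex_of_real (m i)) g) g)"
    by (rule has_sum_nonneg) (simp add: m(2) mult.assoc cinner_mult_cnj del: of_real_power)
qed

text \<open>Take a maximal orthonormal set of eigenvectors and compress T to its orthogonal
  complement. The compression R is again positive and compact; if it were not 0, its top eigenvector
  would be a further eigenvector of T orthogonal to the set.\<close>

theorem compact_spectral:
  assumes T: "positive_op T" and c: "compact_op T"
  obtains B l where "orthonormal_basis B" "\<And>b. 0 \<le> l b" "\<And>b. l b \<le> norm T"
    "T = diag (\<lambda>x. x) B (\<lambda>b. complex_of_real (l b))"
proof -
  define S where "S = {v. \<exists>c. blinfun_apply T v = c *\<^sub>C v}"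
  obtain B where B: "B \<subseteq> S" "orthonormal (\<lambda>x. x) B" "\<And>v. v \<in> S \<Longrightarrow> norm v = 1 \<Longrightarrow> \<exists>e\<in>B. cinner v e \<noteq> 0"
    using orthonormal_extend[of "{}" S] by (auto simp: orthonormal_def)
  define Q where "Q = diag (\<lambda>x. x) B (\<lambda>b. 1)"
  have one: "bounded_on B (\<lambda>b. 1)" by (rule bounded_onI[of _ _ 1]) auto
  define P where "P = id_blinfun - Q"
  have Qs: "adjoint_pair Q Q" using diag_adjoint[OF B(2) one] by (simp add: Q_def)
  have Ps: "adjoint_pair P P" unfolding P_def by (intro adjoint_pair_diff adjoint_pair_id Qs)
  have Pf: "cinner (P f) b = 0" if "b \<in> B" for f b
    using that by (simp add: P_def Q_def blinfun.diff_left cinner_diff_left diag_coeff[OF B(2) one])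
  have Pid: "P f = f" if "\<And>b. b \<in> B \<Longrightarrow> cinner f b = 0" for f
  proof -
    have "Q f = 0" unfolding Q_def by (rule diag_zero[OF B(2) one]) (simp add: that)
    then show ?thesis by (simp add: P_def blinfun.diff_left)
  qed
  have Tinv: "cinner (T f) b = 0" if "b \<in> B" "\<And>b. b \<in> B \<Longrightarrow> cinner f b = 0" for f b
  proof -
    have "b \<in> S" using B(1) that(1) by blast
    then obtain c where "T b = c *\<^sub>C b" by (auto simp: S_def)
    then show ?thesis using that by (simp add: adjoint_pairD[OF positive_opD(2)[OF T]] cinner_scaleC_right)
  qed
  define R where "R = P o\<^sub>L T o\<^sub>L P"
  have R: "positive_op R" unfolding R_def by (rule positive_op_conj[OF T Ps])
  have "compact_op R" unfolding R_def by (intro compact_op_comp_left compact_op_comp_right c)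
  have "R = 0"
  proof (rule ccontr)
    assume "R \<noteq> 0"
    with R \<open>compact_op R\<close> obtain v where v: "norm v = 1" "R v = norm R *\<^sub>R v"
      using compact_op_eigenvector by blast
    have vB: "cinner v b = 0" if "b \<in> B" for b
    proof -
      have "cinner (R v) b = 0" using Pf[OF that] by (simp add: R_def)
      then show ?thesis using \<open>R \<noteq> 0\<close> by (simp add: v scaleR_scaleC cinner_scaleC_left)
    qed
    have "R v = T v" unfolding R_def by (simp add: Pid vB Tinv)
    then have "T v = complex_of_real (norm R) *\<^sub>C v" using v by (simp add: scaleR_scaleC)
    then have "v \<in> S" unfolding S_def by blast
    then show False using B(3) v vB by blast
  qed
  have onb: "orthonormal_basis B"
    unfolding orthonormal_basis_iff
  proof (intro conjI allI impI B)
    fix f assume f: "\<forall>b\<in>B. cinner f b = 0"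
    have "T f = R f" using f by (simp add: R_def Pid Tinv)
    then have Tf: "T f = 0" using \<open>R = 0\<close> by simp
    show "f = 0"
    proof (rule ccontr)
      assume "f \<noteq> 0"
      then have "norm ((1 / norm f) *\<^sub>R f) = 1" by simp
      \<comment> \<open>Kernel vectors are eigenvectors for the eigenvalue 0, so maximality excludes
        them from the complement as well.\<close>
      moreover have "(1 / norm f) *\<^sub>R f \<in> S" using Tf by (auto simp: S_def blinfun.scaleR_right intro: exI[of _ 0])
      ultimately show False using B(3) f by (metis cinner_scaleC_left mult_zero_right scaleR_scaleC)
    qed
  qed
  define l where "l b = (if b \<in> B then Re (cinner (T b) b) else 0)" for b
  have l0: "0 \<le> l b" for b using positive_opD(3)[OF T] by (simp add: l_def)
  have l1: "l b \<le> norm T" for b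
  proof (cases "b \<in> B")
    case True
    then have "norm b = 1" using orthonormal_norm[OF B(2)] by simp
    then have "norm (cinner (T b) b) \<le> norm T"
      using norm_cinner_le[of "T b" b] norm_blinfun[of T b] by simp
    then show ?thesis using complex_Re_le_cmod[of "cinner (T b) b"] True by (simp add: l_def)
  qed (simp add: l_def)
  have "T = diag (\<lambda>x. x) B (\<lambda>b. complex_of_real (l b))"
  proof (rule diag_basis_unique[OF onb])
    show "bounded_on B (\<lambda>b. complex_of_real (l b))"
      by (rule bounded_onI[of _ _ "norm T"]) (simp add: l0 l1)
    fix b assume b: "b \<in> B"
    then have "b \<in> S" using B(1) by blast
    then obtain c where c: "T b = c *\<^sub>C b" by (auto simp: S_def)
    have "cinner (T b) b = c" using orthonormalD[OF B(2) b b] by (simp add: c cinner_scaleC_left)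
    then have "c = complex_of_real (l b)" using positive_op_cinner[OF T, of b] b by (simp add: l_def)
    then show "T b = complex_of_real (l b) *\<^sub>C b" using c by simp
  qed (use T positive_opD in auto)
  with onb l0 l1 show ?thesis using that by blast
qed

section \<open>Spectral resolutions\<close>

lemma strong_convergence_basis:
  assumes B: "orthonormal_basis B" and T: "\<And>n. norm (T n) \<le> C" "\<And>n. T n \<in> BL2" "S \<in> BL2"
    and conv: "\<And>b. b \<in> B \<Longrightarrow> (\<lambda>n. blinfun_apply (T n) b) \<longlonglongrightarrow> blinfun_apply S b"
  shows "(\<lambda>n. blinfun_apply (T n) g) \<longlonglongrightarrow> S g"
proof (rule LIMSEQ_I)
  fix e :: real assume e: "e > 0"
  define D where "D = C + norm S + 1"
  have D: "D > 0" using T(1)[of 0] norm_ge_zero[of "T 0"] norm_ge_zero[of S] unfolding D_def by linarith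
  obtain F where F: "finite F" "F \<subseteq> B" "dist (\<Sum>b\<in>F. cinner g b *\<^sub>C b) g < e / (2 * D)"
  proof -
    have "((\<lambda>F. \<Sum>b\<in>F. cinner g b *\<^sub>C b) \<longlongrightarrow> g) (finite_subsets_at_top B)"
      using basis_has_sum[OF B, of g] by (simp add: has_sum_def)
    then have "\<forall>\<^sub>F F in finite_subsets_at_top B. dist (\<Sum>b\<in>F. cinner g b *\<^sub>C b) g < e / (2 * D)"
      by (rule tendstoD) (use e D in simp)
    then show ?thesis using that by (auto simp: eventually_finite_subsets_at_top)
  qed
  define h where "h = (\<Sum>b\<in>F. cinner g b *\<^sub>C b)"
  have "(\<lambda>n. \<Sum>b\<in>F. cinner g b *\<^sub>C T n b) \<longlonglongrightarrow> (\<Sum>b\<in>F. cinner g b *\<^sub>C S b)"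
    using F(2) by (intro tendsto_sum bounded_linear.tendsto[OF bounded_linear_scaleC] conv) auto
  then have "(\<lambda>n. T n h) \<longlonglongrightarrow> S h"
    by (simp add: h_def blinfun.sum_right BL2_scaleC[OF T(2)] BL2_scaleC[OF T(3)])
  then obtain N where N: "\<And>n. n \<ge> N \<Longrightarrow> norm (T n h - S h) < e / 2"
    using LIMSEQ_D[of _ _ "e/2"] e by (metis half_gt_zero)
  show "\<exists>no. \<forall>n\<ge>no. norm (T n g - S g) < e"
  proof (intro exI allI impI)
    fix n assume n: "n \<ge> N"
    have "norm ((T n - S) (g - h)) \<le> norm (T n - S) * norm (g - h)" by (rule norm_blinfun)
    also have "\<dots> \<le> D * norm (g - h)"
      using T(1)[of n] norm_triangle_ineq4[of "T n" S] by (intro mult_right_mono) (auto simp: D_def)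
    also have "\<dots> \<le> D * (e / (2 * D))"
      using F(3) D by (intro mult_left_mono) (auto simp: h_def dist_norm norm_minus_commute)
    also have "\<dots> = e / 2" using D by simp
    finally have "norm ((T n - S) (g - h)) \<le> e / 2" .
    moreover have "T n g - S g = (T n - S) (g - h) + (T n h - S h)"
      by (simp add: blinfun.diff_left blinfun.diff_right)
    ultimately show "norm (T n g - S g) < e"
      using N[OF n] norm_triangle_ineq[of "(T n - S) (g - h)" "T n h - S h"] by simp
  qed
qed

definition projection_measure :: "(real set \<Rightarrow> op) \<Rightarrow> bool"
  where "projection_measure E \<longleftrightarrow> (\<forall>X\<in>sets borel. projection_op (E X)) \<and>
    (\<forall>X. range X \<subseteq> sets borel \<longrightarrow> disjoint_family X \<longrightarrow> strong_sums (\<lambda>n. E (X n)) (E (\<Union>n. X n)))"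

lemma projection_op_adjoint: "projection_op P \<Longrightarrow> adjoint_pair P P"
  using adjoint_pair_adj[of P] by (simp add: projection_op_def)

lemma projection_op_cinner: "projection_op P \<Longrightarrow> cinner (P f) f = complex_of_real ((norm (P f))\<^sup>2)"
  unfolding cinner_self[symmetric]
  by (metis adjoint_pairD blinfun_apply_blinfun_compose projection_op_adjoint projection_op_def)

lemma projection_op_norm_le: "projection_op P \<Longrightarrow> norm (blinfun_apply P f) \<le> norm f"
proof -
  assume P: "projection_op P"
  have "(norm (P f))\<^sup>2 = norm (cinner (P f) f)" unfolding projection_op_cinner[OF P] norm_of_real by simp
  also have "\<dots> \<le> norm (P f) * norm f" by (rule norm_cinner_le)
  finally show ?thesis by (cases "norm (P f) = 0") (auto simp: power2_eq_square)
qed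

section \<open>Calculus of projection-valued measures\<close>

context
  fixes E assumes E: "projection_measure E"
begin

lemma pm_proj: "X \<in> sets borel \<Longrightarrow> projection_op (E X)"
  using E by (simp add: projection_measure_def)

lemma pm_sums: "range X \<subseteq> sets borel \<Longrightarrow> disjoint_family X \<Longrightarrow> (\<lambda>n. blinfun_apply (E (X n)) f) sums E (\<Union>n. X n) f"
  using E by (auto simp: projection_measure_def strong_sums_def)

lemma pm_empty: "E {} = 0"
proof (rule op_eqI)
  fix f
  have "(\<lambda>n::nat. E {} f) sums E {} f"
    using pm_sums[of "\<lambda>_. {}" f] by (auto simp: disjoint_family_on_def)
  then have "summable (\<lambda>n::nat. E {} f)" by (rule sums_summable)
  then show "blinfun_apply (E {}) f = blinfun_apply 0 f"
    using summable_LIMSEQ_zero[of "\<lambda>n::nat. E {} f"] by (simp add: LIMSEQ_const_iff)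
qed

lemma pm_Un:
  assumes "X \<in> sets borel" "Y \<in> sets borel" "X \<inter> Y = {}"
  shows "E (X \<union> Y) f = E X f + E Y f"
proof -
  define Z where "Z = (\<lambda>n::nat. if n = 0 then X else if n = 1 then Y else {})"
  have "(\<lambda>n. E (Z n) f) sums E (\<Union>n. Z n) f"
    using assms by (intro pm_sums) (auto simp: Z_def disjoint_family_on_def)
  moreover have "(\<Union>n. Z n) = X \<union> Y" by (auto simp: Z_def split: if_splits)
  moreover have "(\<lambda>n. E (Z n) f) sums (\<Sum>n\<in>{0,1}. E (Z n) f)"
    by (rule sums_finite) (auto simp: Z_def pm_empty)
  ultimately have "E (X \<union> Y) f = (\<Sum>n\<in>{0,1}. E (Z n) f)" using sums_unique2 by metis
  then show ?thesis by (simp add: Z_def)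
qed

text \<open>Multiplicativity is not among the defining clauses and is derived here. For g in the
  range of E Y, additivity gives |E(X u Y) g|^2 = |E X g|^2 + |g|^2, while a projection cannot
  increase the norm.\<close>

lemma pm_disjoint:
  assumes X: "X \<in> sets borel" and Y: "Y \<in> sets borel" and XY: "X \<inter> Y = {}"
  shows "E X (E Y f) = 0"
proof -
  define g where "g = E Y f"
  have Yg: "E Y g = g"
    using pm_proj[OF Y] unfolding g_def projection_op_def by (metis blinfun_apply_blinfun_compose)
  have "(norm (E (X \<union> Y) g))\<^sup>2 = Re (cinner (E (X \<union> Y) g) g)"
    using projection_op_cinner[OF pm_proj, of "X \<union> Y" g] X Y by simp
  also have "\<dots> = (norm (E X g))\<^sup>2 + (norm g)\<^sup>2"
    unfolding pm_Un[OF assms] Yg using projection_op_cinner[OF pm_proj[OF X], of g]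
    by (simp add: cinner_add_left norm_sq_cinner)
  finally have "(norm (E X g))\<^sup>2 + (norm g)\<^sup>2 \<le> (norm g)\<^sup>2"
    using projection_op_norm_le[OF pm_proj, of "X \<union> Y" g] X Y by (metis norm_ge_zero power_mono sets.Un)
  then show ?thesis by (simp add: g_def)
qed

lemma pm_Int:
  assumes X: "X \<in> sets borel" and Y: "Y \<in> sets borel"
  shows "E X (E Y f) = E (X \<inter> Y) f"
proof -
  have XY: "X \<inter> Y \<in> sets borel" "X - Y \<in> sets borel" "Y - X \<in> sets borel" using X Y by auto
  have Yf: "E Y f = E (X \<inter> Y) f + E (Y - X) f"
    using pm_Un[OF XY(1,3), of f] by (simp add: Int_Diff_disjoint Un_commute inf_commute Diff_Int_distrib Int_Diff_Un)
       (metis Int_Diff_Un Int_Diff_disjoint inf_commute pm_Un XY(1,3))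
  have Xg: "E X g = E (X \<inter> Y) g + E (X - Y) g" for g
    by (metis Int_Diff_Un Int_Diff_disjoint pm_Un XY(1,2))
  have "E X (E (X \<inter> Y) f) = E (X \<inter> Y) (E (X \<inter> Y) f)"
    unfolding Xg using pm_disjoint[OF XY(2,1), of f] by auto
  also have "\<dots> = E (X \<inter> Y) f"
    using pm_proj[OF XY(1)] unfolding projection_op_def by (metis blinfun_apply_blinfun_compose)
  finally show ?thesis
    unfolding Yf blinfun.add_right using pm_disjoint[OF X XY(3), of f] by simp
qed

lemma sets_spectral_distribution [simp]: "sets (spectral_distribution E f) = sets borel"
  "space (spectral_distribution E f) = UNIV"
  using sets.sigma_sets_eq[of borel]
  by (auto simp: spectral_distribution_def sets_measure_of_conv space_measure_of_conv)

lemma emeasure_spectral_distribution: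
  assumes "X \<in> sets borel"
  shows "emeasure (spectral_distribution E f) X = ennreal ((norm (E X f))\<^sup>2)"
proof -
  have q: "ennreal (Re (cinner (E Y f) f)) = ennreal ((norm (E Y f))\<^sup>2)" if "Y \<in> sets borel" for Y
    using projection_op_cinner[OF pm_proj[OF that]] by simp
  have "emeasure (spectral_distribution E f) X = ennreal (Re (cinner (E X f) f))"
    unfolding spectral_distribution_def
  proof (rule emeasure_measure_of_sigma)
    show "sigma_algebra UNIV (sets borel)" using sets.sigma_algebra_axioms[of borel] by simp
    show "positive (sets borel) (\<lambda>X. ennreal (Re (cinner (E X f) f)))"
      by (simp add: positive_def pm_empty)
    show "countably_additive (sets borel) (\<lambda>X. ennreal (Re (cinner (E X f) f)))"
      unfolding countably_additive_def
    proof (intro allI impI)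
      fix A :: "nat \<Rightarrow> real set" assume A: "range A \<subseteq> sets borel" "disjoint_family A"
      have "(\<lambda>n. cinner (E (A n) f) f) sums cinner (E (\<Union>n. A n) f) f"
        by (rule bounded_linear.sums[OF bounded_linear_cinner_left pm_sums[OF A]])
      then have "(\<lambda>n. Re (cinner (E (A n) f) f)) sums Re (cinner (E (\<Union>n. A n) f) f)"
        by (rule bounded_linear.sums[OF bounded_linear_Re])
      moreover have "0 \<le> Re (cinner (E (A n) f) f)" for n
        using projection_op_cinner[OF pm_proj, of "A n" f] A by auto
      ultimately show "(\<Sum>i. ennreal (Re (cinner (E (A i) f) f))) = ennreal (Re (cinner (E (\<Union> (range A)) f) f))"
        by (intro suminf_ennreal_eq) auto
    qed
  qed fact
  then show ?thesis by (simp add: q assms)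
qed

lemma finite_spectral_distribution: "finite_measure (spectral_distribution E f)"
  by (rule finite_measureI) (simp add: emeasure_spectral_distribution)

end

lemma spectral_resolution_pm: "spectral_resolution T E \<Longrightarrow> projection_measure E"
  by (auto simp: spectral_resolution_def projection_measure_def)

lemma bounded_of_bool: "bounded_on B (\<lambda>b. complex_of_real (of_bool (P b)))"
  by (rule bounded_onI[of _ _ 1]) auto

lemma abs_op_positive: "positive_op T \<Longrightarrow> abs_op T = T"
  unfolding abs_op_def by (rule sqrt_op_eqI) (simp_all add: positive_op_adj)

text \<open>Bridge between the unordered sums of diagonal operators and integrals over counting
  measure, through which spectral distributions are computed.\<close>

lemma count_space_has_sum:
  fixes f :: "'a \<Rightarrow> real"
  assumes f: "\<And>b. b \<in> B \<Longrightarrow> 0 \<le> f b" and s: "(f has_sum s) B"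
  shows "integrable (count_space B) f" "integral\<^sup>L (count_space B) f = s"
    "(\<integral>\<^sup>+b. ennreal (f b) \<partial>count_space B) = ennreal s"
proof -
  have "(\<lambda>b. norm (f b)) summable_on B"
    using s f by (subst summable_on_cong[of B _ f]) (auto simp: summable_on_def)
  then have a: "Infinite_Set_Sum.abs_summable_on f B" using abs_summable_equivalent[of f B] by blast
  show i: "integrable (count_space B) f" using a by (simp add: Infinite_Set_Sum.abs_summable_on_def)
  show I: "integral\<^sup>L (count_space B) f = s"
    using infsetsum_infsum[OF a] infsumI[OF s] by (simp add: infsetsum_def)
  show "(\<integral>\<^sup>+b. ennreal (f b) \<partial>count_space B) = ennreal s"
    unfolding I[symmetric] by (rule nn_integral_eq_integral[OF i]) (auto simp: f AE_count_space)
qed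

section \<open>The spectral resolution of a positive diagonal operator\<close>

context
  fixes B :: "L2 set" and l :: "L2 \<Rightarrow> real" and C :: real
  assumes B: "orthonormal_basis B" and l: "\<And>b. b \<in> B \<Longrightarrow> 0 \<le> l b" "\<And>b. b \<in> B \<Longrightarrow> l b \<le> C"
begin

lemma diag_l_bounded: "bounded_on B (\<lambda>b. complex_of_real (l b))"
  using l by (intro bounded_onI[of _ _ C]) auto

lemma diag_l_positive: "positive_op (diag (\<lambda>x. x) B (\<lambda>b. complex_of_real (l b)))"
  by (rule diag_positive[OF orthonormal_basis_orthonormal[OF B] diag_l_bounded l(1)])

definition diag_resolution :: "real set \<Rightarrow> op"
  where "diag_resolution X = diag (\<lambda>x. x) B (\<lambda>b. complex_of_real (of_bool (l b \<in> X)))"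

lemma diag_resolution_projection: "projection_op (diag_resolution X)"
  unfolding projection_op_def
proof (intro conjI)
  note on = orthonormal_basis_orthonormal[OF B]
  have eq: "(\<lambda>b. complex_of_real (of_bool (l b \<in> X)) * complex_of_real (of_bool (l b \<in> X)))
    = (\<lambda>b. complex_of_real (of_bool (l b \<in> X)))" by (rule ext) simp
  show "diag_resolution X \<in> BL2" unfolding diag_resolution_def by (rule diag_BL2[OF on bounded_of_bool])
  show "diag_resolution X o\<^sub>L diag_resolution X = diag_resolution X"
    unfolding diag_resolution_def diag_comp[OF on bounded_of_bool bounded_of_bool] eq ..
  show "adj (diag_resolution X) = diag_resolution X"
    unfolding diag_resolution_def
    using diag_adjoint[OF on bounded_of_bool, of "\<lambda>b. l b \<in> X"] by (intro adj_eqI) (simp only: complex_cnj_complex_of_real)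
qed

lemma diag_resolution_basis: "b \<in> B \<Longrightarrow> diag_resolution X b = (if l b \<in> X then b else 0)"
  unfolding diag_resolution_def
  by (subst diag_eigen[OF orthonormal_basis_orthonormal[OF B] bounded_of_bool]) auto

lemma diag_resolution_norm_has_sum:
  "((\<lambda>b. of_bool (l b \<in> X) * (norm (cinner f b))\<^sup>2) has_sum (norm (diag_resolution X f))\<^sup>2) B"
proof -
  have "((\<lambda>b. Re (complex_of_real (of_bool (l b \<in> X)) * cinner f b * cinner b f)) has_sum
      Re (cinner (diag_resolution X f) f)) B"
    unfolding diag_resolution_def
    by (rule has_sum_bounded_linear[OF bounded_linear_Re
          diag_cinner_has_sum[OF orthonormal_basis_orthonormal[OF B] bounded_of_bool], unfolded o_def])
  then show ?thesis
    unfolding projection_op_cinner[OF diag_resolution_projection] mult.assoc cinner_mult_cnj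
    by (simp only: of_real_mult[symmetric] Re_complex_of_real)
qed

lemma diag_resolution_pm: "projection_measure diag_resolution"
  unfolding projection_measure_def
proof (intro conjI ballI allI impI diag_resolution_projection)
  fix X :: "nat \<Rightarrow> real set" assume X: "range X \<subseteq> sets borel" "disjoint_family X"
  have fin: "(\<Sum>n<N. diag_resolution (X n)) = diag_resolution (\<Union>n<N. X n)" for N
  proof (rule op_eq_basisI[OF B])
    fix b assume b: "b \<in> B"
    have "(\<Sum>n<N. diag_resolution (X n)) b = (\<Sum>n<N. if l b \<in> X n then b else 0)"
      by (simp add: blinfun.sum_left diag_resolution_basis b)
    also have "\<dots> = (if l b \<in> (\<Union>n<N. X n) then b else 0)"
    proof (cases "l b \<in> (\<Union>n<N. X n)")
      case True
      then obtain k where k: "k < N" "l b \<in> X k" by auto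
      then have "l b \<in> X n \<longleftrightarrow> n = k" for n using X(2) by (auto simp: disjoint_family_on_def)
      then show ?thesis using k by (auto simp: sum.delta)
    qed auto
    also have "\<dots> = diag_resolution (\<Union>n<N. X n) b" by (simp only: diag_resolution_basis b if_True)
    finally show "(\<Sum>n<N. diag_resolution (X n)) b = diag_resolution (\<Union>n<N. X n) b" .
  qed (use diag_resolution_projection in \<open>auto simp: projection_op_def\<close>)
  show "strong_sums (\<lambda>n. diag_resolution (X n)) (diag_resolution (\<Union>n. X n))"
    unfolding strong_sums_def sums_def
  proof
    fix f
    have "(\<lambda>N. blinfun_apply (diag_resolution (\<Union>n<N. X n)) f) \<longlonglongrightarrow> diag_resolution (\<Union>n. X n) f"
    proof (rule strong_convergence_basis[OF B])
      show "norm (diag_resolution (\<Union>n<N. X n)) \<le> 1" for N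
        by (rule norm_blinfun_bound) (auto simp: projection_op_norm_le diag_resolution_projection)
      show "diag_resolution (\<Union>n<N. X n) \<in> BL2" "diag_resolution (\<Union>n. X n) \<in> BL2" for N
        using diag_resolution_projection by (auto simp: projection_op_def)
      fix b assume b: "b \<in> B"
      show "(\<lambda>N. blinfun_apply (diag_resolution (\<Union>n<N. X n)) b) \<longlonglongrightarrow> diag_resolution (\<Union>n. X n) b"
      proof (cases "l b \<in> (\<Union>n. X n)")
        case True
        then obtain k where k: "l b \<in> X k" by auto
        have "\<forall>\<^sub>F N in sequentially. diag_resolution (\<Union>n<N. X n) b = b"
          using eventually_gt_at_top[of k] by eventually_elim (use k b in \<open>auto simp: diag_resolution_basis\<close>)
        then show ?thesis using True b by (simp add: diag_resolution_basis tendsto_eventually)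
      next
        case False
        then show ?thesis using b by (simp add: diag_resolution_basis)
      qed
    qed
    then show "(\<lambda>N. \<Sum>n<N. blinfun_apply (diag_resolution (X n)) f) \<longlonglongrightarrow> diag_resolution (\<Union>n. X n) f"
      by (simp add: blinfun.sum_left[symmetric] fin)
  qed
qed

text \<open>A point mass |<f, b>|^2 sits at each eigenvalue \<open>l b\<close>. Written as an image
  measure, its first moment becomes a sum over the basis, namely the quadratic form of the
  operator.\<close>

lemma diag_spectral_distribution:
  "spectral_distribution diag_resolution f =
    distr (density (count_space B) (\<lambda>b. ennreal ((norm (cinner f b))\<^sup>2))) borel l" (is "?M = ?N")
proof (rule measure_eqI)
  show "sets ?M = sets ?N" by (simp add: sets_spectral_distribution[OF diag_resolution_pm])
  fix X assume "X \<in> sets ?M"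
  then have X: "X \<in> sets borel" by (simp add: sets_spectral_distribution[OF diag_resolution_pm])
  have "emeasure ?N X = emeasure (density (count_space B) (\<lambda>b. ennreal ((norm (cinner f b))\<^sup>2))) (l -` X \<inter> B)"
    by (subst emeasure_distr) (auto simp: X)
  also have "\<dots> = (\<integral>\<^sup>+b. ennreal ((norm (cinner f b))\<^sup>2) * indicator (l -` X \<inter> B) b \<partial>count_space B)"
    by (rule emeasure_density) auto
  also have "\<dots> = (\<integral>\<^sup>+b. ennreal (of_bool (l b \<in> X) * (norm (cinner f b))\<^sup>2) \<partial>count_space B)"
    by (rule nn_integral_cong) (auto simp: indicator_def)
  also have "\<dots> = ennreal ((norm (diag_resolution X f))\<^sup>2)"
    by (rule count_space_has_sum(3)[OF _ diag_resolution_norm_has_sum]) auto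
  finally show "emeasure ?M X = emeasure ?N X"
    by (simp add: emeasure_spectral_distribution[OF diag_resolution_pm X])
qed

lemma diag_resolution_spectral:
  "spectral_resolution (diag (\<lambda>x. x) B (\<lambda>b. complex_of_real (l b))) diag_resolution"
  unfolding spectral_resolution_def
proof (intro conjI allI)
  show "\<forall>X\<in>sets borel. projection_op (diag_resolution X)" by (simp add: diag_resolution_projection)
  show "diag_resolution UNIV = id_blinfun" unfolding diag_resolution_def using diag_one[OF B] by simp
  show "range X \<subseteq> sets borel \<longrightarrow> disjoint_family X \<longrightarrow>
    strong_sums (\<lambda>n. diag_resolution (X n)) (diag_resolution (\<Union>n. X n))" for X
    using diag_resolution_pm by (auto simp: projection_measure_def)
  fix f
  have "((\<lambda>b. Re (complex_of_real (l b) * cinner f b * cinner b f)) has_sum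
      Re (cinner (diag (\<lambda>x. x) B (\<lambda>b. complex_of_real (l b)) f) f)) B"
    by (rule has_sum_bounded_linear[OF bounded_linear_Re
          diag_cinner_has_sum[OF orthonormal_basis_orthonormal[OF B] diag_l_bounded], unfolded o_def])
  then have hs: "((\<lambda>b. (norm (cinner f b))\<^sup>2 *\<^sub>R l b) has_sum
      Re (cinner (diag (\<lambda>x. x) B (\<lambda>b. complex_of_real (l b)) f) f)) B"
    unfolding mult.assoc cinner_mult_cnj by (simp only: of_real_mult[symmetric] Re_complex_of_real) (simp add: mult.commute)
  have nn: "0 \<le> (norm (cinner f b))\<^sup>2 *\<^sub>R l b" if "b \<in> B" for b using l that by simp
  note cs = count_space_has_sum[OF nn hs]
  have lm: "l \<in> borel_measurable (density (count_space B) (\<lambda>b. ennreal ((norm (cinner f b))\<^sup>2)))" by simp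
  show "integrable (spectral_distribution diag_resolution f) (\<lambda>s. s)"
    unfolding diag_spectral_distribution
    by (subst integrable_distr_eq[OF lm]) (simp_all add: integrable_density cs(1)[simplified])
  have "integral\<^sup>L (spectral_distribution diag_resolution f) (\<lambda>s. s)
      = Re (cinner (diag (\<lambda>x. x) B (\<lambda>b. complex_of_real (l b)) f) f)"
    unfolding diag_spectral_distribution
    by (subst integral_distr[OF lm]) (simp_all add: integral_density cs(2)[simplified])
  then show "cinner (diag (\<lambda>x. x) B (\<lambda>b. complex_of_real (l b)) f) f =
      complex_of_real (integral\<^sup>L (spectral_distribution diag_resolution f) (\<lambda>s. s))"
    using positive_op_cinner[OF diag_l_positive] by simp
qed

end

section \<open>Rigidity: an arbitrary spectral resolution evaluated on eigenvectors\<close>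

context
  fixes T :: op and F :: "real set \<Rightarrow> op"
  assumes T: "positive_op T" and R: "spectral_resolution T F"
begin

lemmas rpm = spectral_resolution_pm[OF R]

lemma resolution_UNIV: "F UNIV f = f"
  using R by (simp add: spectral_resolution_def)

lemma resolution_quadratic:
  "integrable (spectral_distribution F f) (\<lambda>s. s)"
  "cinner (T f) f = complex_of_real (integral\<^sup>L (spectral_distribution F f) (\<lambda>s. s))"
  using R by (auto simp: spectral_resolution_def)

text \<open>By multiplicativity the spectral distribution of F Y w is that of w restricted to Y, so
  the quadratic form becomes an integral over Y.\<close>

lemma resolution_restrict:
  assumes Y: "Y \<in> sets borel"
  shows "Re (cinner (T (F Y w)) (F Y w)) = (\<integral>s. indicator Y s *\<^sub>R s \<partial>spectral_distribution F w)"
proof -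
  have "spectral_distribution F (F Y w) = density (spectral_distribution F w) (\<lambda>s. ennreal (indicator Y s))" (is "?M = ?N")
  proof (rule measure_eqI)
    show "sets ?M = sets ?N" by (simp add: sets_spectral_distribution[OF rpm])
    fix X assume "X \<in> sets ?M"
    then have X: "X \<in> sets borel" by (simp add: sets_spectral_distribution[OF rpm])
    have [measurable]: "Y \<in> sets (spectral_distribution F w)" "X \<in> sets (spectral_distribution F w)"
      using X Y by (simp_all add: sets_spectral_distribution[OF rpm])
    have "emeasure ?N X = (\<integral>\<^sup>+s. ennreal (indicator Y s) * indicator X s \<partial>spectral_distribution F w)"
      by (rule emeasure_density) (rule measurable_compose[OF borel_measurable_indicator measurable_ennreal], fact+)
    also have "\<dots> = (\<integral>\<^sup>+s. indicator (X \<inter> Y) s \<partial>spectral_distribution F w)"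
      by (rule nn_integral_cong) (auto simp: indicator_def)
    also have "\<dots> = emeasure (spectral_distribution F w) (X \<inter> Y)" by (rule nn_integral_indicator) measurable
    also have "\<dots> = emeasure ?M X"
      using X Y by (simp add: emeasure_spectral_distribution[OF rpm] pm_Int[OF rpm])
    finally show "emeasure ?M X = emeasure ?N X" by simp
  qed
  moreover have "Y \<in> sets (spectral_distribution F w)" "(\<lambda>s. s) \<in> borel_measurable (spectral_distribution F w)"
    using Y by (auto simp: sets_spectral_distribution[OF rpm] measurable_def)
  ultimately show ?thesis
    unfolding resolution_quadratic by (simp add: integral_density)
qed

text \<open>A resolution is tied to T through quadratic forms only. For w = u + v the integrals over
  Y and its complement add up to <T w, w>, so the mixed terms, which are twice the real part of <T
  u, v>, must vanish. Replacing v by i v in \<open>resolution_cross\<close> removes the imaginary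
  part.\<close>

lemma resolution_cross_Re:
  assumes Y: "Y \<in> sets borel" and u: "F Y u = u" and v: "F (- Y) v = v"
  shows "Re (cinner (T u) v) = 0"
proof -
  define w where "w = u + v"
  have Y': "- Y \<in> sets borel" using Y by auto
  have "F Y v = 0" using pm_disjoint[OF rpm Y Y', of v] v by simp
  then have uw: "F Y w = u" by (simp add: w_def blinfun.add_right u)
  have "F (- Y) u = 0" using pm_disjoint[OF rpm Y' Y, of u] u by simp
  then have vw: "F (- Y) w = v" by (simp add: w_def blinfun.add_right v)
  define M where "M = spectral_distribution F w"
  have iM: "integrable M (\<lambda>s. s)" unfolding M_def by (rule resolution_quadratic)
  have YM: "Y \<in> sets M" "- Y \<in> sets M" using Y by (auto simp: M_def sets_spectral_distribution[OF rpm])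
  have "Re (cinner (T u) u) + Re (cinner (T v) v) = (\<integral>s. indicator Y s *\<^sub>R s \<partial>M) + (\<integral>s. indicator (- Y) s *\<^sub>R s \<partial>M)"
    using resolution_restrict[OF Y, of w] resolution_restrict[OF Y', of w] by (simp add: uw vw M_def)
  also have "\<dots> = (\<integral>s. indicator Y s *\<^sub>R s + indicator (- Y) s *\<^sub>R s \<partial>M)"
    by (intro Bochner_Integration.integral_add[symmetric] integrable_mult_indicator YM iM)
  also have "\<dots> = (\<integral>s. s \<partial>M)" by (rule Bochner_Integration.integral_cong) (auto simp: indicator_def)
  also have "\<dots> = Re (cinner (T w) w)" by (simp add: resolution_quadratic M_def)
  also have "cinner (T w) w = cinner (T u) u + cinner (T v) v + cinner (T u) v + cinner (T v) u"
    by (simp add: w_def blinfun.add_right cinner_add_left cinner_add_right)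
  also have "cinner (T v) u = cnj (cinner (T u) v)"
    by (simp add: adjoint_pairD[OF positive_opD(2)[OF T]] cinner_commute[symmetric])
  finally show ?thesis by simp
qed

lemma resolution_cross:
  assumes Y: "Y \<in> sets borel" and u: "F Y u = u" and v: "F (- Y) v = v"
  shows "cinner (T u) v = 0"
proof -
  have "F (- Y) \<in> BL2" using pm_proj[OF rpm, of "- Y"] Y by (auto simp: projection_op_def)
  then have "F (- Y) (\<i> *\<^sub>C v) = \<i> *\<^sub>C v" by (simp add: BL2_scaleC v)
  then have "Re (cinner (T u) (\<i> *\<^sub>C v)) = 0" by (rule resolution_cross_Re[OF Y u])
  then show ?thesis using resolution_cross_Re[OF assms] by (simp add: cinner_scaleC_right complex_eq_iff)
qed

lemma resolution_idem: "Y \<in> sets borel \<Longrightarrow> F Y (F Y f) = F Y f"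
  using pm_Int[OF rpm, of Y Y f] by simp

context
  fixes b :: L2 and lam :: real
  assumes b: "blinfun_apply T b = complex_of_real lam *\<^sub>C b"
begin

text \<open>Since F Y reduces T, the component u = F Y b satisfies <T u, u> = lam |u|^2. Its
  spectral distribution lives on Y, strictly on one side of lam, yet has barycentre lam; so it has
  mass 0. The sign \<open>\<sigma>\<close> treats both sides at once.\<close>

lemma resolution_eigen_side:
  assumes Y: "Y \<in> sets borel" and side: "\<And>s. s \<in> Y \<Longrightarrow> 0 < \<sigma> * (s - lam)"
  shows "F Y b = 0"
proof -
  have Y': "- Y \<in> sets borel" using Y by auto
  define u v where "u = F Y b" and "v = F (- Y) b"
  have buv: "b = u + v"
    using pm_Un[OF rpm Y Y', of b] by (simp add: u_def v_def resolution_UNIV)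
  have uu: "F Y u = u" "F (- Y) v = v" by (simp_all add: u_def v_def resolution_idem Y Y')
  have vu: "cinner v u = 0"
  proof -
    have "cinner v u = cinner b (F (- Y) u)"
      unfolding v_def using adjoint_pairD[OF projection_op_adjoint[OF pm_proj[OF rpm Y']]] .
    also have "F (- Y) u = 0" unfolding u_def by (rule pm_disjoint[OF rpm Y' Y]) simp
    finally show ?thesis by simp
  qed
  have "cinner (T v) u = 0"
    using resolution_cross[OF Y uu] adjoint_pairD[OF positive_opD(2)[OF T], of v u] cinner_swap_zero by metis
  then have "cinner (T u) u = cinner (T b) u"
    by (simp add: buv blinfun.add_right cinner_add_left)
  also have "\<dots> = complex_of_real lam * cinner b u" by (simp add: b cinner_scaleC_left)
  also have "cinner b u = complex_of_real ((norm u)\<^sup>2)" by (simp add: buv cinner_add_left vu cinner_self)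
  finally have Tu: "cinner (T u) u = complex_of_real (lam * (norm u)\<^sup>2)" by simp
  define M where "M = spectral_distribution F u"
  interpret M: finite_measure M unfolding M_def by (rule finite_spectral_distribution[OF rpm])
  have em: "emeasure M X = ennreal ((norm (F X u))\<^sup>2)" if "X \<in> sets borel" for X
    unfolding M_def by (rule emeasure_spectral_distribution[OF rpm that])
  have sp: "sets M = sets borel" "space M = UNIV"
    by (simp_all add: M_def sets_spectral_distribution[OF rpm])
  have "measure M UNIV = (norm u)\<^sup>2" using em[of UNIV] by (simp add: measure_def resolution_UNIV)
  moreover have iM: "integrable M (\<lambda>s. s)" unfolding M_def by (rule resolution_quadratic)
  moreover have "(\<integral>s. s \<partial>M) = lam * (norm u)\<^sup>2"
    using Tu resolution_quadratic(2)[of u] by (simp add: M_def del: of_real_mult)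
  ultimately have zero: "(\<integral>s. \<sigma> * (s - lam) \<partial>M) = 0" by (simp add: sp mult.commute)
  have "AE s in M. s \<notin> - Y"
    by (rule AE_not_in) (use em[OF Y'] pm_disjoint[OF rpm Y' Y, of b] Y' in \<open>auto simp: null_sets_def sp u_def\<close>)
  then have pos: "AE s in M. 0 < \<sigma> * (s - lam)" by eventually_elim (use side in auto)
  then have nonneg: "AE s in M. 0 \<le> \<sigma> * (s - lam)" by eventually_elim simp
  have "integrable M (\<lambda>s. \<sigma> * (s - lam))" using iM by simp
  from iffD1[OF integral_nonneg_eq_0_iff_AE[OF this nonneg] zero] have "AE s in M. \<sigma> * (s - lam) = 0" .
  with pos have "AE s in M. False" by eventually_elim simp
  then have "emeasure M UNIV = 0" using AE_iff_measurable[of UNIV M "\<lambda>s. False"] by (simp add: sp)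
  then show ?thesis using em[of UNIV] by (simp add: resolution_UNIV u_def)
qed

text \<open>By the two one-sided cases b lies in the range of F {lam}. On a basis of eigenvectors
  this determines F Y, so the choice in \<open>spectral_projection\<close> cannot matter.\<close>

lemma resolution_eigenvector:
  assumes Y: "Y \<in> sets borel"
  shows "F Y b = (if lam \<in> Y then b else 0)"
proof -
  have "F {lam<..} b = 0" by (rule resolution_eigen_side[of _ 1]) auto
  moreover have "F {..<lam} b = 0" by (rule resolution_eigen_side[of _ "-1"]) auto
  moreover have "F ({lam} \<union> ({lam<..} \<union> {..<lam})) b = F {lam} b + F ({lam<..} \<union> {..<lam}) b"
    by (rule pm_Un[OF rpm]) auto
  moreover have "{lam} \<union> ({lam<..} \<union> {..<lam}) = UNIV" by auto
  moreover have "F ({lam<..} \<union> {..<lam}) b = F {lam<..} b + F {..<lam} b"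
    by (rule pm_Un[OF rpm]) auto
  ultimately have lb: "F {lam} b = b" by (simp add: resolution_UNIV)
  have "F Y b = F (Y \<inter> {lam}) b" using pm_Int[OF rpm Y, of "{lam}" b] lb by simp
  then show ?thesis using lb pm_empty[OF rpm] by (cases "lam \<in> Y") auto
qed

end
end

section \<open>Singular values of diagonal operators\<close>

lemma Tr_diag:
  assumes B: "orthonormal_basis B" and m: "\<And>b. b \<in> B \<Longrightarrow> 0 \<le> m b" "\<And>b. b \<in> B \<Longrightarrow> m b \<le> C"
  shows "Tr (diag (\<lambda>x. x) B (\<lambda>b. complex_of_real (m b))) = (\<Sum>\<^sub>\<infinity>b\<in>B. ennreal (m b))"
proof -
  have bd: "bounded_on B (\<lambda>b. complex_of_real (m b))" using m by (intro bounded_onI[of _ _ C]) auto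
  note on = orthonormal_basis_orthonormal[OF B]
  show ?thesis
  proof (subst Tr_positive[OF _ B])
    show "positive_op (diag (\<lambda>x. x) B (\<lambda>b. complex_of_real (m b)))"
      by (rule diag_positive[OF on bd]) (rule m(1))
    show "(\<Sum>\<^sub>\<infinity>e\<in>B. ennreal (Re (cinner (diag (\<lambda>x. x) B (\<lambda>b. complex_of_real (m b)) e) e))) = (\<Sum>\<^sub>\<infinity>b\<in>B. ennreal (m b))"
      by (rule infsum_cong) (simp add: diag_coeff[OF on bd] orthonormalD[OF on])
  qed
qed

lemma infsum_of_bool_le_iff:
  "(\<Sum>\<^sub>\<infinity>b\<in>B. ennreal (of_bool (P b))) \<le> of_nat n \<longleftrightarrow> finite {b \<in> B. P b} \<and> card {b \<in> B. P b} \<le> n"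
proof
  assume le: "(\<Sum>\<^sub>\<infinity>b\<in>B. ennreal (of_bool (P b))) \<le> of_nat n"
  have "card F \<le> n" if "finite F" "F \<subseteq> {b \<in> B. P b}" for F
  proof -
    have "ennreal (of_nat (card F)) = (\<Sum>b\<in>F. ennreal (of_bool (P b)))" using that by (subst sum.cong[of F F _ "\<lambda>_. 1"]) (auto simp: ennreal_of_nat_eq_real_of_nat)
    also have "\<dots> \<le> (\<Sum>\<^sub>\<infinity>b\<in>B. ennreal (of_bool (P b)))" using that by (intro sum_le_infsum_ennreal) auto
    also note le
    finally show ?thesis by (simp add: ennreal_of_nat_eq_real_of_nat)
  qed
  then show "finite {b \<in> B. P b} \<and> card {b \<in> B. P b} \<le> n"
    by (metis (no_types, lifting) infinite_arbitrarily_large not_less_eq_eq order_refl)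
next
  assume fin: "finite {b \<in> B. P b} \<and> card {b \<in> B. P b} \<le> n"
  have "(\<Sum>\<^sub>\<infinity>b\<in>B. ennreal (of_bool (P b))) = (\<Sum>\<^sub>\<infinity>b\<in>{b \<in> B. P b}. 1)"
    by (rule infsum_cong_neutral) auto
  also have "\<dots> = of_nat (card {b \<in> B. P b})" using fin by simp
  finally show "(\<Sum>\<^sub>\<infinity>b\<in>B. ennreal (of_bool (P b))) \<le> of_nat n" using fin by simp
qed

context
  fixes B :: "L2 set" and l :: "L2 \<Rightarrow> real" and C :: real
  assumes B: "orthonormal_basis B" and l: "\<And>b. b \<in> B \<Longrightarrow> 0 \<le> l b" "\<And>b. b \<in> B \<Longrightarrow> l b \<le> C"
begin

lemma spectral_projection_diag:
  assumes Y: "Y \<in> sets borel"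
  shows "spectral_projection (diag (\<lambda>x. x) B (\<lambda>b. complex_of_real (l b))) Y
    = diag (\<lambda>x. x) B (\<lambda>b. complex_of_real (of_bool (l b \<in> Y)))"
proof -
  define T where "T = diag (\<lambda>x. x) B (\<lambda>b. complex_of_real (l b))"
  define F where "F = (SOME E. spectral_resolution T E)"
  have R: "spectral_resolution T F"
    unfolding F_def T_def by (rule someI[of "spectral_resolution _", OF diag_resolution_spectral[where l=l and C=C, OF B l]])
  have T: "positive_op T" unfolding T_def by (rule diag_l_positive[where l=l and C=C, OF B l])
  note bd = diag_l_bounded[where l=l and C=C, OF B l]
  have "F Y = diag (\<lambda>x. x) B (\<lambda>b. complex_of_real (of_bool (l b \<in> Y)))"
  proof (rule diag_basis_unique[OF B bounded_of_bool])
    show "F Y \<in> BL2" using R Y by (auto simp: spectral_resolution_def projection_op_def)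
    fix b assume b: "b \<in> B"
    have "T b = complex_of_real (l b) *\<^sub>C b"
      unfolding T_def by (rule diag_eigen[OF orthonormal_basis_orthonormal[OF B] bd b])
    from resolution_eigenvector[OF T R this Y] show "F Y b = complex_of_real (of_bool (l b \<in> Y)) *\<^sub>C b"
      by simp
  qed
  then show ?thesis by (simp add: spectral_projection_def F_def T_def)
qed

text \<open>The spectral projection onto (s, oo) is diagonal with entries 0 and 1, and its trace
  counts the basis vectors with eigenvalue above s.\<close>

lemma singular_value_diag:
  "singular_value (diag (\<lambda>x. x) B (\<lambda>b. complex_of_real (l b))) n
    = Inf {s. s > 0 \<and> finite {b \<in> B. s < l b} \<and> card {b \<in> B. s < l b} \<le> n}"
proof -
  have "Tr (diag (\<lambda>x. x) B (\<lambda>b. complex_of_real (of_bool (l b \<in> {s<..})))) \<le> of_nat n \<longleftrightarrow>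
      finite {b \<in> B. s < l b} \<and> card {b \<in> B. s < l b} \<le> n" for s
    using infsum_of_bool_le_iff[where B=B and P="\<lambda>b. s < l b" and n=n] by (subst Tr_diag[OF B, of _ 1]) auto
  moreover have "abs_op (diag (\<lambda>x. x) B (\<lambda>b. complex_of_real (l b))) = diag (\<lambda>x. x) B (\<lambda>b. complex_of_real (l b))"
    by (rule abs_op_positive, rule diag_l_positive[where C=C, OF B]) (rule l, assumption)+
  ultimately show ?thesis
    unfolding singular_value_def by (simp add: spectral_projection_diag)
qed

end

section \<open>Multiplication and integral operators on the half-line\<close>

lemma borel_half_line: "f \<in> borel_measurable borel \<Longrightarrow> f \<in> borel_measurable half_line"
  by (intro measurable_restrict_space1 measurable_completion) simp

text \<open>The half-line carries completed Lebesgue measure without the point 0. The null endpoint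
  and the completion are absorbed here once, so that the fundamental theorem on closed intervals
  becomes available.\<close>

lemma has_integral_half_line:
  fixes h :: "real \<Rightarrow> 'b::{banach, second_countable_topology}"
  assumes "has_bochner_integral lborel (\<lambda>x. indicator {0..b} x *\<^sub>R h x) I"
  shows "has_bochner_integral half_line (\<lambda>x. indicator {0..b} x *\<^sub>R h x) I"
proof -
  let ?f = "\<lambda>x. indicator {0..b} x *\<^sub>R h x"
  have fm: "?f \<in> borel_measurable lborel" and fi: "integrable lborel ?f" and fI: "integral\<^sup>L lborel ?f = I"
    using assms by (auto simp: has_bochner_integral_iff)
  have ae: "AE x in lborel. indicator {0<..} x *\<^sub>R ?f x = ?f x"
    using AE_lborel_singleton[of 0] by eventually_elim (auto simp: indicator_def)
  have gm: "(\<lambda>x. indicator {0<..} x *\<^sub>R ?f x) \<in> borel_measurable lborel"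
    by (rule borel_measurable_scaleR[OF _ fm]) simp
  have "integrable lborel (\<lambda>x. indicator {0<..} x *\<^sub>R ?f x)"
    using integrable_cong_AE[OF gm fm ae] fi by simp
  then have "integrable half_line ?f"
    by (subst integrable_restrict_space) (auto simp: integrable_completion gm)
  moreover have "integral\<^sup>L half_line ?f = I"
  proof (subst integral_restrict_space)
    show "(\<integral>x. indicator {0<..} x *\<^sub>R ?f x \<partial>lebesgue) = I"
      unfolding integral_completion[OF gm] integral_cong_AE[OF gm fm ae] by (rule fI)
  qed simp
  ultimately show ?thesis by (simp add: has_bochner_integral_iff)
qed

lemma half_line_FTC:
  fixes f F :: "real \<Rightarrow> complex"
  assumes "0 \<le> b" "\<And>x. (F has_vector_derivative f x) (at x)" "continuous_on UNIV f"
  shows "integrable half_line (\<lambda>x. indicator {0..b} x *\<^sub>R f x)"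
    "integral\<^sup>L half_line (\<lambda>x. indicator {0..b} x *\<^sub>R f x) = F b - F 0"
proof -
  have c: "continuous_on {0..b} f" by (rule continuous_on_subset[OF assms(3) subset_UNIV])
  have "has_bochner_integral lborel (\<lambda>x. indicator {0..b} x *\<^sub>R f x) (F b - F 0)"
    by (rule has_bochner_integral_FTC_Icc[OF assms(1) _ c]) (rule has_vector_derivative_at_within, rule assms(2))
  from has_integral_half_line[OF this]
  show "integrable half_line (\<lambda>x. indicator {0..b} x *\<^sub>R f x)"
    "integral\<^sup>L half_line (\<lambda>x. indicator {0..b} x *\<^sub>R f x) = F b - F 0"
    by (simp_all only: has_bochner_integral_iff)
qed

lemma half_line_indicator:
  assumes "0 \<le> b"
  shows "integrable half_line (indicator {0..b} :: real \<Rightarrow> real)" "integral\<^sup>L half_line (indicator {0..b} :: real \<Rightarrow> real) = b"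
proof -
  have "has_bochner_integral lborel (\<lambda>x. indicator {0..b} x *\<^sub>R (1::real)) (b - 0)"
    using assms by (intro has_bochner_integral_FTC_Icc[of 0 b "\<lambda>x. x"]) (auto intro!: derivative_eq_intros)
  from has_integral_half_line[OF this] show
    "integrable half_line (indicator {0..b} :: real \<Rightarrow> real)" "integral\<^sup>L half_line (indicator {0..b} :: real \<Rightarrow> real) = b"
    by (auto simp: has_bochner_integral_iff)
qed

lemma square_integrable_bounded:
  fixes f :: "real \<Rightarrow> complex"
  assumes "f \<in> borel_measurable half_line" "0 \<le> b" "\<And>x. norm (f x) \<le> C * indicator {0..b} x"
  shows "square_integrable f"
  unfolding square_integrable_def
proof
  show "integrable half_line (\<lambda>x. (norm (f x))\<^sup>2)"
  proof (rule Bochner_Integration.integrable_bound)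
    show "integrable half_line (\<lambda>x. C\<^sup>2 * indicator {0..b} x)"
      by (rule integrable_mult_right[OF half_line_indicator(1)[OF assms(2)]])
    have "(norm (f x))\<^sup>2 \<le> (C * indicator {0..b} x)\<^sup>2" for x by (rule power_mono[OF assms(3)]) simp
    then show "AE x in half_line. norm ((norm (f x))\<^sup>2) \<le> norm (C\<^sup>2 * indicator {0..b} x :: real)"
      unfolding power_mult_distrib
      by (intro AE_I2) (simp add: power2_eq_square[of "indicator _ _ :: real"] flip: indicator_inter_arith)
  qed (use assms(1) in measurable)
qed fact

text \<open>The bound 1 covers both kinds of multipliers below, indicators and unimodular
  exponentials. For any other symbol \<open>mult_fun\<close> returns 0, which makes its lifting
  total.\<close>

definition contractive :: "(real \<Rightarrow> complex) \<Rightarrow> bool"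
  where "contractive \<phi> \<longleftrightarrow> \<phi> \<in> borel_measurable borel \<and> (\<forall>x. norm (\<phi> x) \<le> 1)"

lemma square_integrable_mult:
  assumes \<phi>: "contractive \<phi>" and f: "square_integrable f"
  shows "square_integrable (\<lambda>x. \<phi> x * f x)"
  unfolding square_integrable_def
proof
  have [measurable]: "\<phi> \<in> borel_measurable half_line" "f \<in> borel_measurable half_line"
    using \<phi> f by (auto simp: contractive_def square_integrable_def borel_half_line)
  show "(\<lambda>x. \<phi> x * f x) \<in> borel_measurable half_line" by measurable
  show "integrable half_line (\<lambda>x. (norm (\<phi> x * f x))\<^sup>2)"
  proof (rule Bochner_Integration.integrable_bound)
    show "integrable half_line (\<lambda>x. (norm (f x))\<^sup>2)" using f by (simp add: square_integrable_def)
    have "norm (\<phi> x * f x) \<le> 1 * norm (f x)" for x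
      unfolding norm_mult using \<phi> by (intro mult_right_mono) (auto simp: contractive_def)
    then show "AE x in half_line. norm ((norm (\<phi> x * f x))\<^sup>2) \<le> norm ((norm (f x))\<^sup>2)"
      by (intro AE_I2) (simp add: power_mono)
  qed measurable
qed

lift_definition mult_fun :: "(real \<Rightarrow> complex) \<Rightarrow> L2 \<Rightarrow> L2"
  is "\<lambda>\<phi> f x. if contractive \<phi> then \<phi> x * f x else 0"
proof -
  fix \<phi> f g assume "L2_eq f g"
  then show "L2_eq (\<lambda>x. if contractive \<phi> then \<phi> x * f x else 0) (\<lambda>x. if contractive \<phi> then \<phi> x * g x else 0)"
    by (cases "contractive \<phi>") (auto simp: L2_eq_def square_integrable_zero square_integrable_mult elim: AE_mp)
qed

lemma mult_fun_L2_of: "contractive \<phi> \<Longrightarrow> square_integrable f \<Longrightarrow> mult_fun \<phi> (L2_of f) = L2_of (\<lambda>x. \<phi> x * f x)"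
  by transfer (auto simp: L2_eq_def square_integrable_mult)

definition mult_op :: "(real \<Rightarrow> complex) \<Rightarrow> op"
  where "mult_op \<phi> = Blinfun (mult_fun \<phi>)"

lemma norm_mult_fun_le:
  assumes "contractive \<phi>" shows "norm (mult_fun \<phi> F) \<le> norm F"
proof -
  obtain f where f: "square_integrable f" "F = L2_of f" by (rule L2_cases)
  have "(norm (mult_fun \<phi> F))\<^sup>2 \<le> (norm F)\<^sup>2"
    unfolding f(2) mult_fun_L2_of[OF assms f(1)] norm_L2_of[OF f(1)] norm_L2_of[OF square_integrable_mult[OF assms f(1)]]
  proof (rule integral_mono)
    show "integrable half_line (\<lambda>x. (norm (\<phi> x * f x))\<^sup>2)" "integrable half_line (\<lambda>x. (norm (f x))\<^sup>2)"
      using f square_integrable_mult[OF assms f(1)] by (auto simp: square_integrable_def)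
    have "norm (\<phi> x * f x) \<le> 1 * norm (f x)" for x
      unfolding norm_mult using assms by (intro mult_right_mono) (auto simp: contractive_def)
    then show "(norm (\<phi> x * f x))\<^sup>2 \<le> (norm (f x))\<^sup>2" for x by (simp add: power_mono)
  qed
  then show ?thesis by (simp add: power2_le_iff_abs_le)
qed

lemma mult_op_apply:
  assumes \<phi>: "contractive \<phi>"
  shows "blinfun_apply (mult_op \<phi>) F = mult_fun \<phi> F"
proof -
  have "bounded_linear (mult_fun \<phi>)"
  proof (rule bounded_linear_intro[of _ 1])
    fix F G :: L2 and r
    obtain f where f: "square_integrable f" "F = L2_of f" by (rule L2_cases)
    obtain g where g: "square_integrable g" "G = L2_of g" by (rule L2_cases)
    show "mult_fun \<phi> (F + G) = mult_fun \<phi> F + mult_fun \<phi> G"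
      by (simp add: f g L2_of_add mult_fun_L2_of[OF \<phi>] square_integrable_mult[OF \<phi>] square_integrable_add distrib_left)
    show "mult_fun \<phi> (r *\<^sub>R F) = r *\<^sub>R mult_fun \<phi> F"
      by (simp add: f scaleR_scaleC L2_of_scaleC mult_fun_L2_of[OF \<phi>] square_integrable_mult[OF \<phi>] square_integrable_scale mult_ac)
  qed (simp add: norm_mult_fun_le[OF \<phi>])
  then show ?thesis by (simp add: mult_op_def bounded_linear_Blinfun_apply)
qed

lemma mult_op_L2_of: "contractive \<phi> \<Longrightarrow> square_integrable f \<Longrightarrow> mult_op \<phi> (L2_of f) = L2_of (\<lambda>x. \<phi> x * f x)"
  by (simp add: mult_op_apply mult_fun_L2_of)

lemma norm_mult_op: "contractive \<phi> \<Longrightarrow> norm (mult_op \<phi>) \<le> 1"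
  by (rule norm_blinfun_bound) (auto simp: mult_op_apply norm_mult_fun_le)

lemma mult_op_BL2: assumes \<phi>: "contractive \<phi>" shows "mult_op \<phi> \<in> BL2"
proof (rule BL2_I)
  fix c F
  obtain f where f: "square_integrable f" "F = L2_of f" by (rule L2_cases)
  show "mult_op \<phi> (c *\<^sub>C F) = c *\<^sub>C mult_op \<phi> F"
    by (simp add: f L2_of_scaleC mult_op_L2_of[OF \<phi>] square_integrable_mult[OF \<phi>] square_integrable_scale mult_ac)
qed

lemma contractive_mult: "contractive \<phi> \<Longrightarrow> contractive \<psi> \<Longrightarrow> contractive (\<lambda>x. \<phi> x * \<psi> x)"
  unfolding contractive_def by (auto simp: norm_mult intro: mult_le_one)

lemma mult_op_comp:
  assumes "contractive \<phi>" "contractive \<psi>"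
  shows "mult_op \<phi> o\<^sub>L mult_op \<psi> = mult_op (\<lambda>x. \<phi> x * \<psi> x)"
proof (rule op_eqI)
  fix F
  obtain f where f: "square_integrable f" "F = L2_of f" by (rule L2_cases)
  show "(mult_op \<phi> o\<^sub>L mult_op \<psi>) F = mult_op (\<lambda>x. \<phi> x * \<psi> x) F"
    using assms f by (simp add: mult_op_L2_of contractive_mult square_integrable_mult mult.assoc)
qed

lemma mult_op_commute:
  assumes "contractive \<phi>" "contractive \<psi>"
  shows "mult_op \<phi> o\<^sub>L mult_op \<psi> = mult_op \<psi> o\<^sub>L mult_op \<phi>"
  using assms by (simp add: mult_op_comp mult.commute)

lemma contractive_cnj: "contractive \<phi> \<Longrightarrow> contractive (\<lambda>x. cnj (\<phi> x))"
  unfolding contractive_def by (auto intro!: borel_measurable_continuous_on[of cnj] continuous_intros)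

lemma mult_op_adjoint:
  assumes \<phi>: "contractive \<phi>"
  shows "adjoint_pair (mult_op \<phi>) (mult_op (\<lambda>x. cnj (\<phi> x)))"
  unfolding adjoint_pair_def
proof (intro allI)
  fix F G
  obtain f where f: "square_integrable f" "F = L2_of f" by (rule L2_cases)
  obtain g where g: "square_integrable g" "G = L2_of g" by (rule L2_cases)
  show "cinner (mult_op \<phi> F) G = cinner F (mult_op (\<lambda>x. cnj (\<phi> x)) G)"
    unfolding f(2) g(2) mult_op_L2_of[OF \<phi> f(1)] mult_op_L2_of[OF contractive_cnj[OF \<phi>] g(1)]
      cinner_L2_of[OF square_integrable_mult[OF \<phi> f(1)] g(1)]
      cinner_L2_of[OF f(1) square_integrable_mult[OF contractive_cnj[OF \<phi>] g(1)]]
    by (simp add: mult_ac)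
qed

lemma contractive_indicator: "A \<in> sets borel \<Longrightarrow> contractive (indicator A)"
  by (simp add: contractive_def indicator_def)

definition cut :: "real set \<Rightarrow> op" where "cut A = mult_op (indicator A)"

lemma cut_adjoint: "A \<in> sets borel \<Longrightarrow> adjoint_pair (cut A) (cut A)"
proof -
  assume A: "A \<in> sets borel"
  have "(\<lambda>x. cnj (indicator A x)) = indicator A" by (auto simp: indicator_def)
  then show ?thesis using mult_op_adjoint[OF contractive_indicator[OF A]] by (simp add: cut_def)
qed

lemma cut_BL2: "A \<in> sets borel \<Longrightarrow> cut A \<in> BL2"
  by (simp add: cut_def mult_op_BL2 contractive_indicator)

lemma cut_comp: "A \<in> sets borel \<Longrightarrow> A' \<in> sets borel \<Longrightarrow> cut A o\<^sub>L cut A' = cut (A \<inter> A')"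
  by (simp add: cut_def mult_op_comp contractive_indicator indicator_inter_arith[abs_def])

lemma cut_L2_of: "A \<in> sets borel \<Longrightarrow> square_integrable f \<Longrightarrow> cut A (L2_of f) = L2_of (\<lambda>x. indicator A x * f x)"
  by (simp add: cut_def mult_op_L2_of contractive_indicator)

lemma cut_empty: "cut {} = 0"
proof (rule op_eqI)
  fix F
  obtain f where f: "square_integrable f" "F = L2_of f" by (rule L2_cases)
  have "mult_op (\<lambda>x. 0) F = L2_of (\<lambda>x. 0 * f x)"
    unfolding f(2) by (rule mult_op_L2_of[OF _ f(1)]) (simp add: contractive_def)
  also have "\<dots> = 0 *\<^sub>C F" unfolding f(2) L2_of_scaleC[OF f(1)] ..
  finally show "blinfun_apply (cut {}) F = blinfun_apply 0 F" by (simp add: cut_def indicator_def[abs_def])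
qed

lemma cut_UNIV: "cut UNIV = id_blinfun"
proof (rule op_eqI)
  fix F
  obtain f where f: "square_integrable f" "F = L2_of f" by (rule L2_cases)
  show "cut UNIV F = id_blinfun F" unfolding f(2) by (subst cut_L2_of[OF _ f(1)]) simp_all
qed

lemma cut_Un: 
  assumes "A \<in> sets borel" "A' \<in> sets borel" "A \<inter> A' = {}"
  shows "cut (A \<union> A') = cut A + cut A'"
proof (rule op_eqI)
  fix F
  obtain f where f: "square_integrable f" "F = L2_of f" by (rule L2_cases)
  have "square_integrable (\<lambda>x. indicator A x * f x)" "square_integrable (\<lambda>x. indicator A' x * f x)"
    using assms by (auto intro!: square_integrable_mult contractive_indicator f)
  moreover have "indicator (A \<union> A') x * f x = indicator A x * f x + indicator A' x * f x" for x
    using assms(3) by (auto simp: indicator_def)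
  ultimately show "cut (A \<union> A') F = (cut A + cut A') F"
    using assms f by (simp add: blinfun.add_left cut_L2_of L2_of_add)
qed

lemma cut_finite_union:
  assumes "finite I" "\<And>i. i \<in> I \<Longrightarrow> A i \<in> sets borel" "disjoint_family_on A I"
  shows "cut (\<Union>i\<in>I. A i) = (\<Sum>i\<in>I. cut (A i))"
  using assms
proof (induction I rule: finite_induct)
  case (insert i I)
  have "cut (A i \<union> (\<Union>i\<in>I. A i)) = cut (A i) + cut (\<Union>i\<in>I. A i)"
    using insert by (intro cut_Un) (auto simp: disjoint_family_on_def)
  then show ?case using insert by (simp add: disjoint_family_on_def)
qed (simp add: cut_empty)

subsection \<open>Exponentials\<close>

definition expo :: "real \<Rightarrow> L2"
  where "expo a = L2_of (\<lambda>x. indicator {0..1} x * cis (a * x))"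

text \<open>The inner product with \<open>seg b\<close> is integration over [0, b]; this makes a
  Volterra kernel a curve of vectors.\<close>

definition seg :: "real \<Rightarrow> L2"
  where "seg b = L2_of (indicator {0..b})"

lemma square_integrable_expo: "square_integrable (\<lambda>x. indicator {0..1} x * cis (a * x))"
proof (rule square_integrable_bounded[of _ 1 1])
  have [measurable]: "(\<lambda>x. cis (a * x)) \<in> borel_measurable borel"
    by (intro borel_measurable_continuous_onI continuous_intros)
  show "(\<lambda>x. indicator {0..1} x * cis (a * x)) \<in> borel_measurable half_line"
    by (rule borel_half_line) measurable
qed (auto simp: norm_mult indicator_def)

lemma square_integrable_seg: "square_integrable (indicator {0..b})"
proof (rule square_integrable_bounded[of _ "max b 0" 1])
  show "indicator {0..b} \<in> borel_measurable half_line" by (rule borel_half_line) measurable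
qed (auto simp: indicator_def)

lemma has_vector_derivative_cis:
  assumes "a \<noteq> 0"
  shows "((\<lambda>x. cis (a * x) / (\<i> * a)) has_vector_derivative cis (a * x)) (at x)"
  unfolding has_vector_derivative_complex_iff using assms
  by (auto simp: Re_divide Im_divide power2_eq_square intro!: derivative_eq_intros)

lemma continuous_on_cis_mult: "continuous_on UNIV (\<lambda>x. cis (a * x))"
  by (intro continuous_intros)

lemma cinner_expo_seg:
  assumes "a \<noteq> 0" "0 \<le> b" "b \<le> 1"
  shows "cinner (expo a) (seg b) = (cis (a * b) - 1) / (\<i> * a)"
proof -
  have "cinner (expo a) (seg b) = integral\<^sup>L half_line (\<lambda>x. indicator {0..b} x *\<^sub>R cis (a * x))"
    unfolding expo_def seg_def cinner_L2_of[OF square_integrable_expo square_integrable_seg]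
    using assms by (intro Bochner_Integration.integral_cong) (auto simp: indicator_def)
  also have "\<dots> = cis (a * b) / (\<i> * a) - cis (a * 0) / (\<i> * a)"
    by (rule half_line_FTC(2)[OF assms(2) has_vector_derivative_cis[OF assms(1)] continuous_on_cis_mult])
  finally show ?thesis by (simp add: diff_divide_distrib)
qed

lemma cinner_expo_expo:
  shows "cinner (expo a) (expo b) = (if a = b then 1 else (cis (a - b) - 1) / (\<i> * (a - b)))"
proof -
  have m: "cis (a * x) * cnj (cis (b * x)) = cis ((a - b) * x)" for x
    by (simp add: cis_cnj cis_mult algebra_simps)
  have "cinner (expo a) (expo b) = integral\<^sup>L half_line (\<lambda>x. indicator {0..1} x *\<^sub>R cis ((a - b) * x))"
    unfolding expo_def cinner_L2_of[OF square_integrable_expo square_integrable_expo]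
    by (intro Bochner_Integration.integral_cong) (auto simp: indicator_def m)
  also have "\<dots> = (if a = b then 1 else (cis (a - b) - 1) / (\<i> * (a - b)))"
  proof (cases "a = b")
    case True
    have "integral\<^sup>L half_line (\<lambda>x. indicator {0..1} x *\<^sub>R (1::complex)) = complex_of_real 1 - complex_of_real 0"
      by (rule half_line_FTC(2)) (auto intro!: derivative_eq_intros simp: has_vector_derivative_complex_iff)
    then show ?thesis using True by simp
  next
    case False
    have "integral\<^sup>L half_line (\<lambda>x. indicator {0..1} x *\<^sub>R cis ((a - b) * x))
        = cis ((a - b) * 1) / (\<i> * (a - b)) - cis ((a - b) * 0) / (\<i> * (a - b))"
      using False by (intro half_line_FTC(2) has_vector_derivative_cis continuous_on_cis_mult) auto
    then show ?thesis using False by (simp add: diff_divide_distrib)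
  qed
  finally show ?thesis .
qed

lemma cis_2pi_int: "cis (2 * pi * of_int k) = 1"
  by (simp add: cis.ctr complex_eq_iff)

lemma cinner_seg_seg: "cinner (seg a) (seg b) = complex_of_real (max 0 (min a b))"
proof -
  have "cinner (seg a) (seg b) = integral\<^sup>L half_line (\<lambda>x. complex_of_real (indicator {0..max 0 (min a b)} x))"
  proof -
    have "cinner (seg a) (seg b) = integral\<^sup>L half_line (\<lambda>x. indicator {0..a} x * cnj (indicator {0..b} x))"
      unfolding seg_def by (rule cinner_L2_of[OF square_integrable_seg square_integrable_seg])
    also have "\<dots> = integral\<^sup>L half_line (\<lambda>x. complex_of_real (indicator {0..max 0 (min a b)} x))"
      by (rule Bochner_Integration.integral_cong) (auto simp: indicator_def)
    finally show ?thesis .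
  qed
  also have "\<dots> = complex_of_real (max 0 (min a b))"
    unfolding integral_complex_of_real half_line_indicator(2)[OF max.cobounded1] ..
  finally show ?thesis .
qed

lemma continuous_seg: "continuous_on UNIV seg"
proof (rule continuous_on_sequentiallyI)
  fix u a assume u: "u \<longlonglongrightarrow> (a::real)"
  have "(norm (seg (u n) - seg a))\<^sup>2 \<le> \<bar>u n - a\<bar>" for n
    unfolding norm_sq_diff by (simp add: norm_sq_cinner cinner_seg_seg)
  moreover have "(\<lambda>n. \<bar>u n - a\<bar>) \<longlonglongrightarrow> 0" using u by (simp add: LIM_zero_iff tendsto_rabs_zero)
  ultimately have "(\<lambda>n. (norm (seg (u n) - seg a))\<^sup>2) \<longlonglongrightarrow> 0"
    by (intro tendsto_sandwich[of "\<lambda>_. 0" "\<lambda>n. (norm (seg (u n) - seg a))\<^sup>2"]) (auto intro!: always_eventually)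
  then have "(\<lambda>n. sqrt ((norm (seg (u n) - seg a))\<^sup>2)) \<longlonglongrightarrow> sqrt 0" by (rule tendsto_real_sqrt)
  then have "(\<lambda>n. norm (seg (u n) - seg a)) \<longlonglongrightarrow> 0" by simp
  then have "(\<lambda>n. seg (u n) - seg a) \<longlonglongrightarrow> 0" by (rule tendsto_norm_zero_cancel)
  then show "(\<lambda>n. seg (u n)) \<longlonglongrightarrow> seg a" by (rule LIM_zero_cancel)
qed

subsection \<open>Kernel operators\<close>

text \<open>The kernel enters as a curve of vectors: on [0,1] the image of f has the value <f, u x>
  at x, and it is 0 elsewhere. For a continuous curve, measurability follows from continuity and the
  norm bound from Cauchy-Schwarz.\<close>

definition kernel_op :: "(real \<Rightarrow> L2) \<Rightarrow> op"
  where "kernel_op u = Blinfun (\<lambda>f. L2_of (\<lambda>x. indicator {0..1} x * cinner f (u x)))"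

context
  fixes u :: "real \<Rightarrow> L2" and C :: real
  assumes u: "continuous_on UNIV u" and C: "\<And>x. x \<in> {0..1} \<Longrightarrow> norm (u x) \<le> C"
begin

lemma kernel_measurable: "(\<lambda>x. indicator {0..1} x * cinner f (u x)) \<in> borel_measurable half_line"
proof -
  have "continuous_on UNIV (\<lambda>x. cinner f (u x))"
    by (rule bounded_linear.continuous_on[OF bounded_linear_cinner_right u])
  then have [measurable]: "(\<lambda>x. cinner f (u x)) \<in> borel_measurable borel"
    by (rule borel_measurable_continuous_onI)
  show ?thesis by (rule borel_half_line) measurable
qed

lemma kernel_bound: "norm (indicator {0..1} x * cinner f (u x)) \<le> (C * norm f) * indicator {0..1} x"
proof (cases "x \<in> {0..1}")
  case True
  have "norm (cinner f (u x)) \<le> norm f * norm (u x)" by (rule norm_cinner_le)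
  also have "\<dots> \<le> norm f * C" using C True by (intro mult_left_mono) auto
  finally show ?thesis using True by (simp add: norm_mult mult.commute)
qed simp

lemma kernel_square_integrable: "square_integrable (\<lambda>x. indicator {0..1} x * cinner f (u x))"
  by (rule square_integrable_bounded[OF kernel_measurable _ kernel_bound]) simp

lemma kernel_norm:
  "norm (L2_of (\<lambda>x. indicator {0..1} x * cinner f (u x))) \<le> C * norm f"
proof (rule power2_le_imp_le)
  have "norm (u 0) \<le> C" by (rule C) simp
  then have "0 \<le> C" using norm_ge_zero[of "u 0"] by linarith
  then show "0 \<le> C * norm f" by simp
  have "(norm (L2_of (\<lambda>x. indicator {0..1} x * cinner f (u x))))\<^sup>2 \<le> (\<integral>x. (C * norm f)\<^sup>2 * indicator {0..1} x \<partial>half_line)"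
    unfolding norm_L2_of[OF kernel_square_integrable]
  proof (rule integral_mono)
    show "integrable half_line (\<lambda>x. (norm (indicator {0..1} x * cinner f (u x)))\<^sup>2)"
      using kernel_square_integrable by (simp add: square_integrable_def)
    show "integrable half_line (\<lambda>x. (C * norm f)\<^sup>2 * indicator {0..1} x)"
      by (rule integrable_mult_right[OF half_line_indicator(1)]) simp
    fix x
    have "(norm (indicator {0..1} x * cinner f (u x)))\<^sup>2 \<le> ((C * norm f) * indicator {0..1} x)\<^sup>2"
      by (rule power_mono[OF kernel_bound]) simp
    then show "(norm (indicator {0..1} x * cinner f (u x)))\<^sup>2 \<le> (C * norm f)\<^sup>2 * indicator {0..1} x"
      by (cases "x \<in> {0..1}") simp_all
  qed
  also have "\<dots> = (C * norm f)\<^sup>2" using half_line_indicator(2)[of 1] by simp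
  finally show "(norm (L2_of (\<lambda>x. indicator {0..1} x * cinner f (u x))))\<^sup>2 \<le> (C * norm f)\<^sup>2" .
qed

lemma kernel_op_apply: "kernel_op u f = L2_of (\<lambda>x. indicator {0..1} x * cinner f (u x))"
proof -
  have "bounded_linear (\<lambda>f. L2_of (\<lambda>x. indicator {0..1} x * cinner f (u x)))"
  proof (rule bounded_linear_intro[of _ C])
    show "L2_of (\<lambda>x. indicator {0..1} x * cinner (f + g) (u x)) =
      L2_of (\<lambda>x. indicator {0..1} x * cinner f (u x)) + L2_of (\<lambda>x. indicator {0..1} x * cinner g (u x))" for f g
      by (simp add: L2_of_add kernel_square_integrable cinner_add_left distrib_left)
    show "L2_of (\<lambda>x. indicator {0..1} x * cinner (r *\<^sub>R f) (u x)) =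
      r *\<^sub>R L2_of (\<lambda>x. indicator {0..1} x * cinner f (u x))" for f r
      unfolding scaleR_scaleC L2_of_scaleC[OF kernel_square_integrable] cinner_scaleC_left by (simp add: mult.left_commute)
  qed (use kernel_norm in \<open>simp add: mult.commute\<close>)
  then show ?thesis by (simp add: kernel_op_def bounded_linear_Blinfun_apply)
qed

lemma kernel_op_BL2: "kernel_op u \<in> BL2"
  by (rule BL2_I) (simp only: kernel_op_apply L2_of_scaleC[OF kernel_square_integrable] cinner_scaleC_left mult.left_commute)

lemma kernel_op_norm_sq: "(norm (kernel_op u f))\<^sup>2 = (\<integral>x. indicator {0..1} x * (norm (cinner f (u x)))\<^sup>2 \<partial>half_line)"
  and kernel_op_norm_sq_integrable: "integrable half_line (\<lambda>x. indicator {0..1} x * (norm (cinner f (u x)))\<^sup>2)"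
proof -
  have eq: "(norm (indicator {0..1} x * cinner f (u x)))\<^sup>2 = indicator {0..1} x * (norm (cinner f (u x)))\<^sup>2" for x
    by (simp add: norm_mult power_mult_distrib indicator_def)
  show "(norm (kernel_op u f))\<^sup>2 = (\<integral>x. indicator {0..1} x * (norm (cinner f (u x)))\<^sup>2 \<partial>half_line)"
    unfolding kernel_op_apply norm_L2_of[OF kernel_square_integrable] eq ..
  show "integrable half_line (\<lambda>x. indicator {0..1} x * (norm (cinner f (u x)))\<^sup>2)"
    using kernel_square_integrable[of f] unfolding square_integrable_def eq by simp
qed

text \<open>This is the Hilbert-Schmidt bound for \<open>kernel_op u\<close>, read off from Bessel's inequality under the integral.\<close>

lemma kernel_op_Hilbert_Schmidt:
  assumes "orthonormal b F" "finite F"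
  shows "(\<Sum>i\<in>F. (norm (kernel_op u (b i)))\<^sup>2) \<le> C\<^sup>2"
proof -
  have "(\<Sum>i\<in>F. (norm (kernel_op u (b i)))\<^sup>2) = (\<integral>x. (\<Sum>i\<in>F. indicator {0..1} x * (norm (cinner (b i) (u x)))\<^sup>2) \<partial>half_line)"
    unfolding kernel_op_norm_sq by (rule Bochner_Integration.integral_sum[symmetric]) (rule kernel_op_norm_sq_integrable)
  also have "\<dots> \<le> (\<integral>x. C\<^sup>2 * indicator {0..1} x \<partial>half_line)"
  proof (rule integral_mono)
    show "integrable half_line (\<lambda>x. \<Sum>i\<in>F. indicator {0..1} x * (norm (cinner (b i) (u x)))\<^sup>2)"
      by (rule Bochner_Integration.integrable_sum) (rule kernel_op_norm_sq_integrable)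
    show "integrable half_line (\<lambda>x. C\<^sup>2 * indicator {0..1} x)"
      by (rule integrable_mult_right[OF half_line_indicator(1)]) simp
    fix x
    show "(\<Sum>i\<in>F. indicator {0..1} x * (norm (cinner (b i) (u x)))\<^sup>2) \<le> C\<^sup>2 * indicator {0..1} x"
    proof (cases "x \<in> {0..1}")
      case True
      have "(\<Sum>i\<in>F. (norm (cinner (b i) (u x)))\<^sup>2) \<le> (norm (u x))\<^sup>2"
        using Bessel[OF assms order_refl, of "u x"] by (simp add: norm_cinner_commute)
      also have "\<dots> \<le> C\<^sup>2" using C True by (intro power_mono) auto
      finally show ?thesis using True by simp
    qed simp
  qed
  also have "\<dots> = C\<^sup>2" using half_line_indicator(2)[of 1] by simp
  finally show ?thesis .
qed

lemma cut_kernel: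
  assumes "A \<in> sets borel"
  shows "cut A (kernel_op u f) = L2_of (\<lambda>x. indicator A x * (indicator {0..1} x * cinner f (u x)))"
  unfolding kernel_op_apply by (rule cut_L2_of[OF assms kernel_square_integrable])

end

lemma kernel_bound_exists:
  assumes "continuous_on UNIV u"
  obtains C where "\<And>x. x \<in> {0..1::real} \<Longrightarrow> norm (u x :: L2) \<le> C"
proof -
  have "compact (u ` {0..1})"
    by (rule compact_continuous_image[OF continuous_on_subset[OF assms subset_UNIV] compact_Icc])
  then have "bounded (u ` {0..1})" by (rule compact_imp_bounded)
  then obtain C where "\<forall>y\<in>u ` {0..1}. norm y \<le> C" by (auto simp: bounded_iff)
  then show ?thesis by (intro that[of C]) blast
qed

lemma
  assumes u: "continuous_on UNIV u"
  shows kernel_apply: "kernel_op u f = L2_of (\<lambda>x. indicator {0..1} x * cinner f (u x))"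
    and kernel_sqi: "square_integrable (\<lambda>x. indicator {0..1} x * cinner f (u x))"
    and kernel_BL2: "kernel_op u \<in> BL2"
    and kernel_cut: "A \<in> sets borel \<Longrightarrow> cut A (kernel_op u f) = L2_of (\<lambda>x. indicator A x * (indicator {0..1} x * cinner f (u x)))"
proof -
  obtain C where C: "\<And>x. x \<in> {0..1::real} \<Longrightarrow> norm (u x) \<le> C" using kernel_bound_exists[OF u] by blast
  show "kernel_op u f = L2_of (\<lambda>x. indicator {0..1} x * cinner f (u x))" by (rule kernel_op_apply[OF u C])
  show "square_integrable (\<lambda>x. indicator {0..1} x * cinner f (u x))" by (rule kernel_square_integrable[OF u C])
  show "kernel_op u \<in> BL2" by (rule kernel_op_BL2[OF u C])
  show "cut A (kernel_op u f) = L2_of (\<lambda>x. indicator A x * (indicator {0..1} x * cinner f (u x)))" if "A \<in> sets borel"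
    by (rule cut_kernel[OF u C that])
qed

lemma kernel_op_add:
  assumes "continuous_on UNIV u" "continuous_on UNIV v"
  shows "kernel_op (\<lambda>x. u x + v x) = kernel_op u + kernel_op v"
proof (rule op_eqI)
  fix f
  show "kernel_op (\<lambda>x. u x + v x) f = (kernel_op u + kernel_op v) f"
    unfolding blinfun.add_left kernel_apply[OF assms(1)] kernel_apply[OF assms(2)]
      kernel_apply[OF continuous_on_add[OF assms]] L2_of_add[OF kernel_sqi[OF assms(1)] kernel_sqi[OF assms(2)]]
    by (simp add: cinner_add_right distrib_left)
qed

subsection \<open>The Volterra operator and its skew part\<close>

text \<open>For x in [0,1] the vector \<open>seg 1 - seg x\<close> is the indicator of (x, 1]. So
  \<open>volterra_up\<close> maps f to its integral from x to 1, \<open>volterra_low\<close> to its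
  integral from 0 to x, and \<open>sign_op\<close> is their difference, with kernel sgn(u -
  x).\<close>

definition volterra_up :: op where "volterra_up = kernel_op (\<lambda>x. seg 1 - seg x)"
definition volterra_low :: op where "volterra_low = kernel_op seg"
definition sign_op :: op where "sign_op = kernel_op (\<lambda>x. seg 1 - 2 *\<^sub>R seg x)"

lemma continuous_kernels:
  "continuous_on UNIV (\<lambda>x. seg 1 - seg x)" "continuous_on UNIV (\<lambda>x. seg 1 - 2 *\<^sub>R seg x)"
  by (intro continuous_intros continuous_seg)+

lemma kernel_const: "kernel_op (\<lambda>_. seg 1) = rank_one (seg 1) (seg 1)"
proof (rule op_eqI)
  fix f
  have "rank_one (seg 1) (seg 1) f = L2_of (\<lambda>x. cinner f (seg 1) * indicator {0..1} x)"
    by (subst rank_one_apply, subst (2) seg_def, rule L2_of_scaleC[OF square_integrable_seg])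
  then show "kernel_op (\<lambda>_. seg 1) f = rank_one (seg 1) (seg 1) f"
    by (simp add: kernel_apply mult.commute)
qed

lemma volterra_up_plus_low: "volterra_up + volterra_low = rank_one (seg 1) (seg 1)"
  unfolding volterra_up_def volterra_low_def kernel_op_add[OF continuous_kernels(1) continuous_seg, symmetric]
  by (simp add: kernel_const)

lemma volterra_up_minus_low: "volterra_up - volterra_low = sign_op"
proof -
  have "sign_op + volterra_low = volterra_up"
    unfolding volterra_up_def volterra_low_def sign_op_def
      kernel_op_add[OF continuous_kernels(2) continuous_seg, symmetric]
    by (rule arg_cong[of _ _ kernel_op]) (auto simp: scaleR_2)
  then show ?thesis by (metis add_diff_cancel_right')
qed

lemma seg_one: "seg 1 = expo 0"
  by (simp add: seg_def expo_def)

text \<open>The shift by 1/2 is the antiperiodic boundary condition: the exponential takes the value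
  -1 at the right end of [0,1].\<close>

definition freq :: "int \<Rightarrow> real" where "freq j = 2 * pi * (of_int j + 1/2)"

lemma cis_freq: "cis (freq j) = -1"
proof -
  have "cis (freq j) = cis (2 * pi * of_int j) * cis pi"
    unfolding cis_mult by (rule arg_cong[of _ _ cis]) (simp add: freq_def algebra_simps)
  then show ?thesis by (simp add: cis_2pi_int)
qed

lemma freq_nonzero: "freq j \<noteq> 0"
proof
  assume "freq j = 0"
  then have "real_of_int (2 * j + 1) = 0" by (simp add: freq_def)
  then have "2 * j + 1 = 0" by (simp only: of_int_eq_0_iff)
  then show False by presburger
qed

lemma half_int_nonzero: "real_of_int j + 1/2 \<noteq> 0"
  using freq_nonzero[of j] by (auto simp: freq_def)

definition fexp :: "int \<Rightarrow> L2" where "fexp j = expo (freq j)"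
definition eexp :: "nat \<Rightarrow> L2" where "eexp m = expo (2 * pi * real m)"

lemma orthonormal_fexp: "orthonormal fexp UNIV"
  unfolding orthonormal_def
proof (intro ballI)
  fix j k :: int
  have "freq j - freq k = 2 * pi * of_int (j - k)" by (simp add: freq_def algebra_simps)
  then have "cis (freq j - freq k) = 1" by (simp only: cis_2pi_int)
  moreover have "freq j = freq k \<longleftrightarrow> j = k" by (simp add: freq_def)
  ultimately show "cinner (fexp j) (fexp k) = (if j = k then 1 else 0)"
    by (simp add: fexp_def cinner_expo_expo)
qed

lemma orthonormal_eexp: "orthonormal eexp UNIV"
  unfolding orthonormal_def
proof (intro ballI)
  fix j k :: nat
  have "2 * pi * real j - 2 * pi * real k = 2 * pi * of_int (int j - int k)" by (simp add: algebra_simps)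
  then have "cis (2 * pi * real j - 2 * pi * real k) = 1" by (simp only: cis_2pi_int)
  then show "cinner (eexp j) (eexp k) = (if j = k then 1 else 0)"
    by (simp add: eexp_def cinner_expo_expo)
qed

definition sgn_eig :: "int \<Rightarrow> real" where "sgn_eig j = 1 / (pi * (of_int j + 1/2))"

text \<open>Integrating the exponential over (x,1] and over [0,x] leaves the constant (cis a - 1) +
  2 besides a multiple of the exponential. It is 0 precisely because cis a = -1.\<close>

lemma sign_op_fexp: "sign_op (fexp j) = (\<i> * complex_of_real (sgn_eig j)) *\<^sub>C fexp j"
proof -
  define a where "a = freq j"
  have a: "a \<noteq> 0" "cis a = -1" using freq_nonzero cis_freq by (auto simp: a_def)
  have ev: "\<i> * complex_of_real (sgn_eig j) = 2 * \<i> / a"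
  proof -
    have "sgn_eig j = 2 / a" by (simp add: sgn_eig_def a_def freq_def)
    then show ?thesis by simp
  qed
  have "cinner (expo a) (seg 1 - 2 *\<^sub>R seg x) = (2 * \<i> / a) * cis (a * x)" if x: "x \<in> {0..1}" for x
  proof -
    have "cinner (expo a) (seg 1 - 2 *\<^sub>R seg x) = (cis (a * 1) - 1) / (\<i> * a) - 2 * ((cis (a * x) - 1) / (\<i> * a))"
      using x a by (simp add: cinner_diff_right scaleR_scaleC cinner_scaleC_right cinner_expo_seg)
    also have "\<dots> = (2 * \<i> / a) * cis (a * x)"
      using a by (simp add: field_simps)
    finally show ?thesis .
  qed
  then have "(\<lambda>x. indicator {0..1} x * cinner (expo a) (seg 1 - 2 *\<^sub>R seg x))
      = (\<lambda>x. (2 * \<i> / a) * (indicator {0..1} x * cis (a * x)))"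
    by (auto simp: indicator_def fun_eq_iff)
  then have "sign_op (expo a) = L2_of (\<lambda>x. (2 * \<i> / a) * (indicator {0..1} x * cis (a * x)))"
    unfolding sign_op_def kernel_apply[OF continuous_kernels(2)] by simp
  then show ?thesis
    unfolding ev fexp_def a_def[symmetric] by (simp add: L2_of_scaleC[OF square_integrable_expo] flip: expo_def) (simp add: expo_def L2_of_scaleC[OF square_integrable_expo])
qed

text \<open>The series for pi^2/6 is grouped in consecutive pairs; the even member of the n-th pair
  is a quarter of the n-th term of the whole series, and subtracting these leaves 3/4 of
  pi^2/6.\<close>

lemma odd_inverse_squares: "(\<lambda>n. 1 / (2 * real n + 1)\<^sup>2) sums (pi\<^sup>2 / 8)"
proof -
  define a where "a n = 1 / (real n + 1)\<^sup>2" for n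
  have a: "a sums (pi\<^sup>2 / 6)" using inverse_squares_sums by (simp add: a_def[abs_def] add.commute)
  have 1: "(\<lambda>n. sum a {n*2..<n*2+2}) sums (pi\<^sup>2 / 6)" by (rule sums_group[OF a]) simp
  have 2: "(\<lambda>n. 1/4 * a n) sums (1/4 * (pi\<^sup>2 / 6))" by (rule sums_mult[OF a])
  have 3: "sum a {n*2..<n*2+2} - 1/4 * a n = 1 / (2 * real n + 1)\<^sup>2" for n
  proof -
    have "{n*2..<n*2+2} = {2*n, 2*n+1}" by auto
    then have "sum a {n*2..<n*2+2} = a (2*n) + a (2*n+1)" by simp
    moreover have "a (2*n+1) = 1/4 * a n"
    proof -
      have "(real (2*n+1) + 1)\<^sup>2 = 4 * (real n + 1)\<^sup>2" by (simp add: power2_eq_square algebra_simps)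
      then show ?thesis by (simp add: a_def)
    qed
    ultimately show ?thesis by (simp add: a_def)
  qed
  from sums_diff[OF 1 2] show ?thesis unfolding 3 by simp
qed

text \<open>The window from -N to N-1 is invariant under j -> -j-1, so the terms pair up to 8/pi^2
  times inverse odd squares. The limit 1 is the integral of |sgn(u - s)|^2 over the unit
  square.\<close>

lemma sgn_eig_square_sum: "(\<lambda>N::nat. \<Sum>j\<in>{- int N..<int N}. (sgn_eig j)\<^sup>2) \<longlonglongrightarrow> 1"
proof -
  have eq: "(\<Sum>j\<in>{- int N..<int N}. (sgn_eig j)\<^sup>2) = (\<Sum>n<N. 8 / pi\<^sup>2 * (1 / (2 * real n + 1)\<^sup>2))" for N
  proof (induction N)
    case (Suc N)
    have s: "(sgn_eig (int N))\<^sup>2 = 4 / pi\<^sup>2 * (1 / (2 * real N + 1)\<^sup>2)"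
    proof -
      have "sgn_eig (int N) = 2 / pi * (1 / (2 * real N + 1))"
        by (simp add: sgn_eig_def divide_simps)
      then show ?thesis by (simp only: power_mult_distrib power_divide) simp
    qed
    have "sgn_eig (- int (Suc N)) = - sgn_eig (int N)"
      by (simp add: sgn_eig_def divide_simps)
    then have s': "(sgn_eig (- int (Suc N)))\<^sup>2 = 4 / pi\<^sup>2 * (1 / (2 * real N + 1)\<^sup>2)" using s by simp
    have "{- int (Suc N)..<int (Suc N)} = insert (- int (Suc N)) (insert (int N) {- int N..<int N})" by auto
    then have "(\<Sum>j\<in>{- int (Suc N)..<int (Suc N)}. (sgn_eig j)\<^sup>2)
      = (sgn_eig (- int (Suc N)))\<^sup>2 + ((sgn_eig (int N))\<^sup>2 + (\<Sum>j\<in>{- int N..<int N}. (sgn_eig j)\<^sup>2))"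
      by (simp del: of_nat_Suc) 
    then show ?case unfolding Suc s s' by simp
  qed simp
  have "(\<lambda>n. 8 / pi\<^sup>2 * (1 / (2 * real n + 1)\<^sup>2)) sums (8 / pi\<^sup>2 * (pi\<^sup>2 / 8))"
    by (rule sums_mult[OF odd_inverse_squares])
  then show ?thesis unfolding eq sums_def by simp
qed

lemma norm_sign_kernel: "x \<in> {0..1} \<Longrightarrow> norm (seg 1 - 2 *\<^sub>R seg x) \<le> 1"
proof -
  assume x: "x \<in> {0..1}"
  have "cinner (seg 1 - 2 *\<^sub>R seg x) (seg 1 - 2 *\<^sub>R seg x) = 1"
    using x by (simp add: cinner_diff_left cinner_diff_right scaleR_scaleC cinner_scaleC_left cinner_scaleC_right cinner_seg_seg)
  then show ?thesis using norm_sq_cinner[of "seg 1 - 2 *\<^sub>R seg x"] by (simp add: power2_eq_1_iff) (smt (verit) norm_ge_zero)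
qed

text \<open>
  The eigenvalues on the exponentials already exhaust the Hilbert-Schmidt norm (by \<open>\<zeta>(2) = \<pi>\<^sup>2/6\<close>),
  so nothing is left for the orthogonal complement. This replaces completeness of the trigonometric system.
\<close>

lemma sign_op_orthogonal:
  assumes g: "\<And>j. cinner g (fexp j) = 0"
  shows "sign_op g = 0"
proof (rule ccontr)
  assume n: "sign_op g \<noteq> 0"
  then have g0: "g \<noteq> 0" by (auto simp: blinfun.zero_right)
  define h where "h = (1 / norm g) *\<^sub>R g"
  have h: "norm h = 1" "cinner h (fexp j) = 0" "cinner (fexp j) h = 0" for j
    using g0 g cinner_swap_zero[of g]
    by (simp_all add: h_def, simp_all add: scaleR_scaleC cinner_scaleC_left cinner_scaleC_right)
  define b where "b i = (case i of None \<Rightarrow> h | Some j \<Rightarrow> fexp j)" for i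
  have on: "orthonormal b UNIV"
    using h cinner_self[of h] orthonormal_fexp by (auto simp: orthonormal_def b_def split: option.splits)
  have "(norm (sign_op h))\<^sup>2 + (\<Sum>j\<in>{- int N..<int N}. (sgn_eig j)\<^sup>2) \<le> 1" for N
  proof -
    have "(\<Sum>i\<in>insert None (Some ` {- int N..<int N}). (norm (sign_op (b i)))\<^sup>2) \<le> 1\<^sup>2"
      unfolding sign_op_def
      by (rule kernel_op_Hilbert_Schmidt[OF continuous_kernels(2) norm_sign_kernel orthonormal_subset[OF on subset_UNIV]]) auto
    moreover have "(norm (sign_op (fexp j)))\<^sup>2 = (sgn_eig j)\<^sup>2" for j
      using orthonormal_norm[OF orthonormal_fexp, of j] by (simp add: sign_op_fexp norm_scaleC norm_mult)
    ultimately show ?thesis by (simp add: b_def sum.reindex)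
  qed
  then have "(norm (sign_op h))\<^sup>2 + 1 \<le> 1"
    by (intro LIMSEQ_le_const2[OF tendsto_add[OF tendsto_const sgn_eig_square_sum]]) auto
  then show False using n g0 by (simp add: h_def blinfun.scaleR_right)
qed

lemma sgn_eig_bounded: "\<bar>sgn_eig j\<bar> \<le> 1"
proof -
  have "\<bar>real_of_int j + 1/2\<bar> \<ge> 1/2"
  proof (cases "j \<ge> 0")
    case False
    then have "real_of_int j \<le> -1" by simp
    then show ?thesis by simp
  qed simp
  then have "pi * \<bar>real_of_int j + 1/2\<bar> \<ge> 2 * (1/2)" using pi_ge_two by (intro mult_mono) auto
  then show ?thesis by (simp add: sgn_eig_def abs_mult divide_simps)
qed

lemma sign_op_diag: "sign_op = diag fexp UNIV (\<lambda>j. \<i> * complex_of_real (sgn_eig j))"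
proof (rule diag_unique[OF orthonormal_fexp])
  show "bounded_on UNIV (\<lambda>j. \<i> * complex_of_real (sgn_eig j))"
    by (rule bounded_onI[of _ _ 1]) (simp add: norm_mult sgn_eig_bounded)
  show "sign_op \<in> BL2" unfolding sign_op_def by (rule kernel_BL2[OF continuous_kernels(2)])
qed (auto simp: sign_op_fexp sign_op_orthogonal)

subsection \<open>Modulation\<close>

definition modulate :: "int \<Rightarrow> op" where "modulate m = mult_op (\<lambda>x. cis (2 * pi * of_int m * x))"

lemma contractive_modulate: "contractive (\<lambda>x. cis (2 * pi * of_int m * x))"
  unfolding contractive_def by (auto intro!: borel_measurable_continuous_onI continuous_intros)

lemma modulate_expo: "modulate m (expo a) = expo (a + 2 * pi * of_int m)"
  unfolding modulate_def expo_def
  by (subst mult_op_L2_of[OF contractive_modulate square_integrable_expo], rule arg_cong[of _ _ L2_of])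
     (auto simp: indicator_def cis_mult algebra_simps)

lemma modulate_adjoint: "adjoint_pair (modulate m) (modulate (- m))"
  using mult_op_adjoint[OF contractive_modulate, of m] by (simp add: modulate_def cis_cnj)

lemma modulate_cut: "A \<in> sets borel \<Longrightarrow> modulate m o\<^sub>L cut A = cut A o\<^sub>L modulate m"
  unfolding modulate_def cut_def by (rule mult_op_commute[OF contractive_modulate contractive_indicator])

lemma norm_modulate: "norm (modulate m) \<le> 1"
  unfolding modulate_def by (rule norm_mult_op[OF contractive_modulate])

lemma modulate_BL2: "modulate m \<in> BL2"
  unfolding modulate_def by (rule mult_op_BL2[OF contractive_modulate])

lemma modulate_fexp: "modulate m (fexp j) = fexp (j + m)"
  unfolding fexp_def modulate_expo by (simp add: freq_def algebra_simps)

text \<open>Conjugation by multiplication with the m-th exponential. It multiplies a kernel by a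
  unimodular function, hence keeps its support and triangularity, and it moves the constant function
  on [0,1] to \<open>eexp m\<close>.\<close>

definition mconj :: "nat \<Rightarrow> op \<Rightarrow> op"
  where "mconj m T = modulate (int m) o\<^sub>L T o\<^sub>L modulate (- int m)"

lemma mconj_add: "mconj m (S + T) = mconj m S + mconj m T"
  by (simp add: mconj_def comp_add_left comp_add_right)
lemma mconj_diff: "mconj m (S - T) = mconj m S - mconj m T"
  by (simp add: mconj_def comp_diff_left comp_diff_right)

lemma mconj_rank_one: "mconj m (rank_one (seg 1) (seg 1)) = rank_one (eexp m) (eexp m)"
proof (rule op_eqI)
  fix f
  have "modulate (int m) (seg 1) = eexp m" by (simp add: seg_one modulate_expo eexp_def)
  moreover have "cinner (modulate (- int m) f) (seg 1) = cinner f (modulate (int m) (seg 1))"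
    using adjoint_pairD[OF modulate_adjoint[of "- int m"]] by simp
  ultimately show "mconj m (rank_one (seg 1) (seg 1)) f = rank_one (eexp m) (eexp m) f"
    by (simp add: mconj_def rank_one_apply BL2_scaleC[OF modulate_BL2])
qed

text \<open>Modulation shifts the half-integer frequencies, so all the conjugates stay diagonal in
  the same family. Summed with weights \<open>mu m\<close> their eigenvalues form a convolution, the
  discrete Hilbert transform.\<close>

lemma mconj_sign_op: "mconj m sign_op = diag fexp UNIV (\<lambda>j. \<i> * complex_of_real (sgn_eig (j - int m)))"
proof (rule diag_unique[OF orthonormal_fexp])
  show "bounded_on UNIV (\<lambda>j. \<i> * complex_of_real (sgn_eig (j - int m)))"
    by (rule bounded_onI[of _ _ 1]) (simp add: norm_mult sgn_eig_bounded)
  show "mconj m sign_op \<in> BL2" unfolding mconj_def sign_op_def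
    by (intro BL2_comp modulate_BL2 kernel_BL2[OF continuous_kernels(2)])
  show "mconj m sign_op (fexp j) = (\<i> * complex_of_real (sgn_eig (j - int m))) *\<^sub>C fexp j" for j
    by (simp add: mconj_def modulate_fexp sign_op_fexp BL2_scaleC[OF modulate_BL2])
  fix g assume "\<And>j. j \<in> UNIV \<Longrightarrow> cinner g (fexp j) = 0"
  then have "cinner (modulate (- int m) g) (fexp j) = 0" for j
    using adjoint_pairD[OF modulate_adjoint[of "- int m"], of g "fexp j"] by (simp add: modulate_fexp)
  then show "mconj m sign_op g = 0" by (simp add: mconj_def sign_op_orthogonal blinfun.zero_right)
qed

lemma diag_diff:
  assumes f: "orthonormal f I" and m: "bounded_on I m" "bounded_on I m'" and d: "bounded_on I (\<lambda>i. m i - m' i)"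
  shows "diag f I m - diag f I m' = diag f I (\<lambda>i. m i - m' i)"
proof -
  have "diag f I (\<lambda>i. m i - m' i) + diag f I m' = diag f I m"
    using diag_add[OF f d m(2)] by simp
  then show ?thesis by (metis add_diff_cancel_right')
qed

section \<open>Compactness of diagonal operators with decaying symbol and of the Volterra
  operator\<close>

lemma compact_diag:
  assumes f: "orthonormal f I" and m: "bounded_on I m" and fin: "\<And>e. e > 0 \<Longrightarrow> finite {i \<in> I. norm (m i) > e}"
  shows "compact_op (diag f I m)"
proof (rule compact_op_lim)
  define F where "F n = {i \<in> I. norm (m i) > 1 / real (Suc n)}" for n
  define T where "T n = (\<Sum>i\<in>F n. rank_one (m i *\<^sub>C f i) (f i))" for n
  have F: "finite (F n)" "F n \<subseteq> I" for n using fin[of "1 / real (Suc n)"] by (auto simp: F_def)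
  obtain C where C: "C \<ge> 0" "\<And>i. i \<in> I \<Longrightarrow> norm (m i) \<le> C" using bounded_onE[OF m] by blast
  have b1: "bounded_on I (\<lambda>i. if i \<in> F n then m i else 0)" for n
    using C by (intro bounded_onI[of _ _ C]) auto
  have b2: "norm (m i - (if i \<in> F n then m i else 0)) \<le> 1 / real (Suc n)" if "i \<in> I" for i n
    using that by (auto simp: F_def not_less simp del: of_nat_Suc)
  have T: "T n = diag f I (\<lambda>i. if i \<in> F n then m i else 0)" for n
  proof (rule diag_unique[OF f b1])
    show "T n \<in> BL2" unfolding T_def by (intro BL2_sum rank_one_BL2)
    show "T n (f i) = (if i \<in> F n then m i else 0) *\<^sub>C f i" if "i \<in> I" for i
    proof -
      have "T n (f i) = (\<Sum>j\<in>F n. if i = j then m i *\<^sub>C f i else 0)"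
        unfolding T_def blinfun.sum_left using that F(2)[of n]
        by (intro sum.cong refl) (auto simp: rank_one_apply orthonormalD[OF f])
      then show ?thesis using F(1)[of n] by simp
    qed
    show "T n g = 0" if "\<And>i. i \<in> I \<Longrightarrow> cinner g (f i) = 0" for g
      unfolding T_def blinfun.sum_left using that F(2)[of n]
      by (intro sum.neutral) (auto simp: rank_one_apply)
  qed
  show "compact_op (T n)" for n unfolding T_def by (intro compact_op_sum compact_op_rank_one)
  have "norm (T n - diag f I m) \<le> 1 / real (Suc n)" for n
  proof -
    have "diag f I m - T n = diag f I (\<lambda>i. m i - (if i \<in> F n then m i else 0))"
      unfolding T by (rule diag_diff[OF f m b1 bounded_onI[OF b2]])
    moreover have "norm (diag f I (\<lambda>i. m i - (if i \<in> F n then m i else 0))) \<le> 1 / real (Suc n)"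
      by (rule norm_diag_le[OF f b2]) auto
    ultimately show ?thesis by (simp only: norm_minus_commute[of "T n"])
  qed
  moreover have "(\<lambda>n. 1 / real (Suc n)) \<longlonglongrightarrow> 0"
    using LIMSEQ_inverse_real_of_nat by (simp only: inverse_eq_divide)
  ultimately have "(\<lambda>n. T n - diag f I m) \<longlonglongrightarrow> 0"
    by (intro Lim_null_comparison[of "\<lambda>n. T n - diag f I m" "\<lambda>n. 1 / real (Suc n)"]) (rule always_eventually, blast)
  then show "T \<longlonglongrightarrow> diag f I m" by (rule LIM_zero_cancel)
qed

lemma compact_sign_op: "compact_op sign_op"
  unfolding sign_op_diag
proof (rule compact_diag[OF orthonormal_fexp])
  show "bounded_on UNIV (\<lambda>j. \<i> * complex_of_real (sgn_eig j))"
    by (rule bounded_onI[of _ _ 1]) (simp add: norm_mult sgn_eig_bounded)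
  fix e :: real assume e: "e > 0"
  have "{j \<in> UNIV. norm (\<i> * complex_of_real (sgn_eig j)) > e} \<subseteq> {- \<lceil>1/e\<rceil> - 1..\<lceil>1/e\<rceil> + 1}"
  proof
    fix j assume "j \<in> {j \<in> UNIV. norm (\<i> * complex_of_real (sgn_eig j)) > e}"
    then have "e < \<bar>sgn_eig j\<bar>" by (simp add: norm_mult)
    then have "e < 1 / (pi * \<bar>real_of_int j + 1/2\<bar>)" by (simp add: sgn_eig_def abs_mult)
    then have "e * (pi * \<bar>real_of_int j + 1/2\<bar>) < 1"
      using half_int_nonzero[of j] by (simp add: field_simps)
    moreover have "e * (1 * \<bar>real_of_int j + 1/2\<bar>) \<le> e * (pi * \<bar>real_of_int j + 1/2\<bar>)"
      using e pi_ge_two by (intro mult_left_mono mult_right_mono) auto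
    ultimately have "e * \<bar>real_of_int j + 1/2\<bar> < 1" by linarith
    then have "\<bar>real_of_int j + 1/2\<bar> < 1/e" using e by (simp add: pos_less_divide_eq mult.commute)
    then have "real_of_int j < of_int \<lceil>1/e\<rceil>" "real_of_int j > - of_int \<lceil>1/e\<rceil> - 1" using le_of_int_ceiling[of "1/e"] by linarith+
    then show "j \<in> {- \<lceil>1/e\<rceil> - 1..\<lceil>1/e\<rceil> + 1}" by simp
  qed
  then show "finite {j \<in> UNIV. norm (\<i> * complex_of_real (sgn_eig j)) > e}"
    by (rule finite_subset) simp
qed

lemma volterra_halves:
  "volterra_up = (1/2) *\<^sub>R (rank_one (seg 1) (seg 1) + sign_op)"
  "volterra_low = (1/2) *\<^sub>R (rank_one (seg 1) (seg 1) - sign_op)"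
  unfolding volterra_up_plus_low[symmetric] volterra_up_minus_low[symmetric]
  by (auto simp: scaleR_add_right scaleR_diff_right simp flip: scaleR_add_left)

lemma compact_volterra_up: "compact_op volterra_up"
  unfolding volterra_halves by (intro compact_op_scaleR compact_op_add compact_op_rank_one compact_sign_op)

subsection \<open>Triangularity\<close>

text \<open>The range of every \<open>cut {..<s}\<close> is invariant under T. The condition
  \<open>lower_tri\<close> says the same of the range of the complementary projection; the two are
  exchanged by taking adjoints.\<close>

definition upper_tri :: "op \<Rightarrow> bool"
  where "upper_tri T \<longleftrightarrow> (\<forall>s. cut {..<s} o\<^sub>L T o\<^sub>L cut {..<s} = T o\<^sub>L cut {..<s})"

definition lower_tri :: "op \<Rightarrow> bool"
  where "lower_tri T \<longleftrightarrow> (\<forall>s. cut {..<s} o\<^sub>L T o\<^sub>L (id_blinfun - cut {..<s}) = 0)"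

lemma cut_seg: "A \<in> sets borel \<Longrightarrow> cut A (seg x) = L2_of (indicator (A \<inter> {0..x}))"
  unfolding seg_def by (subst cut_L2_of[OF _ square_integrable_seg]) (simp_all add: indicator_inter_arith[abs_def])

text \<open>For x >= s the kernel vector \<open>seg 1 - seg x\<close> lives on (x, 1], outside
  {..<s}, so a function cut off at s has an image that vanishes from s on.\<close>

lemma upper_tri_volterra: "upper_tri volterra_up"
  unfolding upper_tri_def
proof (intro allI op_eqI)
  fix s f
  define P where "P = cut {..<s}"
  have Pa: "adjoint_pair P P" unfolding P_def by (rule cut_adjoint) simp
  have 0: "cinner (P f) (seg 1 - seg x) = 0" if "x \<in> {0..1}" "s \<le> x" for x
  proof -
    have "{..<s} \<inter> {0..1} = {..<s} \<inter> {0..x}" using that by auto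
    then have "P (seg 1 - seg x) = 0" by (simp add: P_def blinfun.diff_right cut_seg)
    then show ?thesis by (simp add: adjoint_pairD[OF Pa])
  qed
  have "cut {..<s} (volterra_up (P f))
      = L2_of (\<lambda>x. indicator {..<s} x * (indicator {0..1} x * cinner (P f) (seg 1 - seg x)))"
    unfolding volterra_up_def by (rule kernel_cut[OF continuous_kernels(1)]) simp
  also have "\<dots> = volterra_up (P f)"
    unfolding volterra_up_def kernel_apply[OF continuous_kernels(1)]
    by (rule arg_cong[of _ _ L2_of]) (use 0 in \<open>auto simp: indicator_def fun_eq_iff\<close>)
  finally show "(cut {..<s} o\<^sub>L volterra_up o\<^sub>L cut {..<s}) f = (volterra_up o\<^sub>L cut {..<s}) f"
    by (simp add: P_def)
qed

lemma lower_tri_volterra: "lower_tri volterra_low"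
  unfolding lower_tri_def
proof (intro allI op_eqI)
  fix s f
  define P where "P = id_blinfun - cut {..<s}"
  have Pa: "adjoint_pair P P" unfolding P_def by (intro adjoint_pair_diff adjoint_pair_id cut_adjoint) simp
  have 0: "cinner (P f) (seg x) = 0" if "x < s" for x
  proof -
    have "{..<s} \<inter> {0..x} = {0..x}" using that by auto
    then have "P (seg x) = 0" by (simp add: P_def blinfun.diff_left cut_seg) (simp add: seg_def)
    then show ?thesis by (simp add: adjoint_pairD[OF Pa])
  qed
  have "cut {..<s} (volterra_low (P f))
      = L2_of (\<lambda>x. indicator {..<s} x * (indicator {0..1} x * cinner (P f) (seg x)))"
    unfolding volterra_low_def by (rule kernel_cut[OF continuous_seg]) simp
  also have "\<dots> = L2_of (\<lambda>x. 0)"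
    by (rule arg_cong[of _ _ L2_of]) (use 0 in \<open>auto simp: indicator_def fun_eq_iff\<close>)
  also have "\<dots> = 0" using L2_of_scaleC[of "\<lambda>x. 0" 0] by (simp add: square_integrable_zero)
  finally show "(cut {..<s} o\<^sub>L volterra_low o\<^sub>L (id_blinfun - cut {..<s})) f = blinfun_apply 0 f"
    by (simp add: P_def)
qed

lemma upper_tri_add: "upper_tri S \<Longrightarrow> upper_tri T \<Longrightarrow> upper_tri (S + T)"
  by (simp add: upper_tri_def comp_add_left comp_add_right)
lemma upper_tri_scaleR: "upper_tri T \<Longrightarrow> upper_tri (r *\<^sub>R T)"
  by (simp add: upper_tri_def comp_scaleR_left comp_scaleR_right)
lemma upper_tri_sum: "(\<And>i. i \<in> F \<Longrightarrow> upper_tri (T i)) \<Longrightarrow> upper_tri (\<Sum>i\<in>F. T i)"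
  by (induction F rule: infinite_finite_induct) (auto intro: upper_tri_add simp: upper_tri_def[of 0])
lemma lower_tri_add: "lower_tri S \<Longrightarrow> lower_tri T \<Longrightarrow> lower_tri (S + T)"
  by (simp add: lower_tri_def comp_add_left comp_add_right)
lemma lower_tri_scaleR: "lower_tri T \<Longrightarrow> lower_tri (r *\<^sub>R T)"
  by (simp add: lower_tri_def comp_scaleR_left comp_scaleR_right)
lemma lower_tri_sum: "(\<And>i. i \<in> F \<Longrightarrow> lower_tri (T i)) \<Longrightarrow> lower_tri (\<Sum>i\<in>F. T i)"
  by (induction F rule: infinite_finite_induct) (auto intro: lower_tri_add simp: lower_tri_def[of 0])

lemma upper_tri_lim:
  assumes "\<And>n. upper_tri (T n)" "T \<longlonglongrightarrow> S" shows "upper_tri S"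
  unfolding upper_tri_def
proof
  fix s
  show "cut {..<s} o\<^sub>L S o\<^sub>L cut {..<s} = S o\<^sub>L cut {..<s}"
  proof (rule LIMSEQ_unique)
    show "(\<lambda>n. cut {..<s} o\<^sub>L T n o\<^sub>L cut {..<s}) \<longlonglongrightarrow> (cut {..<s} o\<^sub>L S o\<^sub>L cut {..<s})"
      by (intro tendsto_comp tendsto_const assms)
    show "(\<lambda>n. cut {..<s} o\<^sub>L T n o\<^sub>L cut {..<s}) \<longlonglongrightarrow> (S o\<^sub>L cut {..<s})"
      using assms(1) unfolding upper_tri_def by (simp, intro tendsto_comp tendsto_const assms)
  qed
qed

lemma lower_tri_lim:
  assumes "\<And>n. lower_tri (T n)" "T \<longlonglongrightarrow> S" shows "lower_tri S"
  unfolding lower_tri_def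
proof
  fix s
  have "(\<lambda>n. cut {..<s} o\<^sub>L T n o\<^sub>L (id_blinfun - cut {..<s})) \<longlonglongrightarrow> (cut {..<s} o\<^sub>L S o\<^sub>L (id_blinfun - cut {..<s}))"
    by (intro tendsto_comp tendsto_const assms)
  then show "cut {..<s} o\<^sub>L S o\<^sub>L (id_blinfun - cut {..<s}) = 0"
    using assms(1) unfolding lower_tri_def by (simp add: LIMSEQ_const_iff)
qed

lemma mconj_cut_left: "A \<in> sets borel \<Longrightarrow> cut A o\<^sub>L mconj m T = mconj m (cut A o\<^sub>L T)"
  unfolding mconj_def by (metis comp_assoc modulate_cut)
lemma mconj_cut_right: "A \<in> sets borel \<Longrightarrow> mconj m T o\<^sub>L cut A = mconj m (T o\<^sub>L cut A)"
  unfolding mconj_def by (metis comp_assoc modulate_cut)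

lemma mconj_zero: "mconj m 0 = 0" by (simp add: mconj_def)

lemma upper_tri_mconj: "upper_tri T \<Longrightarrow> upper_tri (mconj m T)"
  by (simp add: upper_tri_def mconj_cut_left mconj_cut_right)

lemma lower_tri_mconj: "lower_tri T \<Longrightarrow> lower_tri (mconj m T)"
  by (simp add: lower_tri_def mconj_cut_left mconj_cut_right comp_diff_right mconj_diff[symmetric] mconj_zero)

subsection \<open>The partition of the half-line\<close>

text \<open>For K >= 1 these are the intervals [j/K, (j+1)/K), except that \<open>nat\<close> puts
  all negative reals into cell 0 and the minimum collects [1, oo) in cell K.\<close>

definition cell :: "nat \<Rightarrow> nat \<Rightarrow> real set"
  where "cell K j = {x. min (nat \<lfloor>real K * x\<rfloor>) K = j}"

lemma cell_borel: "cell K j \<in> sets borel"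
proof -
  have "(\<lambda>x. min (nat \<lfloor>real K * x\<rfloor>) K) \<in> measurable borel (count_space UNIV)" by measurable
  then have "(\<lambda>x. min (nat \<lfloor>real K * x\<rfloor>) K) -` {j} \<inter> space borel \<in> sets borel" by (rule measurable_sets) simp
  then show ?thesis by (simp add: cell_def vimage_def)
qed

lemma cell_disjoint: "disjoint_family_on (cell K) I"
  by (auto simp: disjoint_family_on_def cell_def)

lemma cell_empty: "j > K \<Longrightarrow> cell K j = {}"
  by (auto simp: cell_def)

lemma cell_union: 
  assumes "K \<ge> 1"
  shows "(\<Union>i\<le>k. cell K i) = (if k < K then {..<real (Suc k) / real K} else UNIV)"
proof (cases "k < K")
  case True
  have "x \<in> (\<Union>i\<le>k. cell K i) \<longleftrightarrow> x < real (Suc k) / real K" for x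
  proof -
    have "x \<in> (\<Union>i\<le>k. cell K i) \<longleftrightarrow> nat \<lfloor>real K * x\<rfloor> \<le> k" using True by (auto simp: cell_def)
    also have "\<dots> \<longleftrightarrow> \<lfloor>real K * x\<rfloor> < int (Suc k)" by linarith
    also have "\<dots> \<longleftrightarrow> real K * x < real (Suc k)" by (simp add: floor_less_iff)
    also have "\<dots> \<longleftrightarrow> x < real (Suc k) / real K" using assms by (simp add: field_simps)
    finally show ?thesis .
  qed
  then show ?thesis using True by auto
qed (auto simp: cell_def)

definition cellp :: "nat \<Rightarrow> nat \<Rightarrow> op" where "cellp K j = cut (cell K j)"

lemma cellp_sum: "(\<Sum>i\<le>k. cellp K i) = cut (\<Union>i\<le>k. cell K i)"
  unfolding cellp_def by (rule cut_finite_union[symmetric]) (auto simp: cell_borel cell_disjoint)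

lemma cellp_system: "K \<ge> 1 \<Longrightarrow> block_system {..K} (cellp K)"
  unfolding block_system_def
proof (intro conjI ballI)
  assume K: "K \<ge> 1"
  show "adjoint_pair (cellp K j) (cellp K j)" for j by (simp add: cellp_def cut_adjoint cell_borel)
  show "cellp K i o\<^sub>L cellp K j = (if i = j then cellp K i else 0)" for i j
  proof -
    have "cell K i \<inter> cell K j = (if i = j then cell K i else {})" by (auto simp: cell_def)
    then show ?thesis by (simp add: cellp_def cut_comp cell_borel cut_empty)
  qed
  show "(\<Sum>j\<le>K. cellp K j) = id_blinfun" unfolding cellp_sum cell_union[OF K] by (simp add: cut_UNIV)
qed simp

lemma cellp_zero: "j > K \<Longrightarrow> cellp K j = 0"
  by (simp add: cellp_def cell_empty cut_empty)

text \<open>P_k V p_k = V p_k because V leaves the range of P_k invariant. For W the part of P_k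
  below cell k drops out, since P_(k-1) W p_k = 0, and p_k W p_k remains.\<close>

lemma truncation_split:
  assumes K: "K \<ge> 1" and V: "upper_tri V" and W: "lower_tri W"
  shows "(\<Sum>k\<le>K. (\<Sum>i\<le>k. cellp K i) o\<^sub>L (V + W) o\<^sub>L cellp K k) = V + pinching {..K} (cellp K) W"
proof -
  note sys = cellp_system[OF K]
  have pc: "(\<Sum>i\<le>k. cellp K i) o\<^sub>L cellp K j = (if j \<le> k then cellp K j else 0)" for k j
    by (rule partial_comp[OF sys cellp_zero])
  have one: "(\<Sum>i\<le>k. cellp K i) o\<^sub>L V o\<^sub>L cellp K k = V o\<^sub>L cellp K k" for k
  proof (cases "k < K")
    case True
    then have P: "(\<Sum>i\<le>k. cellp K i) = cut {..<real (Suc k) / real K}" by (simp only: cellp_sum cell_union[OF K] if_True)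
    have "(\<Sum>i\<le>k. cellp K i) o\<^sub>L V o\<^sub>L (\<Sum>i\<le>k. cellp K i) = V o\<^sub>L (\<Sum>i\<le>k. cellp K i)"
      unfolding P using V by (simp only: upper_tri_def)
    then have "(\<Sum>i\<le>k. cellp K i) o\<^sub>L V o\<^sub>L ((\<Sum>i\<le>k. cellp K i) o\<^sub>L cellp K k) = V o\<^sub>L ((\<Sum>i\<le>k. cellp K i) o\<^sub>L cellp K k)"
      by (metis comp_assoc)
    then show ?thesis by (simp add: pc)
  next
    case False
    then show ?thesis by (simp add: partial_sum_ge[OF sys cellp_zero])
  qed
  have two: "(\<Sum>i\<le>k. cellp K i) o\<^sub>L W o\<^sub>L cellp K k = cellp K k o\<^sub>L W o\<^sub>L cellp K k" if k: "k \<le> K" for k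
  proof (cases k)
    case 0 then show ?thesis by simp
  next
    case (Suc i)
    then have P: "(\<Sum>j\<le>i. cellp K j) = cut {..<real (Suc i) / real K}" using k by (simp only: cellp_sum cell_union[OF K]) simp
    have "(id_blinfun - (\<Sum>j\<le>i. cellp K j)) o\<^sub>L cellp K k = cellp K k"
      using Suc by (simp add: comp_diff_left pc)
    then have "(\<Sum>j\<le>i. cellp K j) o\<^sub>L W o\<^sub>L cellp K k
      = ((\<Sum>j\<le>i. cellp K j) o\<^sub>L W o\<^sub>L (id_blinfun - (\<Sum>j\<le>i. cellp K j))) o\<^sub>L cellp K k"
      by (metis comp_assoc)
    also have "\<dots> = 0" unfolding P using W by (simp add: lower_tri_def)
    finally show ?thesis using Suc by (simp add: comp_add_left)
  qed
  have "(\<Sum>k\<le>K. (\<Sum>i\<le>k. cellp K i) o\<^sub>L (V + W) o\<^sub>L cellp K k)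
      = (\<Sum>k\<le>K. V o\<^sub>L cellp K k) + (\<Sum>k\<le>K. cellp K k o\<^sub>L W o\<^sub>L cellp K k)"
    by (simp add: comp_add_left comp_add_right sum.distrib one two)
  also have "(\<Sum>k\<le>K. V o\<^sub>L cellp K k) = V"
    by (simp add: comp_sum_right[symmetric] block_sum[OF sys])
  finally show ?thesis by (simp add: pinching_def)
qed

text \<open>The blocks act in mutually orthogonal ranges, so by Pythagoras a common bound for the
  blocks bounds their sum.\<close>

lemma norm_pinching_le:
  fixes Y :: op
  assumes q: "block_system J q" and c: "c \<ge> 0" "\<And>j f. j \<in> J \<Longrightarrow> norm (q j (Y (q j f))) \<le> c * norm (q j f)"
  shows "norm (pinching J q Y) \<le> c"
proof (rule norm_blinfun_bound[OF c(1)])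
  fix f
  have qp: "q j (pinching J q Y f) = q j (Y (q j f))" if j: "j \<in> J" for j
  proof -
    have "q j (pinching J q Y f) = (\<Sum>i\<in>J. if j = i then q j (Y (q j f)) else 0)"
      unfolding pinching_def blinfun.sum_left blinfun.sum_right
      by (rule sum.cong) (auto simp: block_apply[OF q] j)
    then show ?thesis using j block_fin[OF q] by simp
  qed
  have "(norm (pinching J q Y f))\<^sup>2 = (\<Sum>j\<in>J. (norm (q j (pinching J q Y f)))\<^sup>2)"
    by (rule block_sum_norm[OF q, symmetric])
  also have "\<dots> = (\<Sum>j\<in>J. (norm (q j (Y (q j f))))\<^sup>2)"
    by (rule sum.cong) (simp_all add: qp)
  also have "\<dots> \<le> (\<Sum>j\<in>J. c\<^sup>2 * (norm (q j f))\<^sup>2)"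
  proof (rule sum_mono)
    fix j assume "j \<in> J"
    from power_mono[OF c(2)[OF this] norm_ge_zero, of f 2]
    show "(norm (q j (Y (q j f))))\<^sup>2 \<le> c\<^sup>2 * (norm (q j f))\<^sup>2" by (simp add: power_mult_distrib)
  qed
  also have "\<dots> = (c * norm f)\<^sup>2"
    by (simp add: sum_distrib_left[symmetric] block_sum_norm[OF q] power_mult_distrib)
  finally show "norm (pinching J q Y f) \<le> c * norm f"
    by (rule power2_le_imp_le) (simp add: c)
qed

lemma norm_cut_le: "A \<in> sets borel \<Longrightarrow> norm (cut A f) \<le> norm f"
  using norm_mult_fun_le[OF contractive_indicator] by (simp add: cut_def mult_op_apply contractive_indicator)

lemma norm_pinching_contract:
  "norm (pinching {..K} (cellp K) Y) \<le> norm Y" if "K \<ge> 1"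
proof (rule norm_pinching_le[OF cellp_system[OF that]])
  fix j f
  have "norm (cellp K j (Y (cellp K j f))) \<le> norm (Y (cellp K j f))"
    unfolding cellp_def by (rule norm_cut_le[OF cell_borel])
  also have "\<dots> \<le> norm Y * norm (cellp K j f)" by (rule norm_blinfun)
  finally show "norm (cellp K j (Y (cellp K j f))) \<le> norm Y * norm (cellp K j f)" .
qed simp

lemma half_line_singleton:
  assumes "0 \<le> a"
  shows "integrable half_line (indicator {a} :: real \<Rightarrow> real)" "integral\<^sup>L half_line (indicator {a} :: real \<Rightarrow> real) = 0"
proof -
  have eq: "(\<lambda>x. indicator {0..a} x *\<^sub>R (indicator {a} x :: real)) = indicator {a}"
    using assms by (auto simp: indicator_def)
  have "has_bochner_integral lborel (indicator {a} :: real \<Rightarrow> real) (measure lborel {a})"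
    by (rule has_bochner_integral_real_indicator) auto
  then have "has_bochner_integral half_line (indicator {a} :: real \<Rightarrow> real) 0"
    using has_integral_half_line[of a "indicator {a} :: real \<Rightarrow> real" 0] by (simp only: eq measure_lborel_singleton)
  then show "integrable half_line (indicator {a} :: real \<Rightarrow> real)" "integral\<^sup>L half_line (indicator {a} :: real \<Rightarrow> real) = 0"
    by (simp_all only: has_bochner_integral_iff)
qed

lemma norm_cell_seg:
  assumes K: "K \<ge> 1" and x: "x \<in> cell K j" "x \<in> {0..1}"
  shows "norm (cellp K j (seg x)) \<le> 1 / sqrt (real K)"
proof -
  define a where "a = real j / real K"
  have sub: "cell K j \<inter> {0<..x} \<subseteq> {a..a + 1 / real K}"
  proof
    fix y assume y: "y \<in> cell K j \<inter> {0<..x}"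
    \<comment> \<open>For x <= 1 the minimum in \<open>cell\<close> is inactive; in the last cell
      this leaves x = 1 only.\<close>
    have kx: "real K * x \<le> real K" using x K by (simp add: mult_left_le)
    then have "\<lfloor>real K * x\<rfloor> \<le> int K" by (simp add: floor_le_iff)
    then have "nat \<lfloor>real K * x\<rfloor> = j" using x by (auto simp: cell_def)
    then have xj: "real K * x < real j + 1" by (simp add: nat_eq_iff) (metis floor_eq_iff of_int_of_nat_eq nat_0_le linorder_not_le floor_less_zero mult_nonneg_nonneg of_nat_0_le_iff x(2) atLeastAtMost_iff int_nat_eq)
    have "y \<le> x" "y > 0" using y by auto
    then have "real K * y \<le> real K * x" by (simp add: mult_left_mono)
    have "real K * y \<ge> real j"
    proof -
      have "j \<le> nat \<lfloor>real K * y\<rfloor>" using y by (auto simp: cell_def)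
      then have "int j \<le> \<lfloor>real K * y\<rfloor>" using \<open>y > 0\<close> by (simp add: le_nat_iff)
      then show ?thesis by (simp add: le_floor_iff)
    qed
    moreover have "real K * y \<le> real j + 1" using xj \<open>real K * y \<le> real K * x\<close> by linarith
    ultimately show "y \<in> {a..a + 1 / real K}"
      using K by (simp add: a_def field_simps)
  qed
  have sq: "square_integrable (indicator (cell K j \<inter> {0..x}))"
    using square_integrable_mult[OF contractive_indicator[OF cell_borel] square_integrable_seg, of K j x]
    by (simp add: indicator_inter_arith[abs_def])
  have "(norm (cellp K j (seg x)))\<^sup>2 = (\<integral>y. (norm (indicator (cell K j \<inter> {0..x}) y :: complex))\<^sup>2 \<partial>half_line)"
    unfolding cellp_def cut_seg[OF cell_borel] by (rule norm_L2_of[OF sq])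
  \<comment> \<open>The right side is the indicator of [a, a + 1/K], expressed through intervals
    that start at 0 and a single point, whose integrals are known.\<close>
  also have "\<dots> \<le> (\<integral>y. indicator {0..a + 1 / real K} y - indicator {0..a} y + indicator {a} y \<partial>half_line)"
  proof (rule integral_mono)
    show "integrable half_line (\<lambda>y. (norm (indicator (cell K j \<inter> {0..x}) y :: complex))\<^sup>2)"
      using sq by (simp add: square_integrable_def)
    show "integrable half_line (\<lambda>y. indicator {0..a + 1 / real K} y - indicator {0..a} y + indicator {a} y :: real)"
      by (intro Bochner_Integration.integrable_add Bochner_Integration.integrable_diff half_line_indicator half_line_singleton) (auto simp: a_def)
    fix y assume "y \<in> space half_line"
    then show "(norm (indicator (cell K j \<inter> {0..x}) y :: complex))\<^sup>2 \<le> indicator {0..a + 1 / real K} y - indicator {0..a} y + indicator {a} y"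
    proof (cases "y \<in> cell K j \<inter> {0<..x}")
      case True
      then have "y \<in> {a..a + 1 / real K}" using sub by blast
      then show ?thesis using True by (auto simp: indicator_def)
    next
      case False
      have "y \<le> a \<longrightarrow> y \<le> a + 1 / real K" using order_trans[of y a "a + 1 / real K"] by simp
      with False \<open>y \<in> space half_line\<close> show ?thesis by (auto simp: indicator_def)
    qed
  qed
  also have "\<dots> = 1 / real K"
  proof -
    have a: "0 \<le> a" "0 \<le> a + 1 / real K" by (auto simp: a_def)
    note i = half_line_indicator(1)[OF a(1)] half_line_indicator(1)[OF a(2)] half_line_singleton(1)[OF a(1)]
    show ?thesis
      unfolding Bochner_Integration.integral_add[OF Bochner_Integration.integrable_diff[OF i(2,1)] i(3)]
        Bochner_Integration.integral_diff[OF i(2,1)] half_line_indicator(2)[OF a(1)] half_line_indicator(2)[OF a(2)]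
        half_line_singleton(2)[OF a(1)] by simp
  qed
  finally have "norm (cellp K j (seg x)) \<le> sqrt (1 / real K)" by (rule real_le_rsqrt)
  then show ?thesis by (simp add: real_sqrt_divide)
qed

text \<open>A diagonal block integrates over part of one cell: its value at x is <p f, p seg x>, and
  p seg x has norm at most 1/sqrt K by \<open>norm_cell_seg\<close>. The values live on [0,1], so
  the same bound holds for the norm.\<close>

lemma norm_pinching_volterra:
  assumes K: "K \<ge> 1"
  shows "norm (pinching {..K} (cellp K) volterra_low) \<le> 1 / sqrt (real K)"
proof (rule norm_pinching_le[OF cellp_system[OF K]])
  fix j f
  define p where "p = cellp K j"
  define c where "c = norm (p f) / sqrt (real K)"
  have pa: "adjoint_pair p p" by (simp add: p_def cellp_def cut_adjoint cell_borel)
  have pp: "p (p f) = p f" unfolding p_def cellp_def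
    using cut_comp[OF cell_borel cell_borel, of K j K j] by (metis blinfun_apply_blinfun_compose inf.idem)
  define u where "u x = indicator (cell K j) x * (indicator {0..1} x * cinner (p f) (seg x))" for x
  have bound: "norm (u x) \<le> c * indicator {0..1} x" for x
  proof (cases "x \<in> cell K j \<and> x \<in> {0..1}")
    case True
    have "norm (cinner (p f) (seg x)) = norm (cinner (p f) (p (seg x)))"
      using adjoint_pairD[OF pa, of "p f" "seg x"] pp by simp
    also have "\<dots> \<le> norm (p f) * norm (p (seg x))" by (rule norm_cinner_le)
    also have "\<dots> \<le> norm (p f) * (1 / sqrt (real K))"
      using norm_cell_seg[OF K] True by (intro mult_left_mono) (auto simp: p_def)
    finally show ?thesis using True by (simp add: u_def c_def)
  next
    case False
    then show ?thesis by (auto simp: u_def c_def indicator_def)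
  qed
  have usq: "square_integrable u"
    unfolding u_def by (rule square_integrable_mult[OF contractive_indicator[OF cell_borel] kernel_sqi[OF continuous_seg]])
  have "cut (cell K j) (volterra_low (p f)) = L2_of u"
    unfolding volterra_low_def u_def by (rule kernel_cut[OF continuous_seg cell_borel])
  then have "p (volterra_low (p f)) = L2_of u" by (simp add: p_def cellp_def)
  moreover have "(norm (L2_of u))\<^sup>2 \<le> (\<integral>x. c\<^sup>2 * indicator {0..1} x \<partial>half_line)"
    unfolding norm_L2_of[OF usq]
  proof (rule integral_mono)
    show "integrable half_line (\<lambda>x. (norm (u x))\<^sup>2)" using usq by (simp add: square_integrable_def)
    show "integrable half_line (\<lambda>x. c\<^sup>2 * indicator {0..1} x)"
      by (rule integrable_mult_right[OF half_line_indicator(1)]) simp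
    fix x
    have "(norm (u x))\<^sup>2 \<le> (c * indicator {0..1} x)\<^sup>2" by (rule power_mono[OF bound]) simp
    then show "(norm (u x))\<^sup>2 \<le> c\<^sup>2 * indicator {0..1} x" by (cases "x \<in> {0..1}") simp_all
  qed
  then have "(norm (L2_of u))\<^sup>2 \<le> c\<^sup>2" using half_line_indicator(2)[of 1] by simp
  then have "norm (L2_of u) \<le> c" by (rule power2_le_imp_le) (simp add: c_def)
  ultimately show "norm (cellp K j (volterra_low (cellp K j f))) \<le> 1 / sqrt (real K) * norm (cellp K j f)"
    by (simp add: p_def c_def)
qed simp

text \<open>Modulations commute with cuts and are contractions, so the bound for the Volterra
  operator is inherited by all its conjugates, uniformly in m.\<close>

lemma norm_pinching_mconj:
  assumes K: "K \<ge> 1"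
  shows "norm (pinching {..K} (cellp K) (mconj m Y)) \<le> norm (pinching {..K} (cellp K) Y)"
proof -
  have "pinching {..K} (cellp K) (mconj m Y) = mconj m (pinching {..K} (cellp K) Y)"
    unfolding pinching_def cellp_def mconj_cut_left[OF cell_borel] mconj_cut_right[OF cell_borel]
    by (simp add: mconj_def comp_sum_left comp_sum_right)
  also have "norm \<dots> \<le> norm (modulate (int m)) * norm (pinching {..K} (cellp K) Y) * norm (modulate (- int m))"
    unfolding mconj_def by (intro order_trans[OF norm_blinfun_compose] mult_right_mono norm_blinfun_compose norm_ge_zero)
  also have "\<dots> \<le> 1 * norm (pinching {..K} (cellp K) Y) * 1"
    by (intro mult_mono norm_modulate) auto
  finally show ?thesis by simp
qed

section \<open>Discrete Hilbert transform of a decreasing sequence\<close>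

lemma half_twice: "(1/2) *\<^sub>R ((A + B) + (A - B)) = A" "(1/2) *\<^sub>R ((A + B) - (A - B)) = B" for A B :: op
  by (simp_all add: scaleR_add_right flip: scaleR_2)

text \<open>The points j - m + 1/2 with m <= N form a window whose ends have moduli a and b with a +
  b >= N and a, b >= 1/2; the larger one is at least (N+1)/4. Removing that end leaves a window of N
  points starting at j or j - 1, hence the induction over arbitrary j.\<close>

lemma sum_sgn_eig_le: "(\<Sum>m<N. \<bar>sgn_eig (j - int m)\<bar>) \<le> (\<Sum>m<N. 4 / (real m + 1))"
proof (induction N arbitrary: j)
  case (Suc N)
  define a b where "a = \<bar>real_of_int j + 1/2\<bar>" and "b = \<bar>real_of_int (j - int N) + 1/2\<bar>"
  have ev: "\<bar>sgn_eig k\<bar> \<le> 1 / \<bar>real_of_int k + 1/2\<bar>" for k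
  proof -
    have "1 * \<bar>real_of_int k + 1/2\<bar> \<le> pi * \<bar>real_of_int k + 1/2\<bar>"
      using pi_ge_two by (intro mult_right_mono) auto
    then show ?thesis
      using half_int_nonzero[of k] by (simp add: sgn_eig_def abs_mult) (intro divide_left_mono, auto)
  qed
  have half: "\<bar>real_of_int k + 1/2\<bar> \<ge> 1/2" for k
  proof (cases "k \<ge> 0")
    case False
    then have "real_of_int k \<le> -1" by simp
    then show ?thesis by simp
  qed simp
  have "a + b \<ge> real N" by (simp add: a_def b_def)
  moreover have "a \<ge> 1/2" using half[of j] by (simp only: a_def)
  moreover have "b \<ge> 1/2" using half[of "j - int N"] by (simp only: b_def)
  ultimately have big: "1 / c \<le> 4 / (real N + 1)" if "c = a \<and> b \<le> a \<or> c = b \<and> a \<le> b" for c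
  proof -
    have c: "c \<ge> (real N + 1) / 4"
      using that \<open>a + b \<ge> real N\<close> \<open>a \<ge> 1/2\<close> \<open>b \<ge> 1/2\<close> by (elim disjE conjE) (simp_all add: field_simps)
    have "1 / c \<le> 1 / ((real N + 1) / 4)" by (rule divide_left_mono[OF c]) (use c in auto)
    then show ?thesis by simp
  qed
  show ?case
  proof (cases "a \<le> b")
    case True
    have "\<bar>sgn_eig (j - int N)\<bar> \<le> 1 / b" using ev[of "j - int N"] by (simp add: b_def)
    also have "\<dots> \<le> 4 / (real N + 1)" using big[of b] True by simp
    finally show ?thesis using Suc[of j] by simp
  next
    case False
    have "\<bar>sgn_eig j\<bar> \<le> 1 / a" using ev[of j] by (simp add: a_def)
    also have "\<dots> \<le> 4 / (real N + 1)" using big[of a] False by simp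
    finally have "\<bar>sgn_eig j\<bar> \<le> 4 / (real N + 1)" .
    moreover have "(\<Sum>m<Suc N. \<bar>sgn_eig (j - int m)\<bar>) = \<bar>sgn_eig j\<bar> + (\<Sum>m<N. \<bar>sgn_eig ((j - 1) - int m)\<bar>)"
      unfolding sum.lessThan_Suc_shift by (simp add: algebra_simps)
    ultimately show ?thesis using Suc[of "j - 1"] by simp
  qed
qed simp

text \<open>Abel summation. With d = w - c all partial sums are nonpositive, and the sharper claim,
  that the weighted sum is at most the last weight times the plain sum, propagates because the
  weights decrease.\<close>

lemma sum_decseq_mono:
  fixes nu w c :: "nat \<Rightarrow> real"
  assumes dec: "decseq nu" and nn: "\<And>m. 0 \<le> nu m" and le: "\<And>N. (\<Sum>m<N. w m) \<le> (\<Sum>m<N. c m)"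
  shows "(\<Sum>m<N. nu m * w m) \<le> (\<Sum>m<N. nu m * c m)"
proof -
  define d where "d m = w m - c m" for m
  have D: "(\<Sum>m<N. d m) \<le> 0" for N using le[of N] by (simp add: d_def sum_subtractf)
  have "(\<Sum>m<Suc N. nu m * d m) \<le> nu N * (\<Sum>m<Suc N. d m)" for N
  proof (induction N)
    case (Suc N)
    have "(\<Sum>m<Suc (Suc N). nu m * d m) \<le> nu N * (\<Sum>m<Suc N. d m) + nu (Suc N) * d (Suc N)"
      using Suc by simp
    also have "nu N * (\<Sum>m<Suc N. d m) \<le> nu (Suc N) * (\<Sum>m<Suc N. d m)"
      by (rule mult_right_mono_neg[OF decseq_SucD[OF dec] D])
    finally show ?case by (simp add: distrib_left)
  qed simp
  note abel = this
  have "(\<Sum>m<N. nu m * d m) \<le> 0"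
  proof (cases N)
    case (Suc k)
    show ?thesis unfolding Suc by (rule order_trans[OF abel mult_nonneg_nonpos[OF nn D]])
  qed simp
  then show ?thesis by (simp add: d_def algebra_simps sum_subtractf)
qed

section \<open>The eigenvalues of H: tail estimates, sign and comparison with the Calderon
  operator\<close>

context
  fixes mu :: "nat \<Rightarrow> real"
  assumes nonneg: "\<And>m. 0 \<le> mu m" and dec: "decseq mu" and lim: "mu \<longlonglongrightarrow> 0"
    and summ: "summable (\<lambda>m. mu m / (real m + 1))"
begin

text \<open>A bound for the tail from p on that is uniform in j. The sequence is flattened to
  \<open>mu p\<close> below p, so that it stays decreasing and \<open>sum_decseq_mono\<close>
  applies from index 0; the first summand is the price of the flattened part, and 4 comes from
  \<open>sum_sgn_eig_le\<close>.\<close>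

definition tailb :: "nat \<Rightarrow> real"
  where "tailb p = 4 * (mu p * (\<Sum>m<p. 1 / (real m + 1)) + (\<Sum>m. mu (m + p) / (real (m + p) + 1)))"

lemma tail_bound:
  assumes "p \<le> N"
  shows "(\<Sum>m\<in>{p..<N}. mu m * \<bar>sgn_eig (j - int m)\<bar>) \<le> tailb p"
proof -
  define nu where "nu m = mu (max m p)" for m
  have nu: "decseq nu" "\<And>m. 0 \<le> nu m"
    using dec nonneg by (auto simp: nu_def decseq_def)
  have "(\<Sum>m\<in>{p..<N}. mu m * \<bar>sgn_eig (j - int m)\<bar>) = (\<Sum>m\<in>{p..<N}. nu m * \<bar>sgn_eig (j - int m)\<bar>)"
    by (rule sum.cong) (auto simp: nu_def max_def)
  also have "\<dots> \<le> (\<Sum>m<N. nu m * \<bar>sgn_eig (j - int m)\<bar>)"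
    by (rule sum_mono2) (auto simp: nu)
  also have "\<dots> \<le> (\<Sum>m<N. nu m * (4 / (real m + 1)))"
    by (rule sum_decseq_mono[OF nu sum_sgn_eig_le])
  also have "\<dots> = (\<Sum>m<p. nu m * (4 / (real m + 1))) + (\<Sum>m\<in>{p..<N}. nu m * (4 / (real m + 1)))"
    using sum.atLeastLessThan_concat[OF le0 assms, of "\<lambda>m. nu m * (4 / (real m + 1))"] by (simp only: lessThan_atLeast0)
  also have "(\<Sum>m<p. nu m * (4 / (real m + 1))) = 4 * (mu p * (\<Sum>m<p. 1 / (real m + 1)))"
  proof -
    have "nu m = mu p" if "m < p" for m using that by (simp add: nu_def max_def)
    then have "(\<Sum>m<p. nu m * (4 / (real m + 1))) = (\<Sum>m<p. (4 * mu p) * (1 / (real m + 1)))"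
      by (intro sum.cong) auto
    then show ?thesis by (simp only: sum_distrib_left mult.assoc)
  qed
  also have "(\<Sum>m\<in>{p..<N}. nu m * (4 / (real m + 1))) = 4 * (\<Sum>m\<in>{p..<N}. mu m / (real m + 1))"
    unfolding sum_distrib_left by (rule sum.cong) (auto simp: nu_def max_def)
  also have "(\<Sum>m\<in>{p..<N}. mu m / (real m + 1)) = (\<Sum>m<N - p. mu (m + p) / (real (m + p) + 1))"
    using sum.shift_bounds_nat_ivl[of "\<lambda>m. mu m / (real m + 1)" 0 p "N - p"] assms
    by (simp add: lessThan_atLeast0)
  also have "\<dots> \<le> (\<Sum>m. mu (m + p) / (real (m + p) + 1))"
    by (rule sum_le_suminf) (use summable_ignore_initial_segment[OF summ, of p] nonneg in \<open>auto simp: add_nonneg_nonneg\<close>)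
  finally show ?thesis by (simp add: tailb_def)
qed

text \<open>The harmonic sum is split at an index q. Beyond q the factor \<open>mu p\<close> is at
  most \<open>mu m\<close>, so that part is dominated by a small tail of the convergent series; the
  fixed head is killed by \<open>mu p\<close> tending to 0.\<close>

lemma mu_harm_tendsto: "(\<lambda>p. mu p * (\<Sum>m<p. 1 / (real m + 1))) \<longlonglongrightarrow> 0"
proof (rule LIMSEQ_I)
  fix e :: real assume e: "e > 0"
  define a where "a m = mu m / (real m + 1)" for m
  have a0: "a m \<ge> 0" for m using nonneg by (simp add: a_def)
  obtain q where q: "\<And>m n. m \<ge> q \<Longrightarrow> norm (sum a {m..<n}) < e/2"
  proof -
    have "summable a" using summ by (simp add: a_def[abs_def])
    moreover have "e/2 > 0" using e by simp
    ultimately obtain q where "\<forall>m\<ge>q. \<forall>n. norm (sum a {m..<n}) < e/2" unfolding summable_Cauchy by blast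
    then show ?thesis using that by blast
  qed
  have "(\<lambda>p. mu p * (\<Sum>m<q. 1 / (real m + 1))) \<longlonglongrightarrow> 0 * (\<Sum>m<q. 1 / (real m + 1))"
    by (intro tendsto_mult lim tendsto_const)
  then obtain r where r: "\<And>p. p \<ge> r \<Longrightarrow> norm (mu p * (\<Sum>m<q. 1 / (real m + 1))) < e/2"
    using LIMSEQ_D[of "\<lambda>p. mu p * (\<Sum>m<q. 1 / (real m + 1))" 0 "e/2"] e by auto
  show "\<exists>no. \<forall>p\<ge>no. norm (mu p * (\<Sum>m<p. 1 / (real m + 1)) - 0) < e"
  proof (intro exI allI impI)
    fix p assume p: "p \<ge> max q r"
    have "(\<Sum>m<p. 1 / (real m + 1)) = (\<Sum>m<q. 1 / (real m + 1)) + (\<Sum>m\<in>{q..<p}. 1 / (real m + 1))"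
      using p sum.atLeastLessThan_concat[of 0 q p "\<lambda>m. 1 / (real m + 1)"] by (simp add: lessThan_atLeast0)
    moreover have "mu p * (\<Sum>m\<in>{q..<p}. 1 / (real m + 1)) \<le> sum a {q..<p}"
      unfolding sum_distrib_left a_def using dec p
      by (intro sum_mono) (auto simp: decseq_def divide_right_mono)
    moreover have "sum a {q..<p} < e/2" using q[of q p] by simp
    moreover have "mu p * (\<Sum>m<q. 1 / (real m + 1)) < e/2" using r[of p] p by simp
    ultimately have "mu p * (\<Sum>m<p. 1 / (real m + 1)) < e" by (simp add: distrib_left)
    moreover have "0 \<le> mu p * (\<Sum>m<p. 1 / (real m + 1))" by (intro mult_nonneg_nonneg nonneg sum_nonneg) auto
    ultimately show "norm (mu p * (\<Sum>m<p. 1 / (real m + 1)) - 0) < e" by simp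
  qed
qed

lemma tailb_tendsto: "tailb \<longlonglongrightarrow> 0"
proof -
  have "(\<lambda>p. \<Sum>m. mu (m + p) / (real (m + p) + 1)) \<longlonglongrightarrow> 0"
    by (rule suminf_exist_split2[OF summ])
  then have "(\<lambda>p. 4 * (mu p * (\<Sum>m<p. 1 / (real m + 1)) + (\<Sum>m. mu (m + p) / (real (m + p) + 1)))) \<longlonglongrightarrow> 4 * (0 + 0)"
    by (intro tendsto_mult tendsto_add tendsto_const mu_harm_tendsto)
  then show ?thesis by (simp add: tailb_def[abs_def])
qed

definition eta :: "int \<Rightarrow> real" where "eta j = (\<Sum>m. mu m * sgn_eig (j - int m))"

lemma eta_abs_summable: "summable (\<lambda>m. \<bar>mu m * sgn_eig (j - int m)\<bar>)"
proof (rule bounded_imp_summable)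
  show "sum (\<lambda>m. \<bar>mu m * sgn_eig (j - int m)\<bar>) {..n} \<le> tailb 0" for n
    using tail_bound[of 0 "Suc n" j] nonneg by (simp add: abs_mult lessThan_Suc_atMost lessThan_atLeast0[symmetric])
qed simp

lemma eta_summable: "summable (\<lambda>m. mu m * sgn_eig (j - int m))"
  using eta_abs_summable[of j] by (rule summable_rabs_cancel)

lemma eta_partial: "\<bar>eta j - (\<Sum>m<p. mu m * sgn_eig (j - int m))\<bar> \<le> tailb p"
proof (rule LIMSEQ_le_const2)
  have "(\<lambda>N. \<Sum>m<N. mu m * sgn_eig (j - int m)) \<longlonglongrightarrow> eta j"
    unfolding eta_def using summable_LIMSEQ[OF eta_summable] .
  then show "(\<lambda>N. \<bar>(\<Sum>m<N. mu m * sgn_eig (j - int m)) - (\<Sum>m<p. mu m * sgn_eig (j - int m))\<bar>)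
      \<longlonglongrightarrow> \<bar>eta j - (\<Sum>m<p. mu m * sgn_eig (j - int m))\<bar>"
    by (intro tendsto_intros)
  show "\<exists>N. \<forall>n\<ge>N. \<bar>(\<Sum>m<n. mu m * sgn_eig (j - int m)) - (\<Sum>m<p. mu m * sgn_eig (j - int m))\<bar> \<le> tailb p"
  proof (intro exI allI impI)
    fix n assume n: "p \<le> n"
    have "(\<Sum>m<n. mu m * sgn_eig (j - int m)) - (\<Sum>m<p. mu m * sgn_eig (j - int m))
        = (\<Sum>m\<in>{p..<n}. mu m * sgn_eig (j - int m))"
      using sum.atLeastLessThan_concat[of 0 p n "\<lambda>m. mu m * sgn_eig (j - int m)"] n by (simp add: lessThan_atLeast0)
    also have "\<bar>\<dots>\<bar> \<le> (\<Sum>m\<in>{p..<n}. \<bar>mu m * sgn_eig (j - int m)\<bar>)" by (rule sum_abs)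
    also have "\<dots> \<le> tailb p" using tail_bound[OF n, of j] nonneg by (simp add: abs_mult)
    finally show "\<bar>(\<Sum>m<n. mu m * sgn_eig (j - int m)) - (\<Sum>m<p. mu m * sgn_eig (j - int m))\<bar> \<le> tailb p" .
  qed
qed

lemma eta_bounded: "\<bar>eta j\<bar> \<le> tailb 0"
  using eta_partial[of j 0] by simp

text \<open>At j = -n-1 all denominators j - m + 1/2 = -(m + n + 1/2) have the same sign. Without
  cancellation the eigenvalue is monotone in n and can be compared with the Calderon
  operator.\<close>

lemma eta_neg: "- eta (- int n - 1) = (\<Sum>m. mu m / (pi * (real m + real n + 1/2)))"
  and eta_neg_summable: "summable (\<lambda>m. mu m / (pi * (real m + real n + 1/2)))"
proof -
  have eq: "- (mu m * sgn_eig (- int n - 1 - int m)) = mu m / (pi * (real m + real n + 1/2))" for m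
  proof -
    have "of_int (- int n - 1 - int m) + 1/2 = - (real m + real n + 1/2)" by simp
    then have "sgn_eig (- int n - 1 - int m) = - (1 / (pi * (real m + real n + 1/2)))"
      unfolding sgn_eig_def by (metis divide_minus_right mult_minus_right)
    then show ?thesis by simp
  qed
  show "- eta (- int n - 1) = (\<Sum>m. mu m / (pi * (real m + real n + 1/2)))"
    unfolding eta_def suminf_minus[OF eta_summable, symmetric] eq ..
  show "summable (\<lambda>m. mu m / (pi * (real m + real n + 1/2)))"
    using summable_minus[OF eta_summable, of "- int n - 1"] unfolding eq .
qed

lemma eta_neg_mono: "k \<le> n \<Longrightarrow> - eta (- int n - 1) \<le> - eta (- int k - 1)"
  unfolding eta_neg
  by (rule suminf_le[OF _ eta_neg_summable eta_neg_summable])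
     (auto intro!: divide_left_mono mult_left_mono nonneg mult_pos_pos)

lemma Calderon_tail: "(\<Sum>\<^sub>\<infinity>k\<in>{n..}. mu k / (real k + 1)) = (\<Sum>k. if k < n then 0 else mu k / (real k + 1))"
proof -
  have s: "summable (\<lambda>k. if k < n then 0 else mu k / (real k + 1))"
    by (rule summable_comparison_test'[OF summ]) (auto simp: nonneg)
  have "(\<Sum>\<^sub>\<infinity>k\<in>{n..}. mu k / (real k + 1)) = (\<Sum>\<^sub>\<infinity>k\<in>UNIV. if k < n then 0 else mu k / (real k + 1))"
    by (rule infsum_cong_neutral) auto
  also have "\<dots> = (\<Sum>k. if k < n then 0 else mu k / (real k + 1))"
    by (rule infsumI, rule norm_summable_imp_has_sum) (use s nonneg in \<open>auto simp: summable_sums\<close>)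
  finally show ?thesis .
qed

text \<open>The kernel 1/(m + n + 1/2) is at least 1/(2(n+1)) for m <= n and at least 1/(2(m+1)) for
  m >= n. Each half of the Calderon operator is thus at most twice the sum of \<open>b\<close>,
  which is pi times the eigenvalue.\<close>

lemma Calderon_le_eta: "Calderon mu n \<le> 4 * pi * (- eta (- int n - 1))"
proof -
  define b where "b k = mu k / (real k + real n + 1/2)" for k
  have bs: "summable b"
  proof -
    have "summable (\<lambda>k. pi * (mu k / (pi * (real k + real n + 1/2))))" by (rule summable_mult[OF eta_neg_summable])
    moreover have "pi * (mu k / (pi * (real k + real n + 1/2))) = b k" for k by (simp add: b_def)
    ultimately show ?thesis by simp
  qed
  have b0: "0 \<le> b k" for k by (simp add: b_def nonneg)
  have eb: "pi * (- eta (- int n - 1)) = suminf b"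
    unfolding eta_neg suminf_mult[OF eta_neg_summable, symmetric] by (simp add: b_def[abs_def])
  have "(\<Sum>k=0..n. mu k) / (real n + 1) \<le> (\<Sum>k=0..n. 2 * b k)"
    unfolding sum_divide_distrib
  proof (rule sum_mono)
    fix k assume "k \<in> {0..n}"
    then have "real k + real n + 1/2 \<le> 2 * (real n + 1)" by simp
    then have "mu k / (2 * (real n + 1)) \<le> b k"
      unfolding b_def by (intro divide_left_mono nonneg mult_pos_pos) auto
    then show "mu k / (real n + 1) \<le> 2 * b k" by (simp add: field_simps)
  qed
  also have "\<dots> \<le> 2 * suminf b"
    unfolding sum_distrib_left[symmetric] by (intro mult_left_mono sum_le_suminf bs) (auto simp: b0)
  finally have 1: "(\<Sum>k=0..n. mu k) / (real n + 1) \<le> 2 * suminf b" .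
  have "(\<Sum>k. if k < n then 0 else mu k / (real k + 1)) \<le> (\<Sum>k. 2 * b k)"
  proof (rule suminf_le)
    fix k
    show "(if k < n then 0 else mu k / (real k + 1)) \<le> 2 * b k"
    proof (cases "k < n")
      case False
      then have "real k + real n + 1/2 \<le> 2 * (real k + 1)" by simp
      then have "mu k / (2 * (real k + 1)) \<le> b k"
        unfolding b_def by (intro divide_left_mono nonneg mult_pos_pos) auto
      then show ?thesis using False by (simp add: field_simps)
    qed (simp add: b0)
  qed (rule summable_comparison_test'[OF summ], simp add: nonneg, rule summable_mult[OF bs])
  also have "\<dots> = 2 * suminf b" by (rule suminf_mult[OF bs])
  finally show ?thesis unfolding Calderon_def Calderon_tail using 1 eb by simp
qed

subsection \<open>The operators with symbol \<open>\<mu>\<close>\<close>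

definition opX :: op where "opX = diag eexp UNIV (\<lambda>m. complex_of_real (mu m))"
definition opH :: op where "opH = diag fexp UNIV (\<lambda>j. \<i> * complex_of_real (eta j))"
definition opV :: op where "opV = (1/2) *\<^sub>R (opX + opH)"
definition opW :: op where "opW = (1/2) *\<^sub>R (opX - opH)"

text \<open>As \<open>mu\<close> need not be summable, convergence of these sums is not seen
  termwise. It is obtained from partV + partW and partV - partW, which are diagonal in
  \<open>eexp\<close> and \<open>fexp\<close> with errors at most \<open>mu n\<close> and
  \<open>tailb n\<close>.\<close>

definition partV :: "nat \<Rightarrow> op" where "partV n = (\<Sum>m<n. mu m *\<^sub>R mconj m volterra_up)"
definition partW :: "nat \<Rightarrow> op" where "partW n = (\<Sum>m<n. mu m *\<^sub>R mconj m volterra_low)"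

lemma bounded_mu: "bounded_on UNIV (\<lambda>m. complex_of_real (mu m))"
  using dec by (intro bounded_onI[of _ _ "mu 0"]) (auto simp: nonneg decseq_def)

lemma bounded_eta: "bounded_on UNIV (\<lambda>j. \<i> * complex_of_real (eta j))"
  by (rule bounded_onI[of _ _ "tailb 0"]) (simp add: norm_mult eta_bounded)

lemma tailb_nonneg: "0 \<le> tailb p"
  using eta_partial[of 0 p] by linarith

lemma partV_plus_partW: "partV n + partW n = diag eexp UNIV (\<lambda>m. if m < n then complex_of_real (mu m) else 0)"
proof (rule diag_unique[OF orthonormal_eexp])
  have eq: "partV n + partW n = (\<Sum>m<n. mu m *\<^sub>R rank_one (eexp m) (eexp m))"
    unfolding partV_def partW_def sum.distrib[symmetric] scaleR_add_right[symmetric] mconj_add[symmetric]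
      volterra_up_plus_low mconj_rank_one ..
  show "bounded_on UNIV (\<lambda>m. if m < n then complex_of_real (mu m) else 0)"
    using dec by (intro bounded_onI[of _ _ "mu 0"]) (auto simp: nonneg decseq_def)
  show "partV n + partW n \<in> BL2" unfolding eq by (intro BL2_sum BL2_scaleR rank_one_BL2)
  show "(partV n + partW n) (eexp i) = (if i < n then complex_of_real (mu i) else 0) *\<^sub>C eexp i" for i
  proof -
    have "(partV n + partW n) (eexp i) = (\<Sum>m<n. if i = m then complex_of_real (mu i) *\<^sub>C eexp i else 0)"
      unfolding eq blinfun.sum_left
      by (rule sum.cong) (auto simp: blinfun.scaleR_left rank_one_apply orthonormalD[OF orthonormal_eexp] scaleR_scaleC)
    then show ?thesis by simp
  qed
  show "(partV n + partW n) g = 0" if "\<And>i. i \<in> UNIV \<Longrightarrow> cinner g (eexp i) = 0" for g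
    unfolding eq blinfun.sum_left using that by (intro sum.neutral) (auto simp: blinfun.scaleR_left rank_one_apply)
qed

lemma partV_minus_partW: "partV n - partW n = diag fexp UNIV (\<lambda>j. \<i> * complex_of_real (\<Sum>m<n. mu m * sgn_eig (j - int m)))"
proof (rule diag_unique[OF orthonormal_fexp])
  have eq: "partV n - partW n = (\<Sum>m<n. mu m *\<^sub>R mconj m sign_op)"
    unfolding partV_def partW_def sum_subtractf[symmetric] scaleR_diff_right[symmetric] mconj_diff[symmetric]
      volterra_up_minus_low ..
  have b1: "bounded_on UNIV (\<lambda>j. \<i> * complex_of_real (sgn_eig (j - int m)))" for m
    by (rule bounded_onI[of _ _ 1]) (simp add: norm_mult sgn_eig_bounded)
  show "bounded_on UNIV (\<lambda>j. \<i> * complex_of_real (\<Sum>m<n. mu m * sgn_eig (j - int m)))"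
  proof (rule bounded_onI[of _ _ "tailb 0 + tailb n"])
    fix j show "norm (\<i> * complex_of_real (\<Sum>m<n. mu m * sgn_eig (j - int m))) \<le> tailb 0 + tailb n"
      using eta_partial[of j n] eta_bounded[of j] by (simp add: norm_mult del: of_real_sum of_real_mult)
  qed
  show "partV n - partW n \<in> BL2" unfolding eq mconj_sign_op
    by (intro BL2_sum BL2_scaleR diag_BL2[OF orthonormal_fexp] b1)
  show "(partV n - partW n) (fexp i) = (\<i> * complex_of_real (\<Sum>m<n. mu m * sgn_eig (i - int m))) *\<^sub>C fexp i" for i
  proof -
    have "(partV n - partW n) (fexp i) = (\<Sum>m<n. complex_of_real (mu m) *\<^sub>C (\<i> * complex_of_real (sgn_eig (i - int m))) *\<^sub>C fexp i)"
      unfolding eq blinfun.sum_left mconj_sign_op by (simp add: blinfun.scaleR_left diag_eigen[OF orthonormal_fexp b1] scaleR_scaleC)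
    also have "\<dots> = (\<Sum>m<n. \<i> * complex_of_real (mu m * sgn_eig (i - int m))) *\<^sub>C fexp i"
    proof (induction n)
      case (Suc n) then show ?case by (simp add: scaleC_scaleC scaleC_add_left mult_ac)
    qed simp
    finally show ?thesis by (simp add: sum_distrib_left)
  qed
  show "(partV n - partW n) g = 0" if "\<And>i. i \<in> UNIV \<Longrightarrow> cinner g (fexp i) = 0" for g
    unfolding eq blinfun.sum_left mconj_sign_op using that
    by (intro sum.neutral) (auto simp: blinfun.scaleR_left intro!: diag_zero[OF orthonormal_fexp b1])
qed

lemma norm_opX_diff: "norm (opX - (partV n + partW n)) \<le> mu n"
proof -
  have b: "norm (complex_of_real (mu m) - (if m < n then complex_of_real (mu m) else 0)) \<le> mu n" for m
    using nonneg dec by (auto simp: decseq_def)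
  have "bounded_on UNIV (\<lambda>m. if m < n then complex_of_real (mu m) else 0)"
    using dec by (intro bounded_onI[of _ _ "mu 0"]) (auto simp: nonneg decseq_def)
  then have "opX - (partV n + partW n) = diag eexp UNIV (\<lambda>m. complex_of_real (mu m) - (if m < n then complex_of_real (mu m) else 0))"
    unfolding opX_def partV_plus_partW using b by (intro diag_diff[OF orthonormal_eexp bounded_mu]) (auto intro: bounded_onI)
  then show ?thesis using norm_diag_le[OF orthonormal_eexp b nonneg] by simp
qed

lemma norm_opH_diff: "norm (opH - (partV n - partW n)) \<le> tailb n"
proof -
  have b: "norm (\<i> * complex_of_real (eta j) - \<i> * complex_of_real (\<Sum>m<n. mu m * sgn_eig (j - int m))) \<le> tailb n" for j
    using eta_partial[of j n] by (simp add: norm_mult del: of_real_sum of_real_mult flip: right_diff_distrib of_real_diff)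
  have "bounded_on UNIV (\<lambda>j. \<i> * complex_of_real (\<Sum>m<n. mu m * sgn_eig (j - int m)))"
  proof (rule bounded_onI[of _ _ "tailb 0 + tailb n"])
    fix j show "norm (\<i> * complex_of_real (\<Sum>m<n. mu m * sgn_eig (j - int m))) \<le> tailb 0 + tailb n"
      using eta_partial[of j n] eta_bounded[of j] by (simp add: norm_mult del: of_real_sum of_real_mult)
  qed
  then have "opH - (partV n - partW n)
      = diag fexp UNIV (\<lambda>j. \<i> * complex_of_real (eta j) - \<i> * complex_of_real (\<Sum>m<n. mu m * sgn_eig (j - int m)))"
    unfolding opH_def partV_minus_partW using b by (intro diag_diff[OF orthonormal_fexp bounded_eta]) (auto intro: bounded_onI)
  then show ?thesis using norm_diag_le[OF orthonormal_fexp b tailb_nonneg] by simp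
qed

lemma tendsto_XH: "(\<lambda>n. partV n + partW n) \<longlonglongrightarrow> opX" "(\<lambda>n. partV n - partW n) \<longlonglongrightarrow> opH"
proof -
  have "(\<lambda>n. (partV n + partW n) - opX) \<longlonglongrightarrow> 0"
    by (rule Lim_null_comparison[OF _ lim]) (rule always_eventually, use norm_opX_diff in \<open>simp add: norm_minus_commute\<close>)
  then show "(\<lambda>n. partV n + partW n) \<longlonglongrightarrow> opX" by (rule LIM_zero_cancel)
  have "(\<lambda>n. (partV n - partW n) - opH) \<longlonglongrightarrow> 0"
    by (rule Lim_null_comparison[OF _ tailb_tendsto]) (rule always_eventually, use norm_opH_diff in \<open>simp add: norm_minus_commute\<close>)
  then show "(\<lambda>n. partV n - partW n) \<longlonglongrightarrow> opH" by (rule LIM_zero_cancel)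
qed

lemma tendsto_partV: "partV \<longlonglongrightarrow> opV"
proof -
  have "(\<lambda>n. (1/2) *\<^sub>R ((partV n + partW n) + (partV n - partW n))) \<longlonglongrightarrow> opV"
    unfolding opV_def by (intro tendsto_intros tendsto_XH)
  then show ?thesis by (simp only: half_twice)
qed

lemma tendsto_partW: "partW \<longlonglongrightarrow> opW"
proof -
  have "(\<lambda>n. (1/2) *\<^sub>R ((partV n + partW n) - (partV n - partW n))) \<longlonglongrightarrow> opW"
    unfolding opW_def by (intro tendsto_intros tendsto_XH)
  then show ?thesis by (simp only: half_twice)
qed

lemma opV_plus_opW: "opV + opW = opX"
proof -
  have "(\<lambda>n. partV n + partW n) \<longlonglongrightarrow> opV + opW" by (intro tendsto_intros tendsto_partV tendsto_partW)
  then show ?thesis using tendsto_XH(1) LIMSEQ_unique by blast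
qed

lemma opV_minus_opW: "opV - opW = opH"
proof -
  have "(\<lambda>n. partV n - partW n) \<longlonglongrightarrow> opV - opW" by (intro tendsto_intros tendsto_partV tendsto_partW)
  then show ?thesis using tendsto_XH(2) LIMSEQ_unique by blast
qed

lemma opX_adjoint: "adjoint_pair opX opX"
  using diag_adjoint[OF orthonormal_eexp bounded_mu] by (simp add: opX_def)

lemma opH_adjoint: "adjoint_pair opH (- opH)"
proof -
  have b: "bounded_on UNIV (\<lambda>j. cnj (\<i> * complex_of_real (eta j)))"
    by (rule bounded_onI[of _ _ "tailb 0"]) (simp add: norm_mult eta_bounded)
  have "opH + diag fexp UNIV (\<lambda>j. cnj (\<i> * complex_of_real (eta j))) = diag fexp UNIV (\<lambda>j. 0)"
    unfolding opH_def diag_add[OF orthonormal_fexp bounded_eta b] by simp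
  also have "\<dots> = 0"
    by (rule diag_unique[OF orthonormal_fexp, symmetric]) (auto intro: bounded_onI)
  finally have "diag fexp UNIV (\<lambda>j. cnj (\<i> * complex_of_real (eta j))) = - opH"
    by (metis add_eq_0_iff)
  then show ?thesis using diag_adjoint[OF orthonormal_fexp bounded_eta] by (simp add: opH_def)
qed

lemma opV_adjoint: "adjoint_pair opV opW"
  unfolding opV_def opW_def
  using adjoint_pair_scaleR[OF adjoint_pair_add[OF opX_adjoint opH_adjoint], of "1/2"] by simp

lemma compact_opV: "compact_op opV"
proof (rule compact_op_lim[OF tendsto_partV])
  have "compact_op (mconj m volterra_up)" for m
    unfolding mconj_def by (rule compact_op_comp_right, rule compact_op_comp_left, rule compact_volterra_up)
  then show "compact_op (partV n)" for n
    unfolding partV_def by (intro compact_op_sum compact_op_scaleR)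
qed

lemma upper_tri_opV: "upper_tri opV"
  by (rule upper_tri_lim[OF _ tendsto_partV])
     (auto simp: partV_def intro!: upper_tri_sum upper_tri_scaleR upper_tri_mconj upper_tri_volterra)

lemma lower_tri_opW: "lower_tri opW"
  by (rule lower_tri_lim[OF _ tendsto_partW])
     (auto simp: partW_def intro!: lower_tri_sum lower_tri_scaleR lower_tri_mconj lower_tri_volterra)

text \<open>W is first replaced by a finite sum at a cost that pinching does not increase. Each of
  its finitely many terms contributes at most \<open>mu m\<close> / sqrt K.\<close>

lemma tendsto_pinching: "(\<lambda>K. pinching {..K} (cellp K) opW) \<longlonglongrightarrow> 0"
proof (rule LIMSEQ_I)
  fix e :: real assume e: "e > 0"
  obtain n where n: "norm (partW n - opW) < e/2"
    using LIMSEQ_D[OF tendsto_partW, of "e/2"] e by auto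
  define M where "M = (\<Sum>m<n. mu m)"
  have M: "M \<ge> 0" by (simp add: M_def sum_nonneg nonneg)
  have part: "norm (pinching {..K} (cellp K) (partW n)) \<le> M * (1 / sqrt (real K))" if K: "K \<ge> 1" for K
  proof -
    have "norm (pinching {..K} (cellp K) (partW n)) \<le> (\<Sum>m<n. norm (mu m *\<^sub>R pinching {..K} (cellp K) (mconj m volterra_low)))"
      unfolding partW_def pinching_sum pinching_scaleR by (rule norm_sum)
    also have "\<dots> \<le> (\<Sum>m<n. mu m * (1 / sqrt (real K)))"
    proof (rule sum_mono)
      fix m
      have "norm (pinching {..K} (cellp K) (mconj m volterra_low)) \<le> 1 / sqrt (real K)"
        using norm_pinching_mconj[OF K] norm_pinching_volterra[OF K] order_trans by blast
      then show "norm (mu m *\<^sub>R pinching {..K} (cellp K) (mconj m volterra_low)) \<le> mu m * (1 / sqrt (real K))"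
        by (simp only: norm_scaleR abs_of_nonneg[OF nonneg]) (rule mult_left_mono[OF _ nonneg])
    qed
    finally show ?thesis by (simp only: M_def sum_distrib_right)
  qed
  have "(\<lambda>K. M * (1 / sqrt (real K))) \<longlonglongrightarrow> M * 0"
    by (intro tendsto_mult tendsto_const tendsto_divide_0[OF tendsto_const] filterlim_at_top_imp_at_infinity
        filterlim_compose[OF sqrt_at_top filterlim_real_sequentially])
  then have "(\<lambda>K. M * (1 / sqrt (real K))) \<longlonglongrightarrow> 0" by simp
  then have "\<forall>\<^sub>F K in sequentially. M * (1 / sqrt (real K)) < e/2" by (rule order_tendstoD(2)) (use e in simp)
  then obtain K0 where K0: "\<And>K. K \<ge> K0 \<Longrightarrow> M * (1 / sqrt (real K)) < e/2"
    by (auto simp: eventually_sequentially)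
  show "\<exists>no. \<forall>K\<ge>no. norm (pinching {..K} (cellp K) opW - 0) < e"
  proof (intro exI allI impI)
    fix K assume "K \<ge> max K0 1"
    then have K: "K \<ge> K0" "K \<ge> 1" by auto
    have "opW = partW n + (opW - partW n)" by simp
    then have "pinching {..K} (cellp K) opW = pinching {..K} (cellp K) (partW n) + pinching {..K} (cellp K) (opW - partW n)"
      by (metis pinching_add)
    then have "norm (pinching {..K} (cellp K) opW) \<le> norm (pinching {..K} (cellp K) (partW n)) + norm (pinching {..K} (cellp K) (opW - partW n))"
      by (simp add: norm_triangle_ineq)
    also have "\<dots> < e/2 + e/2"
      using part[OF K(2)] K0[OF K(1)] norm_pinching_contract[OF K(2), of "opW - partW n"]
        n[unfolded norm_minus_commute[of "partW n"]] by linarith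
    finally show "norm (pinching {..K} (cellp K) opW - 0) < e" by simp
  qed
qed

end

text \<open>Gaussian elimination by induction on the equations: an unknown k0 with nonzero
  coefficient in row b is eliminated from the other rows, giving M', and is recovered as d. This is
  the dimension count in \<open>singular_value_lower\<close>.\<close>

lemma homogeneous_solution:
  fixes M :: "'b \<Rightarrow> 'k \<Rightarrow> complex"
  assumes "finite S" "finite K" "card S < card K"
  shows "\<exists>c. (\<exists>k\<in>K. c k \<noteq> 0) \<and> (\<forall>b\<in>S. (\<Sum>k\<in>K. c k * M b k) = 0)"
  using assms
proof (induction S arbitrary: K M rule: finite_induct)
  case empty
  then obtain k where "k \<in> K" by (metis card_gt_0_iff card.empty ex_in_conv)
  then show ?case by (intro exI[of _ "\<lambda>_. 1"]) auto
next
  case (insert b S)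
  show ?case
  proof (cases "\<forall>k\<in>K. M b k = 0")
    case True
    have "card S < card K" using insert by simp
    from insert.IH[OF insert.prems(1) this, of M] obtain c where
      c: "\<exists>k\<in>K. c k \<noteq> 0" "\<forall>b\<in>S. (\<Sum>k\<in>K. c k * M b k) = 0" by blast
    moreover have "(\<Sum>k\<in>K. c k * M b k) = 0" using True by simp
    ultimately show ?thesis by auto
  next
    case False
    then obtain k0 where k0: "k0 \<in> K" "M b k0 \<noteq> 0" by blast
    define K' where "K' = K - {k0}"
    have K': "finite K'" "card S < card K'" "K = insert k0 K'" "k0 \<notin> K'"
      using insert k0 by (auto simp: K'_def card_Diff_singleton)
    define M' where "M' s k = M s k - M s k0 * M b k / M b k0" for s k
    from insert.IH[OF K'(1,2), of M'] obtain c where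
      c: "\<exists>k\<in>K'. c k \<noteq> 0" "\<forall>s\<in>S. (\<Sum>k\<in>K'. c k * M' s k) = 0" by blast
    define d where "d = - (\<Sum>k\<in>K'. c k * M b k) / M b k0"
    define c' where "c' = c(k0 := d)"
    have sum: "(\<Sum>k\<in>K. c' k * M s k) = d * M s k0 + (\<Sum>k\<in>K'. c k * M s k)" for s
    proof -
      have "(\<Sum>k\<in>K'. c' k * M s k) = (\<Sum>k\<in>K'. c k * M s k)"
        by (rule sum.cong) (use K'(4) in \<open>auto simp: c'_def\<close>)
      then show ?thesis unfolding K'(3) using K'(1,4) by (simp add: c'_def)
    qed
    have "(\<Sum>k\<in>K. c' k * M s k) = 0" if "s \<in> insert b S" for s
    proof (cases "s = b")
      case True
      then show ?thesis unfolding sum using k0(2) by (simp add: d_def)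
    next
      case False
      then have "(\<Sum>k\<in>K'. c k * M' s k) = 0" using that c(2) by auto
      moreover have "(\<Sum>k\<in>K'. c k * M' s k) = (\<Sum>k\<in>K'. c k * M s k) - (M s k0 / M b k0) * (\<Sum>k\<in>K'. c k * M b k)"
        unfolding sum_distrib_left sum_subtractf[symmetric] by (rule sum.cong) (auto simp: M'_def algebra_simps)
      ultimately show ?thesis unfolding sum by (simp add: d_def)
    qed
    moreover have "\<exists>k\<in>K. c' k \<noteq> 0" using c(1) K' by (auto simp: c'_def)
    ultimately show ?thesis by blast
  qed
qed

lemma norm_adjoint_le:
  assumes "adjoint_pair S S'" shows "norm S' \<le> norm S"
proof (rule norm_blinfun_bound)
  fix g
  show "norm (S' g) \<le> norm S * norm g"
  proof (cases "S' g = 0")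
    case False
    have "(norm (S' g))\<^sup>2 = norm (cinner (S (S' g)) g)"
      unfolding adjoint_pairD[OF assms] cinner_self norm_of_real by simp
    also have "\<dots> \<le> (norm S * norm (S' g)) * norm g"
      by (rule order_trans[OF norm_cinner_le]) (intro mult_right_mono norm_blinfun norm_ge_zero)
    finally have "norm (S' g) * norm (S' g) \<le> (norm S * norm g) * norm (S' g)" by (simp add: power2_eq_square mult_ac)
    then show ?thesis by (rule mult_right_le_imp_le) (use False in simp)
  qed simp
qed simp

lemma strong_sums_finite:
  assumes "\<And>k. k > K \<Longrightarrow> A k = 0"
  shows "strong_sums A (\<Sum>k\<le>K. A k)"
  unfolding strong_sums_def blinfun.sum_left
  by (intro allI sums_finite) (auto simp: assms)

lemma strong_sums_suminf: "strong_sums A S \<Longrightarrow> strong_suminf A = S"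
  unfolding strong_suminf_def
  by (rule the_equality) (auto simp: strong_sums_def intro!: op_eqI sums_unique2)

section \<open>Rearrangements\<close>

lemma Inf_above: "0 \<le> a \<Longrightarrow> Inf {s::real. s > 0 \<and> a \<le> s} = a"
proof -
  assume a: "0 \<le> a"
  have ne: "{s::real. s > 0 \<and> a \<le> s} \<noteq> {}" by (auto intro!: exI[of _ "a + 1"] simp: a add_nonneg_pos)
  show ?thesis
  proof (rule antisym)
    show "Inf {s::real. s > 0 \<and> a \<le> s} \<le> a"
    proof (rule field_le_epsilon)
      fix e :: real assume "e > 0"
      then show "Inf {s. s > 0 \<and> a \<le> s} \<le> a + e"
        by (intro cInf_lower) (auto simp: a add_nonneg_pos intro!: bdd_belowI[of _ a])
    qed
    show "a \<le> Inf {s::real. s > 0 \<and> a \<le> s}" by (rule cInf_greatest[OF ne]) auto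
  qed
qed

text \<open>The indices at which a decreasing sequence exceeds s form an initial segment, so
  counting them amounts to comparing one term with s.\<close>

lemma decseq_count_le:
  fixes mu :: "nat \<Rightarrow> real"
  assumes dec: "decseq mu" and lim: "mu \<longlonglongrightarrow> 0" and s: "s > 0"
  shows "finite {k. s < mu k} \<and> card {k. s < mu k} \<le> n \<longleftrightarrow> mu n \<le> s"
proof
  assume le: "mu n \<le> s"
  have sub: "{k. s < mu k} \<subseteq> {..<n}"
  proof
    fix k assume "k \<in> {k. s < mu k}"
    then have "\<not> n \<le> k" using le decseqD[OF dec, of n k] by auto
    then show "k \<in> {..<n}" by simp
  qed
  then show "finite {k. s < mu k} \<and> card {k. s < mu k} \<le> n"
    using finite_subset[OF sub] card_mono[OF _ sub] by auto
next
  assume c: "finite {k. s < mu k} \<and> card {k. s < mu k} \<le> n"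
  show "mu n \<le> s"
  proof (rule ccontr)
    assume "\<not> mu n \<le> s"
    then have "s < mu k" if "k \<le> n" for k using decseqD[OF dec that] by linarith
    then have "{..n} \<subseteq> {k. s < mu k}" by auto
    then have "card {..n} \<le> card {k. s < mu k}" using c by (intro card_mono) auto
    then show False using c by simp
  qed
qed

lemma rearrangement_decseq:
  fixes mu :: "nat \<Rightarrow> real"
  assumes "\<And>m. 0 \<le> mu m" "decseq mu" "mu \<longlonglongrightarrow> 0"
  shows "rearrangement mu = mu"
proof
  fix n
  have "{s. s > 0 \<and> finite {k. norm (mu k) > s} \<and> card {k. norm (mu k) > s} \<le> n} = {s. s > 0 \<and> mu n \<le> s}"
    using decseq_count_le[OF assms(2,3)] by (auto simp: assms(1))
  then show "rearrangement mu n = mu n" by (simp add: rearrangement_def Inf_above assms(1))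
qed

section \<open>The decreasing rearrangement of a null sequence\<close>

context
  fixes x :: "nat \<Rightarrow> 'a::real_normed_vector"
  assumes x: "x \<longlonglongrightarrow> 0"
begin

lemma count_finite: "s > 0 \<Longrightarrow> finite {k. norm (x k) > s}"
proof -
  assume s: "s > 0"
  obtain N where "\<And>k. k \<ge> N \<Longrightarrow> norm (x k) < s" using LIMSEQ_D[OF x s] by auto
  then have "k < N" if "norm (x k) > s" for k using that by (meson less_asym not_le)
  then have "{k. norm (x k) > s} \<subseteq> {..<N}" by auto
  then show ?thesis by (rule finite_subset) simp
qed

lemma rearrangement_set_nonempty: "{s. s > 0 \<and> finite {k. norm (x k) > s} \<and> card {k. norm (x k) > s} \<le> n} \<noteq> {}"
proof -
  have "Bseq x" using x by (intro convergent_imp_Bseq) (auto simp: convergent_def)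
  then obtain C where C: "C > 0" "\<And>k. norm (x k) \<le> C" by (auto elim: BseqE)
  then have "{k. norm (x k) > C} = {}" by (auto simp: not_less)
  then show ?thesis using C(1) by (auto intro!: exI[of _ C])
qed

lemma rearrangement_bdd: "bdd_below {s. s > 0 \<and> finite {k. norm (x k) > s} \<and> card {k. norm (x k) > s} \<le> n}"
  by (rule bdd_belowI[of _ 0]) auto

lemma rearrangement_nonneg: "0 \<le> rearrangement x n"
  unfolding rearrangement_def by (rule cInf_greatest[OF rearrangement_set_nonempty]) auto

lemma rearrangement_dec: "decseq (rearrangement x)"
  unfolding decseq_Suc_iff rearrangement_def
  by (intro allI cInf_superset_mono rearrangement_set_nonempty rearrangement_bdd) auto

lemma rearrangement_tendsto: "rearrangement x \<longlonglongrightarrow> 0"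
proof (rule LIMSEQ_I)
  fix e :: real assume e: "e > 0"
  show "\<exists>no. \<forall>n\<ge>no. norm (rearrangement x n - 0) < e"
  proof (intro exI allI impI)
    fix n assume n: "n \<ge> card {k. norm (x k) > e/2}"
    have "rearrangement x n \<le> e/2"
      unfolding rearrangement_def by (rule cInf_lower[OF _ rearrangement_bdd]) (use e n count_finite[of "e/2"] in auto)
    then show "norm (rearrangement x n - 0) < e" using e rearrangement_nonneg[of n] by simp
  qed
qed

end

text \<open>From ln y <= y - 1 at y = (n+1)/(n+2) the logarithmic weight is at least 1/(n+2), hence
  at least half of 1/(n+1).\<close>

lemma summable_harmonic_weight:
  fixes mu :: "nat \<Rightarrow> real"
  assumes nn: "\<And>m. 0 \<le> mu m" and s: "summable (\<lambda>n. mu n * (ln (real n + 2) - ln (real n + 1)))"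
  shows "summable (\<lambda>m. mu m / (real m + 1))"
proof (rule summable_comparison_test'[of "\<lambda>n. 2 * (mu n * (ln (real n + 2) - ln (real n + 1)))"])
  show "summable (\<lambda>n. 2 * (mu n * (ln (real n + 2) - ln (real n + 1))))" by (rule summable_mult[OF s])
  fix n :: nat
  have "ln ((real n + 1) / (real n + 2)) \<le> (real n + 1) / (real n + 2) - 1" by (rule ln_le_minus_one) simp
  also have "\<dots> = - 1 / (real n + 2)" by (simp add: field_simps)
  finally have "1 / (real n + 2) \<le> ln (real n + 2) - ln (real n + 1)" by (simp add: ln_div)
  moreover have "1 / (real n + 1) \<le> 2 * (1 / (real n + 2))" by (simp add: field_simps)
  ultimately have "1 / (real n + 1) \<le> 2 * (ln (real n + 2) - ln (real n + 1))"
    by (meson mult_left_mono order_trans zero_le_numeral)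
  from mult_left_mono[OF this nn[of n]]
  show "norm (mu n / (real n + 1)) \<le> 2 * (mu n * (ln (real n + 2) - ln (real n + 1)))"
    by (simp add: nn mult_ac)
qed

section \<open>Singular values of z1 and z2, and convergence of the square functions\<close>

context
  fixes mu :: "nat \<Rightarrow> real"
  assumes nonneg: "\<And>m. 0 \<le> mu m" and dec: "decseq mu" and lim: "mu \<longlonglongrightarrow> 0"
    and summ: "summable (\<lambda>m. mu m / (real m + 1))"
begin

lemmas mu_assms = nonneg dec lim summ

abbreviation "zX \<equiv> opX mu"
abbreviation "zV \<equiv> opV mu"
abbreviation "zW \<equiv> opW mu"

lemma zX_positive: "positive_op zX"
  unfolding opX_def[OF mu_assms] by (rule diag_positive[OF orthonormal_eexp bounded_mu[OF mu_assms] nonneg])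

text \<open>The vectors \<open>eexp m\<close> are not a basis; they are extended to one, and the
  added vectors get the eigenvalue 0. These are never counted, since only levels s > 0 enter the
  singular values.\<close>

lemma singular_value_zX: "singular_value zX n = mu n"
proof -
  have inj: "inj eexp"
  proof (rule injI)
    fix i j assume "eexp i = eexp j"
    then show "i = j" using orthonormalD[OF orthonormal_eexp, of i j] orthonormalD[OF orthonormal_eexp, of i i]
      by (auto split: if_splits)
  qed
  have "orthonormal (\<lambda>x. x) (range eexp)"
    using orthonormal_eexp inj by (auto simp: orthonormal_def inj_eq)
  then obtain B where B: "range eexp \<subseteq> B" "orthonormal_basis B" by (rule orthonormal_extend_basis)
  note on = orthonormal_basis_orthonormal[OF B(2)]
  define l where "l b = (if b \<in> range eexp then mu (inv eexp b) else 0)" for b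
  have l: "0 \<le> l b" "l b \<le> mu 0" for b using nonneg dec by (auto simp: l_def decseq_def)
  have le: "l (eexp m) = mu m" for m using inj by (simp add: l_def)
  have X: "zX = diag (\<lambda>x. x) B (\<lambda>b. complex_of_real (l b))"
  proof (rule diag_basis_unique[OF B(2)])
    show "bounded_on B (\<lambda>b. complex_of_real (l b))" by (rule bounded_onI[of _ _ "mu 0"]) (simp add: l)
    show "zX \<in> BL2" using zX_positive by (rule positive_opD)
    fix b assume b: "b \<in> B"
    show "zX b = complex_of_real (l b) *\<^sub>C b"
    proof (cases "b \<in> range eexp")
      case True
      then obtain m where "b = eexp m" by auto
      then show ?thesis unfolding opX_def[OF mu_assms] by (simp add: diag_eigen[OF orthonormal_eexp bounded_mu[OF mu_assms]] le)
    next
      case False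
      have "cinner b (eexp m) = 0" for m
      proof -
        have "eexp m \<in> B" "b \<noteq> eexp m" using B(1) False by auto
        then show ?thesis using orthonormalD[OF on b] by simp
      qed
      then have "zX b = 0" unfolding opX_def[OF mu_assms] by (intro diag_zero[OF orthonormal_eexp bounded_mu[OF mu_assms]]) simp
      then show ?thesis using False by (simp add: l_def)
    qed
  qed
  have "{b \<in> B. s < l b} = eexp ` {m. s < mu m}" if "s > 0" for s
  proof -
    have "b \<in> eexp ` {m. s < mu m}" if "b \<in> B" "s < l b" for b
      using that \<open>s > 0\<close> le by (cases "b \<in> range eexp") (auto simp: l_def)
    then show ?thesis using B(1) le by auto
  qed
  then have "finite {b \<in> B. s < l b} \<and> card {b \<in> B. s < l b} \<le> n \<longleftrightarrow> mu n \<le> s" if "s > 0" for s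
    using decseq_count_le[OF dec lim that, of n] that inj
    by (simp add: card_image[OF inj_on_subset[OF inj subset_UNIV]] finite_image_iff[OF inj_on_subset[OF inj subset_UNIV]])
  then have "{s. s > 0 \<and> finite {b \<in> B. s < l b} \<and> card {b \<in> B. s < l b} \<le> n} = {s. s > 0 \<and> mu n \<le> s}" by blast
  then show ?thesis
    unfolding X singular_value_diag[where l=l and C="mu 0", OF B(2) l] by (simp only: Inf_above[OF nonneg])
qed

lemma zVW_positive: "positive_op (zV o\<^sub>L zW)"
  by (rule positive_op_square[OF opV_adjoint[OF mu_assms]])

text \<open>Min-max argument: if at most n eigenvalues of the modulus Z exceed s, then the
  (n+1)-dimensional span of the test exponentials contains a nonzero f orthogonal to all the
  corresponding eigenvectors. So |Z f| <= s |f|, while |<H f, f>| is at least h |f|^2 on the whole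
  span.\<close>

lemma singular_value_lower: "singular_value (sqrt_op (zV o\<^sub>L zW)) n \<ge> (- eta mu (- int n - 1)) / 2"
proof -
  obtain B l where B: "orthonormal_basis B" and l: "\<And>b. 0 \<le> l b" "\<And>b. l b \<le> norm (zV o\<^sub>L zW)"
    and VW: "zV o\<^sub>L zW = diag (\<lambda>x. x) B (\<lambda>b. complex_of_real (l b))"
    using compact_spectral[OF zVW_positive compact_op_comp_right[OF compact_opV[OF mu_assms]]] by blast
  note on = orthonormal_basis_orthonormal[OF B]
  define r where "r b = sqrt (l b)" for b
  define C where "C = sqrt (norm (zV o\<^sub>L zW))"
  have r: "0 \<le> r b" "r b \<le> C" for b using l by (auto simp: r_def C_def)
  have rb: "bounded_on B (\<lambda>b. complex_of_real (r b))" by (rule bounded_onI[of _ _ C]) (simp add: r)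
  have "(\<lambda>b. complex_of_real (r b) * complex_of_real (r b)) = (\<lambda>b. complex_of_real (l b))"
    using l(1) by (auto simp: r_def simp flip: of_real_mult)
  then have sq: "sqrt_op (zV o\<^sub>L zW) = diag (\<lambda>x. x) B (\<lambda>b. complex_of_real (r b))"
    using diag_comp[OF on rb rb] by (intro sqrt_op_eqI diag_positive[OF on rb]) (auto simp: VW r)
  define Z where "Z = diag (\<lambda>x. x) B (\<lambda>b. complex_of_real (r b))"
  have Zs: "adjoint_pair Z Z" unfolding Z_def using diag_adjoint[OF on rb] by simp
  have ZZ: "Z (Z f) = zV (zW f)" for f
    using sqrt_op_positive(2)[OF zVW_positive] unfolding sq Z_def[symmetric] by (metis blinfun_apply_blinfun_compose)
  \<comment> \<open>Z^2 = V W and V is the adjoint of W, so Z is the modulus of W.\<close>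
  have ZW: "norm (Z f) = norm (zW f)" for f
  proof -
    have "complex_of_real ((norm (Z f))\<^sup>2) = cinner (Z (Z f)) f"
      unfolding cinner_self[symmetric] by (rule adjoint_pairD[OF Zs, symmetric])
    also have "\<dots> = complex_of_real ((norm (zW f))\<^sup>2)"
      unfolding ZZ adjoint_pairD[OF opV_adjoint[OF mu_assms]] cinner_self ..
    finally have "(norm (Z f))\<^sup>2 = (norm (zW f))\<^sup>2" by (simp only: of_real_eq_iff)
    then show ?thesis by (simp add: power2_eq_iff_nonneg)
  qed
  define h where "h = - eta mu (- int n - 1)"
  have main: "h / 2 \<le> s" if s: "s > 0" and fin: "finite {b \<in> B. s < r b}" "card {b \<in> B. s < r b} \<le> n" for s
  proof -
    define g where "g k = fexp (- int k - 1)" for k :: nat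
    have g: "orthonormal g UNIV"
      using orthonormal_fexp by (auto simp: orthonormal_def g_def)
    obtain c where c: "\<exists>k\<in>{..n}. c k \<noteq> 0" "\<forall>b\<in>{b \<in> B. s < r b}. (\<Sum>k\<in>{..n}. c k * cinner (g k) b) = 0"
      using homogeneous_solution[OF fin(1), of "{..n}" "\<lambda>b k. cinner (g k) b"] fin(2) by auto
    define f where "f = (\<Sum>k\<le>n. c k *\<^sub>C g k)"
    have nf: "(norm f)\<^sup>2 = (\<Sum>k\<le>n. (norm (c k))\<^sup>2)"
      unfolding f_def by (rule norm_sq_orthonormal_sum[OF g]) auto
    have "f \<noteq> 0"
    proof
      assume "f = 0"
      then have "\<forall>k\<in>{..n}. (norm (c k))\<^sup>2 = 0" using nf by (simp add: sum_nonneg_eq_0_iff)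
      then show False using c(1) by auto
    qed
    have fb: "cinner f b = 0" if "b \<in> B" "s < r b" for b
      using c(2) that by (simp add: f_def cinner_sum_left cinner_scaleC_left)
    have Zf: "norm (Z f) \<le> s * norm f"
    proof -
      \<comment> \<open>Z is split at level s: the part above s annihilates f by \<open>fb\<close>,
        and the other part has norm at most s.\<close>
      have b1: "bounded_on B (\<lambda>b. complex_of_real (if s < r b then 0 else r b))"
        by (rule bounded_onI[of _ _ s]) (use r s in auto)
      have b2: "bounded_on B (\<lambda>b. complex_of_real (if s < r b then r b else 0))"
      proof (rule bounded_onI)
        have "0 \<le> C" using r(1)[of 0] r(2)[of 0] by linarith
        then show "norm (complex_of_real (if s < r b then r b else 0)) \<le> C" for b by (simp add: r)
      qed
      have "(\<lambda>b. complex_of_real (if s < r b then 0 else r b) + complex_of_real (if s < r b then r b else 0))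
          = (\<lambda>b. complex_of_real (r b))" by (rule ext) simp
      then have "diag (\<lambda>x. x) B (\<lambda>b. complex_of_real (if s < r b then 0 else r b))
        + diag (\<lambda>x. x) B (\<lambda>b. complex_of_real (if s < r b then r b else 0)) = Z"
        using diag_add[OF on b1 b2] unfolding Z_def by simp
      from arg_cong[OF this, of "\<lambda>T. blinfun_apply T f", symmetric]
      have "Z f = diag (\<lambda>x. x) B (\<lambda>b. complex_of_real (if s < r b then 0 else r b)) f
        + diag (\<lambda>x. x) B (\<lambda>b. complex_of_real (if s < r b then r b else 0)) f"
        by (simp only: blinfun.add_left)
      moreover have "diag (\<lambda>x. x) B (\<lambda>b. complex_of_real (if s < r b then r b else 0)) f = 0"
        by (rule diag_zero[OF on b2]) (simp add: fb)
      moreover have "norm (diag (\<lambda>x. x) B (\<lambda>b. complex_of_real (if s < r b then 0 else r b)) f) \<le> s * norm f"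
        by (rule order_trans[OF norm_blinfun], intro mult_right_mono norm_diag_le[OF on]) (use r s in auto)
      ultimately show ?thesis by simp
    qed
    have Hg: "opH mu (g k) = (\<i> * complex_of_real (eta mu (- int k - 1))) *\<^sub>C g k" for k
      unfolding opH_def[OF mu_assms] g_def by (rule diag_eigen[OF orthonormal_fexp bounded_eta[OF mu_assms]]) simp
    have HB: "opH mu \<in> BL2" unfolding opH_def[OF mu_assms] by (rule diag_BL2[OF orthonormal_fexp bounded_eta[OF mu_assms]])
    have "cinner (opH mu f) f = (\<Sum>k\<le>n. (\<i> * complex_of_real (eta mu (- int k - 1)) * c k) * cinner (g k) f)"
      by (subst f_def) (simp add: blinfun.sum_right BL2_scaleC[OF HB] Hg cinner_sum_left cinner_scaleC_left mult_ac)
    also have "\<dots> = (\<Sum>k\<le>n. \<i> * complex_of_real (eta mu (- int k - 1)) * (c k * cnj (c k)))"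
    proof (rule sum.cong)
      fix k assume "k \<in> {..n}"
      then have "cinner f (g k) = c k" unfolding f_def by (subst orthonormal_cinner_sum[OF g]) auto
      then have "cinner (g k) f = cnj (c k)" by (metis cinner_commute)
      then show "(\<i> * complex_of_real (eta mu (- int k - 1)) * c k) * cinner (g k) f
        = \<i> * complex_of_real (eta mu (- int k - 1)) * (c k * cnj (c k))" by (simp add: mult_ac)
    qed simp
    also have "\<dots> = - \<i> * complex_of_real (\<Sum>k\<le>n. (- eta mu (- int k - 1)) * (norm (c k))\<^sup>2)"
      unfolding complex_norm_square[symmetric]
      by (simp add: sum_distrib_left sum_negf mult_ac)
    finally have Hf: "norm (cinner (opH mu f) f) = \<bar>\<Sum>k\<le>n. (- eta mu (- int k - 1)) * (norm (c k))\<^sup>2\<bar>"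
      by (simp only: norm_mult norm_of_real) simp
    \<comment> \<open>The moduli of the eigenvalues decrease in k, so the last index n gives the
      least of them, which is h.\<close>
    have "h * (norm f)\<^sup>2 \<le> (\<Sum>k\<le>n. (- eta mu (- int k - 1)) * (norm (c k))\<^sup>2)"
      unfolding nf sum_distrib_left h_def
      by (intro sum_mono mult_right_mono eta_neg_mono[OF mu_assms]) auto
    also have "\<dots> \<le> norm (cinner (opH mu f) f)" unfolding Hf by simp
    also have "cinner (opH mu f) f = cinner f (zW f) - cinner (zW f) f"
      unfolding opV_minus_opW[OF mu_assms, symmetric] blinfun.diff_left cinner_diff_left
        adjoint_pairD[OF opV_adjoint[OF mu_assms]] ..
    also have "norm \<dots> \<le> norm f * norm (zW f) + norm (zW f) * norm f"
      by (rule order_trans[OF norm_triangle_ineq4 add_mono[OF norm_cinner_le norm_cinner_le]])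
    also have "\<dots> = 2 * norm (Z f) * norm f" by (simp add: ZW)
    also have "\<dots> \<le> 2 * (s * norm f) * norm f" using Zf by (intro mult_right_mono mult_left_mono) auto
    finally have "h * (norm f)\<^sup>2 \<le> (2 * s) * (norm f)\<^sup>2" by (simp add: power2_eq_square mult_ac)
    then have "h \<le> 2 * s" by (rule mult_right_le_imp_le) (use \<open>f \<noteq> 0\<close> in simp)
    then show ?thesis by simp
  qed
  \<comment> \<open>The level C + 1 lies above all eigenvalues, so the infimum is taken over a
    nonempty set.\<close>
  have emp: "{b \<in> B. C + 1 < r b} = {}"
  proof -
    have "\<not> C + 1 < r b" for b using r(2)[of b] by linarith
    then show ?thesis by simp
  qed
  have "C + 1 > 0" using order_trans[OF r(1) r(2)] by (simp add: add_nonneg_pos)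
  then have "C + 1 \<in> {s. s > 0 \<and> finite {b \<in> B. s < r b} \<and> card {b \<in> B. s < r b} \<le> n}"
    by (simp only: mem_Collect_eq emp) simp
  then have "{s. s > 0 \<and> finite {b \<in> B. s < r b} \<and> card {b \<in> B. s < r b} \<le> n} \<noteq> {}" by blast
  then show ?thesis
    unfolding sq singular_value_diag[where l=r and C=C, OF B r] h_def[symmetric]
    by (rule cInf_greatest) (use main in blast)
qed

subsection \<open>Truncations\<close>

definition truncX :: "nat \<Rightarrow> op"
  where "truncX K = (\<Sum>k\<le>K. (\<Sum>i\<le>k. cellp K i) o\<^sub>L zX o\<^sub>L cellp K k)"

definition truncX' :: "nat \<Rightarrow> op"
  where "truncX' K = (\<Sum>k\<le>K. cellp K k o\<^sub>L zX o\<^sub>L (\<Sum>i\<le>k. cellp K i))"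

lemma trunc_term_adjoint:
  assumes K: "K \<ge> 1"
  shows "adjoint_pair ((\<Sum>i\<le>k. cellp K i) o\<^sub>L zX o\<^sub>L cellp K k) (cellp K k o\<^sub>L zX o\<^sub>L (\<Sum>i\<le>k. cellp K i))"
proof -
  have p: "adjoint_pair (cellp K j) (cellp K j)" for j by (rule decomp_adj[OF cellp_system[OF K] cellp_zero])
  show ?thesis
    unfolding comp_assoc[of "cellp K k"] by (intro adjoint_pair_comp adjoint_pair_sum p opX_adjoint[OF mu_assms])
qed

lemma truncX_adjoint: "K \<ge> 1 \<Longrightarrow> adjoint_pair (truncX K) (truncX' K)"
  unfolding truncX_def truncX'_def by (intro adjoint_pair_sum trunc_term_adjoint)

text \<open>Cross terms contain p_k p_j = 0. The square function of the expectations is therefore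
  the modulus of the adjoint of a single operator, the block triangular truncation of X.\<close>

lemma truncX_square:
  assumes K: "K \<ge> 1"
  shows "(\<Sum>k\<le>K. ((\<Sum>i\<le>k. cellp K i) o\<^sub>L zX o\<^sub>L cellp K k) o\<^sub>L (cellp K k o\<^sub>L zX o\<^sub>L (\<Sum>i\<le>k. cellp K i))) = truncX K o\<^sub>L truncX' K"
proof -
  have pp: "cellp K i o\<^sub>L cellp K j = (if i = j then cellp K i else 0)" for i j
    by (rule decomp_comp[OF cellp_system[OF K] cellp_zero])
  define L where "L k = (\<Sum>i\<le>k. cellp K i) o\<^sub>L zX o\<^sub>L cellp K k" for k
  define R where "R k = cellp K k o\<^sub>L zX o\<^sub>L (\<Sum>i\<le>k. cellp K i)" for k
  have cross: "L k o\<^sub>L R j = (if j = k then L k o\<^sub>L R k else 0)" for k j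
  proof (cases "j = k")
    case False
    have "L k o\<^sub>L R j = (\<Sum>i\<le>k. cellp K i) o\<^sub>L zX o\<^sub>L ((cellp K k o\<^sub>L cellp K j) o\<^sub>L (zX o\<^sub>L (\<Sum>i\<le>j. cellp K i)))"
      unfolding L_def R_def by (simp only: comp_assoc)
    then show ?thesis using False by (simp add: pp)
  qed simp
  have t: "truncX K = (\<Sum>k\<le>K. L k)" "truncX' K = (\<Sum>k\<le>K. R k)"
    by (simp_all add: truncX_def truncX'_def L_def R_def)
  have "truncX K o\<^sub>L truncX' K = (\<Sum>k\<le>K. \<Sum>j\<le>K. L k o\<^sub>L R j)"
    unfolding t comp_sum_left by (simp only: comp_sum_right)
  also have "\<dots> = (\<Sum>k\<le>K. \<Sum>j\<le>K. if j = k then L k o\<^sub>L R k else 0)"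
    by (intro sum.cong refl cross)
  also have "\<dots> = (\<Sum>k\<le>K. L k o\<^sub>L R k)"
    by (intro sum.cong refl) simp
  finally show ?thesis unfolding L_def R_def by (rule sym)
qed

lemma tendsto_truncX: "truncX \<longlonglongrightarrow> zV" "truncX' \<longlonglongrightarrow> zW"
proof -
  have eq: "truncX K - zV = pinching {..K} (cellp K) zW" if K: "K \<ge> 1" for K
    using truncation_split[OF K upper_tri_opV[OF mu_assms] lower_tri_opW[OF mu_assms]]
    unfolding truncX_def opV_plus_opW[OF mu_assms] by simp
  have "(\<lambda>K. truncX K - zV) \<longlonglongrightarrow> 0"
    by (rule Lim_transform_eventually[OF tendsto_pinching[OF mu_assms]])
       (use eventually_ge_at_top[of 1] in \<open>eventually_elim, simp add: eq\<close>)
  then show V: "truncX \<longlonglongrightarrow> zV" by (rule LIM_zero_cancel)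
  have "norm (truncX' K - zW) \<le> norm (truncX K - zV)" if "K \<ge> 1" for K
    by (intro norm_adjoint_le adjoint_pair_diff truncX_adjoint that opV_adjoint[OF mu_assms])
  then have "\<forall>\<^sub>F K in sequentially. norm (truncX' K - zW) \<le> norm (truncX K - zV)"
    using eventually_ge_at_top[of 1] by (rule eventually_mono[rotated])
  moreover have "(\<lambda>K. norm (truncX K - zV)) \<longlonglongrightarrow> 0"
    using V LIM_zero tendsto_norm_zero by blast
  ultimately have "(\<lambda>K. truncX' K - zW) \<longlonglongrightarrow> 0" by (rule Lim_null_comparison)
  then show "truncX' \<longlonglongrightarrow> zW" by (rule LIM_zero_cancel)
qed

lemma tendsto_sqrt_trunc: "(\<lambda>K. sqrt_op (truncX K o\<^sub>L truncX' K)) \<longlonglongrightarrow> sqrt_op (zV o\<^sub>L zW)"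
proof (rule tendsto_sqrt_op[OF tendsto_comp[OF tendsto_truncX] zVW_positive])
  show "\<forall>\<^sub>F K in sequentially. positive_op (truncX K o\<^sub>L truncX' K)"
    using eventually_ge_at_top[of 1] by eventually_elim (rule positive_op_square[OF truncX_adjoint])
qed

lemma column_sums:
  assumes K: "K \<ge> 1"
  shows "strong_sums (\<lambda>k. (zX o\<^sub>L cellp K k) o\<^sub>L adj (zX o\<^sub>L cellp K k)) (zX o\<^sub>L zX)"
proof -
  have p: "adjoint_pair (cellp K j) (cellp K j)" for j by (rule decomp_adj[OF cellp_system[OF K] cellp_zero])
  have pp: "cellp K k o\<^sub>L (cellp K k o\<^sub>L A) = cellp K k o\<^sub>L A" for k A
    unfolding comp_assoc[symmetric] by (simp add: decomp_comp[OF cellp_system[OF K] cellp_zero])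
  have "adj (zX o\<^sub>L cellp K k) = cellp K k o\<^sub>L zX" for k
    by (intro adj_eqI adjoint_pair_comp p opX_adjoint[OF mu_assms])
  then have eq: "(zX o\<^sub>L cellp K k) o\<^sub>L adj (zX o\<^sub>L cellp K k) = zX o\<^sub>L cellp K k o\<^sub>L zX" for k
    by (simp add: comp_assoc pp)
  have "strong_sums (\<lambda>k. zX o\<^sub>L cellp K k o\<^sub>L zX) (\<Sum>k\<le>K. zX o\<^sub>L cellp K k o\<^sub>L zX)"
    by (rule strong_sums_finite) (simp add: cellp_zero)
  also have "(\<Sum>k\<le>K. zX o\<^sub>L cellp K k o\<^sub>L zX) = zX o\<^sub>L zX"
    by (simp add: comp_sum_left[symmetric] comp_sum_right[symmetric] block_sum[OF cellp_system[OF K]])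
  finally show ?thesis by (simp only: eq)
qed

lemma expectation_sums:
  assumes K: "K \<ge> 1"
  shows "strong_sums (\<lambda>k. cond_expectation (merged_algebra K (cellp K) k) (zX o\<^sub>L cellp K k) o\<^sub>L
    adj (cond_expectation (merged_algebra K (cellp K) k) (zX o\<^sub>L cellp K k))) (truncX K o\<^sub>L truncX' K)"
proof -
  have "cond_expectation (merged_algebra K (cellp K) k) (zX o\<^sub>L cellp K k) = (\<Sum>i\<le>k. cellp K i) o\<^sub>L zX o\<^sub>L cellp K k" for k
    by (rule cond_expectation_merged[OF cellp_system[OF K] cellp_zero positive_opD(1)[OF zX_positive]])
  then have eq: "cond_expectation (merged_algebra K (cellp K) k) (zX o\<^sub>L cellp K k) o\<^sub>L
      adj (cond_expectation (merged_algebra K (cellp K) k) (zX o\<^sub>L cellp K k))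
    = ((\<Sum>i\<le>k. cellp K i) o\<^sub>L zX o\<^sub>L cellp K k) o\<^sub>L (cellp K k o\<^sub>L zX o\<^sub>L (\<Sum>i\<le>k. cellp K i))" for k
    by (simp add: adj_eqI[OF trunc_term_adjoint[OF K]])
  show ?thesis
    unfolding eq truncX_square[OF K, symmetric] by (rule strong_sums_finite) (simp add: cellp_zero)
qed

end

theorem theorem6p1:
  shows "\<exists>c::real. c > 0 \<and> (\<forall>x::nat \<Rightarrow> complex. x \<in> Lambda_log \<longrightarrow>
    (\<exists>(N :: real \<Rightarrow> nat \<Rightarrow> op set) (a :: real \<Rightarrow> nat \<Rightarrow> op) z1 z2.
       (\<forall>t>0. filtration (N t) \<and> (\<forall>k. a t k \<in> BL2)) \<and>
       z1 \<in> Lambda_log_op \<and> z2 \<in> BL2 \<and>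
       singular_value z1 = rearrangement x \<and>
       (\<forall>t>0. strong_summable (\<lambda>k. a t k o\<^sub>L adj (a t k)) \<and>
          sqrt_op (strong_suminf (\<lambda>k. a t k o\<^sub>L adj (a t k))) = z1) \<and>
       (\<forall>n. singular_value z2 n \<ge> c * Calderon (rearrangement x) n) \<and>
       (\<forall>t>0. strong_summable (\<lambda>k. cond_expectation (N t k) (a t k) o\<^sub>L
          adj (cond_expectation (N t k) (a t k)))) \<and>
       ((\<lambda>t. sqrt_op (strong_suminf (\<lambda>k. cond_expectation (N t k) (a t k) o\<^sub>L
          adj (cond_expectation (N t k) (a t k))))) \<longlongrightarrow> z2) (at_right 0)))"
proof (intro exI[of _ "1 / (8 * pi)"] conjI allI impI)
  show "1 / (8 * pi) > 0" by simp
  fix x :: "nat \<Rightarrow> complex" assume "x \<in> Lambda_log"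
  then have x: "x \<longlonglongrightarrow> 0" and xs: "summable (\<lambda>n. rearrangement x n * (ln (real n + 2) - ln (real n + 1)))"
    by (auto simp: Lambda_log_def)
  define mu where "mu = rearrangement x"
  have mu: "\<And>m. 0 \<le> mu m" "decseq mu" "mu \<longlonglongrightarrow> 0" "summable (\<lambda>m. mu m / (real m + 1))"
    unfolding mu_def using xs
    by (auto intro: rearrangement_nonneg[OF x] rearrangement_dec[OF x] rearrangement_tendsto[OF x] summable_harmonic_weight)
  \<comment> \<open>Rounding up gives at least one cell of width 1/K for every t > 0, so the
    identity for z1 holds for each t and not only in the limit.\<close>
  define K where "K t = nat \<lceil>1 / t\<rceil>" for t :: real
  have K: "K t \<ge> 1" if "t > 0" for t using that by (simp add: K_def Suc_le_eq)
  have Klim: "filterlim K sequentially (at_right 0)"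
    unfolding filterlim_at_top
  proof
    fix Z :: nat
    have "\<forall>\<^sub>F t in at_right 0. real Z \<le> inverse t"
      using filterlim_inverse_at_top_right unfolding filterlim_at_top by blast
    then show "\<forall>\<^sub>F t in at_right 0. Z \<le> K t"
    proof eventually_elim
      case (elim t)
      have "real Z \<le> real (K t)"
        using order_trans[OF elim[unfolded inverse_eq_divide] real_nat_ceiling_ge[of "1 / t"]] by (simp only: K_def)
      then show ?case by simp
    qed
  qed
  define N where "N t k = merged_algebra (K t) (cellp (K t)) k" for t k
  define a where "a t k = opX mu o\<^sub>L cellp (K t) k" for t k
  define z2 where "z2 = sqrt_op (opV mu o\<^sub>L opW mu)"
  have XB: "opX mu \<in> BL2" by (rule positive_opD(1)[OF zX_positive[OF mu]])
  have sv: "singular_value (opX mu) = mu" by (rule ext) (rule singular_value_zX[OF mu])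
  have E: "strong_sums (\<lambda>k. cond_expectation (N t k) (a t k) o\<^sub>L adj (cond_expectation (N t k) (a t k)))
      (truncX mu (K t) o\<^sub>L truncX' mu (K t))" if "t > 0" for t
    unfolding N_def a_def by (rule expectation_sums[OF mu K[OF that]])
  show "\<exists>(N :: real \<Rightarrow> nat \<Rightarrow> op set) (a :: real \<Rightarrow> nat \<Rightarrow> op) z1 z2.
       (\<forall>t>0. filtration (N t) \<and> (\<forall>k. a t k \<in> BL2)) \<and>
       z1 \<in> Lambda_log_op \<and> z2 \<in> BL2 \<and>
       singular_value z1 = rearrangement x \<and>
       (\<forall>t>0. strong_summable (\<lambda>k. a t k o\<^sub>L adj (a t k)) \<and>
          sqrt_op (strong_suminf (\<lambda>k. a t k o\<^sub>L adj (a t k))) = z1) \<and>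
       (\<forall>n. singular_value z2 n \<ge> 1 / (8 * pi) * Calderon (rearrangement x) n) \<and>
       (\<forall>t>0. strong_summable (\<lambda>k. cond_expectation (N t k) (a t k) o\<^sub>L
          adj (cond_expectation (N t k) (a t k)))) \<and>
       ((\<lambda>t. sqrt_op (strong_suminf (\<lambda>k. cond_expectation (N t k) (a t k) o\<^sub>L
          adj (cond_expectation (N t k) (a t k))))) \<longlongrightarrow> z2) (at_right 0)"
  proof (rule exI[of _ N], rule exI[of _ a], rule exI[of _ "opX mu"], rule exI[of _ z2], intro conjI allI impI)
    fix t :: real assume t: "t > 0"
    show "filtration (N t)"
      unfolding N_def[abs_def] by (rule merged_filtration[OF cellp_system[OF K[OF t]] cellp_zero])
    show "a t k \<in> BL2" for k
      unfolding a_def cellp_def by (intro BL2_comp XB cut_BL2 cell_borel)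
    have A: "strong_sums (\<lambda>k. a t k o\<^sub>L adj (a t k)) (opX mu o\<^sub>L opX mu)"
      unfolding a_def by (rule column_sums[OF mu K[OF t]])
    then show "strong_summable (\<lambda>k. a t k o\<^sub>L adj (a t k))" by (auto simp: strong_summable_def)
    show "sqrt_op (strong_suminf (\<lambda>k. a t k o\<^sub>L adj (a t k))) = opX mu"
      unfolding strong_sums_suminf[OF A] by (rule sqrt_op_eqI[OF zX_positive[OF mu] refl])
    show "strong_summable (\<lambda>k. cond_expectation (N t k) (a t k) o\<^sub>L adj (cond_expectation (N t k) (a t k)))"
      using E[OF t] by (auto simp: strong_summable_def)
  next
    show "opX mu \<in> Lambda_log_op"
      unfolding Lambda_log_op_def Lambda_log_def using XB xs mu(3)
      by (simp add: sv rearrangement_decseq[OF mu(1-3)]) (simp add: mu_def)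
    show "z2 \<in> BL2" unfolding z2_def by (rule positive_opD(1)[OF sqrt_op_positive(1)[OF zVW_positive[OF mu]]])
    show "singular_value (opX mu) = rearrangement x" using sv by (simp only: mu_def)
    show "singular_value z2 n \<ge> 1 / (8 * pi) * Calderon (rearrangement x) n" for n
    proof -
      \<comment> \<open>The constant is the product of 1/(4 pi), from the comparison with the
        Calderon operator, and 1/2, from bounding H by twice the modulus z2.\<close>
      have "1 / (8 * pi) * Calderon mu n \<le> 1 / (8 * pi) * (4 * pi * (- eta mu (- int n - 1)))"
        by (rule mult_left_mono[OF Calderon_le_eta[OF mu]]) simp
      also have "\<dots> = (- eta mu (- int n - 1)) / 2" by simp
      also have "\<dots> \<le> singular_value z2 n" unfolding z2_def by (rule singular_value_lower[OF mu])
      finally show ?thesis by (simp add: mu_def)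
    qed
    have "((\<lambda>t. sqrt_op (truncX mu (K t) o\<^sub>L truncX' mu (K t))) \<longlongrightarrow> z2) (at_right 0)"
      unfolding z2_def by (rule filterlim_compose[OF tendsto_sqrt_trunc[OF mu] Klim])
    then show "((\<lambda>t. sqrt_op (strong_suminf (\<lambda>k. cond_expectation (N t k) (a t k) o\<^sub>L
          adj (cond_expectation (N t k) (a t k))))) \<longlongrightarrow> z2) (at_right 0)"
      by (rule Lim_transform_eventually)
         (use eventually_at_right_less[of 0] in \<open>eventually_elim, simp add: strong_sums_suminf[OF E]\<close>)
  qed
qed

end
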